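(* For $k\ge 3$, there exist $\zeta>0$ and $c>0$ such that for all $n$, \[|\mathcal I_1^*(n,\zeta)|\le 2^{\binom nk}+\exp_2\!\Big[(1-c)\tbinom nk\Big]+\sum_{i=1}^{k-2}\exp_2\!\Big[i(1-c)\tbinom n{k-1}\Big]|\mathcal I(n-i)|+\exp_2\!\Big[\tfrac k2(1-c)\tbinom n{k-1}\Big]|\mathcal I(n-k)|+\exp_2\!\Big[\tbinom nk-cn\Big].\] For $k=2$, there exist $\zeta>0$ and $c>0$ such that for all $n$, \[|\mathcal I_1^*(n,\zeta)|\le 2^{\binom nk}+2\exp_2\!\Big[(1-c)\tbinom nk\Big]+\exp_2\!\Big[\tfrac k2(1-c)\tbinom n{k-1}\Big]|\mathcal I(n-k)|.\]
   Context: $\exp_2[t]=2^t$. Clauses are conjunctions of $k$ literals ($x$ or $\overline x$) on $k$ distinct variables; a formula is a set of clauses. Minimal: every clause $C$ has a witness, an assignment satisfying $C$ and no other clause. $\mathcal I(n)$ is the set of minimal $k$-SAT formulae on variables $x_1,\dots,x_n$. For a formula $\Phi$ on $n$ variables and literal $v$, $m(v)$ is the number of occurrences of $v$ in $\Phi$. $\Phi$ is $\zeta$-nearly monotone if it has at most $\zeta n^k$ clauses containing a negative literal; $\zeta$-sparsely minimal if it is minimal and every clause has a witness with fewer than $\zeta n$ variables set to $1$; positive-dominant if $m(x)\ge m(\overline x)$ for every variable $x$; $\zeta'$-dense if every variable is used by at least $\zeta'\binom{n-1}{k-1}$ clauses. $\mathcal I_1^*(n,\zeta)$ is the set of minimal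 $k$-SAT formulae on $n$ variables that are $\zeta$-nearly monotone, $\zeta$-sparsely minimal, positive-dominant and $\frac1{10k}$-dense. *)

theory Defs
  imports Complex_Main
begin

datatype literal = Pos (var: nat) | Neg (var: nat)

type_synonym clause = "literal set"
type_synonym formula = "clause set"
type_synonym assignment = "nat \<Rightarrow> bool"

fun lit_true :: "assignment \<Rightarrow> literal \<Rightarrow> bool" where
  "lit_true a (Pos x) = a x"
| "lit_true a (Neg x) = (\<not> a x)"

text \<open>The variables of a formula on \<open>n\<close> variables are \<open>1, \<dots>, n\<close>. Injectivity of \<open>var\<close> on a
  clause says that its \<open>k\<close> literals are on \<open>k\<close> distinct variables.\<close>

definition clauses :: "nat \<Rightarrow> nat \<Rightarrow> clause set" where
  "clauses k n = {C. finite C \<and> card C = k \<and> inj_on var C \<and> var ` C \<subseteq> {1..n}}"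

definition formulae :: "nat \<Rightarrow> nat \<Rightarrow> formula set" where
  "formulae k n = Pow (clauses k n)"

text \<open>Clauses are conjunctions of literals.\<close>

definition satisfies :: "assignment \<Rightarrow> clause \<Rightarrow> bool" where
  "satisfies a C \<longleftrightarrow> (\<forall>l\<in>C. lit_true a l)"

definition witness :: "formula \<Rightarrow> clause \<Rightarrow> assignment \<Rightarrow> bool" where
  "witness \<Phi> C a \<longleftrightarrow> satisfies a C \<and> (\<forall>D\<in>\<Phi>. D \<noteq> C \<longrightarrow> \<not> satisfies a D)"

definition minimal :: "formula \<Rightarrow> bool" where
  "minimal \<Phi> \<longleftrightarrow> (\<forall>C\<in>\<Phi>. \<exists>a. witness \<Phi> C a)"

definition minimal_formulae :: "nat \<Rightarrow> nat \<Rightarrow> formula set" where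
  "minimal_formulae k n = {\<Phi> \<in> formulae k n. minimal \<Phi>}"

definition occurrences :: "formula \<Rightarrow> literal \<Rightarrow> nat" where
  "occurrences \<Phi> v = card {C \<in> \<Phi>. v \<in> C}"

definition nearly_monotone :: "nat \<Rightarrow> nat \<Rightarrow> real \<Rightarrow> formula \<Rightarrow> bool" where
  "nearly_monotone k n \<zeta> \<Phi> \<longleftrightarrow> real (card {C \<in> \<Phi>. \<exists>x. Neg x \<in> C}) \<le> \<zeta> * real n ^ k"

definition sparsely_minimal :: "nat \<Rightarrow> real \<Rightarrow> formula \<Rightarrow> bool" where
  "sparsely_minimal n \<zeta> \<Phi> \<longleftrightarrow> minimal \<Phi> \<and>
     (\<forall>C\<in>\<Phi>. \<exists>a. witness \<Phi> C a \<and> real (card {x \<in> {1..n}. a x}) < \<zeta> * real n)"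

definition positive_dominant :: "nat \<Rightarrow> formula \<Rightarrow> bool" where
  "positive_dominant n \<Phi> \<longleftrightarrow> (\<forall>x\<in>{1..n}. occurrences \<Phi> (Pos x) \<ge> occurrences \<Phi> (Neg x))"

definition dense_formula :: "nat \<Rightarrow> nat \<Rightarrow> real \<Rightarrow> formula \<Rightarrow> bool" where
  "dense_formula k n \<zeta> \<Phi> \<longleftrightarrow>
     (\<forall>x\<in>{1..n}. real (card {C \<in> \<Phi>. x \<in> var ` C}) \<ge> \<zeta> * real ((n - 1) choose (k - 1)))"

definition I1_star :: "nat \<Rightarrow> nat \<Rightarrow> real \<Rightarrow> formula set" where
  "I1_star k n \<zeta> = {\<Phi> \<in> minimal_formulae k n.
     nearly_monotone k n \<zeta> \<Phi> \<and> sparsely_minimal n \<zeta> \<Phi> \<and> positive_dominant n \<Phi> \<and>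
     dense_formula k n (1 / (10 * real k)) \<Phi>}"

definition exp2 :: "real \<Rightarrow> real" where
  "exp2 t = 2 powr t"

lemma finite_clauses: "finite (clauses k n)"
proof (rule finite_subset)
  have "l \<in> Pos ` {1..n} \<union> Neg ` {1..n}" if "var l \<in> {1..n}" for l
    using that by (cases l) auto
  then show "clauses k n \<subseteq> Pow (Pos ` {1..n} \<union> Neg ` {1..n})"
    unfolding clauses_def by blast
qed simp

lemma finite_minimal_formulae: "finite (minimal_formulae k n)"
  by (simp add: minimal_formulae_def formulae_def finite_clauses)

end

theory Submission
  imports Defs "HOL-Real_Asymp.Real_Asymp" "HOL-Library.Disjoint_Sets" "HOL-Library.FuncSet"
begin

text \<open>
  A clause with negated variables \<open>S\<close> and positive variables \<open>T\<close> rules out every positive clause \<open>C \<supseteq> T\<close>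
  such that each \<open>x \<in> S\<close> has a positive clause \<open>{x} \<union> Q\<close> with \<open>Q \<subseteq> C\<close>. If for some \<open>S\<close> a positive
  proportion of all \<open>k\<close>-sets is ruled out, the formula is one of \<open>exp2 ((1 - c) * (n choose k))\<close>;
  sparsity of witnesses makes the choice of the clauses with negative literals cheap.
  Otherwise, if some variable has a large negative link, if the common intersection of the positive
  links of some \<open>S\<close> is atypically thin, or if there is a clause with only negative literals, then the
  positive links of \<open>i \<le> k - 2\<close> (or of all \<open>k\<close>) of the variables involved are confined to an
  exponentially small proportion of the possible links; deleting these variables leaves a minimal
  formula on \<open>n - i\<close> variables. A clause with only negative literals whose links are pairwise
  incompatible costs \<open>k / 2\<close> links rather than \<open>k\<close>, because pairwise related \<open>k\<close>-tuples number at most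
  the \<open>k / 2\<close>-th power of the relation.
  In the remaining formulae every set \<open>T\<close> carrying a typical clause \<open>(S, T)\<close> with \<open>card S = i\<close> rules
  out of the order of \<open>n ^ i\<close> positive clauses, much more than the description of its clauses costs,
  and every atypical pair \<open>(S, T')\<close> saves of the order of \<open>n\<close>; one such set or pair already gains a
  factor \<open>exp2 (c * n)\<close>. For \<open>k = 2\<close> this gain is absorbed by the number of unate formulae on
  \<open>n - 2\<close> variables.
\<close>

section \<open>Counting subsets\<close>

text \<open>Two scales of savings have to be reconciled. Irregular formulae save a positive multiple
  of \<open>n ^ k\<close> or of \<open>n ^ (k - 1)\<close> in the exponent, and against that sparse
  witnesses allow a crude encoding: all clauses with negative literals cost
  \<open>e * n ^ k\<close>, and the irregular ones at boundedly many variables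
  \<open>e * n ^ (k - 1)\<close>. The last term saves only \<open>c * n\<close>, so no fixed cost is
  affordable there: every bit spent on describing a formula has to be charged to something that
  saves a multiple of it. Hence clauses over a typical set are bounded by \<open>e * n ^ i\<close>
  per set and clauses over atypical pairs by \<open>e * n\<close> per pair, which needs a count of
  cliques that is linear in the number of pairs.

  The limit \<open>i \<le> k - 2\<close> comes from reference families. A common intersection of
  links is thin only relative to a dense family that is known or cheap to describe; with
  \<open>k - 1\<close> or \<open>k\<close> variables involved, one or two of them are left in place
  to supply it.\<close>

definition ksub :: "'a set \<Rightarrow> nat \<Rightarrow> 'a set set" where
  "ksub V r = {A. A \<subseteq> V \<and> card A = r}"

lemma finite_ksub [simp]: "finite V \<Longrightarrow> finite (ksub V r)"
  unfolding ksub_def by (rule finite_subset[of _ "Pow V"]) auto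

lemma card_ksub: "finite V \<Longrightarrow> card (ksub V r) = card V choose r"
  unfolding ksub_def by (rule n_subsets)

lemma card_ksub_le: "finite V \<Longrightarrow> real (card (ksub V r)) \<le> real (card V) ^ r"
proof (cases "r \<le> card V")
  case True
  assume "finite V"
  moreover have "card V choose r \<le> card V ^ r" by (rule binomial_le_pow[OF True])
  ultimately show ?thesis by (metis card_ksub of_nat_le_iff of_nat_power)
qed (simp add: card_ksub binomial_eq_0)

lemma card_ksub_ge:
  "finite V \<Longrightarrow> r \<le> card V \<Longrightarrow> (real (card V) / real r) ^ r \<le> real (card (ksub V r))"
  using binomial_ge_n_over_k_pow_k[of r "card V", where ?'a = real] by (simp add: card_ksub)

lemma ksub_mono: "U \<subseteq> V \<Longrightarrow> ksub U r \<subseteq> ksub V r"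
  by (auto simp: ksub_def)

section \<open>Weighted counts of families of subsets\<close>

lemma sum_power_card_Pow:
  fixes l :: real
  assumes "finite X" shows "(\<Sum>Y\<in>Pow X. l ^ card Y) = (1 + l) ^ card X"
  using assms
proof (induction X rule: finite_induct)
  case (insert x X)
  have "Pow X \<inter> insert x ` Pow X = {}" using insert by auto
  moreover have "inj_on (insert x) (Pow X)"
    using insert.hyps(2) by (auto simp: inj_on_def)
  moreover have "l ^ card (insert x Y) = l * l ^ card Y" if "Y \<in> Pow X" for Y
    using that insert.hyps finite_subset[of Y X] by (subst card_insert_disjoint) auto
  ultimately have "(\<Sum>Y\<in>Pow (insert x X). l ^ card Y)
      = (\<Sum>Y\<in>Pow X. l ^ card Y) + (\<Sum>Y\<in>Pow X. l * l ^ card Y)"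
    using insert.hyps by (simp add: Pow_insert sum.union_disjoint sum.reindex)
  then show ?case using insert by (simp add: sum_distrib_left[symmetric] algebra_simps)
qed simp

text \<open>The threshold that solves the Chernoff estimate: with the weight
  \<open>l = min (e / 4) (1 / 2)\<close> the factor \<open>l powr (thin e * M)\<close> is exactly
  \<open>2 powr (- (e / 2 * M))\<close>, so half of the budget \<open>e * M\<close> pays for
  Markov's inequality and half for the weighted sum.\<close>

definition thin :: "real \<Rightarrow> real" where
  "thin e = e / 2 / log 2 (1 / min (e / 4) (1 / 2))"

lemma thin_pos: assumes "e > 0" shows "thin e > 0"
proof -
  have "log 2 (1 / min (e/4) (1/2)) > 0"
    using assms by (subst zero_less_log_cancel_iff) (auto simp: field_simps min_def)
  then show ?thesis using assms by (simp add: thin_def)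
qed

text \<open>Chernoff-style: weight every subset \<open>Y\<close> by \<open>l ^ card Y\<close> with a small \<open>l\<close>.\<close>

lemma card_thin_subsets:
  assumes "e > 0" "finite X" "real (card X) \<le> M"
  shows "real (card {Y. Y \<subseteq> X \<and> real (card Y) \<le> thin e * M}) \<le> 2 powr (e * M)"
proof -
  define l :: real where "l = min (e/4) (1/2)"
  have l: "0 < l" "l \<le> 1/2" "l \<le> e/4" using assms by (auto simp: l_def)
  have M: "M \<ge> 0" using assms(3) by linarith
  have logl: "log 2 (1/l) > 0" using l by (subst zero_less_log_cancel_iff) (auto simp: field_simps)
  define A where "A = {Y. Y \<subseteq> X \<and> real (card Y) \<le> thin e * M}"
  have finA: "finite A" unfolding A_def using assms(2) by (rule_tac finite_subset[of _ "Pow X"]) auto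
  have "real (card A) * l powr (thin e * M) = (\<Sum>Y\<in>A. l powr (thin e * M))" by simp
  also have "\<dots> \<le> (\<Sum>Y\<in>A. l ^ card Y)"
  proof (rule sum_mono)
    fix Y assume "Y \<in> A"
    then have "l powr (thin e * M) \<le> l powr (real (card Y))"
      using l by (intro powr_mono') (auto simp: A_def)
    then show "l powr (thin e * M) \<le> l ^ card Y" using l by (simp add: powr_realpow)
  qed
  also have "\<dots> \<le> (\<Sum>Y\<in>Pow X. l ^ card Y)"
    using assms(2) l by (intro sum_mono2) (auto simp: A_def)
  also have "\<dots> = (1 + l) ^ card X" using assms(2) by (rule sum_power_card_Pow)
  also have "\<dots> = (1 + l) powr real (card X)" using l by (simp add: powr_realpow)
  also have "\<dots> \<le> (1 + l) powr M" using l assms(3) by (intro powr_mono) auto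
  also have "\<dots> \<le> (2 powr (e/2)) powr M"
  proof (rule powr_mono2)
    \<comment> \<open>Here \<open>l \<le> e / 4\<close> and \<open>ln 2 \<ge> 1 / 2\<close> give
      \<open>l \<le> e / 2 * ln 2\<close>.\<close>
    have "1 + l \<le> exp l" by (rule exp_ge_add_one_self)
    also have "exp l \<le> exp (e/2 * ln 2)"
    proof -
      have "l \<le> e/2 * (1/2)" using l by simp
      also have "\<dots> \<le> e/2 * ln 2" using assms(1) ln_le_minus_one[of "1/2::real"] by (intro mult_left_mono) (auto simp: ln_div)
      finally show ?thesis by simp
    qed
    also have "\<dots> = 2 powr (e/2)" by (simp add: powr_def)
    finally show "1 + l \<le> 2 powr (e/2)" .
  qed (use M l in auto)
  also have "\<dots> = 2 powr (e/2 * M)" by (simp add: powr_powr)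
  finally have main: "real (card A) * l powr (thin e * M) \<le> 2 powr (e/2 * M)" .
  have "l = 2 powr (- log 2 (1/l))" using l by (simp add: log_divide powr_minus)
  then have "l powr (thin e * M) = 2 powr (- log 2 (1/l) * (thin e * M))"
    by (metis powr_powr)
  also have "- log 2 (1/l) * (thin e * M) = - (e/2 * M)"
    using logl by (simp add: thin_def l_def[symmetric])
  finally have "real (card A) * 2 powr (- (e/2 * M)) \<le> 2 powr (e/2 * M)" using main by simp
  then have "real (card A) \<le> 2 powr (e/2*M) * 2 powr (e/2*M)"
    by (simp add: powr_minus divide_simps split: if_splits)
  also have "\<dots> = 2 powr (e * M)" by (simp add: powr_add[symmetric] mult.commute)
  finally show ?thesis by (simp add: A_def)
qed

text \<open>The induction inserts one element at a time, with the extra 1 for inserting nothing. The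
  bound serves both for fixed \<open>q\<close> and for a \<open>q\<close> that grows with the weight
  of a formula.\<close>

lemma card_subsets_le_pow:
  assumes "finite X"
  shows "card {Y. Y \<subseteq> X \<and> card Y \<le> q} \<le> (card X + 1) ^ q"
proof (induction q)
  case 0
  have "{Y. Y \<subseteq> X \<and> card Y \<le> 0} = {{}}" using assms finite_subset by fastforce
  then show ?case by simp
next
  case (Suc q)
  let ?A = "{Y. Y \<subseteq> X \<and> card Y \<le> q}"
  have finA: "finite ?A" using assms by (rule_tac finite_subset[of _ "Pow X"]) auto
  have "{Y. Y \<subseteq> X \<and> card Y \<le> Suc q} \<subseteq> ?A \<union> (\<lambda>(Y,x). insert x Y) ` (?A \<times> X)"
  proof
    fix Y assume Y: "Y \<in> {Y. Y \<subseteq> X \<and> card Y \<le> Suc q}"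
    show "Y \<in> ?A \<union> (\<lambda>(Y,x). insert x Y) ` (?A \<times> X)"
    proof (cases "Y = {}")
      case False
      then obtain y where y: "y \<in> Y" by auto
      have "(Y - {y}, y) \<in> ?A \<times> X" using Y y finite_subset[OF _ assms, of Y]
        by (auto simp: card_Diff_singleton)
      moreover have "Y = (\<lambda>(Y,x). insert x Y) (Y - {y}, y)" using y by auto
      ultimately show ?thesis by blast
    qed auto
  qed
  then have "card {Y. Y \<subseteq> X \<and> card Y \<le> Suc q} \<le> card (?A \<union> (\<lambda>(Y,x). insert x Y) ` (?A \<times> X))"
    using finA assms by (intro card_mono) auto
  also have "\<dots> \<le> card ?A + card (?A \<times> X)"
    using finA assms by (intro order_trans[OF card_Un_le] add_left_mono card_image_le) auto
  also have "\<dots> = card ?A * (card X + 1)" by (simp add: card_cartesian_product)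
  also have "\<dots> \<le> (card X + 1) ^ q * (card X + 1)" using Suc by (intro mult_right_mono) auto
  finally show ?case by (simp add: algebra_simps)
qed

text \<open>Subsets of \<open>S \<times> K\<close> code families of \<open>i = card S\<close> subsets of \<open>K\<close>. Weighting the full pattern at a
  point by \<open>1 / 2\<close> leaves \<open>2 ^ i - 1 / 2\<close> of the \<open>2 ^ i\<close> patterns, a gain of \<open>2 * tuple_gain i\<close> per point,
  half of which pays for passing from the weighted sum to the number of families.\<close>

definition tuple_gain :: "nat \<Rightarrow> real" where
  "tuple_gain i = - log 2 (1 - 1 / 2 ^ (i + 1)) / 2"

lemma tuple_gain_pos: "tuple_gain i > 0"
proof -
  have "0 < 1 - 1 / (2::real) ^ (i + 1)" "1 - 1 / (2::real) ^ (i + 1) < 1"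
    using one_less_power[of "2::real" "i+1"] by (auto simp: field_simps)
  then have "log 2 (1 - 1 / 2 ^ (i + 1)) < 0" by (subst log_less_zero_cancel_iff) auto
  then show ?thesis by (simp add: tuple_gain_def)
qed

lemma sum_half_power_full:
  assumes "finite S" "finite K" "Q \<subseteq> K"
  shows "(\<Sum>Y\<in>Pow (S \<times> K). (1/2::real) ^ card {q\<in>Q. \<forall>x\<in>S. (x,q) \<in> Y})
          = 2 ^ (card S * card K) * (1 - 1 / 2 ^ (card S + 1)) ^ card Q"
  using assms(2,3)
proof (induction K arbitrary: Q rule: finite_induct)
  case (insert a K)
  let ?i = "card S"
  define f where "f Q Y = (1/2::real) ^ card {q\<in>Q. \<forall>x\<in>S. (x,q) \<in> Y}" for Q and Y :: "('a \<times> 'b) set"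
  have finQ: "finite Q" using insert finite_subset by blast
  have aK: "a \<notin> K" using insert by auto
  \<comment> \<open>\<open>g\<close> adds to a set over \<open>K\<close> the pattern
    \<open>Z\<close> of those \<open>x\<close> whose pair with the new point \<open>a\<close> is
    chosen. It is a bijection, so the sum splits into a factor for \<open>a\<close> and the sum over
    \<open>K\<close>; the full pattern \<open>Z = S\<close> carries the weight 1/2 when
    \<open>a \<in> Q\<close>.\<close>
  define g where "g = (\<lambda>(Z,Y). (\<lambda>x. (x,a)) ` Z \<union> Y :: ('a \<times> 'b) set)"
  have inj: "inj_on g (Pow S \<times> Pow (S \<times> K))"
  proof (rule inj_onI, clarify)
    fix Z Y Z' Y' assume h: "Z \<subseteq> S" "Y \<subseteq> S \<times> K" "Z' \<subseteq> S" "Y' \<subseteq> S \<times> K" "g (Z,Y) = g (Z',Y')"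
    have "Y = g (Z,Y) \<inter> (S \<times> K)" "Y' = g (Z',Y') \<inter> (S \<times> K)" using h(1-4) aK by (auto simp: g_def)
    moreover have "Z = {x. (x,a) \<in> g (Z,Y)}" "Z' = {x. (x,a) \<in> g (Z',Y')}" using h(1-4) aK by (auto simp: g_def)
    ultimately show "Z = Z' \<and> Y = Y'" using h(5) by metis
  qed
  have img: "g ` (Pow S \<times> Pow (S \<times> K)) = Pow (S \<times> insert a K)"
  proof
    show "Pow (S \<times> insert a K) \<subseteq> g ` (Pow S \<times> Pow (S \<times> K))"
    proof
      fix Y assume Y: "Y \<in> Pow (S \<times> insert a K)"
      have "Y = g ({x. (x,a) \<in> Y}, Y \<inter> (S \<times> K))" using Y by (auto simp: g_def)
      moreover have "({x. (x,a) \<in> Y}, Y \<inter> (S \<times> K)) \<in> Pow S \<times> Pow (S \<times> K)" using Y by auto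
      ultimately show "Y \<in> g ` (Pow S \<times> Pow (S \<times> K))" by blast
    qed
  qed (auto simp: g_def)
  have fg: "f Q (g (Z,Y)) = (if a \<in> Q \<and> Z = S then 1/2 else 1) * f (Q - {a}) Y"
    if "Z \<subseteq> S" "Y \<subseteq> S \<times> K" for Z Y
  proof -
    have eq: "{q\<in>Q. \<forall>x\<in>S. (x,q) \<in> g (Z,Y)} =
        (if a \<in> Q \<and> Z = S then {a} else {}) \<union> {q\<in>Q - {a}. \<forall>x\<in>S. (x,q) \<in> Y} \<union>
        (if a \<in> Q \<and> S = {} then {a} else {})"
      using that aK insert.prems by (auto simp: g_def split: if_splits) 
    have "{q\<in>Q. \<forall>x\<in>S. (x,q) \<in> g (Z,Y)} =
        (if a \<in> Q \<and> Z = S then insert a {q\<in>Q - {a}. \<forall>x\<in>S. (x,q) \<in> Y} else {q\<in>Q - {a}. \<forall>x\<in>S. (x,q) \<in> Y})"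
      unfolding eq using that by auto
    then show ?thesis using finQ by (auto simp: f_def)
  qed
  have "(\<Sum>Y\<in>Pow (S \<times> insert a K). f Q Y) = (\<Sum>p\<in>Pow S \<times> Pow (S \<times> K). f Q (g p))"
    unfolding img[symmetric] by (subst sum.reindex[OF inj]) simp
  also have "\<dots> = (\<Sum>Z\<in>Pow S. \<Sum>Y\<in>Pow (S \<times> K). f Q (g (Z,Y)))"
    by (simp add: sum.cartesian_product)
  also have "\<dots> = (\<Sum>Z\<in>Pow S. \<Sum>Y\<in>Pow (S \<times> K). (if a \<in> Q \<and> Z = S then 1/2 else 1) * f (Q - {a}) Y)"
    using fg by (intro sum.cong) auto
  also have "\<dots> = (\<Sum>Z\<in>Pow S. (if a \<in> Q \<and> Z = S then 1/2 else 1)) * (\<Sum>Y\<in>Pow (S \<times> K). f (Q - {a}) Y)"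
    by (rule sum_product[symmetric])
  also have "(\<Sum>Y\<in>Pow (S \<times> K). f (Q - {a}) Y) = 2 ^ (?i * card K) * (1 - 1 / 2 ^ (?i + 1)) ^ card (Q - {a})"
    unfolding f_def using insert by (intro insert.IH) auto
  also have "(\<Sum>Z\<in>Pow S. (if a \<in> Q \<and> Z = S then 1/2 else 1::real)) =
      2 ^ ?i * (if a \<in> Q then 1 - 1 / 2 ^ (?i + 1) else 1)"
  proof (cases "a \<in> Q")
    case True
    have "(\<Sum>Z\<in>Pow S. (if Z = S then 1/2 else 1::real)) = 1/2 + (\<Sum>Z\<in>Pow S - {S}. (if Z = S then 1/2 else 1))"
      using assms(1) by (subst sum.remove[of _ S]) auto
    also have "(\<Sum>Z\<in>Pow S - {S}. (if Z = S then 1/2 else 1::real)) = (\<Sum>Z\<in>Pow S - {S}. 1)"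
      by (intro sum.cong) auto
    also have "\<dots> = 2 ^ ?i - 1" using assms(1) by (simp add: card_Diff_singleton card_Pow of_nat_diff)
    finally have "(\<Sum>Z\<in>Pow S. (if Z = S then 1/2 else 1::real)) = 2 ^ ?i - 1/2" by simp
    moreover have "2 ^ ?i * (1 - 1 / 2 ^ (?i + 1)) = 2 ^ ?i - (1/2::real)" by (simp add: field_simps)
    ultimately show ?thesis using True by simp
  qed (use assms(1) in \<open>simp add: card_Pow\<close>)
  also have "2 ^ ?i * (if a \<in> Q then 1 - 1 / 2 ^ (?i + 1) else 1) *
      (2 ^ (?i * card K) * (1 - 1 / 2 ^ (?i + 1)) ^ card (Q - {a})) =
      2 ^ (?i * card (insert a K)) * (1 - 1 / 2 ^ (?i + 1) :: real) ^ card Q"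
  proof -
    have "(if a \<in> Q then 1 - 1 / 2 ^ (?i + 1) else 1) * (1 - 1 / 2 ^ (?i + 1)) ^ card (Q - {a})
      = (1 - 1 / 2 ^ (?i + 1) :: real) ^ card Q"
    proof (cases "a \<in> Q")
      case True
      then have "card Q = Suc (card (Q - {a}))" using finQ by (metis card_Suc_Diff1)
      then show ?thesis by (simp only: True if_True power_Suc)
    qed simp
    then show ?thesis using insert.hyps aK by (simp add: power_add algebra_simps)
  qed
  finally show ?case by (simp add: f_def)
qed simp

text \<open>Markov's inequality: a family whose full pattern occurs at most
  \<open>tuple_gain (card S) * card Q\<close> times has weight at least 1/2 to that power, while the
  total weight is \<open>2 powr (card S * card K - 2 * tuple_gain (card S) * card Q)\<close>. Points
  of \<open>K\<close> outside \<open>Q\<close> remain free.\<close>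

lemma card_thin_intersections:
  assumes "finite S" "finite K" "Q \<subseteq> K"
  shows "real (card {Y. Y \<subseteq> S \<times> K \<and> real (card {q\<in>Q. \<forall>x\<in>S. (x,q) \<in> Y}) \<le> tuple_gain (card S) * real (card Q)})
     \<le> 2 powr (real (card S) * real (card K) - tuple_gain (card S) * real (card Q))"
proof -
  let ?g = "tuple_gain (card S)" and ?q = "real (card Q)"
  define f where "f Y = card {q\<in>Q. \<forall>x\<in>S. (x,q) \<in> Y}" for Y :: "('a \<times> 'b) set"
  define A where "A = {Y. Y \<subseteq> S \<times> K \<and> real (f Y) \<le> ?g * ?q}"
  define u :: real where "u = 1 - 1 / 2 ^ (card S + 1)"
  have u: "u > 0" using one_less_power[of "2::real" "card S+1"] by (auto simp: u_def field_simps)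
  have u2: "u = 2 powr (- 2 * ?g)" using u by (simp add: tuple_gain_def u_def)
  have "real (card A) * (1/2) powr (?g * ?q) = (\<Sum>Y\<in>A. (1/2) powr (?g * ?q))" by simp
  also have "\<dots> \<le> (\<Sum>Y\<in>A. (1/2) ^ f Y)"
  proof (rule sum_mono)
    fix Y assume "Y \<in> A"
    then have "(1/2::real) powr (?g * ?q) \<le> (1/2) powr (real (f Y))" by (intro powr_mono') (auto simp: A_def)
    then show "(1/2::real) powr (?g * ?q) \<le> (1/2) ^ f Y" by (simp add: powr_realpow)
  qed
  also have "\<dots> \<le> (\<Sum>Y\<in>Pow (S \<times> K). (1/2) ^ f Y)"
    using assms by (intro sum_mono2) (auto simp: A_def)
  also have "\<dots> = 2 ^ (card S * card K) * u ^ card Q"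
    unfolding f_def u_def by (rule sum_half_power_full[OF assms])
  also have "\<dots> = 2 powr (real (card S) * real (card K)) * 2 powr (- 2 * ?g * ?q)"
    using u by (simp add: powr_realpow[symmetric] u2 powr_powr)
  finally have "real (card A) * 2 powr (- (?g * ?q)) \<le> 2 powr (real (card S) * real (card K)) * 2 powr (- 2 * ?g * ?q)"
    by (simp add: powr_divide powr_minus field_simps)
  then have "real (card A) \<le> 2 powr (real (card S) * real (card K)) * 2 powr (- 2 * ?g * ?q) * 2 powr (?g * ?q)"
    by (simp add: powr_minus divide_simps split: if_splits)
  also have "\<dots> = 2 powr (real (card S) * real (card K) - ?g * ?q)"
    by (simp add: powr_add[symmetric] algebra_simps)
  finally show ?thesis by (simp add: A_def f_def)
qed

section \<open>Products over blocks, disjoint constraints and greedy choices\<close>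

lemma card_image_UN_le:
  assumes "finite J" "finite G"
  shows "card ((\<lambda>F. \<Union>j\<in>J. p j F) ` G) \<le> (\<Prod>j\<in>J. card (p j ` G))"
  using assms(1)
proof (induction J rule: finite_induct)
  case empty
  then show ?case by (cases "G = {}") (auto simp: image_constant_conv)
next
  case (insert i J)
  have "(\<lambda>F. \<Union>j\<in>insert i J. p j F) ` G \<subseteq> (\<lambda>(a,b). a \<union> b) ` ((p i ` G) \<times> ((\<lambda>F. \<Union>j\<in>J. p j F) ` G))"
    by (auto simp: image_iff)
  then have "card ((\<lambda>F. \<Union>j\<in>insert i J. p j F) ` G) \<le> card ((p i ` G) \<times> ((\<lambda>F. \<Union>j\<in>J. p j F) ` G))"
    using assms(2) by (meson card_image_le card_mono finite_SigmaI finite_imageI le_trans)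
  also have "\<dots> \<le> card (p i ` G) * (\<Prod>j\<in>J. card (p j ` G))"
    by (simp add: card_cartesian_product insert.IH)
  finally show ?case using insert by simp
qed

lemma card_separating_sets:
  assumes "finite V" "T \<subseteq> V" "S \<subseteq> V" "S \<inter> T = {}"
  shows "card {A. A \<subseteq> V \<and> T \<subseteq> A \<and> S \<inter> A = {}} = 2 ^ (card V - card T - card S)"
proof -
  have "bij_betw (\<lambda>A. A \<union> T) (Pow (V - T - S)) {A. A \<subseteq> V \<and> T \<subseteq> A \<and> S \<inter> A = {}}"
    by (rule bij_betw_byWitness[where f' = "\<lambda>A. A - T"]) (use assms in auto)
  then have "card {A. A \<subseteq> V \<and> T \<subseteq> A \<and> S \<inter> A = {}} = card (Pow (V - T - S))"
    by (rule bij_betw_same_card[symmetric])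
  also have "card (V - T - S) = card V - card T - card S"
  proof -
    have "S \<subseteq> V - T" using assms by auto
    moreover have "finite S" "finite T" using assms by (auto intro: finite_subset)
    ultimately have "S \<subseteq> V - T" "finite S" "finite T" by auto
    then show ?thesis using assms(2) by (simp add: card_Diff_subset)
  qed
  then have "card (Pow (V - T - S)) = 2 ^ (card V - card T - card S)"
    using assms by (simp add: card_Pow)
  finally show ?thesis .
qed

text \<open>Blocks are peeled off one at a time; disjointness leaves the constraints on the other
  blocks untouched, so the savings \<open>g\<close> add up.\<close>

lemma card_block_constraints:
  fixes g :: real
  assumes "finite I" "finite X" "\<forall>p\<in>I. B p \<subseteq> X" "disjoint_family_on B I"
    and "\<forall>p\<in>I. real (card {Y. Y \<subseteq> B p \<and> P p Y}) \<le> 2 powr (real (card (B p)) - g)"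
  shows "real (card {Y. Y \<subseteq> X \<and> (\<forall>p\<in>I. P p (Y \<inter> B p))}) \<le> 2 powr (real (card X) - g * real (card I))"
  using assms
proof (induction I arbitrary: X rule: finite_induct)
  case empty
  then show ?case by (simp add: card_Pow[unfolded Pow_def] powr_realpow)
next
  case (insert i I)
  let ?A = "{Y. Y \<subseteq> B i \<and> P i Y}"
  let ?C = "{Y. Y \<subseteq> X - B i \<and> (\<forall>p\<in>I. P p (Y \<inter> B p))}"
  have finB: "finite (B i)" using insert.prems finite_subset by blast
  have dis: "B p \<inter> B i = {}" if "p \<in> I" for p
    using insert.prems(3) insert.hyps(2) that by (auto simp: disjoint_family_on_def)
  have IH: "real (card ?C) \<le> 2 powr (real (card (X - B i)) - g * real (card I))"
  proof (rule insert.IH)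
    show "\<forall>p\<in>I. B p \<subseteq> X - B i" using insert.prems(2) dis by blast
    show "disjoint_family_on B I" using insert.prems(3) by (auto simp: disjoint_family_on_def)
  qed (use insert.prems in auto)
  have fin: "finite ?A" "finite ?C" using finB insert.prems(1)
    by (auto intro: finite_subset[of _ "Pow (B i)"] finite_subset[of _ "Pow X"])
  have "inj_on (\<lambda>Y. (Y \<inter> B i, Y - B i)) {Y. Y \<subseteq> X \<and> (\<forall>p\<in>insert i I. P p (Y \<inter> B p))}"
    by (auto simp: inj_on_def)
  moreover have "(\<lambda>Y. (Y \<inter> B i, Y - B i)) ` {Y. Y \<subseteq> X \<and> (\<forall>p\<in>insert i I. P p (Y \<inter> B p))} \<subseteq> ?A \<times> ?C"
  proof (clarsimp simp only: mem_Sigma_iff mem_Collect_eq)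
    fix Y assume Y: "Y \<subseteq> X" "\<forall>p\<in>insert i I. P p (Y \<inter> B p)"
    have "(Y - B i) \<inter> B p = Y \<inter> B p" if "p \<in> I" for p using dis[OF that] by blast
    then show "(Y \<inter> B i \<subseteq> B i \<and> P i (Y \<inter> B i)) \<and> Y - B i \<subseteq> X - B i \<and> (\<forall>p\<in>I. P p ((Y - B i) \<inter> B p))"
      using Y by auto
  qed
  ultimately have "card {Y. Y \<subseteq> X \<and> (\<forall>p\<in>insert i I. P p (Y \<inter> B p))} \<le> card (?A \<times> ?C)"
    using fin by (intro card_inj_on_le) auto
  also have "\<dots> = card ?A * card ?C" by (rule card_cartesian_product)
  finally have "real (card {Y. Y \<subseteq> X \<and> (\<forall>p\<in>insert i I. P p (Y \<inter> B p))}) \<le> real (card ?A) * real (card ?C)"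
    by (simp only: of_nat_mult[symmetric] of_nat_le_iff)
  also have "\<dots> \<le> 2 powr (real (card (B i)) - g) * 2 powr (real (card (X - B i)) - g * real (card I))"
    using insert.prems(4) IH by (intro mult_mono) auto
  also have "\<dots> = 2 powr (real (card X) - g * real (card (insert i I)))"
  proof -
    have "card X = card (B i) + card (X - B i)"
      using insert.prems(1,2) finB card_mono[of X "B i"] by (simp add: card_Diff_subset)
    then show ?thesis using insert.hyps by (simp add: powr_add[symmetric] algebra_simps)
  qed
  finally show ?case .
qed

text \<open>Pick any \<open>a\<close>, discard the at most \<open>d\<close> elements in conflict
  with it and recurse; reflexivity of \<open>conf\<close> on \<open>A\<close> makes \<open>a\<close>
  one of the discarded elements.\<close>

lemma greedy_independent_set:
  assumes "finite A" and "\<And>x y. conf x y \<Longrightarrow> conf y x"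
    and "\<And>x. x \<in> A \<Longrightarrow> conf x x" and "\<And>x. x \<in> A \<Longrightarrow> card {y\<in>A. conf x y} \<le> d"
  shows "\<exists>I\<subseteq>A. (\<forall>x\<in>I. \<forall>y\<in>I. x \<noteq> y \<longrightarrow> \<not> conf x y) \<and> card A \<le> d * card I"
  using assms(1,3,4)
proof (induction "card A" arbitrary: A rule: less_induct)
  case less
  show ?case
  proof (cases "A = {}")
    case False
    then obtain a where a: "a \<in> A" by auto
    let ?N = "{y\<in>A. conf a y}"
    have aN: "a \<in> ?N" using a less.prems by auto
    have lt: "card (A - ?N) < card A" using a aN less.prems(1) by (intro psubset_card_mono) auto
    have "card {y\<in>A - ?N. conf x y} \<le> d" if "x \<in> A - ?N" for x
    proof -
      have "card {y\<in>A - ?N. conf x y} \<le> card {y\<in>A. conf x y}"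
        using less.prems(1) by (intro card_mono) auto
      then show ?thesis using less.prems(3)[of x] that by force
    qed
    then obtain I where I: "I \<subseteq> A - ?N" "\<forall>x\<in>I. \<forall>y\<in>I. x \<noteq> y \<longrightarrow> \<not> conf x y" "card (A - ?N) \<le> d * card I"
      using less.hyps[OF lt] less.prems by blast
    have "finite I" using I(1) less.prems(1) finite_subset by blast
    moreover have "a \<notin> I" using I(1) aN by blast
    moreover have "card A = card ?N + card (A - ?N)"
      using less.prems(1) by (subst card_Un_disjoint[symmetric]) (auto intro: arg_cong[of _ _ card])
    ultimately have "card A \<le> d * card (insert a I)"
      using I(3) less.prems(3)[OF a] by simp
    moreover have "\<forall>x\<in>insert a I. \<forall>y\<in>insert a I. x \<noteq> y \<longrightarrow> \<not> conf x y"
      using I assms(2) by blast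
    moreover have "insert a I \<subseteq> A" using I a by blast
    ultimately show ?thesis by blast
  qed auto
qed

section \<open>Degrees, cliques and mixed sets in uniform families\<close>

definition deg :: "'a set \<Rightarrow> 'a set set \<Rightarrow> 'a set \<Rightarrow> nat" where
  "deg V D Y = card {v\<in>V - Y. insert v Y \<in> D}"

lemma sum_deg:
  assumes "finite V" "D \<subseteq> ksub V (Suc s)"
  shows "(\<Sum>Y\<in>ksub V s. deg V D Y) = Suc s * card D"
proof -
  have finD: "finite D" using assms finite_subset finite_ksub by blast
  let ?P = "SIGMA Y:ksub V s. {v\<in>V - Y. insert v Y \<in> D}"
  have "bij_betw (\<lambda>(Y,v). (insert v Y, v)) ?P (SIGMA C:D. C)"
    by (rule bij_betw_byWitness[where f' = "\<lambda>(C,v). (C - {v}, v)"])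
       (use assms in \<open>auto simp: ksub_def dest: finite_subset simp: insert_absorb subset_iff\<close>)
  then have "card ?P = card (SIGMA C:D. C)" by (rule bij_betw_same_card)
  moreover have "card ?P = (\<Sum>Y\<in>ksub V s. deg V D Y)"
    unfolding deg_def using assms(1) by (subst card_SigmaI) auto
  moreover have "card (SIGMA C:D. C) = (\<Sum>C\<in>D. card C)"
    using assms finD finite_subset[OF _ assms(1)] by (subst card_SigmaI) (auto simp: ksub_def)
  moreover have "(\<Sum>C\<in>D. card C) = (\<Sum>C\<in>D. Suc s)" using assms by (intro sum.cong) (auto simp: ksub_def)
  ultimately show ?thesis by (simp add: mult.commute)
qed

lemma card_high_deg:
  assumes "finite V" "D \<subseteq> ksub V (Suc s)"
  shows "real (card {Y\<in>ksub V s. real (deg V D Y) > t}) * t \<le> real (Suc s) * real (card D)"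
proof -
  have "real (card {Y\<in>ksub V s. real (deg V D Y) > t}) * t = (\<Sum>Y\<in>{Y\<in>ksub V s. real (deg V D Y) > t}. t)" by simp
  also have "\<dots> \<le> (\<Sum>Y\<in>{Y\<in>ksub V s. real (deg V D Y) > t}. real (deg V D Y))" by (intro sum_mono) auto
  also have "\<dots> \<le> (\<Sum>Y\<in>ksub V s. real (deg V D Y))" using assms(1) by (intro sum_mono2) auto
  also have "\<dots> = real (Suc s) * real (card D)" using sum_deg[OF assms] by (metis of_nat_mult of_nat_sum)
  finally show ?thesis .
qed

text \<open>The factor \<open>card B\<close> is the point: a multiple of \<open>n ^ Suc m\<close>
  would be useless for small \<open>B\<close>. Induction on \<open>s\<close>: the family
  \<open>D1\<close> of \<open>s\<close>-sets of large degree into \<open>D\<close> is sparse. Either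
  all \<open>s\<close>-subsets of \<open>T\<close> lie in \<open>D1\<close>, and the induction
  hypothesis applies to \<open>D1\<close>, or \<open>T\<close> contains some \<open>Y\<close> of
  small degree; then \<open>T\<close> arises from a facet in \<open>B\<close> that contains
  \<open>Y\<close> by adding one of the few neighbours of \<open>Y\<close>.\<close>

lemma clique_count:
  fixes e :: real
  assumes "e > 0" "1 \<le> s" "s \<le> m"
  shows "\<exists>\<xi>>0. \<forall>(V::'a set) D B. finite V \<longrightarrow> D \<subseteq> ksub V s \<longrightarrow> real (card D) \<le> \<xi> * real (card V) ^ s \<longrightarrow>
      B \<subseteq> ksub V m \<longrightarrow>
      real (card {T\<in>ksub V (Suc m). (\<forall>t\<in>T. T - {t} \<in> B) \<and> ksub T s \<subseteq> D}) \<le> e * real (card V) * real (card B)"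
  using assms(2,1,3)
proof (induction s arbitrary: e rule: nat_induct_at_least)
  case base
  show ?case
  proof (intro exI[of _ e] conjI allI impI)
    fix V :: "'a set" and D B
    assume h: "finite V" "D \<subseteq> ksub V 1" "real (card D) \<le> e * real (card V) ^ 1" "B \<subseteq> ksub V m"
    have fin: "finite D" "finite B" using h finite_subset finite_ksub by blast+
    have "{T\<in>ksub V (Suc m). (\<forall>t\<in>T. T - {t} \<in> B) \<and> ksub T 1 \<subseteq> D} \<subseteq> (\<lambda>(A,E). A \<union> E) ` (B \<times> D)"
    proof clarify
      fix T assume T: "T \<in> ksub V (Suc m)" "\<forall>t\<in>T. T - {t} \<in> B" "ksub T 1 \<subseteq> D"
      then obtain t where t: "t \<in> T" by (force simp: ksub_def)
      then have "{t} \<in> D" using T by (auto simp: ksub_def)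
      moreover have "T = (T - {t}) \<union> {t}" using t by auto
      ultimately show "T \<in> (\<lambda>(A,E). A \<union> E) ` (B \<times> D)" using T(2) t by (metis (mono_tags, lifting) SigmaI case_prod_conv imageI)
    qed
    then have "card {T\<in>ksub V (Suc m). (\<forall>t\<in>T. T - {t} \<in> B) \<and> ksub T 1 \<subseteq> D} \<le> card (B \<times> D)"
      using fin by (meson card_image_le card_mono finite_SigmaI finite_imageI le_trans)
    then have "real (card {T\<in>ksub V (Suc m). (\<forall>t\<in>T. T - {t} \<in> B) \<and> ksub T 1 \<subseteq> D}) \<le> real (card B) * real (card D)"
      by (simp only: card_cartesian_product of_nat_mult[symmetric] of_nat_le_iff)
    also have "\<dots> \<le> real (card B) * (e * real (card V))" using h(3) by (intro mult_left_mono) auto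
    finally show "real (card {T\<in>ksub V (Suc m). (\<forall>t\<in>T. T - {t} \<in> B) \<and> ksub T 1 \<subseteq> D}) \<le> e * real (card V) * real (card B)"
      by (simp add: algebra_simps)
  qed (use base in auto)
next
  case (Suc s)
  \<comment> \<open>The factor \<open>2 ^ m\<close> is for the subsets \<open>Y\<close> of a facet
    with \<open>m\<close> elements; the other half of \<open>e\<close> goes to the induction
    hypothesis.\<close>
  define e' where "e' = e / 2 / 2 ^ m"
  have e': "e' > 0" using Suc.prems by (simp add: e'_def)
  from Suc.IH[of "e/2"] Suc.prems obtain x where x: "x > 0" and IH:
    "\<And>(V::'a set) D B. finite V \<Longrightarrow> D \<subseteq> ksub V s \<Longrightarrow> real (card D) \<le> x * real (card V) ^ s \<Longrightarrow>
      B \<subseteq> ksub V m \<Longrightarrow>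
      real (card {T\<in>ksub V (Suc m). (\<forall>t\<in>T. T - {t} \<in> B) \<and> ksub T s \<subseteq> D}) \<le> e / 2 * real (card V) * real (card B)"
    by auto
  show ?case
  \<comment> \<open>Markov's inequality for degrees above \<open>e' * n\<close> turns this density
    of \<open>D\<close> into density \<open>x\<close> of \<open>D1\<close>.\<close>
  proof (intro exI[of _ "x * e' / real (Suc s)"] conjI allI impI)
    fix V :: "'a set" and D B
    assume h: "finite V" "D \<subseteq> ksub V (Suc s)" "real (card D) \<le> x * e' / real (Suc s) * real (card V) ^ Suc s" "B \<subseteq> ksub V m"
    let ?n = "real (card V)"
    have fin: "finite D" "finite B" using h finite_subset finite_ksub by blast+
    define D1 where "D1 = {Y\<in>ksub V s. real (deg V D Y) > e' * ?n}"
    define G where "G = {T\<in>ksub V (Suc m). (\<forall>t\<in>T. T - {t} \<in> B) \<and> ksub T (Suc s) \<subseteq> D}"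
    define G1 where "G1 = {T\<in>ksub V (Suc m). (\<forall>t\<in>T. T - {t} \<in> B) \<and> ksub T s \<subseteq> D1}"
    define N where "N Y = {v\<in>V - Y. insert v Y \<in> D}" for Y
    define G2 where "G2 = (\<Union>A\<in>B. \<Union>Y\<in>{Y. Y \<subseteq> A \<and> Y \<in> ksub V s - D1}. (\<lambda>t. insert t A) ` N Y)"
    have finBm: "finite A" "card A = m" if "A \<in> B" for A
      using that h finite_subset[OF _ h(1)] by (auto simp: ksub_def)
    have D1: "real (card D1) \<le> x * ?n ^ s"
    proof (cases "card V = 0")
      case True
      then have "V = {}" using h by auto
      then have "D1 = {}" unfolding D1_def deg_def by auto
      then show ?thesis using x by simp
    next
      case False
      have "real (card D1) * (e' * ?n) \<le> real (Suc s) * real (card D)"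
        unfolding D1_def by (rule card_high_deg[OF h(1,2)])
      also have "\<dots> \<le> real (Suc s) * (x * e' / real (Suc s) * ?n ^ Suc s)"
        by (rule mult_left_mono[OF h(3)]) simp
      also have "\<dots> = (x * ?n ^ s) * (e' * ?n)" by (simp add: field_simps)
      finally show ?thesis using e' False by (simp add: mult_le_cancel_right)
    qed
    have "G \<subseteq> G1 \<union> G2"
    proof
      fix T assume T: "T \<in> G"
      show "T \<in> G1 \<union> G2"
      proof (cases "ksub T s \<subseteq> D1")
        case True then show ?thesis using T by (auto simp: G_def G1_def)
      next
        case False
        then obtain Y where Y: "Y \<subseteq> T" "card Y = s" "Y \<notin> D1" by (auto simp: ksub_def)
        have TV: "T \<subseteq> V" "card T = Suc m" using T by (auto simp: G_def ksub_def)
        have "Y \<noteq> T" using Y TV Suc.prems by auto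
        then obtain t where t: "t \<in> T" "t \<notin> Y" using Y(1) by blast
        have finY: "finite Y" using finite_subset[OF Y(1) finite_subset[OF TV(1) h(1)]] .
        have "insert t Y \<in> ksub T (Suc s)" using t Y finY by (auto simp: ksub_def)
        then have "insert t Y \<in> D" using T by (auto simp: G_def)
        then have "t \<in> N Y" using t TV by (auto simp: N_def)
        moreover have "T - {t} \<in> B" using T t by (auto simp: G_def)
        moreover have "Y \<subseteq> T - {t}" "Y \<in> ksub V s - D1" using Y t TV by (auto simp: ksub_def)
        moreover have "T = insert t (T - {t})" using t by auto
        ultimately have "T \<in> G2" unfolding G2_def by blast
        then show ?thesis by simp
      qed
    qed
    moreover have fG1: "finite G1" using h(1) by (simp add: G1_def)
    moreover have fN: "finite (N Y)" for Y using h(1) by (simp add: N_def)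
    moreover have fG2: "finite G2" unfolding G2_def using fin finBm(1) fN by auto
    ultimately have "card G \<le> card G1 + card G2"
      by (intro order_trans[OF card_mono card_Un_le]) auto
    moreover have "real (card G1) \<le> e / 2 * ?n * real (card B)"
      unfolding G1_def using D1 h by (intro IH) (auto simp: D1_def)
    moreover have "real (card G2) \<le> e / 2 * ?n * real (card B)"
    proof -
      have "real (card G2) \<le> (\<Sum>A\<in>B. real (card (\<Union>Y\<in>{Y. Y \<subseteq> A \<and> Y \<in> ksub V s - D1}. (\<lambda>t. insert t A) ` N Y)))"
        unfolding G2_def of_nat_sum[symmetric] of_nat_le_iff using fin by (intro card_UN_le)
      also have "\<dots> \<le> (\<Sum>A\<in>B. 2 ^ m * (e' * ?n))"
      proof (rule sum_mono)
        fix A assume A: "A \<in> B"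
        let ?Y = "{Y. Y \<subseteq> A \<and> Y \<in> ksub V s - D1}"
        have fY: "finite ?Y" using finBm(1)[OF A] by (rule_tac finite_subset[of _ "Pow A"]) auto
        have "real (card (\<Union>Y\<in>?Y. (\<lambda>t. insert t A) ` N Y)) \<le> (\<Sum>Y\<in>?Y. real (card ((\<lambda>t. insert t A) ` N Y)))"
          unfolding of_nat_sum[symmetric] of_nat_le_iff using fY by (intro card_UN_le)
        also have "\<dots> \<le> (\<Sum>Y\<in>?Y. e' * ?n)"
        proof (rule sum_mono)
          fix Y assume "Y \<in> ?Y"
          then have "real (card (N Y)) \<le> e' * ?n" by (auto simp: D1_def N_def deg_def not_less)
          moreover have "card ((\<lambda>t. insert t A) ` N Y) \<le> card (N Y)" using fN card_image_le by blast
          ultimately show "real (card ((\<lambda>t. insert t A) ` N Y)) \<le> e' * ?n" by linarith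
        qed
        also have "\<dots> = real (card ?Y) * (e' * ?n)" by simp
        also have "\<dots> \<le> 2 ^ m * (e' * ?n)"
        proof (rule mult_right_mono)
          have "card ?Y \<le> card (Pow A)" using finBm(1)[OF A] by (intro card_mono) auto
          then show "real (card ?Y) \<le> 2 ^ m" using finBm[OF A] by (simp add: card_Pow)
        qed (use e' in auto)
        finally show "real (card (\<Union>Y\<in>?Y. (\<lambda>t. insert t A) ` N Y)) \<le> 2 ^ m * (e' * ?n)" .
      qed
      also have "\<dots> = e / 2 * ?n * real (card B)" by (simp add: e'_def)
      finally show ?thesis .
    qed
    ultimately have "real (card G) \<le> e * ?n * real (card B)" by linarith
    then show "real (card {T\<in>ksub V (Suc m). (\<forall>t\<in>T. T - {t} \<in> B) \<and> ksub T (Suc s) \<subseteq> D}) \<le> e * ?n * real (card B)"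
      by (simp add: G_def)
  qed (use x e' in auto)
qed

text \<open>A family \<open>A\<close> of \<open>(r - 1)\<close>-sets and its complement two-colour
  the facets; \<open>cliques V A r\<close> and \<open>cliques V (- A) r\<close> are the
  monochromatic \<open>r\<close>-sets, and all other \<open>r\<close>-sets are mixed.\<close>

definition cliques :: "'a set \<Rightarrow> 'a set set \<Rightarrow> nat \<Rightarrow> 'a set set" where
  "cliques V A r = {Q\<in>ksub V r. \<forall>t\<in>Q. Q - {t} \<in> A}"

text \<open>Move from \<open>Q1\<close> to \<open>Q0\<close> by exchanging one element at a time.
  Consecutive sets share a facet, so a clique of one colour is never followed by a clique of the
  other; the successor of the last \<open>A\<close>-clique is mixed. Maximality of
  \<open>card (Q \<inter> Q0)\<close> stands for being last.\<close>

lemma mixed_between_cliques: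
  assumes "finite V" "r \<ge> 1" "Q1 \<in> cliques V A r" "Q0 \<in> cliques V (- A) r"
  shows "\<exists>Q\<in>ksub V r - cliques V A r - cliques V (- A) r. Q \<subseteq> Q1 \<union> Q0"
proof -
  let ?C = "{Q\<in>cliques V A r. Q \<subseteq> Q1 \<union> Q0}"
  have fin: "finite ?C" using assms(1) by (auto simp: cliques_def)
  have "Q1 \<in> ?C" using assms by auto
  then have ne: "(\<lambda>Q. card (Q \<inter> Q0)) ` ?C \<noteq> {}" by blast
  obtain Q where Q: "Q \<in> ?C" and Qmax: "card (Q \<inter> Q0) = Max ((\<lambda>Q. card (Q \<inter> Q0)) ` ?C)"
    using Max_in[OF _ ne] fin by (metis (no_types, lifting) finite_imageI imageE)
  have maxi: "card (Q' \<inter> Q0) \<le> card (Q \<inter> Q0)" if "Q' \<in> ?C" for Q'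
    unfolding Qmax using fin that by (intro Max_ge) auto
  have Qk: "Q \<subseteq> V" "card Q = r" "Q0 \<subseteq> V" "card Q0 = r" using Q assms by (auto simp: cliques_def ksub_def)
  then have f: "finite Q" "finite Q0" using assms(1) finite_subset by auto
  have "Q0 \<noteq> {}" using Qk assms(2) by auto
  then obtain q where "q \<in> Q0" by auto
  then have "Q0 \<notin> cliques V A r" using assms(4) by (auto simp: cliques_def)
  then have "Q \<noteq> Q0" using Q by auto
  then obtain b where b: "b \<in> Q0" "b \<notin> Q" using Qk f by (metis card_subset_eq subsetI)
  obtain a where a: "a \<in> Q" "a \<notin> Q0" using Qk f \<open>Q \<noteq> Q0\<close> by (metis card_subset_eq subsetI)
  let ?Q = "insert b (Q - {a})"
  have Q'k: "?Q \<in> ksub V r" using a b Qk f by (auto simp: ksub_def card_insert_if card_Diff_singleton) (metis Suc_pred assms(2) card_gt_0_iff empty_iff less_eq_Suc_le)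
  have "?Q \<inter> Q0 = insert b (Q \<inter> Q0)" using a b by auto
  then have "card (?Q \<inter> Q0) > card (Q \<inter> Q0)" using b f by simp
  then have "?Q \<notin> ?C" using maxi by force
  moreover have sub: "?Q \<subseteq> Q1 \<union> Q0" using Q b by auto
  ultimately have 1: "?Q \<notin> cliques V A r" by blast
  have "Q - {a} \<in> A" using Q a by (auto simp: cliques_def)
  moreover have "?Q - {b} = Q - {a}" using b by auto
  ultimately have 2: "?Q \<notin> cliques V (- A) r" unfolding cliques_def by (metis (mono_tags, lifting) ComplD insertI1 mem_Collect_eq)
  show ?thesis using 1 2 Q'k sub by blast
qed

text \<open>Cliques of positive density in both colours force a positive density of mixed sets. A
  pair of cliques is mapped to a mixed set \<open>C \<subseteq> Q1 \<union> Q0\<close> together with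
  the at most \<open>r\<close> remaining points; their union has at most \<open>2 * r\<close> points
  and thus at most \<open>16 ^ r\<close> pairs of subsets.\<close>

lemma card_mixed:
  fixes V :: "'a set"
  assumes "finite V" "r \<ge> 1"
  shows "real (card (cliques V A r)) * real (card (cliques V (- A) r))
     \<le> real (card (ksub V r - cliques V A r - cliques V (- A) r)) * ((real (card V) + 1) ^ r * 16 ^ r)"
proof -
  let ?M = "ksub V r - cliques V A r - cliques V (- A) r"
  let ?Y = "{Y. Y \<subseteq> V \<and> card Y \<le> r}"
  have finM: "finite ?M" using assms by auto
  have finY: "finite ?Y" using assms by (rule_tac finite_subset[of _ "Pow V"]) auto
  have "cliques V A r \<times> cliques V (- A) r \<subseteq> (\<Union>p\<in>?M \<times> ?Y. Pow (fst p \<union> snd p) \<times> Pow (fst p \<union> snd p))"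
  proof clarify
    fix Q1 Q0 assume Q: "Q1 \<in> cliques V A r" "Q0 \<in> cliques V (- A) r"
    obtain C where C: "C \<in> ?M" "C \<subseteq> Q1 \<union> Q0" using mixed_between_cliques[OF assms Q] by blast
    have k: "Q1 \<subseteq> V" "card Q1 = r" "Q0 \<subseteq> V" "card Q0 = r" "C \<subseteq> V" "card C = r"
      using Q C by (auto simp: cliques_def ksub_def)
    then have f: "finite Q1" "finite Q0" "finite C" using assms(1) finite_subset by auto
    have "card (Q1 \<union> Q0 - C) = card (Q1 \<union> Q0) - card C" using C f by (intro card_Diff_subset)
    also have "\<dots> \<le> r" using card_Un_le[of Q1 Q0] k by linarith
    finally have "(C, Q1 \<union> Q0 - C) \<in> ?M \<times> ?Y" using C k by auto
    moreover have "(Q1,Q0) \<in> Pow (fst (C, Q1 \<union> Q0 - C) \<union> snd (C, Q1 \<union> Q0 - C)) \<times> Pow (fst (C, Q1 \<union> Q0 - C) \<union> snd (C, Q1 \<union> Q0 - C))"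
      by auto
    ultimately show "(Q1,Q0) \<in> (\<Union>p\<in>?M \<times> ?Y. Pow (fst p \<union> snd p) \<times> Pow (fst p \<union> snd p))" by blast
  qed
  moreover have finP: "finite (fst p \<union> snd p)" if "p \<in> ?M \<times> ?Y" for p
    using that assms(1) by (auto simp: ksub_def dest: finite_subset)
  ultimately have "card (cliques V A r \<times> cliques V (- A) r) \<le> card (\<Union>p\<in>?M \<times> ?Y. Pow (fst p \<union> snd p) \<times> Pow (fst p \<union> snd p))"
    using finM finY by (intro card_mono finite_UN_I) auto
  also have "\<dots> \<le> (\<Sum>p\<in>?M \<times> ?Y. card (Pow (fst p \<union> snd p) \<times> Pow (fst p \<union> snd p)))"
    using finM finY by (intro card_UN_le) auto
  also have "\<dots> \<le> (\<Sum>p\<in>?M \<times> ?Y. 16 ^ r)"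
  proof (rule sum_mono)
    fix p assume p: "p \<in> ?M \<times> ?Y"
    have "card (fst p \<union> snd p) \<le> 2 * r" using p card_Un_le[of "fst p" "snd p"] by (auto simp: ksub_def)
    then have "(2::nat) ^ card (fst p \<union> snd p) \<le> 2 ^ (2 * r)" by (intro power_increasing) auto
    then have "(2::nat) ^ card (fst p \<union> snd p) * 2 ^ card (fst p \<union> snd p) \<le> 2 ^ (2 * r) * 2 ^ (2 * r)"
      by (intro mult_mono) auto
    also have "\<dots> = 16 ^ r" by (simp add: power_mult[symmetric] power_mult power_mult_distrib[symmetric])
    finally show "card (Pow (fst p \<union> snd p) \<times> Pow (fst p \<union> snd p)) \<le> 16 ^ r"
      using finP[OF p] by (simp add: card_cartesian_product card_Pow)
  qed
  also have "\<dots> = card ?M * card ?Y * 16 ^ r" by (simp add: card_cartesian_product)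
  also have "\<dots> \<le> card ?M * (card V + 1) ^ r * 16 ^ r"
    using card_subsets_le_pow[OF assms(1), of r] by (intro mult_right_mono mult_left_mono) auto
  finally have "real (card (cliques V A r) * card (cliques V (- A) r)) \<le> real (card ?M * (card V + 1) ^ r * 16 ^ r)"
    by (simp only: card_cartesian_product of_nat_le_iff)
  then show ?thesis by (simp add: algebra_simps)
qed

text \<open>The part of \<open>L\<close> inside \<open>Z\<close> is arbitrary, the part outside is
  one of the few thin sets.\<close>

lemma card_nearly_within:
  assumes "e > 0" "finite X" "real (card X) \<le> M"
  shows "real (card {L. L \<subseteq> X \<and> real (card (L - Z)) \<le> thin e * M}) \<le> 2 powr (real (card (X \<inter> Z)) + e * M)"
proof -
  let ?A = "{Y. Y \<subseteq> X \<and> real (card Y) \<le> thin e * M}"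
  have fin: "finite ?A" using assms(2) by (rule_tac finite_subset[of _ "Pow X"]) auto
  have "card {L. L \<subseteq> X \<and> real (card (L - Z)) \<le> thin e * M} \<le> card (Pow (X \<inter> Z) \<times> ?A)"
    by (rule card_inj_on_le[where f = "\<lambda>L. (L \<inter> Z, L - Z)"]) (use fin assms in \<open>auto simp: inj_on_def\<close>)
  also have "\<dots> = 2 ^ card (X \<inter> Z) * card ?A" using assms by (simp add: card_cartesian_product card_Pow del: Pow_Int_eq)
  finally have "real (card {L. L \<subseteq> X \<and> real (card (L - Z)) \<le> thin e * M}) \<le> 2 ^ card (X \<inter> Z) * real (card ?A)"
    by (metis (no_types, lifting) of_nat_le_iff of_nat_mult of_nat_numeral of_nat_power)
  also have "\<dots> \<le> 2 ^ card (X \<inter> Z) * 2 powr (e * M)"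
    using card_thin_subsets[OF assms] by (intro mult_left_mono) auto
  finally show ?thesis by (simp add: powr_add powr_realpow)
qed

text \<open>Coordinates taken in pairs give a factor \<open>card R\<close> per pair; an odd number
  of them leaves a triple, where a split by degree gives the exponent 3/2. The factor 2 arises only
  at that triple and is not multiplied in the induction, which removes two coordinates at a
  time.\<close>

lemma card_pairwise_related:
  fixes R :: "('b \<times> 'b) set"
  assumes "finite D" "R \<subseteq> D \<times> D" "finite S" "card S \<ge> 2"
  shows "real (card {f\<in>S \<rightarrow>\<^sub>E D. \<forall>x\<in>S. \<forall>y\<in>S. x \<noteq> y \<longrightarrow> (f x, f y) \<in> R}) \<le> 2 * real (card R) powr (real (card S) / 2)"
  using assms(3,4)
proof (induction "card S" arbitrary: S rule: less_induct)
  case less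
  have finR: "finite R" using assms finite_subset by blast
  let ?N = "\<lambda>S. {f\<in>S \<rightarrow>\<^sub>E D. \<forall>x\<in>S. \<forall>y\<in>S. x \<noteq> y \<longrightarrow> (f x, f y) \<in> R}"
  have finN: "finite (?N S)" if "finite S" for S :: "'a set"
    using that assms(1) by (auto intro: finite_subset[of _ "S \<rightarrow>\<^sub>E D"] finite_PiE)
  let ?r = "real (card R)"
  consider "card S = 2" | "card S = 3" | "card S \<ge> 4" using less.prems by linarith
  then show ?case
  proof cases
    case 1
    then obtain a b where S: "S = {a,b}" "a \<noteq> b" by (auto simp: card_2_iff)
    have "card (?N S) \<le> card R"
      by (rule card_inj_on_le[where f = "\<lambda>f. (f a, f b)"])
         (use S finR in \<open>auto simp: inj_on_def PiE_iff intro!: extensionalityI[of _ "{a,b}"]\<close>)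
    then show ?thesis using 1 by simp
  next
    case 2
    then obtain a b c where S: "S = {a,b,c}" "a \<noteq> b" "a \<noteq> c" "b \<noteq> c" by (auto simp: card_3_iff)
    \<comment> \<open>At most \<open>sqrt ?r\<close> elements have more than \<open>sqrt ?r\<close>
      successors. If \<open>f b\<close> is one of them, the triple is coded by
      \<open>(f a, f c)\<close> and \<open>f b\<close>; otherwise by \<open>(f a, f b)\<close> and a
      successor of \<open>f b\<close>. Each code has at most \<open>?r * sqrt ?r\<close>
      values.\<close>
    define H where "H = {y\<in>D. real (card (R `` {y})) > sqrt ?r}"
    have finH: "finite H" using assms by (simp add: H_def)
    have H: "real (card H) * sqrt ?r \<le> ?r"
    proof -
      have "real (card H) * sqrt ?r = (\<Sum>y\<in>H. sqrt ?r)" by simp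
      also have "\<dots> \<le> (\<Sum>y\<in>H. real (card (R `` {y})))" by (intro sum_mono) (auto simp: H_def)
      also have "\<dots> = real (card (SIGMA y:H. R `` {y}))"
        using finH finR assms by (subst card_SigmaI) (auto intro: finite_subset[of _ D])
      also have "\<dots> \<le> ?r" using finR by (intro of_nat_mono card_mono) auto
      finally show ?thesis .
    qed
    define T1 where "T1 = (SIGMA p:{p\<in>R. snd p \<notin> H}. R `` {snd p})"
    have finR2: "finite (R `` {y})" for y using finR assms by (auto intro: finite_subset[of _ D])
    have fT1: "finite T1" unfolding T1_def using finR finR2 by auto
    have cT1: "real (card T1) \<le> ?r * sqrt ?r"
    proof -
      have "real (card T1) = (\<Sum>p\<in>{p\<in>R. snd p \<notin> H}. real (card (R `` {snd p})))"
        unfolding T1_def using finR finR2 by (subst card_SigmaI) auto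
      also have "\<dots> \<le> (\<Sum>p\<in>{p\<in>R. snd p \<notin> H}. sqrt ?r)"
        using assms by (intro sum_mono) (auto simp: H_def not_less)
      also have "\<dots> = real (card {p\<in>R. snd p \<notin> H}) * sqrt ?r" by simp
      also have "\<dots> \<le> ?r * sqrt ?r" using finR by (intro mult_right_mono of_nat_mono card_mono) auto
      finally show ?thesis .
    qed
    have "card (?N S) \<le> card (Inl ` T1 \<union> Inr ` (R \<times> H))"
      by (rule card_inj_on_le[where f = "\<lambda>f. if f b \<in> H then Inr ((f a, f c), f b) else Inl ((f a, f b), f c)"])
         (use S finR fT1 finH in \<open>auto simp: T1_def inj_on_def PiE_iff split: if_splits intro!: extensionalityI[of _ "{a,b,c}"]\<close>)
    also have "\<dots> \<le> card T1 + card (R \<times> H)"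
      using fT1 finR finH by (intro order_trans[OF card_Un_le] add_mono card_image_le) auto
    finally have "real (card (?N S)) \<le> real (card T1) + ?r * real (card H)"
      by (simp only: card_cartesian_product of_nat_mult[symmetric] of_nat_add[symmetric] of_nat_le_iff)
    moreover have "real (card H) \<le> sqrt ?r"
    proof (cases "card R = 0")
      case True
      then have "H = {}" using finR by (auto simp: H_def)
      then show ?thesis by simp
    next
      case False
      have "real (card H) * sqrt ?r \<le> sqrt ?r * sqrt ?r" using H by simp
      then show ?thesis using False by (simp only: mult_le_cancel_right) auto
    qed
    then have "?r * real (card H) \<le> ?r * sqrt ?r" by (intro mult_left_mono) auto
    moreover have "?r * sqrt ?r = ?r powr (real (card S) / 2)"
    proof (cases "card R = 0")
      case False
      then have "?r * sqrt ?r = ?r powr 1 * ?r powr (1/2)" by (simp add: powr_half_sqrt)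
      also have "\<dots> = ?r powr (1 + 1/2)" by (rule powr_add[symmetric])
      finally show ?thesis using 2 by simp
    qed (use 2 in simp)
    ultimately show ?thesis using cT1 by linarith
  next
    case 3
    then obtain a where a: "a \<in> S" by force
    have "card (S - {a}) \<ge> 3" using 3 a less.prems by simp
    then obtain b where b: "b \<in> S" "b \<noteq> a" by (metis card.empty empty_iff insert_Diff_single insert_iff not_numeral_le_zero subsetI subset_antisym Diff_iff)
    define S' where "S' = S - {a,b}"
    have S': "finite S'" "card S' = card S - 2" using a b less.prems by (auto simp: S'_def card_Diff_subset)
    have S_eq: "S = insert a (insert b S')" using a b by (auto simp: S'_def)
    have "card (?N S) \<le> card (R \<times> ?N S')"
    proof (rule card_inj_on_le[where f = "\<lambda>f. ((f a, f b), restrict f S')"])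
      show "inj_on (\<lambda>f. ((f a, f b), restrict f S')) (?N S)"
      proof (rule inj_onI)
        fix f g assume fg: "f \<in> ?N S" "g \<in> ?N S" "((f a, f b), restrict f S') = ((g a, g b), restrict g S')"
        show "f = g"
        proof (rule extensionalityI[of _ S])
          fix x assume "x \<in> S"
          then consider "x = a" | "x = b" | "x \<in> S'" by (auto simp: S'_def)
          then show "f x = g x" by cases (use fg in \<open>auto simp: restrict_def fun_eq_iff, metis\<close>)
        qed (use fg in \<open>auto simp: PiE_iff\<close>)
      qed
      show "(\<lambda>f. ((f a, f b), restrict f S')) ` ?N S \<subseteq> R \<times> ?N S'"
        using a b by (auto simp: S'_def PiE_iff split: if_splits)
      show "finite (R \<times> ?N S')" using finR finN[OF S'(1)] by blast
    qed
    then have "real (card (?N S)) \<le> ?r * real (card (?N S'))"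
      by (simp only: card_cartesian_product of_nat_mult[symmetric] of_nat_le_iff)
    also have "\<dots> \<le> ?r * (2 * ?r powr (real (card S') / 2))"
      using less.hyps[of S'] S' 3 by (intro mult_left_mono) auto
    also have "\<dots> = 2 * ?r powr (real (card S) / 2)"
    proof (cases "card R = 0")
      case False
      then have "?r * ?r powr (real (card S') / 2) = ?r powr 1 * ?r powr (real (card S') / 2)" by simp
      also have "\<dots> = ?r powr (1 + real (card S') / 2)" by (rule powr_add[symmetric])
      also have "1 + real (card S') / 2 = real (card S) / 2" using S' 3 by (simp add: field_simps of_nat_diff)
      finally show ?thesis by simp
    qed simp
    finally show ?thesis .
  qed
qed

section \<open>Pairs of dense families with few common supersets\<close>

lemma eventually_real_ge: "eventually (\<lambda>n::nat. real n \<ge> x) sequentially"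
  by real_asymp

text \<open>For \<open>L\<close> and \<open>L'\<close> the positive and the negative link of
  \<open>x\<close> these are the \<open>k\<close>-sets ruled out by the clauses whose only negated
  variable is \<open>x\<close>; for two positive links they are the sets that, as positive clauses,
  force both variables to zero in a witness.\<close>

definition common :: "'a set \<Rightarrow> nat \<Rightarrow> 'a set set \<Rightarrow> 'a set set \<Rightarrow> 'a set set" where
  "common V r L L' = {C\<in>ksub V (Suc r). (\<exists>Q\<in>L. Q \<subseteq> C) \<and> (\<exists>Q\<in>L'. Q \<subseteq> C)}"

definition dense_pairs :: "'a set \<Rightarrow> nat \<Rightarrow> real \<Rightarrow> real \<Rightarrow> ('a set set \<times> 'a set set) set" where
  "dense_pairs V r d \<gamma> = {(L,L'). L \<subseteq> ksub V r \<and> L' \<subseteq> ksub V r \<and>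
     d * real (card V) ^ r \<le> real (card L) \<and> d * real (card V) ^ r \<le> real (card L') \<and>
     real (card (common V r L L')) \<le> \<gamma> * real (card V) ^ Suc r}"

lemma card_non_cliques:
  assumes "finite V" "L \<subseteq> ksub V (Suc s)"
  shows "card (L - cliques V A (Suc s)) \<le> (\<Sum>T\<in>ksub V s - A. deg V L T)"
proof -
  let ?P = "SIGMA T:ksub V s - A. {v\<in>V - T. insert v T \<in> L}"
  have fin: "finite ?P" using assms(1) by auto
  have "L - cliques V A (Suc s) \<subseteq> (\<lambda>(T,v). insert v T) ` ?P"
  proof
    fix Q assume Q: "Q \<in> L - cliques V A (Suc s)"
    then have Qk: "Q \<subseteq> V" "card Q = Suc s" using assms(2) by (auto simp: ksub_def)
    obtain t where t: "t \<in> Q" "Q - {t} \<notin> A" using Q assms(2) by (auto simp: cliques_def)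
    have "finite Q" using finite_subset[OF Qk(1) assms(1)] .
    then have "(Q - {t}, t) \<in> ?P" using t Q Qk by (auto simp: ksub_def insert_absorb)
    moreover have "Q = (\<lambda>(T,v). insert v T) (Q - {t}, t)" using t by auto
    ultimately show "Q \<in> (\<lambda>(T,v). insert v T) ` ?P" by blast
  qed
  then have "card (L - cliques V A (Suc s)) \<le> card ?P"
    using fin by (meson card_image_le card_mono finite_imageI le_trans)
  also have "\<dots> = (\<Sum>T\<in>ksub V s - A. deg V L T)"
    unfolding deg_def using assms(1) by (subst card_SigmaI) auto
  finally show ?thesis .
qed

lemma deg_le: "finite V \<Longrightarrow> deg V L T \<le> card V"
  unfolding deg_def by (intro card_mono) auto

text \<open>Extending \<open>T\<close> by some \<open>a\<close> towards \<open>L\<close> and a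
  different \<open>b\<close> towards \<open>L'\<close> gives a common set, which is reached from at
  most 4 ordered pairs. There are at least \<open>t * (t / 2)\<close> such pairs, as
  \<open>t - 1 \<ge> t / 2\<close>.\<close>

lemma card_common_above:
  assumes "finite V" "T \<in> ksub V s" "t \<ge> 2" "real (deg V L T) > t" "real (deg V L' T) > t"
  shows "t\<^sup>2 / 8 \<le> real (card {C\<in>common V (Suc s) L L'. T \<subseteq> C})"
proof -
  define N where "N L = {v\<in>V - T. insert v T \<in> L}" for L
  have finN: "finite (N L)" for L using assms(1) by (simp add: N_def)
  have cN: "real (card (N L)) > t" "real (card (N L')) > t" using assms by (auto simp: N_def deg_def)
  have finT: "finite T" and Tk: "T \<subseteq> V" "card T = s"
    using assms(1,2) finite_subset by (auto simp: ksub_def)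
  let ?C = "{C\<in>common V (Suc s) L L'. T \<subseteq> C}"
  let ?P = "{(a,b). a \<in> N L \<and> b \<in> N L' \<and> a \<noteq> b}"
  have finC: "finite ?C" using assms(1) by (simp add: common_def)
  have "?P \<subseteq> (\<Union>C\<in>?C. (C - T) \<times> (C - T))"
  proof clarify
    fix a b assume ab: "a \<in> N L" "b \<in> N L'" "a \<noteq> b"
    let ?D = "insert a (insert b T)"
    have "card ?D = Suc (Suc s)" "?D \<subseteq> V" using ab finT Tk by (auto simp: N_def)
    then have "?D \<in> ?C" using ab unfolding common_def ksub_def N_def by blast
    moreover have "(a,b) \<in> (?D - T) \<times> (?D - T)" using ab by (auto simp: N_def)
    ultimately show "(a,b) \<in> (\<Union>C\<in>?C. (C - T) \<times> (C - T))" by blast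
  qed
  moreover have fCT: "finite (C - T)" if "C \<in> ?C" for C
    using that assms(1) by (auto simp: common_def ksub_def dest: finite_subset)
  ultimately have "card ?P \<le> card (\<Union>C\<in>?C. (C - T) \<times> (C - T))" using finC
    by (intro card_mono) (auto intro!: finite_UN_I)
  also have "\<dots> \<le> (\<Sum>C\<in>?C. card ((C - T) \<times> (C - T)))" using finC by (intro card_UN_le)
  also have "\<dots> = (\<Sum>C\<in>?C. 4)"
  proof (rule sum.cong)
    fix C assume C: "C \<in> ?C"
    then have "card C = Suc (Suc s)" by (auto simp: common_def ksub_def)
    then have "card (C - T) = 2" using C finT Tk by (subst card_Diff_subset) auto
    then show "card ((C - T) \<times> (C - T)) = 4" by (simp add: card_cartesian_product)
  qed simp
  finally have P1: "real (card ?P) \<le> 4 * real (card ?C)" by simp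
  have calc1: "card (N L) * card (N L') \<le> card ?P + card (N L)"
  proof -
    have "N L \<times> N L' \<subseteq> ?P \<union> (\<lambda>a. (a,a)) ` N L" by auto
    moreover have "finite ?P" using finN by (rule_tac finite_subset[of _ "N L \<times> N L'"]) auto
    ultimately have "card (N L \<times> N L') \<le> card ?P + card ((\<lambda>a. (a,a)) ` N L)"
      using finN by (intro order_trans[OF card_mono card_Un_le]) auto
    moreover have "card ((\<lambda>a. (a,a)) ` N L) \<le> card (N L)" using finN by (rule card_image_le)
    ultimately show ?thesis by (simp add: card_cartesian_product)
  qed
  have "real (card ?P) \<ge> real (card (N L)) * real (card (N L')) - real (card (N L))"
  proof -
    have "card (N L) * card (N L') \<le> card ?P + card (N L)" using calc1 by linarith
    then have "real (card (N L) * card (N L')) \<le> real (card ?P + card (N L))" by (simp only: of_nat_le_iff)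
    then show ?thesis by simp
  qed
  also have "real (card (N L)) * real (card (N L')) - real (card (N L)) = real (card (N L)) * (real (card (N L')) - 1)"
    by (simp add: algebra_simps)
  also have "\<dots> \<ge> t * (t / 2)" using cN assms(3) by (intro mult_mono) auto
  finally have "t * (t/2) \<le> 4 * real (card ?C)" using P1 by linarith
  then show ?thesis by (simp add: power2_eq_square)
qed

text \<open>Sets outside \<open>A\<close> contribute little to \<open>L\<close> by the choice of
  \<open>A\<close>. For \<open>L'\<close> the bad sets are those in \<open>A\<close>: the ones of
  small degree into \<open>L'\<close> contribute at most a share \<open>\<delta>\<close>, and the
  ones of large degree into both families are few, since each lies below at least
  \<open>(\<delta> * n) ^ 2 / 8\<close> common sets while a common set has only
  \<open>2 ^ (s + 2)\<close> subsets. This is the origin of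
  \<open>\<delta> ^ 3 / 2 ^ (s + 5)\<close>.\<close>

lemma dense_pairs_structure:
  fixes V :: "'a set"
  assumes "finite V" "L \<subseteq> ksub V (Suc s)" "L' \<subseteq> ksub V (Suc s)" "\<delta> > 0" "\<delta> * real (card V) \<ge> 2"
    and c: "real (card (common V (Suc s) L L')) \<le> \<delta> ^ 3 / 2 ^ (s + 5) * real (card V) ^ Suc (Suc s)"
    and A: "A = {T\<in>ksub V s. real (deg V L T) > \<delta> * real (card V)}"
  shows "real (card (L - cliques V A (Suc s))) \<le> \<delta> * real (card V) ^ Suc s"
    and "real (card (L' - cliques V (- A) (Suc s))) \<le> 2 * \<delta> * real (card V) ^ Suc s"
proof -
  let ?n = "real (card V)"
  have n: "?n > 0" using assms(4,5) by (metis mult_zero_right not_numeral_le_zero of_nat_0_le_iff order_le_less)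
  have low: "(\<Sum>T\<in>B. real (deg V M T)) \<le> \<delta> * ?n ^ Suc s"
    if "B \<subseteq> ksub V s" "\<forall>T\<in>B. real (deg V M T) \<le> \<delta> * ?n" for B M
  proof -
    have "(\<Sum>T\<in>B. real (deg V M T)) \<le> (\<Sum>T\<in>B. \<delta> * ?n)" using that by (intro sum_mono) auto
    also have "\<dots> = real (card B) * (\<delta> * ?n)" by simp
    also have "\<dots> \<le> ?n ^ s * (\<delta> * ?n)"
    proof (rule mult_right_mono)
      have "card B \<le> card (ksub V s)" using that assms(1) by (intro card_mono) auto
      then show "real (card B) \<le> ?n ^ s" using card_ksub_le[OF assms(1), of s] by linarith
    qed (use assms(4) in auto)
    finally show ?thesis by (simp add: algebra_simps)
  qed
  have "real (card (L - cliques V A (Suc s))) \<le> (\<Sum>T\<in>ksub V s - A. real (deg V L T))"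
    unfolding of_nat_sum[symmetric] of_nat_le_iff by (rule card_non_cliques[OF assms(1,2)])
  also have "\<dots> \<le> \<delta> * ?n ^ Suc s" by (rule low) (auto simp: A)
  finally show "real (card (L - cliques V A (Suc s))) \<le> \<delta> * ?n ^ Suc s" .
  define H where "H = {T\<in>A. real (deg V L' T) > \<delta> * ?n}"
  have HA: "H \<subseteq> A" "A \<subseteq> ksub V s" "finite A" "finite H" using assms(1) by (auto simp: H_def A)
  have "real (card H) * ((\<delta> * ?n)\<^sup>2 / 8) = (\<Sum>T\<in>H. (\<delta> * ?n)\<^sup>2 / 8)" by simp
  also have "\<dots> \<le> (\<Sum>T\<in>H. real (card {C\<in>common V (Suc s) L L'. T \<subseteq> C}))"
    using assms(1,5) by (intro sum_mono card_common_above) (auto simp: H_def A)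
  also have "\<dots> = real (card (SIGMA T:H. {C\<in>common V (Suc s) L L'. T \<subseteq> C}))"
    using HA assms(1) by (subst card_SigmaI) (auto simp: common_def)
  also have "\<dots> \<le> real (card (SIGMA C:common V (Suc s) L L'. Pow C))"
  proof (intro of_nat_mono card_inj_on_le[where f = "\<lambda>(T,C). (C,T)"])
    show "finite (SIGMA C:common V (Suc s) L L'. Pow C)"
      using assms(1) by (auto simp: common_def ksub_def intro!: finite_SigmaI dest: finite_subset
        intro: finite_subset[of _ "Pow V"])
  qed (auto simp: inj_on_def)
  also have "\<dots> = (\<Sum>C\<in>common V (Suc s) L L'. 2 ^ (s + 2))"
  proof -
    have "card (SIGMA C:common V (Suc s) L L'. Pow C) = (\<Sum>C\<in>common V (Suc s) L L'. card (Pow C))"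
      using assms(1) by (intro card_SigmaI) (auto simp: common_def ksub_def dest: finite_subset intro: finite_subset[of _ "Pow V"])
    also have "\<dots> = (\<Sum>C\<in>common V (Suc s) L L'. 2 ^ (s + 2))"
      using assms(1) by (intro sum.cong) (auto simp: common_def ksub_def card_Pow dest: finite_subset)
    finally show ?thesis by simp
  qed
  also have "\<dots> = 2 ^ (s + 2) * real (card (common V (Suc s) L L'))" by simp
  also have "\<dots> \<le> 2 ^ (s + 2) * (\<delta> ^ 3 / 2 ^ (s + 5) * ?n ^ Suc (Suc s))" by (rule mult_left_mono[OF c]) simp
  also have "\<dots> = (\<delta> * ?n ^ s) * ((\<delta> * ?n)\<^sup>2 / 8)" by (simp add: power_add power2_eq_square power3_eq_cube)
  finally have H: "real (card H) \<le> \<delta> * ?n ^ s" using n assms(4) by (simp add: mult_le_cancel_right divide_le_cancel)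
  have "real (card (L' - cliques V (- A) (Suc s))) \<le> (\<Sum>T\<in>ksub V s - - A. real (deg V L' T))"
    unfolding of_nat_sum[symmetric] of_nat_le_iff by (rule card_non_cliques[OF assms(1,3)])
  also have "ksub V s - - A = (A - H) \<union> H" using HA by auto
  also have "(\<Sum>T\<in>(A - H) \<union> H. real (deg V L' T)) = (\<Sum>T\<in>A - H. real (deg V L' T)) + (\<Sum>T\<in>H. real (deg V L' T))"
    using HA by (intro sum.union_disjoint) auto
  also have "(\<Sum>T\<in>A - H. real (deg V L' T)) \<le> \<delta> * ?n ^ Suc s" using HA by (intro low) (auto simp: H_def)
  also have "(\<Sum>T\<in>H. real (deg V L' T)) \<le> (\<Sum>T\<in>H. ?n)" using deg_le[OF assms(1)] by (intro sum_mono) auto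
  also have "(\<Sum>T\<in>H. ?n) = real (card H) * ?n" by simp
  also have "\<dots> \<le> \<delta> * ?n ^ s * ?n" using H by (intro mult_right_mono) auto
  finally show "real (card (L' - cliques V (- A) (Suc s))) \<le> 2 * \<delta> * ?n ^ Suc s" by (simp add: algebra_simps)
qed

text \<open>The sets of high degree towards the first member of a pair are almost disjoint from those
  of high degree towards the second, so the two members are essentially confined to the cliques of
  a family \<open>A\<close> and of its complement; density of both forces many mixed sets.\<close>

lemma dense_pairs_count:
  assumes "d > 0" "r \<ge> 1"
  shows "\<exists>\<gamma>>0. \<exists>c>0. \<forall>\<^sub>F n in sequentially. \<forall>V::'a set. finite V \<longrightarrow> card V = n \<longrightarrow>
     real (card (dense_pairs V r d \<gamma>)) \<le> 2 powr (real (n choose r) - c * real n ^ r)"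
proof -
  obtain s where r: "r = Suc s" using assms(2) by (cases r) auto
  \<comment> \<open>\<open>32 ^ r = 2 ^ r * 16 ^ r\<close> is the loss in the count of mixed sets,
    with \<open>n + 1 \<le> 2 * n\<close>. Of the resulting saving \<open>c0\<close> the two
    near-inclusions in cliques spend \<open>2 * e = c0 / 4\<close>, and the choice of
    \<open>A\<close> among at most \<open>2 powr (n ^ s)\<close> families another
    \<open>c0 / 8\<close>.\<close>
  define c0 where "c0 = (d/2)\<^sup>2 / 32 ^ r"
  have c0: "c0 > 0" using assms by (simp add: c0_def)
  define e where "e = c0 / 8"
  \<comment> \<open>The first bound makes the exceptional part of each member thin, the second
    leaves cliques of density \<open>d / 2\<close> in both colours.\<close>
  define \<delta> where "\<delta> = min (thin e / 2) (d / 4)"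
  have e: "e > 0" using c0 by (simp add: e_def)
  have \<delta>: "\<delta> > 0" "2 * \<delta> \<le> thin e" "2 * \<delta> \<le> d / 2" using thin_pos[OF e] assms by (auto simp: \<delta>_def)
  define \<gamma> where "\<gamma> = \<delta> ^ 3 / 2 ^ (s + 5)"
  have main: "real (card (dense_pairs V r d \<gamma>)) \<le> 2 powr (real (n choose r) - c0 / 2 * real n ^ r)"
    if n: "real n \<ge> 2 / \<delta>" "real n \<ge> 8 / c0" "real n \<ge> 1" and V: "finite V" "card V = n" for n and V :: "'a set"
  proof -
    let ?K = "ksub V r"
    have n': "\<delta> * real n \<ge> 2" "c0 * real n \<ge> 8" using n \<delta> c0 by (auto simp: field_simps)
    define W where "W A = {L. L \<subseteq> ?K \<and> real (card (L - cliques V A r)) \<le> thin e * real n ^ r}" for A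
    define Good where "Good = {A\<in>Pow (ksub V s). d / 2 * real n ^ r \<le> real (card (cliques V A r)) \<and>
       d / 2 * real n ^ r \<le> real (card (cliques V (- A) r))}"
    have finW: "finite (W A)" for A using V(1) by (auto simp: W_def intro: finite_subset[of _ "Pow ?K"])
    have finG: "finite Good" using V(1) by (auto simp: Good_def)
    have clK: "cliques V A r \<subseteq> ?K" "finite (cliques V A r)" for A using V(1) by (auto simp: cliques_def)
    have sub: "dense_pairs V r d \<gamma> \<subseteq> (\<Union>A\<in>Good. W A \<times> W (- A))"
    proof clarify
      fix L L' assume "(L,L') \<in> dense_pairs V r d \<gamma>"
      then have p: "L \<subseteq> ?K" "L' \<subseteq> ?K" "d * real n ^ r \<le> real (card L)" "d * real n ^ r \<le> real (card L')"
        "real (card (common V r L L')) \<le> \<gamma> * real n ^ Suc r" using V by (auto simp: dense_pairs_def)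
      define A where "A = {T\<in>ksub V s. real (deg V L T) > \<delta> * real (card V)}"
      have st: "real (card (L - cliques V A r)) \<le> \<delta> * real n ^ r"
        "real (card (L' - cliques V (- A) r)) \<le> 2 * \<delta> * real n ^ r"
        using dense_pairs_structure[OF V(1), of L s L' \<delta> A] p \<delta>(1) n' V(2) unfolding \<gamma>_def r A_def by auto
      have nr: "real n ^ r \<ge> 0" by simp
      have st2: "real (card (L - cliques V A r)) \<le> 2 * \<delta> * real n ^ r" using st(1) \<delta>(1) nr
        by (smt (verit) mult_right_mono)
      have big: "d / 2 * real n ^ r \<le> real (card (cliques V B r))"
        if "M \<subseteq> ?K" "d * real n ^ r \<le> real (card M)" "real (card (M - cliques V B r)) \<le> 2 * \<delta> * real n ^ r" for M B
      proof -
        have "finite M" using that(1) V(1) finite_subset finite_ksub by metis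
        then have "card M \<le> card (M - cliques V B r) + card (cliques V B r)"
          using clK(2)[of B] by (intro order_trans[OF card_mono card_Un_le]) auto
        moreover have "2 * \<delta> * real n ^ r \<le> d / 2 * real n ^ r" using \<delta>(3) by (intro mult_right_mono) auto
        ultimately show ?thesis using that by (simp add: field_simps)
      qed
      have "2 * \<delta> * real n ^ r \<le> thin e * real n ^ r" using \<delta>(2) by (intro mult_right_mono) auto
      then have "L \<in> W A" "L' \<in> W (- A)" using p st(2) st2 by (auto simp: W_def)
      moreover have "A \<in> Good" using big[OF p(1,3) st2] big[OF p(2,4) st(2)] by (auto simp: Good_def A_def)
      ultimately show "(L,L') \<in> (\<Union>A\<in>Good. W A \<times> W (- A))" by blast
    qed
    have Kle: "real (card ?K) \<le> real n ^ r" using card_ksub_le[OF V(1), of r] V by simp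
    have each: "real (card (W A \<times> W (- A))) \<le> 2 powr (real (n choose r) - c0 * real n ^ r + 2 * e * real n ^ r)"
      if A: "A \<in> Good" for A
    proof -
      have w: "real (card (W B)) \<le> 2 powr (real (card (cliques V B r)) + e * real n ^ r)" for B
        unfolding W_def using card_nearly_within[OF e finite_ksub[OF V(1)] Kle, of "cliques V B r"] clK[of B]
        by (simp add: Int_absorb1)
      let ?M = "?K - cliques V A r - cliques V (- A) r"
      have "(d / 2 * real n ^ r) * (d / 2 * real n ^ r) \<le> real (card (cliques V A r)) * real (card (cliques V (- A) r))"
        using A assms by (intro mult_mono) (auto simp: Good_def)
      also have "\<dots> \<le> real (card ?M) * ((real n + 1) ^ r * 16 ^ r)"
        using card_mixed[OF V(1) assms(2), of A] V by simp
      also have "\<dots> \<le> real (card ?M) * ((2 * real n) ^ r * 16 ^ r)"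
        using n(3) by (intro mult_left_mono mult_right_mono power_mono) auto
      also have "\<dots> = (real (card ?M) * 32 ^ r) * real n ^ r"
      proof -
        have "(32::real) ^ r = 2 ^ r * 16 ^ r" by (subst power_mult_distrib[symmetric]) simp
        then show ?thesis by (simp add: power_mult_distrib)
      qed
      finally have "((d / 2)\<^sup>2 * real n ^ r) * real n ^ r \<le> (real (card ?M) * 32 ^ r) * real n ^ r"
        by (simp add: power2_eq_square algebra_simps)
      then have "(d / 2)\<^sup>2 * real n ^ r \<le> real (card ?M) * 32 ^ r"
        using n(3) by (simp only: mult_le_cancel_right) auto
      then have mixed: "c0 * real n ^ r \<le> real (card ?M)" by (simp add: c0_def field_simps)
      have disj: "cliques V A r \<inter> cliques V (- A) r = {}"
        using assms(2) by (force simp: cliques_def ksub_def)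
      have "card ?K = card ?M + card (cliques V A r \<union> cliques V (- A) r)"
        using V(1) clK[of A] clK[of "- A"]
        by (subst card_Un_disjoint[symmetric]) (auto intro!: arg_cong[of _ _ card])
      also have "card (cliques V A r \<union> cliques V (- A) r) = card (cliques V A r) + card (cliques V (- A) r)"
        using clK disj by (intro card_Un_disjoint) auto
      finally have "real (card (cliques V A r)) + real (card (cliques V (- A) r)) = real (n choose r) - real (card ?M)"
        using card_ksub[OF V(1), of r] V(2) by simp
      then have le: "real (card (cliques V A r)) + e * real n ^ r + (real (card (cliques V (- A) r)) + e * real n ^ r)
         \<le> real (n choose r) - c0 * real n ^ r + 2 * e * real n ^ r" using mixed by simp
      have "real (card (W A \<times> W (- A))) \<le> 2 powr (real (card (cliques V A r)) + e * real n ^ r) *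
          2 powr (real (card (cliques V (- A) r)) + e * real n ^ r)"
        unfolding card_cartesian_product of_nat_mult using w by (intro mult_mono) auto
      also have "\<dots> \<le> 2 powr (real (n choose r) - c0 * real n ^ r + 2 * e * real n ^ r)"
        unfolding powr_add[symmetric] using le by (intro powr_mono) auto
      finally show ?thesis .
    qed
    have "real (card (dense_pairs V r d \<gamma>)) \<le> real (card (\<Union>A\<in>Good. W A \<times> W (- A)))"
      using sub finW finG by (intro of_nat_mono card_mono finite_UN_I) auto
    also have "\<dots> \<le> (\<Sum>A\<in>Good. real (card (W A \<times> W (- A))))"
      unfolding of_nat_sum[symmetric] of_nat_le_iff using finG by (intro card_UN_le)
    also have "\<dots> \<le> (\<Sum>A\<in>Good. 2 powr (real (n choose r) - c0 * real n ^ r + 2 * e * real n ^ r))"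
      using each by (intro sum_mono)
    also have "\<dots> = real (card Good) * 2 powr (real (n choose r) - c0 * real n ^ r + 2 * e * real n ^ r)" by simp
    also have "\<dots> \<le> 2 powr (c0 / 8 * real n ^ r) * 2 powr (real (n choose r) - c0 * real n ^ r + 2 * e * real n ^ r)"
    proof (rule mult_right_mono)
      have "card Good \<le> card (Pow (ksub V s))" using V(1) by (intro card_mono) (auto simp: Good_def)
      then have "real (card Good) \<le> 2 ^ card (ksub V s)" using V(1) by (simp add: card_Pow)
      also have "\<dots> = 2 powr real (card (ksub V s))" by (simp add: powr_realpow)
      also have "\<dots> \<le> 2 powr (c0 / 8 * real n ^ r)"
      proof (rule powr_mono)
        have "real (card (ksub V s)) \<le> real n ^ s" using card_ksub_le[OF V(1), of s] V by simp
        also have "\<dots> = 1 * real n ^ s" by simp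
        also have "\<dots> \<le> (c0 / 8 * real n) * real n ^ s" using n'(2) by (intro mult_right_mono) auto
        finally show "real (card (ksub V s)) \<le> c0 / 8 * real n ^ r" by (simp add: r)
      qed simp
      finally show "real (card Good) \<le> 2 powr (c0 / 8 * real n ^ r)" .
    qed simp
    also have "\<dots> \<le> 2 powr (real (n choose r) - c0 / 2 * real n ^ r)"
      unfolding powr_add[symmetric] using c0 by (intro powr_mono) (auto simp: e_def)
    finally show ?thesis .
  qed
  have "\<forall>\<^sub>F n in sequentially. \<forall>V::'a set. finite V \<longrightarrow> card V = n \<longrightarrow>
     real (card (dense_pairs V r d \<gamma>)) \<le> 2 powr (real (n choose r) - c0 / 2 * real n ^ r)"
    using eventually_real_ge[of "2/\<delta>"] eventually_real_ge[of "8/c0"] eventually_real_ge[of 1]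
    by eventually_elim (use main in blast)
  moreover have "\<gamma> > 0" using \<delta> by (simp add: \<gamma>_def)
  ultimately show ?thesis using c0 by (intro exI[of _ \<gamma>] conjI exI[of _ "c0/2"]) auto
qed

section \<open>Formulae as families of signed pairs\<close>

text \<open>A clause is coded by the pair of the set of its negated and the set of its positive variables, an
  assignment by the set \<open>W\<close> of variables set to one.\<close>

definition pairs :: "nat \<Rightarrow> nat set \<Rightarrow> (nat set \<times> nat set) set" where
  "pairs k V = {(S,T). S \<subseteq> V \<and> T \<subseteq> V \<and> S \<inter> T = {} \<and> card S + card T = k}"

definition psat :: "nat set \<Rightarrow> nat set \<times> nat set \<Rightarrow> bool" where
  "psat W p \<longleftrightarrow> snd p \<subseteq> W \<and> fst p \<inter> W = {}"

definition pwitness :: "(nat set \<times> nat set) set \<Rightarrow> nat set \<times> nat set \<Rightarrow> nat set \<Rightarrow> bool" where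
  "pwitness F p W \<longleftrightarrow> psat W p \<and> (\<forall>q\<in>F. q \<noteq> p \<longrightarrow> \<not> psat W q)"

definition minimal_forms :: "nat \<Rightarrow> nat set \<Rightarrow> (nat set \<times> nat set) set set" where
  "minimal_forms k V = {F. F \<subseteq> pairs k V \<and> (\<forall>p\<in>F. \<exists>W\<subseteq>V. pwitness F p W)}"

definition sparse_forms :: "nat \<Rightarrow> nat set \<Rightarrow> real \<Rightarrow> (nat set \<times> nat set) set set" where
  "sparse_forms k V s = {F. F \<subseteq> pairs k V \<and> (\<forall>p\<in>F. \<exists>W\<subseteq>V. real (card W) < s \<and> pwitness F p W)}"

definition plink :: "(nat set \<times> nat set) set \<Rightarrow> nat \<Rightarrow> nat set set" where
  "plink F x = {Q. x \<notin> Q \<and> ({}, insert x Q) \<in> F}"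

text \<open>Clauses negating \<open>x\<close> together with further variables are left out: with
  \<open>x\<close> fixed they are cheap to describe, while a link as defined here may have of the
  order of \<open>n ^ (k - 1)\<close> members until large negative links are excluded.\<close>

definition nlink :: "(nat set \<times> nat set) set \<Rightarrow> nat \<Rightarrow> nat set set" where
  "nlink F x = {Q. ({x}, Q) \<in> F}"

text \<open>Witnesses with few ones make formulae cheap to describe: if \<open>W\<close> is the set of ones of a witness of
  \<open>(S, T)\<close>, then every other \<open>S'\<close> with \<open>(S', T)\<close> in the formula meets \<open>W\<close>. Families with this
  property are few.\<close>

definition neg_parts :: "(nat set \<times> nat set) set \<Rightarrow> nat set \<Rightarrow> nat set set" where
  "neg_parts F T = {S. (S,T) \<in> F}"

definition loose_families :: "nat set \<Rightarrow> nat \<Rightarrow> real \<Rightarrow> nat set set set" where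
  "loose_families V i s = {A. A \<subseteq> ksub V i \<and> (\<forall>S\<in>A. \<exists>W\<subseteq>V. real (card W) < s \<and> S \<inter> W = {} \<and> (\<forall>S'\<in>A. S' \<noteq> S \<longrightarrow> S' \<inter> W \<noteq> {}))}"

text \<open>With one family per positive part \<open>T\<close>, the at most \<open>n ^ t\<close>
  sets of size \<open>t\<close> carry families of \<open>(k - t)\<close>-sets, so every size costs
  at most \<open>e * n ^ k\<close>; the scaling \<open>n ^ j\<close> is made for this.\<close>

definition cheap :: "nat \<Rightarrow> nat set \<Rightarrow> real \<Rightarrow> real \<Rightarrow> bool" where
  "cheap k V s e \<longleftrightarrow> (\<forall>j\<in>{1..k}. real (card (loose_families V j s)) \<le> 2 powr (e * real (card V) ^ j))"

lemma FamE:
  assumes "A \<in> loose_families V i s" "S \<in> A"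
  obtains W where "W \<subseteq> V" "real (card W) < s" "\<forall>S'\<in>A. S' \<noteq> S \<longrightarrow> S' \<inter> W \<noteq> {}"
proof -
  have "\<exists>W\<subseteq>V. real (card W) < s \<and> S \<inter> W = {} \<and> (\<forall>S'\<in>A. S' \<noteq> S \<longrightarrow> S' \<inter> W \<noteq> {})"
    using assms by (simp add: loose_families_def)
  then show ?thesis using that by (elim exE conjE)
qed

lemma finite_pairs: "finite V \<Longrightarrow> finite (pairs k V)"
  by (rule finite_subset[of _ "Pow V \<times> Pow V"]) (auto simp: pairs_def)

lemma finite_sparse_forms: "finite V \<Longrightarrow> finite (sparse_forms k V s)"
  by (rule finite_subset[of _ "Pow (pairs k V)"]) (auto simp: sparse_forms_def finite_pairs)

lemma finite_minimal_forms: "finite V \<Longrightarrow> finite (minimal_forms k V)"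
  by (rule finite_subset[of _ "Pow (pairs k V)"]) (auto simp: minimal_forms_def finite_pairs)

lemma finite_loose_families: "finite V \<Longrightarrow> finite (loose_families V i s)"
  by (rule finite_subset[of _ "Pow (ksub V i)"]) (auto simp: loose_families_def)

lemma sparse_forms_sub: "F \<in> sparse_forms k V s \<Longrightarrow> F \<subseteq> pairs k V" by (simp add: sparse_forms_def)

lemma sparse_forms_minimal_forms: "sparse_forms k V s \<subseteq> minimal_forms k V"
  by (auto simp: sparse_forms_def minimal_forms_def) blast

lemma neg_parts_loose_families:
  assumes "F \<in> sparse_forms k V s"
  shows "neg_parts F T \<in> loose_families V (k - card T) s"
proof -
  have "neg_parts F T \<subseteq> ksub V (k - card T)"
    using assms by (auto simp: neg_parts_def sparse_forms_def pairs_def ksub_def)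
  moreover have "\<exists>W\<subseteq>V. real (card W) < s \<and> S \<inter> W = {} \<and> (\<forall>S'\<in>neg_parts F T. S' \<noteq> S \<longrightarrow> S' \<inter> W \<noteq> {})"
    if S: "S \<in> neg_parts F T" for S
  proof -
    obtain W where "W \<subseteq> V" "real (card W) < s" "pwitness F (S,T) W"
      using S assms by (auto simp: neg_parts_def sparse_forms_def)
    moreover from this have "S' \<inter> W \<noteq> {}" if "S' \<in> neg_parts F T" "S' \<noteq> S" for S'
    proof -
      have "\<not> psat W (S',T)" using \<open>pwitness F (S,T) W\<close> that by (auto simp: pwitness_def neg_parts_def)
      then show ?thesis using \<open>pwitness F (S,T) W\<close> by (auto simp: pwitness_def psat_def)
    qed
    ultimately show ?thesis by (intro exI[of _ W]) (auto simp: pwitness_def psat_def)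
  qed
  ultimately show ?thesis by (auto simp: loose_families_def)
qed

text \<open>A witness of a clause negating \<open>x\<close> has \<open>x\<close> outside
  \<open>W\<close>, so any other clause with the same \<open>T\<close> and with \<open>x\<close>
  negated must be falsified on its remaining negated variables.\<close>

lemma neg_parts_at_loose_families:
  assumes "F \<in> sparse_forms k V s" "finite V"
  shows "{S. x \<notin> S \<and> (insert x S, T) \<in> F} \<in> loose_families V (k - card T - 1) s"
proof -
  let ?A = "{S. x \<notin> S \<and> (insert x S, T) \<in> F}"
  have "?A \<subseteq> ksub V (k - card T - 1)"
  proof
    fix S assume S: "S \<in> ?A"
    then have p: "insert x S \<subseteq> V" "card (insert x S) + card T = k"
      using assms(1) by (auto simp: sparse_forms_def pairs_def)
    have "finite S" using p(1) assms(2) by (auto intro: finite_subset)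
    then have "card (insert x S) = Suc (card S)" using S by simp
    then show "S \<in> ksub V (k - card T - 1)" using p by (auto simp: ksub_def)
  qed
  moreover have "\<exists>W\<subseteq>V. real (card W) < s \<and> S \<inter> W = {} \<and> (\<forall>S'\<in>?A. S' \<noteq> S \<longrightarrow> S' \<inter> W \<noteq> {})"
    if S: "S \<in> ?A" for S
  proof -
    obtain W where W: "W \<subseteq> V" "real (card W) < s" "pwitness F (insert x S,T) W"
      using S assms by (auto simp: sparse_forms_def)
    have "S' \<inter> W \<noteq> {}" if S': "S' \<in> ?A" "S' \<noteq> S" for S'
    proof -
      have "insert x S' \<noteq> insert x S" using S S' by (auto simp: insert_ident)
      then have "\<not> psat W (insert x S',T)" using W(3) S' by (auto simp: pwitness_def)
      then show ?thesis using W(3) by (auto simp: pwitness_def psat_def)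
    qed
    then show ?thesis using W by (intro exI[of _ W]) (auto simp: pwitness_def psat_def)
  qed
  ultimately show ?thesis by (auto simp: loose_families_def)
qed

text \<open>In a witness of the positive clause \<open>C\<close> the positive clauses on \<open>insert x Q\<close> force all \<open>x \<in> S\<close> to be
  zero, which satisfies \<open>(S, T)\<close>.\<close>

lemma killed:
  assumes "F \<in> minimal_forms k V" "(S,T) \<in> F" "S \<noteq> {}" "T \<subseteq> C" "C \<inter> S = {}" "\<forall>x\<in>S. \<exists>Q\<in>plink F x. Q \<subseteq> C"
  shows "({},C) \<notin> F"
proof
  assume C: "({},C) \<in> F"
  then obtain W where W: "pwitness F ({},C) W" using assms(1) by (auto simp: minimal_forms_def)
  then have CW: "C \<subseteq> W" by (auto simp: pwitness_def psat_def)
  have "x \<notin> W" if x: "x \<in> S" for x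
  proof
    assume xW: "x \<in> W"
    obtain Q where Q: "x \<notin> Q" "({}, insert x Q) \<in> F" "Q \<subseteq> C" using assms(6) x by (auto simp: plink_def)
    have "insert x Q \<noteq> C" using assms(5) x by auto
    then have "\<not> psat W ({}, insert x Q)" using W Q by (auto simp: pwitness_def)
    then show False using xW Q CW by (auto simp: psat_def)
  qed
  then have "psat W (S,T)" using CW assms(4) by (auto simp: psat_def)
  then show False using W assms(2,3) by (auto simp: pwitness_def)
qed

section \<open>Size and number of loose families\<close>

lemma card_meeting:
  assumes "finite V" "W \<subseteq> V"
  shows "real (card {S\<in>ksub V (Suc i). S \<inter> W \<noteq> {}}) \<le> real (card W) * real (card V) ^ i"
proof -
  have finW: "finite W" using assms finite_subset by auto
  have "{S\<in>ksub V (Suc i). S \<inter> W \<noteq> {}} \<subseteq> (\<lambda>(w,Y). insert w Y) ` (W \<times> ksub V i)"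
  proof
    fix S assume "S \<in> {S\<in>ksub V (Suc i). S \<inter> W \<noteq> {}}"
    then obtain x where S: "S \<in> ksub V (Suc i)" "x \<in> S" "x \<in> W" by blast
    then have "finite S" using assms(1) by (auto simp: ksub_def intro: finite_subset)
    then have "(x, S - {x}) \<in> W \<times> ksub V i" "S = (\<lambda>(w,Y). insert w Y) (x, S - {x})"
      using S by (auto simp: ksub_def)
    then show "S \<in> (\<lambda>(w,Y). insert w Y) ` (W \<times> ksub V i)" by blast
  qed
  then have "card {S\<in>ksub V (Suc i). S \<inter> W \<noteq> {}} \<le> card (W \<times> ksub V i)"
    using finW assms(1) by (meson card_image_le card_mono finite_SigmaI finite_imageI finite_ksub le_trans)
  then have "real (card {S\<in>ksub V (Suc i). S \<inter> W \<noteq> {}}) \<le> real (card W) * real (card (ksub V i))"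
    by (simp only: card_cartesian_product of_nat_mult[symmetric] of_nat_le_iff)
  also have "\<dots> \<le> real (card W) * real (card V) ^ i"
    using card_ksub_le[OF assms(1), of i] by (intro mult_left_mono) auto
  finally show ?thesis .
qed

text \<open>All members but one meet the small set \<open>W\<close> attached to that one.\<close>

lemma loose_families_card_le:
  assumes "finite V" "A \<in> loose_families V (Suc i) s" "s \<ge> 0"
  shows "real (card A) \<le> 1 + s * real (card V) ^ i"
proof (cases "A = {}")
  case False
  then obtain S where "S \<in> A" by auto
  then obtain W where W: "W \<subseteq> V" "real (card W) < s" "\<forall>S'\<in>A. S' \<noteq> S \<longrightarrow> S' \<inter> W \<noteq> {}"
    by (rule FamE[OF assms(2)])
  let ?H = "{S\<in>ksub V (Suc i). S \<inter> W \<noteq> {}}"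
  have "A \<subseteq> insert S ?H" using W(3) assms(2) by (auto simp: loose_families_def)
  then have "card A \<le> card (insert S ?H)" using assms(1) by (intro card_mono) auto
  also have "\<dots> \<le> Suc (card ?H)" using assms(1) by (simp add: card_insert_if)
  finally have "real (card A) \<le> 1 + real (card ?H)" by simp
  also have "\<dots> \<le> 1 + real (card W) * real (card V) ^ i" using card_meeting[OF assms(1) W(1), of i] by simp
  also have "\<dots> \<le> 1 + s * real (card V) ^ i" using W(2) by (intro add_left_mono mult_right_mono) auto
  finally show ?thesis .
qed (use assms in simp)

text \<open>A nonempty loose family is given by one member \<open>S\<close>, its set
  \<open>W\<close> and a subfamily of the sets meeting \<open>W\<close>. The bound
  \<open>z \<le> thin (e/4)\<close> makes the sets \<open>W\<close> few, \<open>z \<le> e/4\<close>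
  makes the sets meeting \<open>W\<close> few, and \<open>e/2\<close> remains for the polynomial
  number of choices of \<open>S\<close>.\<close>

lemma card_loose_families:
  fixes e :: real
  assumes "e > 0"
  shows "\<exists>\<zeta>>0. \<forall>k. \<forall>\<^sub>F n in sequentially. \<forall>V. finite V \<longrightarrow> card V = n \<longrightarrow> cheap k V (\<zeta> * real n) e"
proof -
  define z where "z = min (thin (e/4)) (e/4)"
  have e4: "e/4 > 0" using assms by simp
  have z: "z > 0" "z \<le> thin (e/4)" "z \<le> e/4" using thin_pos[OF e4] e4 by (auto simp: z_def)
  have main: "real (card (loose_families V (Suc i) (z * real n))) \<le> 2 powr (e * real n ^ Suc i)"
    if n: "2 + real (Suc i) * log 2 (real n) \<le> e / 2 * real n" "real n \<ge> 1" and V: "finite V" "card V = n"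
    for n V i
  proof -
    let ?Ws = "{W. W \<subseteq> V \<and> real (card W) \<le> thin (e/4) * real n}"
    define H where "H W = {S\<in>ksub V (Suc i). S \<inter> W \<noteq> {}}" for W
    let ?U = "(\<Union>p\<in>ksub V (Suc i) \<times> ?Ws. if real (card (snd p)) \<le> z * real n then Pow (insert (fst p) (H (snd p))) else {})"
    have finH: "finite (H W)" for W using V(1) by (simp add: H_def)
    have finWs: "finite ?Ws" using V(1) by (rule_tac finite_subset[of _ "Pow V"]) auto
    have "loose_families V (Suc i) (z * real n) \<subseteq> insert {} ?U"
    proof
      fix A assume A: "A \<in> loose_families V (Suc i) (z * real n)"
      show "A \<in> insert {} ?U"
      proof (cases "A = {}")
        case False
        then obtain S where S: "S \<in> A" by auto
        then obtain W where W: "W \<subseteq> V" "real (card W) < z * real n" "\<forall>S'\<in>A. S' \<noteq> S \<longrightarrow> S' \<inter> W \<noteq> {}"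
          by (rule FamE[OF A])
        have "z * real n \<le> thin (e/4) * real n" using z by (intro mult_right_mono) auto
        then have "(S,W) \<in> ksub V (Suc i) \<times> ?Ws" using S A W by (auto simp: loose_families_def)
        moreover have "A \<in> Pow (insert S (H W))" using A W(3) by (auto simp: H_def loose_families_def)
        ultimately have "A \<in> ?U" using W(2) by (intro UN_I[of "(S,W)"]) auto
        then show ?thesis by (rule insertI2)
      qed simp
    qed
    then have "card (loose_families V (Suc i) (z * real n)) \<le> card (insert {} ?U)"
      using V(1) finWs finH by (intro card_mono) auto
    also have "\<dots> \<le> Suc (card ?U)" by (rule card_insert_le_m1) auto
    finally have "real (card (loose_families V (Suc i) (z * real n))) \<le> 1 + real (card ?U)" by simp
    also have "real (card ?U) \<le> (\<Sum>p\<in>ksub V (Suc i) \<times> ?Ws. real (card (if real (card (snd p)) \<le> z * real n then Pow (insert (fst p) (H (snd p))) else {})))"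
      unfolding of_nat_sum[symmetric] of_nat_le_iff using V(1) finWs by (intro card_UN_le) auto
    also have "\<dots> \<le> (\<Sum>p\<in>ksub V (Suc i) \<times> ?Ws. 2 * 2 powr (e/4 * real n ^ Suc i))"
    proof (rule sum_mono)
      fix p assume p: "p \<in> ksub V (Suc i) \<times> ?Ws"
      show "real (card (if real (card (snd p)) \<le> z * real n then Pow (insert (fst p) (H (snd p))) else {})) \<le> 2 * 2 powr (e/4 * real n ^ Suc i)"
      proof (cases "real (card (snd p)) \<le> z * real n")
        case True
        have "card (insert (fst p) (H (snd p))) \<le> Suc (card (H (snd p)))" using finH by (simp add: card_insert_if)
        then have "(2::real) ^ card (insert (fst p) (H (snd p))) \<le> 2 ^ Suc (card (H (snd p)))"
          by (intro power_increasing) auto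
        also have "\<dots> = 2 * 2 powr real (card (H (snd p)))" by (simp add: powr_realpow)
        also have "\<dots> \<le> 2 * 2 powr (e/4 * real n ^ Suc i)"
        proof (intro mult_left_mono powr_mono)
          have "real (card (H (snd p))) \<le> real (card (snd p)) * real n ^ i"
            unfolding H_def using card_meeting[OF V(1), of "snd p" i] p V(2) by auto
          also have "\<dots> \<le> (e/4 * real n) * real n ^ i"
          proof (rule mult_right_mono)
            have "z * real n \<le> e/4 * real n" using z by (intro mult_right_mono) auto
            then show "real (card (snd p)) \<le> e/4 * real n" using True by linarith
          qed simp
          finally show "real (card (H (snd p))) \<le> e/4 * real n ^ Suc i" by (simp add: algebra_simps)
        qed auto
        finally show ?thesis using True finH by (simp add: card_Pow)
      qed simp
    qed
    also have "\<dots> = real (card (ksub V (Suc i))) * real (card ?Ws) * (2 * 2 powr (e/4 * real n ^ Suc i))"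
      by (simp add: card_cartesian_product)
    also have "\<dots> \<le> real n ^ Suc i * 2 powr (e/4 * real n ^ Suc i) * (2 * 2 powr (e/4 * real n ^ Suc i))"
    proof (intro mult_right_mono mult_mono)
      show "real (card (ksub V (Suc i))) \<le> real n ^ Suc i" using card_ksub_le[OF V(1)] V(2) by metis
      have "real (card ?Ws) \<le> 2 powr (e/4 * real n)" using card_thin_subsets[OF e4 V(1)] V(2) by simp
      also have "\<dots> \<le> 2 powr (e/4 * real n ^ Suc i)"
        using e4 n(2) by (intro powr_mono mult_left_mono) (auto simp: self_le_power)
      finally show "real (card ?Ws) \<le> 2 powr (e/4 * real n ^ Suc i)" .
    qed auto
    also have "\<dots> = 2 * real n ^ Suc i * 2 powr (e/2 * real n ^ Suc i)" by (simp add: powr_add[symmetric])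
    also have "1 + 2 * real n ^ Suc i * 2 powr (e/2 * real n ^ Suc i) \<le> 4 * real n ^ Suc i * 2 powr (e/2 * real n ^ Suc i)"
    proof -
      have "1 * 1 \<le> real n ^ Suc i * 2 powr (e/2 * real n ^ Suc i)"
        using n(2) assms by (intro mult_mono ge_one_powr_ge_zero one_le_power) auto
      then show ?thesis by simp
    qed
    also have "4 * real n ^ Suc i = 2 powr (2 + real (Suc i) * log 2 (real n))"
    proof -
      have "2 powr (real (Suc i) * log 2 (real n)) = (2 powr log 2 (real n)) powr real (Suc i)"
        by (simp add: powr_powr mult.commute)
      also have "\<dots> = real n powr real (Suc i)" using n(2) by simp
      also have "\<dots> = real n ^ Suc i" using n(2) by (subst powr_realpow) auto
      finally show ?thesis by (simp add: powr_add)
    qed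
    also have "2 powr (2 + real (Suc i) * log 2 (real n)) * 2 powr (e/2 * real n ^ Suc i) \<le> 2 powr (e/2 * real n ^ Suc i) * 2 powr (e/2 * real n ^ Suc i)"
    proof (intro mult_right_mono powr_mono)
      have "e/2 * real n \<le> e/2 * real n ^ Suc i" using n(2) assms by (intro mult_left_mono) (auto simp: self_le_power)
      then show "2 + real (Suc i) * log 2 (real n) \<le> e/2 * real n ^ Suc i" using n(1) by linarith
    qed auto
    also have "\<dots> = 2 powr (e * real n ^ Suc i)" by (simp add: powr_add[symmetric])
    finally show ?thesis by simp
  qed
  have "\<forall>\<^sub>F n in sequentially. \<forall>V. finite V \<longrightarrow> card V = n \<longrightarrow> cheap k V (z * real n) e" for k
  proof -
    have "\<forall>\<^sub>F n in sequentially. 2 + real k * log 2 (real n) \<le> e / 2 * real n"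
      using assms by real_asymp
    then show ?thesis using eventually_real_ge[of 1]
    proof eventually_elim
      case (elim n)
      have "real (card (loose_families V j (z * real n))) \<le> 2 powr (e * real n ^ j)"
        if V: "finite V" "card V = n" and j: "j \<in> {1..k}" for V j
      proof -
        obtain i where i: "j = Suc i" using j by (cases j) auto
        have "real (Suc i) * log 2 (real n) \<le> real k * log 2 (real n)"
          using j i elim(2) by (intro mult_right_mono) auto
        then show ?thesis unfolding i using elim V by (intro main) auto
      qed
      then show ?case by (auto simp: cheap_def)
    qed
  qed
  then show ?thesis using z(1) by blast
qed

section \<open>Deleting variables\<close>

definition core :: "nat set \<Rightarrow> (nat set \<times> nat set) set \<Rightarrow> (nat set \<times> nat set) set" where
  "core X F = {p\<in>F. (fst p \<union> snd p) \<inter> X = {}}"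

definition plinks_at :: "nat set \<Rightarrow> (nat set \<times> nat set) set \<Rightarrow> (nat \<times> nat set) set" where
  "plinks_at X F = {(x,Q). x \<in> X \<and> Q \<in> plink F x \<and> Q \<inter> X = {}}"

definition nlinks_at :: "nat set \<Rightarrow> (nat set \<times> nat set) set \<Rightarrow> (nat \<times> nat set) set" where
  "nlinks_at X F = {(x,Q). x \<in> X \<and> Q \<in> nlink F x \<and> Q \<inter> X = {}}"

definition rest :: "nat set \<Rightarrow> (nat set \<times> nat set) set \<Rightarrow> (nat set \<times> nat set) set" where
  "rest X F = {(S,T). (S,T) \<in> F \<and> (S \<union> T) \<inter> X \<noteq> {} \<and> \<not> (S = {} \<and> card (T \<inter> X) = 1) \<and>
     \<not> (card S = 1 \<and> T \<inter> X = {})}"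

definition negs :: "(nat set \<times> nat set) set \<Rightarrow> (nat set \<times> nat set) set" where
  "negs F = {p\<in>F. fst p \<noteq> {}}"

text \<open>A witness with \<open>X\<close> removed still treats clauses avoiding \<open>X\<close>
  in the same way; this is what turns a deletion into a factor counting minimal formulae on fewer
  variables.\<close>

lemma core_minimal_forms: assumes "F \<in> minimal_forms k V" shows "core X F \<in> minimal_forms k (V - X)"
proof -
  have "core X F \<subseteq> pairs k (V - X)" using assms by (auto simp: core_def minimal_forms_def pairs_def)
  moreover have "\<exists>W\<subseteq>V - X. pwitness (core X F) p W" if p: "p \<in> core X F" for p
  proof -
    obtain W where W: "W \<subseteq> V" "pwitness F p W" using p assms by (auto simp: core_def minimal_forms_def)
    have "psat (W - X) q \<longleftrightarrow> psat W q" if "q \<in> core X F" for q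
      using that by (auto simp: core_def psat_def)
    then have "pwitness (core X F) p (W - X)" using W(2) p by (auto simp: pwitness_def core_def)
    then show ?thesis using W(1) by blast
  qed
  ultimately show ?thesis by (auto simp: minimal_forms_def)
qed

lemma formula_from_parts:
  "F = core X F \<union> rest X F \<union> (\<lambda>(x,Q). ({}, insert x Q)) ` plinks_at X F \<union> (\<lambda>(x,Q). ({x}, Q)) ` nlinks_at X F"
  (is "_ = ?R")
proof
  show "?R \<subseteq> F" by (auto simp: core_def rest_def plinks_at_def nlinks_at_def plink_def nlink_def)
  show "F \<subseteq> ?R"
  proof
    fix p assume p: "p \<in> F"
    obtain S T where ST: "p = (S,T)" by (cases p)
    show "p \<in> ?R"
    proof (rule ccontr)
      assume n: "p \<notin> ?R"
      then have t: "(S \<union> T) \<inter> X \<noteq> {}" using p ST by (auto simp: core_def)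
      have "p \<notin> rest X F" using n by blast
      then consider "S = {}" "card (T \<inter> X) = 1" | "card S = 1" "T \<inter> X = {}" using p ST t by (auto simp: rest_def)
      then show False
      proof cases
        case 1
        then obtain x where x: "T \<inter> X = {x}" by (auto simp: card_1_singleton_iff)
        then have "T = insert x (T - {x})" "x \<in> X" by auto
        moreover have "(x, T - {x}) \<in> plinks_at X F" using x p ST 1 calculation
          by (auto simp: plinks_at_def plink_def insert_absorb)
        ultimately have "p \<in> (\<lambda>(x,Q). ({}, insert x Q)) ` plinks_at X F" using ST 1(1)
          by (metis (no_types, lifting) case_prod_conv image_eqI)
        then show False using n by blast
      next
        case 2
        then obtain x where x: "S = {x}" by (auto simp: card_1_singleton_iff)
        then have "(x,T) \<in> nlinks_at X F" using p ST t 2 by (auto simp: nlinks_at_def nlink_def)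
        then have "p \<in> (\<lambda>(x,Q). ({x}, Q)) ` nlinks_at X F" using ST x by force
        then show False using n by blast
      qed
    qed
  qed
qed

text \<open>\<open>M\<close> bounds the links separately over each core, because the families with
  which the links are compared will be read off from the core.\<close>

lemma deletion_count:
  assumes "finite V" "G \<subseteq> minimal_forms k V" "M \<ge> 0"
    and M: "\<And>F0. real (card ((\<lambda>F. (plinks_at X F, nlinks_at X F)) ` {F\<in>G. core X F = F0})) \<le> M"
  shows "real (card G) \<le> real (card (minimal_forms k (V - X))) * M * real (card (rest X ` G))"
proof -
  have finG: "finite G" using finite_subset[OF assms(2) finite_minimal_forms[OF assms(1)]] .
  let ?I = "\<lambda>F0. (\<lambda>F. (plinks_at X F, nlinks_at X F)) ` {F\<in>G. core X F = F0}"
  let ?Z = "SIGMA F0:minimal_forms k (V - X). ?I F0 \<times> rest X ` G"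
  have finZ: "finite ?Z" using finG finite_minimal_forms[of "V - X"] assms(1) by auto
  have "card G \<le> card ?Z"
  proof (rule card_inj_on_le[where f = "\<lambda>F. (core X F, (plinks_at X F, nlinks_at X F), rest X F)"])
    show "inj_on (\<lambda>F. (core X F, (plinks_at X F, nlinks_at X F), rest X F)) G"
    proof (rule inj_onI)
      fix F F' assume "(core X F, (plinks_at X F, nlinks_at X F), rest X F) = (core X F', (plinks_at X F', nlinks_at X F'), rest X F')"
      then have "core X F = core X F'" "plinks_at X F = plinks_at X F'" "nlinks_at X F = nlinks_at X F'" "rest X F = rest X F'" by auto
      then show "F = F'" using formula_from_parts[of F X] formula_from_parts[of F' X] by simp
    qed
    show "(\<lambda>F. (core X F, (plinks_at X F, nlinks_at X F), rest X F)) ` G \<subseteq> ?Z"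
      using assms(2) core_minimal_forms by blast
  qed (rule finZ)
  also have "\<dots> = (\<Sum>F0\<in>minimal_forms k (V - X). card (?I F0) * card (rest X ` G))"
    using finG finite_minimal_forms[of "V - X"] assms(1) by (subst card_SigmaI) (auto simp: card_cartesian_product)
  finally have "real (card G) \<le> (\<Sum>F0\<in>minimal_forms k (V - X). real (card (?I F0)) * real (card (rest X ` G)))"
    by (simp only: of_nat_mult[symmetric] of_nat_sum[symmetric] of_nat_le_iff)
  also have "\<dots> \<le> (\<Sum>F0\<in>minimal_forms k (V - X). M * real (card (rest X ` G)))"
    using M by (intro sum_mono mult_right_mono) auto
  finally show ?thesis by simp
qed

lemma sum_by_card_le:
  fixes f :: "nat \<Rightarrow> real"
  assumes "finite A" "finite I" "\<And>T. T \<in> A \<Longrightarrow> card T \<in> I"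
    and "\<And>t. t \<in> I \<Longrightarrow> real (card {T\<in>A. card T = t}) * f t \<le> b"
  shows "(\<Sum>T\<in>A. f (card T)) \<le> real (card I) * b"
proof -
  have "(\<Sum>T\<in>A. f (card T)) = (\<Sum>t\<in>I. \<Sum>T\<in>{T\<in>A. card T = t}. f (card T))"
    using assms by (subst sum.group) auto
  also have "\<dots> = (\<Sum>t\<in>I. real (card {T\<in>A. card T = t}) * f t)" by (intro sum.cong) auto
  also have "\<dots> \<le> (\<Sum>t\<in>I. b)" using assms by (intro sum_mono)
  finally show ?thesis by simp
qed

lemma card_image_Un_le:
  assumes "finite G" shows "card ((\<lambda>F. f F \<union> g F) ` G) \<le> card (f ` G) * card (g ` G)"
proof -
  have "(\<lambda>F. f F \<union> g F) ` G \<subseteq> (\<lambda>(a,b). a \<union> b) ` (f ` G \<times> g ` G)" by auto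
  then have "card ((\<lambda>F. f F \<union> g F) ` G) \<le> card (f ` G \<times> g ` G)"
    using assms by (meson card_image_le card_mono finite_SigmaI finite_imageI le_trans)
  then show ?thesis by (simp add: card_cartesian_product)
qed

text \<open>The common form of the encodings of clauses with negative literals: one loose family per
  index, with costs that add up in the exponent.\<close>

lemma card_UN_loose_families_le:
  assumes "finite J" "finite G" "finite V" "\<And>j. j \<in> J \<Longrightarrow> card (p j ` G) \<le> card (loose_families V (m j) s)"
    and "cheap k V s e" "\<And>j. j \<in> J \<Longrightarrow> m j \<in> {1..k}" "(\<Sum>j\<in>J. e * real (card V) ^ m j) \<le> b"
  shows "real (card ((\<lambda>F. \<Union>j\<in>J. p j F) ` G)) \<le> 2 powr b"
proof -
  have "real (card ((\<lambda>F. \<Union>j\<in>J. p j F) ` G)) \<le> real (\<Prod>j\<in>J. card (p j ` G))"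
    using card_image_UN_le[OF assms(1,2)] by (simp only: of_nat_le_iff)
  also have "\<dots> \<le> (\<Prod>j\<in>J. 2 powr (e * real (card V) ^ m j))"
    unfolding of_nat_prod
  proof (rule prod_mono, safe)
    fix j assume j: "j \<in> J"
    have "real (card (p j ` G)) \<le> real (card (loose_families V (m j) s))" using assms(4)[OF j] by simp
    also have "\<dots> \<le> 2 powr (e * real (card V) ^ m j)" using assms(5) assms(6)[OF j] unfolding cheap_def by blast
    finally show "real (card (p j ` G)) \<le> 2 powr (e * real (card V) ^ m j)" .
  qed simp
  also have "\<dots> = 2 powr (\<Sum>j\<in>J. e * real (card V) ^ m j)" using assms(1) by (simp add: powr_sum)
  also have "\<dots> \<le> 2 powr b" using assms(7) by (intro powr_mono) auto
  finally show ?thesis .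
qed

lemma card_neg_parts_image:
  assumes "finite V" "G \<subseteq> sparse_forms k V s"
  shows "card ((\<lambda>F. (\<lambda>S. (S,T)) ` neg_parts F T) ` G) \<le> card (loose_families V (k - card T) s)"
proof -
  have "(\<lambda>F. (\<lambda>S. (S,T)) ` neg_parts F T) ` G \<subseteq> (\<lambda>A. (\<lambda>S. (S,T)) ` A) ` loose_families V (k - card T) s"
  proof (rule image_subsetI)
    fix F assume "F \<in> G"
    then have "neg_parts F T \<in> loose_families V (k - card T) s" using assms(2) by (intro neg_parts_loose_families) auto
    then show "(\<lambda>S. (S,T)) ` neg_parts F T \<in> (\<lambda>A. (\<lambda>S. (S,T)) ` A) ` loose_families V (k - card T) s" by (rule imageI)
  qed
  then show ?thesis using finite_loose_families[OF assms(1)] by (meson card_image_le card_mono finite_imageI le_trans)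
qed

lemma card_ksub_subset_le:
  assumes "finite V" "A \<subseteq> ksub V r" shows "real (card A) \<le> real (card V) ^ r"
proof -
  have "card A \<le> card (ksub V r)" using assms by (intro card_mono) auto
  then show ?thesis using card_ksub_le[OF assms(1), of r] by linarith
qed

text \<open>The clauses with negative literals are grouped by their positive part \<open>T\<close>,
  and each group is a loose family; for each of the \<open>k\<close> possible sizes of
  \<open>T\<close> the groups cost at most \<open>e * n ^ k\<close> together.\<close>

lemma negs_count:
  assumes "finite V" "G \<subseteq> sparse_forms k V s" "cheap k V s e" "e \<ge> 0"
  shows "real (card (negs ` G)) \<le> 2 powr (real k * (e * real (card V) ^ k))"
proof -
  let ?J = "{T. T \<subseteq> V \<and> card T < k}"
  have finG: "finite G" using finite_subset[OF assms(2) finite_sparse_forms[OF assms(1)]] .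
  have finJ: "finite ?J" using assms(1) by (rule_tac finite_subset[of _ "Pow V"]) auto
  have "negs F = (\<Union>T\<in>?J. (\<lambda>S. (S,T)) ` neg_parts F T)" if "F \<in> G" for F
  proof -
    have sub: "F \<subseteq> pairs k V" by (rule sparse_forms_sub[OF subsetD[OF assms(2) that]])
    have ne: "card S > 0 \<longleftrightarrow> S \<noteq> {}" if "(S,T) \<in> F" for S T
      using sub that finite_subset[OF _ assms(1), of S] by (auto simp: pairs_def card_gt_0_iff)
    show ?thesis
    proof (rule set_eqI)
      fix p :: "nat set \<times> nat set"
      obtain S T where p: "p = (S,T)" by (cases p)
      show "p \<in> negs F \<longleftrightarrow> p \<in> (\<Union>T\<in>?J. (\<lambda>S. (S,T)) ` neg_parts F T)"
      proof -
        have "p \<in> (\<Union>T\<in>?J. (\<lambda>S. (S,T)) ` neg_parts F T) \<longleftrightarrow> (S,T) \<in> F \<and> T \<subseteq> V \<and> card T < k"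
          unfolding p neg_parts_def by (auto simp: image_iff)
        moreover have "p \<in> negs F \<longleftrightarrow> (S,T) \<in> F \<and> S \<noteq> {}" unfolding p negs_def by simp
        moreover have "T \<subseteq> V \<and> (card T < k \<longleftrightarrow> card S > 0)" if "(S,T) \<in> F"
          using that sub by (auto simp: pairs_def)
        ultimately show ?thesis using ne[of S T] by (cases "(S,T) \<in> F") auto
      qed
    qed
  qed
  then have "negs ` G = (\<lambda>F. \<Union>T\<in>?J. (\<lambda>S. (S,T)) ` neg_parts F T) ` G" by (intro image_cong) auto
  also have "real (card \<dots>) \<le> 2 powr (real k * (e * real (card V) ^ k))"
  proof (rule card_UN_loose_families_le[OF finJ finG assms(1) _ assms(3), where m = "\<lambda>T. k - card T"])
    show "card ((\<lambda>F. (\<lambda>S. (S,T)) ` neg_parts F T) ` G) \<le> card (loose_families V (k - card T) s)" for T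
      by (rule card_neg_parts_image[OF assms(1,2)])
    have "(\<Sum>T\<in>?J. e * real (card V) ^ (k - card T)) \<le> real (card {..<k}) * (e * real (card V) ^ k)"
    proof (rule sum_by_card_le[OF finJ])
      fix t assume t: "t \<in> {..<k}"
      have "real (card {T\<in>?J. card T = t}) \<le> real (card V) ^ t"
        by (rule card_ksub_subset_le[OF assms(1)]) (auto simp: ksub_def)
      then have "real (card {T\<in>?J. card T = t}) * (e * real (card V) ^ (k - t)) \<le> real (card V) ^ t * (e * real (card V) ^ (k - t))"
        using assms(4) by (intro mult_right_mono) auto
      also have "\<dots> = e * real (card V) ^ k" using t by (simp add: power_add[symmetric])
      finally show "real (card {T\<in>?J. card T = t}) * (e * real (card V) ^ (k - t)) \<le> e * real (card V) ^ k" .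
    qed auto
    then show "(\<Sum>T\<in>?J. e * real (card V) ^ (k - card T)) \<le> real k * (e * real (card V) ^ k)" by simp
  qed auto
  finally show ?thesis .
qed

text \<open>Three kinds of clauses remain. Positive clauses with two variables in \<open>X\<close>
  lie among at most \<open>k ^ 2 * n ^ (k - 2)\<close> sets and may be arbitrary, which is where
  \<open>n \<ge> k ^ 2 / e\<close> enters. Clauses with a negated variable and a positive one in
  \<open>X\<close> have at most \<open>k * n ^ (t - 1)\<close> possible positive parts of size
  \<open>t\<close>. Clauses that negate a variable of \<open>X\<close> and a further variable, with
  positive part outside \<open>X\<close>, give loose families of sets that are smaller by one. Each
  kind costs a multiple of \<open>e * n ^ (k - 1)\<close>.\<close>

lemma rest_count:
  assumes "finite V" "G \<subseteq> sparse_forms k V s" "cheap k V s e" "e > 0" "X \<subseteq> V" "card X \<le> k" "k \<ge> 2"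
    and n: "real (card V) \<ge> real k ^ 2 / e"
  shows "real (card (rest X ` G)) \<le> 2 powr (3 * real k ^ 2 * e * real (card V) ^ (k - 1))"
proof -
  let ?n = "real (card V)"
  have finG: "finite G" using finite_subset[OF assms(2) finite_sparse_forms[OF assms(1)]] .
  have finX: "finite X" using assms(1,5) finite_subset by auto
  have k2: "k = Suc (Suc (k - 2))" "k - 1 = Suc (k - 2)" using assms(7) by auto
  let ?J = "{T. T \<subseteq> V \<and> T \<inter> X \<noteq> {} \<and> card T < k}"
  let ?K = "{T. T \<subseteq> V \<and> T \<inter> X = {} \<and> card T + 2 \<le> k}"
  have finJ: "finite ?J" "finite ?K" using assms(1) by (auto intro: finite_subset[of _ "Pow V"])
  define P1 where "P1 F = {(S::nat set,C). S = {} \<and> ({},C) \<in> F \<and> 2 \<le> card (C \<inter> X)}" for F :: "(nat set \<times> nat set) set"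
  define p2 where "p2 T F = (\<lambda>S. (S,T)) ` neg_parts F T" for T and F :: "(nat set \<times> nat set) set"
  define p3 where "p3 q F = (\<lambda>S. (insert (fst q) S, snd q)) ` {S. fst q \<notin> S \<and> (insert (fst q) S, snd q) \<in> F}"
    for q and F :: "(nat set \<times> nat set) set"
  have dec: "rest X F = (P1 F \<union> (\<Union>T\<in>?J. p2 T F)) \<union> (\<Union>q\<in>X \<times> ?K. p3 q F)" if F: "F \<in> G" for F
  proof -
    have sub: "F \<subseteq> pairs k V" by (rule sparse_forms_sub[OF subsetD[OF assms(2) that]])
    show ?thesis
    proof (rule set_eqI)
      fix p :: "nat set \<times> nat set"
      obtain S T where p: "p = (S,T)" by (cases p)
      show "p \<in> rest X F \<longleftrightarrow> p \<in> (P1 F \<union> (\<Union>T\<in>?J. p2 T F)) \<union> (\<Union>q\<in>X \<times> ?K. p3 q F)"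
      proof (cases "(S,T) \<in> F")
        case False
        then show ?thesis unfolding p by (auto simp: rest_def P1_def p2_def p3_def neg_parts_def)
      next
        case True
        then have q: "S \<subseteq> V" "T \<subseteq> V" "S \<inter> T = {}" "card S + card T = k" using sub by (auto simp: pairs_def)
        then have fin: "finite S" "finite T" using assms(1) finite_subset by auto
        have e1: "p \<in> P1 F \<longleftrightarrow> S = {} \<and> 2 \<le> card (T \<inter> X)" using True unfolding p P1_def by auto
        have e2: "p \<in> (\<Union>T\<in>?J. p2 T F) \<longleftrightarrow> T \<inter> X \<noteq> {} \<and> S \<noteq> {}"
        proof -
          have "p \<in> (\<Union>T\<in>?J. p2 T F) \<longleftrightarrow> T \<subseteq> V \<and> T \<inter> X \<noteq> {} \<and> card T < k"
            using True unfolding p p2_def neg_parts_def by (auto simp: image_iff)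
          moreover have "card T < k \<longleftrightarrow> S \<noteq> {}" using q(4) fin by (auto simp: card_gt_0_iff)
          ultimately show ?thesis using q(2) by blast
        qed
        have p3i: "p \<in> p3 (x,T') F \<longleftrightarrow> T' = T \<and> x \<in> S" for x T'
        proof
          assume "T' = T \<and> x \<in> S"
          then show "p \<in> p3 (x,T') F" using True unfolding p p3_def
            by (auto simp: insert_absorb image_iff intro!: exI[of _ "S - {x}"])
        qed (auto simp: p p3_def)
        have e3: "p \<in> (\<Union>q\<in>X \<times> ?K. p3 q F) \<longleftrightarrow> S \<inter> X \<noteq> {} \<and> T \<inter> X = {} \<and> 2 \<le> card S"
          using p3i q by auto
        have c: "card (T \<inter> X) = 0 \<longleftrightarrow> T \<inter> X = {}" "card S = 0 \<longleftrightarrow> S = {}" using fin by auto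
        have "p \<in> rest X F \<longleftrightarrow> (S \<union> T) \<inter> X \<noteq> {} \<and> \<not> (S = {} \<and> card (T \<inter> X) = 1) \<and> \<not> (card S = 1 \<and> T \<inter> X = {})"
          using True unfolding p rest_def by auto
        also have "\<dots> \<longleftrightarrow> (S = {} \<and> 2 \<le> card (T \<inter> X)) \<or> (T \<inter> X \<noteq> {} \<and> S \<noteq> {}) \<or> (S \<inter> X \<noteq> {} \<and> T \<inter> X = {} \<and> 2 \<le> card S)"
        proof (cases "S = {}")
          case True
          have "T \<inter> X \<noteq> {} \<and> card (T \<inter> X) \<noteq> 1 \<longleftrightarrow> 2 \<le> card (T \<inter> X)"
            unfolding c(1)[symmetric] by auto
          then show ?thesis using True by auto
        next
          case False
          then have "card S \<ge> 1" using c(2) by linarith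
          then have "card S \<noteq> 1 \<longleftrightarrow> 2 \<le> card S" by auto
          then show ?thesis using False by auto
        qed
        finally show ?thesis using e1 e2 e3 by auto
      qed
    qed
  qed
  have P1: "real (card (P1 ` G)) \<le> 2 powr (e * ?n ^ (k - 1))"
  proof -
    let ?D = "{C\<in>ksub V k. 2 \<le> card (C \<inter> X)}"
    have finD: "finite ?D" using assms(1) by simp
    have "P1 ` G \<subseteq> Pow (Pair {} ` ?D)"
    proof (intro image_subsetI PowI subsetI)
      fix F p assume F: "F \<in> G" and "p \<in> P1 F"
      then obtain C where C: "p = ({},C)" "({},C) \<in> F" "2 \<le> card (C \<inter> X)" unfolding P1_def by blast
      have "({},C) \<in> pairs k V" using sparse_forms_sub[OF subsetD[OF assms(2) F]] C(2) by (rule subsetD)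
      then have "C \<in> ?D" using C(3) by (simp add: pairs_def ksub_def)
      then show "p \<in> Pair {} ` ?D" using C(1) by simp
    qed
    then have "card (P1 ` G) \<le> card (Pow (Pair {} ` ?D :: (nat set \<times> nat set) set))" using finD by (intro card_mono) auto
    also have "\<dots> \<le> 2 ^ card ?D" using finD by (simp add: card_Pow card_image inj_on_def)
    finally have "real (card (P1 ` G)) \<le> real (2 ^ card ?D)" by (simp only: of_nat_le_iff)
    also have "\<dots> = 2 powr real (card ?D)" by (simp add: powr_realpow)
    also have "\<dots> \<le> 2 powr (e * ?n ^ (k - 1))"
    proof (rule powr_mono)
      have "?D \<subseteq> (\<lambda>(x,y,Y). insert x (insert y Y)) ` (X \<times> X \<times> ksub V (k - 2))"
      proof
        fix C assume C: "C \<in> ?D"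
        then have Ck: "C \<subseteq> V" "card C = k" by (auto simp: ksub_def)
        then have fC: "finite C" using assms(1) finite_subset by auto
        obtain x y where xy: "x \<in> C \<inter> X" "y \<in> C \<inter> X" "x \<noteq> y"
          using C fC card_le_Suc0_iff_eq[of "C \<inter> X"] by fastforce
        have "C - {x,y} \<in> ksub V (k - 2)" using Ck xy fC by (auto simp: ksub_def card_Diff_subset)
        moreover have "C = insert x (insert y (C - {x,y}))" using xy by auto
        ultimately show "C \<in> (\<lambda>(x,y,Y). insert x (insert y Y)) ` (X \<times> X \<times> ksub V (k - 2))"
          using xy by (intro image_eqI[of _ _ "(x,y,C - {x,y})"]) auto
      qed
      then have "card ?D \<le> card (X \<times> X \<times> ksub V (k - 2))"
        using finX assms(1) by (meson card_image_le card_mono finite_SigmaI finite_imageI finite_ksub le_trans)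
      then have "real (card ?D) \<le> real (card X) * (real (card X) * real (card (ksub V (k - 2))))"
        by (simp only: card_cartesian_product of_nat_mult[symmetric] of_nat_le_iff)
      also have "\<dots> \<le> real k * (real k * ?n ^ (k - 2))"
        using assms(6) card_ksub_le[OF assms(1)] by (intro mult_mono) auto
      also have "\<dots> = real k ^ 2 * ?n ^ (k - 2)" by (simp add: power2_eq_square)
      also have "\<dots> \<le> (e * ?n) * ?n ^ (k - 2)" using n assms(4) by (intro mult_right_mono) (auto simp: field_simps)
      also have "\<dots> = e * ?n ^ (k - 1)" by (subst k2(2)) simp
      finally show "real (card ?D) \<le> e * ?n ^ (k - 1)" .
    qed simp
    finally show ?thesis .
  qed
  have P2: "real (card ((\<lambda>F. \<Union>T\<in>?J. p2 T F) ` G)) \<le> 2 powr (real k ^ 2 * (e * ?n ^ (k - 1)))"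
  proof (rule card_UN_loose_families_le[OF finJ(1) finG assms(1) _ assms(3), where m = "\<lambda>T. k - card T"])
    show "card (p2 T ` G) \<le> card (loose_families V (k - card T) s)" for T
      unfolding p2_def by (rule card_neg_parts_image[OF assms(1,2)])
    have "(\<Sum>T\<in>?J. e * ?n ^ (k - card T)) \<le> real (card {1..<k}) * (real k * (e * ?n ^ (k - 1)))"
    proof (rule sum_by_card_le[OF finJ(1)])
      fix T assume "T \<in> ?J"
      moreover from this have "finite T" using assms(1) finite_subset by auto
      ultimately have "card T > 0" by (auto simp: card_gt_0_iff)
      then show "card T \<in> {1..<k}" using \<open>T \<in> ?J\<close> by auto
    next
      fix t assume t: "t \<in> {1..<k}"
      then obtain i where i: "t = Suc i" by (cases t) auto
      have "card {T\<in>?J. card T = t} \<le> card {S\<in>ksub V (Suc i). S \<inter> X \<noteq> {}}"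
        using assms(1) by (intro card_mono) (auto simp: ksub_def i)
      then have "real (card {T\<in>?J. card T = t}) \<le> real (card X) * ?n ^ i"
        using card_meeting[OF assms(1,5), of i] by linarith
      also have "\<dots> \<le> real k * ?n ^ i" using assms(6) by (intro mult_right_mono) auto
      finally have "real (card {T\<in>?J. card T = t}) * (e * ?n ^ (k - t)) \<le> real k * ?n ^ i * (e * ?n ^ (k - t))"
        using assms(4) by (intro mult_right_mono) auto
      also have "\<dots> = real k * (e * ?n ^ (i + (k - t)))" by (simp add: power_add)
      also have "i + (k - t) = k - 1" using t i by auto
      finally show "real (card {T\<in>?J. card T = t}) * (e * ?n ^ (k - t)) \<le> real k * (e * ?n ^ (k - 1))" .
    qed simp
    also have "\<dots> \<le> real k * (real k * (e * ?n ^ (k - 1)))" using assms(4) by (intro mult_right_mono) auto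
    finally show "(\<Sum>T\<in>?J. e * ?n ^ (k - card T)) \<le> real k ^ 2 * (e * ?n ^ (k - 1))" by (simp add: power2_eq_square)
    show "k - card T \<in> {1..k}" if "T \<in> ?J" for T using that by auto
  qed
  have P3: "real (card ((\<lambda>F. \<Union>q\<in>X \<times> ?K. p3 q F) ` G)) \<le> 2 powr (real k * (real (k - 1) * (e * ?n ^ (k - 1))))"
  proof (rule card_UN_loose_families_le[OF _ finG assms(1) _ assms(3), where m = "\<lambda>q. k - card (snd q) - 1"])
    show "card (p3 q ` G) \<le> card (loose_families V (k - card (snd q) - 1) s)" for q
    proof -
      have "p3 q ` G \<subseteq> (\<lambda>A. (\<lambda>S. (insert (fst q) S, snd q)) ` A) ` loose_families V (k - card (snd q) - 1) s"
      proof (rule image_subsetI)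
        fix F assume "F \<in> G"
        then have "{S. fst q \<notin> S \<and> (insert (fst q) S, snd q) \<in> F} \<in> loose_families V (k - card (snd q) - 1) s"
          using assms(1,2) by (intro neg_parts_at_loose_families) auto
        then show "p3 q F \<in> (\<lambda>A. (\<lambda>S. (insert (fst q) S, snd q)) ` A) ` loose_families V (k - card (snd q) - 1) s"
          unfolding p3_def by (rule imageI)
      qed
      then show ?thesis using finite_loose_families[OF assms(1)] by (meson card_image_le card_mono finite_imageI le_trans)
    qed
    have inner: "(\<Sum>T\<in>?K. e * ?n ^ (k - card T - 1)) \<le> real (card {..<k-1}) * (e * ?n ^ (k - 1))"
    proof (rule sum_by_card_le[OF finJ(2)])
      fix t assume t: "t \<in> {..<k-1}"
      have "real (card {T\<in>?K. card T = t}) \<le> ?n ^ t"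
        by (rule card_ksub_subset_le[OF assms(1)]) (auto simp: ksub_def)
      then have "real (card {T\<in>?K. card T = t}) * (e * ?n ^ (k - t - 1)) \<le> ?n ^ t * (e * ?n ^ (k - t - 1))"
        using assms(4) by (intro mult_right_mono) auto
      also have "\<dots> = e * ?n ^ (t + (k - t - 1))" by (simp add: power_add)
      also have "t + (k - t - 1) = k - 1" using t by auto
      finally show "real (card {T\<in>?K. card T = t}) * (e * ?n ^ (k - t - 1)) \<le> e * ?n ^ (k - 1)" .
    qed auto
    have "(\<Sum>q\<in>X \<times> ?K. e * ?n ^ (k - card (snd q) - 1)) = (\<Sum>x\<in>X. \<Sum>T\<in>?K. e * ?n ^ (k - card T - 1))"
      by (simp only: sum.cartesian_product case_prod_unfold)
    also have "\<dots> = real (card X) * (\<Sum>T\<in>?K. e * ?n ^ (k - card T - 1))" by simp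
    also have "\<dots> \<le> real k * (real (card {..<k-1}) * (e * ?n ^ (k - 1)))"
      using inner assms(4,6) by (intro mult_mono) (auto intro!: sum_nonneg)
    finally show "(\<Sum>q\<in>X \<times> ?K. e * ?n ^ (k - card (snd q) - 1)) \<le> real k * (real (k - 1) * (e * ?n ^ (k - 1)))" by simp
    show "k - card (snd q) - 1 \<in> {1..k}" if "q \<in> X \<times> ?K" for q using that by auto
    show "finite (X \<times> ?K)" using finX finJ by blast
  qed
  have img: "rest X ` G = (\<lambda>F. (P1 F \<union> (\<Union>T\<in>?J. p2 T F)) \<union> (\<Union>q\<in>X \<times> ?K. p3 q F)) ` G"
    using dec by (intro image_cong) auto
  have "card (rest X ` G) \<le> card ((\<lambda>F. P1 F \<union> (\<Union>T\<in>?J. p2 T F)) ` G) * card ((\<lambda>F. \<Union>q\<in>X \<times> ?K. p3 q F) ` G)"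
    unfolding img by (rule card_image_Un_le[OF finG])
  also have "\<dots> \<le> (card (P1 ` G) * card ((\<lambda>F. \<Union>T\<in>?J. p2 T F) ` G)) * card ((\<lambda>F. \<Union>q\<in>X \<times> ?K. p3 q F) ` G)"
    by (intro mult_right_mono card_image_Un_le[OF finG]) auto
  finally have "real (card (rest X ` G)) \<le> real (card (P1 ` G)) * real (card ((\<lambda>F. \<Union>T\<in>?J. p2 T F) ` G)) * real (card ((\<lambda>F. \<Union>q\<in>X \<times> ?K. p3 q F) ` G))"
    by (simp only: of_nat_mult[symmetric] of_nat_le_iff)
  also have "\<dots> \<le> 2 powr (e * ?n ^ (k - 1)) * 2 powr (real k ^ 2 * (e * ?n ^ (k - 1))) * 2 powr (real k * (real (k - 1) * (e * ?n ^ (k - 1))))"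
    using P1 P2 P3 by (intro mult_mono) auto
  also have "\<dots> = 2 powr ((1 + real k ^ 2 + real k * real (k - 1)) * (e * ?n ^ (k - 1)))"
    by (simp add: powr_add[symmetric] algebra_simps)
  also have "\<dots> \<le> 2 powr ((3 * real k ^ 2) * (e * ?n ^ (k - 1)))"
  proof (intro powr_mono mult_right_mono)
    have "real (k - 1) = real k - 1" using assms(7) by (simp add: of_nat_diff)
    moreover have "real k ^ 2 \<ge> 1" using assms(7) by (intro one_le_power) auto
    ultimately show "1 + real k ^ 2 + real k * real (k - 1) \<le> 3 * real k ^ 2"
      by (simp add: power2_eq_square algebra_simps)
  qed (use assms(4) in auto)
  finally show ?thesis by (simp add: mult.assoc)
qed

section \<open>Clauses ruled out by a clause with negative literals\<close>

definition pos :: "(nat set \<times> nat set) set \<Rightarrow> nat set set" where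
  "pos F = {C. ({},C) \<in> F}"

lemma pos_sub: "F \<subseteq> pairs k V \<Longrightarrow> pos F \<subseteq> ksub V k"
  by (auto simp: pos_def pairs_def ksub_def)

lemma plink_pos: "plink F x = {Q. x \<notin> Q \<and> insert x Q \<in> pos F}"
  by (simp add: plink_def pos_def)

lemma formula_negs_pos: "F = negs F \<union> Pair {} ` pos F"
  by (auto simp: negs_def pos_def)

lemma plink_sub:
  assumes "finite V" "F \<subseteq> pairs k V" shows "plink F x \<subseteq> ksub (V - {x}) (k - 1)"
proof
  fix Q assume Q: "Q \<in> plink F x"
  then have p: "({}, insert x Q) \<in> pairs k V" "x \<notin> Q" using assms(2) by (auto simp: plink_def)
  have "insert x Q \<subseteq> V" using p by (simp add: pairs_def)
  then have "finite Q" using finite_subset[OF _ assms(1)] by auto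
  then show "Q \<in> ksub (V - {x}) (k - 1)" using p by (auto simp: pairs_def ksub_def)
qed

lemma nlink_sub:
  assumes "F \<subseteq> pairs k V" shows "nlink F x \<subseteq> ksub (V - {x}) (k - 1)"
proof
  fix Q assume Q: "Q \<in> nlink F x"
  then have "({x}, Q) \<in> pairs k V" using assms by (auto simp: nlink_def)
  then show "Q \<in> ksub (V - {x}) (k - 1)" by (auto simp: pairs_def ksub_def)
qed

lemma card_fibres:
  assumes "finite G" "inj_on (\<lambda>F. (a F, b F)) G" "B \<ge> 0"
    and "\<And>N. N \<in> a ` G \<Longrightarrow> real (card (b ` {F\<in>G. a F = N})) \<le> B"
  shows "real (card G) \<le> real (card (a ` G)) * B"
proof -
  let ?Z = "SIGMA N:a ` G. b ` {F\<in>G. a F = N}"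
  have "card G \<le> card ?Z"
    by (rule card_inj_on_le[OF assms(2)]) (use assms(1) in auto)
  also have "\<dots> = (\<Sum>N\<in>a ` G. card (b ` {F\<in>G. a F = N}))" using assms(1) by (subst card_SigmaI) auto
  finally have "real (card G) \<le> (\<Sum>N\<in>a ` G. real (card (b ` {F\<in>G. a F = N})))"
    by (simp only: of_nat_sum[symmetric] of_nat_le_iff)
  also have "\<dots> \<le> (\<Sum>N\<in>a ` G. B)" using assms(4) by (intro sum_mono)
  finally show ?thesis by simp
qed

text \<open>The trace on \<open>X1\<close> determines a forbidden family outside \<open>X1\<close>
  of size at least \<open>g\<close>, so each trace has at most
  \<open>2 powr (card (X - X1) - g)\<close> continuations. That \<open>f\<close> takes values
  outside \<open>X1\<close> avoids any circularity.\<close>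

lemma card_avoiding:
  fixes g :: real
  assumes "finite X" "X1 \<subseteq> X" "\<And>Y. Y \<subseteq> X1 \<Longrightarrow> f Y \<subseteq> X - X1"
  shows "real (card {Y. Y \<subseteq> X \<and> Y \<inter> f (Y \<inter> X1) = {} \<and> g \<le> real (card (f (Y \<inter> X1)))}) \<le> 2 powr (real (card X) - g)"
proof -
  let ?A = "{Z. Z \<subseteq> X1 \<and> g \<le> real (card (f Z))}"
  let ?Z = "SIGMA Z:?A. Pow (X - X1 - f Z)"
  have fX1: "finite X1" by (rule finite_subset[OF assms(2,1)])
  have fA: "finite ?A" using fX1 by (rule_tac finite_subset[of _ "Pow X1"]) auto
  have cX: "card X = card X1 + card (X - X1)" using assms fX1 by (simp add: card_Diff_subset card_mono)
  have "card {Y. Y \<subseteq> X \<and> Y \<inter> f (Y \<inter> X1) = {} \<and> g \<le> real (card (f (Y \<inter> X1)))} \<le> card ?Z"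
  proof (rule card_inj_on_le[where f = "\<lambda>Y. (Y \<inter> X1, Y - X1)"])
    show "finite ?Z" using fA assms(1) by auto
  qed (auto simp: inj_on_def)
  also have "\<dots> = (\<Sum>Z\<in>?A. card (Pow (X - X1 - f Z)))" using fA assms(1) by (subst card_SigmaI) auto
  finally have "real (card {Y. Y \<subseteq> X \<and> Y \<inter> f (Y \<inter> X1) = {} \<and> g \<le> real (card (f (Y \<inter> X1)))})
     \<le> (\<Sum>Z\<in>?A. real (card (Pow (X - X1 - f Z))))" by (simp only: of_nat_sum[symmetric] of_nat_le_iff)
  also have "\<dots> \<le> (\<Sum>Z\<in>?A. 2 powr (real (card (X - X1)) - g))"
  proof (rule sum_mono)
    fix Z assume Z: "Z \<in> ?A"
    have "f Z \<subseteq> X - X1" "finite (X - X1)" using assms Z by auto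
    then have "card (X - X1 - f Z) = card (X - X1) - card (f Z)" "card (f Z) \<le> card (X - X1)"
      by (auto simp: card_Diff_subset finite_subset card_mono)
    then have "real (card (X - X1 - f Z)) \<le> real (card (X - X1)) - g" using Z by auto
    then have "2 powr real (card (X - X1 - f Z)) \<le> 2 powr (real (card (X - X1)) - g)" by (intro powr_mono) auto
    then show "real (card (Pow (X - X1 - f Z))) \<le> 2 powr (real (card (X - X1)) - g)"
      using assms(1) by (simp add: card_Pow powr_realpow)
  qed
  also have "\<dots> = real (card ?A) * 2 powr (real (card (X - X1)) - g)" by simp
  also have "\<dots> \<le> 2 powr (real (card X1)) * 2 powr (real (card (X - X1)) - g)"
  proof (rule mult_right_mono)
    have "card ?A \<le> card (Pow X1)" using fX1 by (intro card_mono) auto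
    then have "real (card ?A) \<le> real (card (Pow X1))" by (simp only: of_nat_le_iff)
    then show "real (card ?A) \<le> 2 powr (real (card X1))" using fX1 by (simp add: card_Pow powr_realpow)
  qed simp
  also have "\<dots> = 2 powr (real (card X) - g)" using cX by (simp add: powr_add[symmetric] algebra_simps)
  finally show ?thesis .
qed

text \<open>The sets \<open>C\<close> avoid \<open>S\<close>, whereas the positive clauses that
  encode the links of \<open>S\<close> meet \<open>S\<close>. So the sets ruled out are determined
  without looking at any positive clause that might be ruled out.\<close>

definition kill :: "nat \<Rightarrow> nat set \<Rightarrow> nat set \<Rightarrow> (nat set \<times> nat set) set \<Rightarrow> nat set set" where
  "kill k V S F = {C\<in>ksub (V - S) k. (\<exists>T. T \<subseteq> C \<and> (S,T) \<in> F) \<and> (\<forall>x\<in>S. \<exists>Q\<in>plink F x. Q \<subseteq> C)}"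

text \<open>Fix the clauses with negative literals, at cost \<open>k * e * n ^ k\<close>. Then the
  positive clauses meeting \<open>S\<close> determine \<open>kill\<close>, which the positive
  clauses avoiding \<open>S\<close> must miss entirely.\<close>

lemma big_kill_count:
  assumes "finite V" "cheap k V s e" "e > 0" "S \<noteq> {}" "S \<subseteq> V"
  shows "real (card {F\<in>sparse_forms k V s. g \<le> real (card (kill k V S F))})
     \<le> 2 powr (real (card V choose k) - g + real k * (e * real (card V) ^ k))"
proof -
  let ?G = "{F\<in>sparse_forms k V s. g \<le> real (card (kill k V S F))}"
  let ?X = "ksub V k"
  define X1 where "X1 = {C\<in>ksub V k. C \<inter> S \<noteq> {}}"
  define f where "f N Y = {C\<in>ksub (V - S) k. (\<exists>T. T \<subseteq> C \<and> (S,T) \<in> N) \<and>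
     (\<forall>x\<in>S. \<exists>Q. x \<notin> Q \<and> insert x Q \<in> Y \<and> Q \<subseteq> C)}" for N :: "(nat set \<times> nat set) set" and Y
  have finG: "finite ?G" using finite_sparse_forms[OF assms(1)] by simp
  have kf: "kill k V S F = f (negs F) (pos F \<inter> X1)" if "F \<in> ?G" for F
  proof -
    have sub: "pos F \<subseteq> ?X" using that by (intro pos_sub) (auto simp: sparse_forms_def)
    have a: "(S,T) \<in> F \<longleftrightarrow> (S,T) \<in> negs F" for T using assms(4) by (auto simp: negs_def)
    have b: "insert x Q \<in> pos F \<longleftrightarrow> insert x Q \<in> pos F \<inter> X1" if "x \<in> S" for x Q
      using that sub by (auto simp: X1_def)
    show ?thesis unfolding kill_def f_def plink_pos using a b by auto
  qed
  have "real (card ?G) \<le> real (card (negs ` ?G)) * 2 powr (real (card ?X) - g)"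
  proof (rule card_fibres[OF finG])
    show "inj_on (\<lambda>F. (negs F, pos F)) ?G"
      using formula_negs_pos by (metis (no_types, lifting) Pair_inject inj_onI)
    fix N assume "N \<in> negs ` ?G"
    have "pos ` {F\<in>?G. negs F = N} \<subseteq> {Y. Y \<subseteq> ?X \<and> Y \<inter> f N (Y \<inter> X1) = {} \<and> g \<le> real (card (f N (Y \<inter> X1)))}"
    proof (rule image_subsetI)
      fix F assume F: "F \<in> {F\<in>?G. negs F = N}"
      then have FG: "F \<in> ?G" and N: "negs F = N" by auto
      have Fm: "F \<in> minimal_forms k V" using FG sparse_forms_minimal_forms by auto
      have sub: "pos F \<subseteq> ?X" using FG by (intro pos_sub) (auto simp: sparse_forms_def)
      have eq: "f N (pos F \<inter> X1) = kill k V S F" using kf[OF FG] N by simp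
      have "C \<notin> pos F" if C: "C \<in> kill k V S F" for C
      proof -
        obtain T where T: "T \<subseteq> C" "(S,T) \<in> F" using C by (auto simp: kill_def)
        have "({},C) \<notin> F" by (rule killed[OF Fm T(2) assms(4) T(1)]) (use C in \<open>auto simp: kill_def ksub_def\<close>)
        then show ?thesis by (simp add: pos_def)
      qed
      then show "pos F \<in> {Y. Y \<subseteq> ?X \<and> Y \<inter> f N (Y \<inter> X1) = {} \<and> g \<le> real (card (f N (Y \<inter> X1)))}"
        using sub FG eq by auto
    qed
    then have "card (pos ` {F\<in>?G. negs F = N}) \<le> card {Y. Y \<subseteq> ?X \<and> Y \<inter> f N (Y \<inter> X1) = {} \<and> g \<le> real (card (f N (Y \<inter> X1)))}"
      using assms(1) by (intro card_mono) (auto intro: finite_subset[of _ "Pow ?X"])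
    moreover have "real (card {Y. Y \<subseteq> ?X \<and> Y \<inter> f N (Y \<inter> X1) = {} \<and> g \<le> real (card (f N (Y \<inter> X1)))}) \<le> 2 powr (real (card ?X) - g)"
    proof (rule card_avoiding)
      show "f N Y \<subseteq> ?X - X1" for Y by (auto simp: f_def X1_def ksub_def)
    qed (use assms(1) in \<open>auto simp: X1_def\<close>)
    ultimately show "real (card (pos ` {F\<in>?G. negs F = N})) \<le> 2 powr (real (card ?X) - g)" by linarith
  qed simp
  also have "\<dots> \<le> 2 powr (real k * (e * real (card V) ^ k)) * 2 powr (real (card ?X) - g)"
    using assms by (intro mult_right_mono negs_count) auto
  also have "\<dots> = 2 powr (real (card V choose k) - g + real k * (e * real (card V) ^ k))"
    by (simp add: powr_add[symmetric] card_ksub[OF assms(1)] algebra_simps)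
  finally show ?thesis .
qed

lemma plinks_at_sub:
  assumes "finite V" "F \<subseteq> pairs k V" shows "plinks_at X F \<subseteq> X \<times> ksub (V - X) (k - 1)"
proof clarify
  fix x Q assume Q: "(x,Q) \<in> plinks_at X F"
  then have "Q \<in> ksub (V - {x}) (k - 1)" using plink_sub[OF assms, of x] by (auto simp: plinks_at_def)
  then show "x \<in> X \<and> Q \<in> ksub (V - X) (k - 1)" using Q by (auto simp: plinks_at_def ksub_def)
qed

text \<open>Thin negative links cost \<open>e * n ^ (k - 1)\<close> each, which is of the same order
  as the clauses in \<open>rest\<close>; the factor \<open>4 * k ^ 2\<close> collects both. It
  remains to bound the positive links over a given core.\<close>

lemma deletion_thin:
  assumes "finite V" "G \<subseteq> sparse_forms k V s" "cheap k V s e" "e > 0" "X \<subseteq> V" "card X \<le> k" "k \<ge> 2"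
    and n: "real (card V) \<ge> real k ^ 2 / e" and "M \<ge> 0"
    and thinN: "\<And>F x. F \<in> G \<Longrightarrow> x \<in> X \<Longrightarrow> real (card (nlink F x)) \<le> thin e * real (card V) ^ (k - 1)"
    and M: "\<And>F0. real (card (plinks_at X ` {F\<in>G. core X F = F0})) \<le> M"
  shows "real (card G) \<le> real (card (minimal_forms k (V - X))) * M * 2 powr (4 * real k ^ 2 * e * real (card V) ^ (k - 1))"
proof -
  let ?n = "real (card V)"
  have finG: "finite G" using finite_subset[OF assms(2) finite_sparse_forms[OF assms(1)]] .
  have finX: "finite X" by (rule finite_subset[OF assms(5,1)])
  have Gm: "G \<subseteq> minimal_forms k V" using assms(2) sparse_forms_minimal_forms by (rule subset_trans)
  define p where "p x F = Pair x ` {Q\<in>nlink F x. Q \<inter> X = {}}" for x :: nat and F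
  have "nlinks_at X F = (\<Union>x\<in>X. p x F)" for F by (auto simp: nlinks_at_def p_def)
  then have img: "nlinks_at X ` G = (\<lambda>F. \<Union>x\<in>X. p x F) ` G" by simp
  have px: "real (card (p x ` G)) \<le> 2 powr (e * ?n ^ (k - 1))" if x: "x \<in> X" for x
  proof -
    let ?S = "{Y. Y \<subseteq> ksub V (k - 1) \<and> real (card Y) \<le> thin e * ?n ^ (k - 1)}"
    have fS: "finite ?S" using assms(1) by (auto intro: finite_subset[of _ "Pow (ksub V (k - 1))"])
    have "p x ` G \<subseteq> (\<lambda>Y. Pair x ` Y) ` ?S"
    proof (rule image_subsetI)
      fix F assume F: "F \<in> G"
      have sub: "nlink F x \<subseteq> ksub V (k - 1)"
        using nlink_sub[OF sparse_forms_sub[OF subsetD[OF assms(2) F]], of x] ksub_mono[of "V - {x}" V] by auto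
      then have "finite (nlink F x)" using finite_subset finite_ksub[OF assms(1)] by metis
      then have "card {Q\<in>nlink F x. Q \<inter> X = {}} \<le> card (nlink F x)" by (intro card_mono) auto
      then have "{Q\<in>nlink F x. Q \<inter> X = {}} \<in> ?S" using thinN[OF F x] sub by auto
      then show "p x F \<in> (\<lambda>Y. Pair x ` Y) ` ?S" unfolding p_def by (rule imageI)
    qed
    then have "card (p x ` G) \<le> card ?S" using fS by (meson card_image_le card_mono finite_imageI le_trans)
    then have "real (card (p x ` G)) \<le> real (card ?S)" by (simp only: of_nat_le_iff)
    also have "\<dots> \<le> 2 powr (e * ?n ^ (k - 1))"
      using assms(1,4) card_ksub_le[OF assms(1)] by (intro card_thin_subsets) auto
    finally show ?thesis .
  qed
  have "real (card (nlinks_at X ` G)) \<le> real (\<Prod>x\<in>X. card (p x ` G))"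
    unfolding img using card_image_UN_le[OF finX finG] by (simp only: of_nat_le_iff)
  also have "\<dots> \<le> (\<Prod>x\<in>X. 2 powr (e * ?n ^ (k - 1)))" unfolding of_nat_prod using px by (intro prod_mono) auto
  also have "\<dots> = 2 powr (real (card X) * (e * ?n ^ (k - 1)))" by (simp add: powr_power mult.commute)
  also have "\<dots> \<le> 2 powr (real k ^ 2 * (e * ?n ^ (k - 1)))"
  proof (intro powr_mono mult_right_mono)
    have "real (card X) \<le> real k" using assms(6) by simp
    also have "\<dots> \<le> real k ^ 2" using assms(7) by (simp add: power2_eq_square)
    finally show "real (card X) \<le> real k ^ 2" .
  qed (use assms(4) in auto)
  finally have NcB: "real (card (nlinks_at X ` G)) \<le> 2 powr (real k ^ 2 * (e * ?n ^ (k - 1)))" .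
  have "real (card G) \<le> real (card (minimal_forms k (V - X))) * (M * 2 powr (real k ^ 2 * (e * ?n ^ (k - 1)))) * real (card (rest X ` G))"
  proof (rule deletion_count[OF assms(1) Gm])
    fix F0
    let ?H = "{F\<in>G. core X F = F0}"
    have "(\<lambda>F. (plinks_at X F, nlinks_at X F)) ` ?H \<subseteq> plinks_at X ` ?H \<times> nlinks_at X ` G" by auto
    then have "card ((\<lambda>F. (plinks_at X F, nlinks_at X F)) ` ?H) \<le> card (plinks_at X ` ?H \<times> nlinks_at X ` G)"
      using finG by (intro card_mono) auto
    then have "real (card ((\<lambda>F. (plinks_at X F, nlinks_at X F)) ` ?H)) \<le> real (card (plinks_at X ` ?H)) * real (card (nlinks_at X ` G))"
      by (simp only: card_cartesian_product of_nat_mult[symmetric] of_nat_le_iff)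
    also have "\<dots> \<le> M * 2 powr (real k ^ 2 * (e * ?n ^ (k - 1)))"
      using M NcB assms(9) by (intro mult_mono) auto
    finally show "real (card ((\<lambda>F. (plinks_at X F, nlinks_at X F)) ` ?H)) \<le> M * 2 powr (real k ^ 2 * (e * ?n ^ (k - 1)))" .
  qed (use assms(9) in simp)
  also have "\<dots> \<le> real (card (minimal_forms k (V - X))) * (M * 2 powr (real k ^ 2 * (e * ?n ^ (k - 1)))) * 2 powr (3 * real k ^ 2 * e * ?n ^ (k - 1))"
    using assms by (intro mult_left_mono rest_count) auto
  also have "\<dots> = real (card (minimal_forms k (V - X))) * M * (2 powr (real k ^ 2 * (e * ?n ^ (k - 1))) * 2 powr (3 * real k ^ 2 * e * ?n ^ (k - 1)))"
    by (simp only: mult.assoc)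
  also have "2 powr (real k ^ 2 * (e * ?n ^ (k - 1))) * 2 powr (3 * real k ^ 2 * e * ?n ^ (k - 1)) = 2 powr (4 * real k ^ 2 * e * ?n ^ (k - 1))"
    by (simp add: powr_add[symmetric] algebra_simps)
  finally show ?thesis .
qed

section \<open>Deletions forced by irregular links\<close>

lemma finite_dense_pairs:
  assumes "finite V" shows "finite (dense_pairs V r d \<gamma>)"
proof (rule finite_subset)
  show "dense_pairs V r d \<gamma> \<subseteq> Pow (ksub V r) \<times> Pow (ksub V r)" unfolding dense_pairs_def by blast
qed (use assms in simp)

lemma choose_mono_left: "m \<le> n \<Longrightarrow> real (m choose r) \<le> real (n choose r)"
  by (simp add: binomial_right_mono)

text \<open>The sets common to both links of \<open>x\<close> are exactly those in
  \<open>kill\<close> for \<open>{x}\<close>. If these are few although both links are dense, the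
  links form a dense pair, so the two of them together cost less than one unrestricted link.\<close>

lemma large_negative_link_count:
  assumes "d > 0" "\<xi> > 0" "k \<ge> 3"
  shows "\<exists>\<gamma>>0. \<exists>c>0. \<forall>\<^sub>F n in sequentially. \<forall>V s e x. finite V \<longrightarrow> card V = n \<longrightarrow> cheap k V s e \<longrightarrow> e > 0 \<longrightarrow>
     real n \<ge> real k ^ 2 / e \<longrightarrow> x \<in> V \<longrightarrow>
     real (card {F\<in>sparse_forms k V s. d * real n ^ (k - 1) \<le> real (card (plink F x)) \<and>
        \<xi> * real n ^ (k - 1) \<le> real (card (nlink F x)) \<and> real (card (kill k V {x} F)) \<le> \<gamma> * real n ^ k})
     \<le> real (card (minimal_forms k (V - {x}))) *
        2 powr (real (n choose (k - 1)) - c * real n ^ (k - 1) + 3 * real k ^ 2 * e * real n ^ (k - 1))"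
proof -
  define d' where "d' = min d \<xi>"
  have d': "d' > 0" "d' \<le> d" "d' \<le> \<xi>" using assms by (auto simp: d'_def)
  have k1: "k - 1 \<ge> 1" using assms(3) by simp
  obtain g c where g: "g > 0" and c: "c > 0" and ev: "\<forall>\<^sub>F n in sequentially. \<forall>V::nat set. finite V \<longrightarrow> card V = n \<longrightarrow>
     real (card (dense_pairs V (k - 1) d' g)) \<le> 2 powr (real (n choose (k - 1)) - c * real n ^ (k - 1))"
    using dense_pairs_count[OF d'(1) k1] by blast
  have k: "k = Suc (k - 1)" using assms(3) by simp
  have ev': "\<forall>\<^sub>F n in sequentially. \<forall>V::nat set. finite V \<longrightarrow> card V = n - 1 \<longrightarrow>
     real (card (dense_pairs V (k - 1) d' g)) \<le> 2 powr (real ((n - 1) choose (k - 1)) - c * real (n - 1) ^ (k - 1))"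
    using eventually_compose_filterlim[OF ev, of "\<lambda>n. n - 1" sequentially] filterlim_minus_const_nat_at_top by blast
  have "\<forall>\<^sub>F n in sequentially. \<forall>V s e x. finite V \<longrightarrow> card V = n \<longrightarrow> cheap k V s e \<longrightarrow> e > 0 \<longrightarrow>
     real n \<ge> real k ^ 2 / e \<longrightarrow> x \<in> V \<longrightarrow>
     real (card {F\<in>sparse_forms k V s. d * real n ^ (k - 1) \<le> real (card (plink F x)) \<and>
        \<xi> * real n ^ (k - 1) \<le> real (card (nlink F x)) \<and> real (card (kill k V {x} F)) \<le> g / 2 ^ k * real n ^ k})
     \<le> real (card (minimal_forms k (V - {x}))) *
        2 powr (real (n choose (k - 1)) - c / 2 ^ (k - 1) * real n ^ (k - 1) + 3 * real k ^ 2 * e * real n ^ (k - 1))"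
    using ev' eventually_real_ge[of 2]
  proof eventually_elim
    case (elim n)
    show ?case
    proof (intro allI impI)
      fix V s e x
      assume V: "finite V" "card V = n" and ch: "cheap k V s e" "e > 0" "real n \<ge> real k ^ 2 / e" and x: "x \<in> V"
      define G where "G = {F\<in>sparse_forms k V s. d * real n ^ (k - 1) \<le> real (card (plink F x)) \<and>
        \<xi> * real n ^ (k - 1) \<le> real (card (nlink F x)) \<and> real (card (kill k V {x} F)) \<le> g / 2 ^ k * real n ^ k}"
      let ?V = "V - {x}" and ?m = "real (n - 1)"
      have V': "finite ?V" "card ?V = n - 1" using V x by auto
      \<comment> \<open>The links of \<open>x\<close> live on \<open>n - 1\<close> variables;
        \<open>n - 1 \<ge> n / 2\<close> accounts for the factors \<open>2 ^ k\<close> and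
        \<open>2 ^ (k - 1)\<close> in the constants.\<close>
      have m: "?m \<le> real n" "?m \<ge> real n / 2" using elim(2) by auto
      have mk: "?m ^ j \<le> real n ^ j" "real n ^ j / 2 ^ j \<le> ?m ^ j" for j
        using m power_mono[of ?m "real n" j] power_mono[of "real n / 2" ?m j] by (auto simp: power_divide)
      let ?D = "dense_pairs ?V (k - 1) d' g"
      have finD: "finite ?D" by (rule finite_dense_pairs[OF V'(1)])
      have mem: "(plink F x, nlink F x) \<in> ?D" if F: "F \<in> G" for F
      proof -
        have sub: "F \<subseteq> pairs k V" using F by (auto simp: G_def sparse_forms_def)
        have l: "plink F x \<subseteq> ksub ?V (k - 1)" "nlink F x \<subseteq> ksub ?V (k - 1)"
          using plink_sub[OF V(1) sub] nlink_sub[OF sub] by auto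
        have "common ?V (k - 1) (plink F x) (nlink F x) = kill k V {x} F"
          unfolding common_def kill_def k[symmetric] nlink_def by auto
        then have "real (card (common ?V (k - 1) (plink F x) (nlink F x))) \<le> g / 2 ^ k * real n ^ k"
          using F by (simp add: G_def)
        also have "\<dots> = g * (real n ^ k / 2 ^ k)" by simp
        also have "\<dots> \<le> g * ?m ^ k" using g mk(2)[of k] by (intro mult_left_mono) auto
        finally have cc: "real (card (common ?V (k - 1) (plink F x) (nlink F x))) \<le> g * ?m ^ Suc (k - 1)" using k by simp
        have "d' * ?m ^ (k - 1) \<le> d * real n ^ (k - 1)" "d' * ?m ^ (k - 1) \<le> \<xi> * real n ^ (k - 1)"
          using d' assms mk(1)[of "k - 1"] by (auto intro!: mult_mono)
        then show ?thesis using l cc F V' unfolding dense_pairs_def G_def by auto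
      qed
      have "real (card G) \<le> real (card (minimal_forms k (V - {x}))) * real (card ?D) * real (card (rest {x} ` G))"
      proof (rule deletion_count[OF V(1)])
        show "G \<subseteq> minimal_forms k V" using sparse_forms_minimal_forms by (auto simp: G_def)
        fix F0
        let ?H = "{F\<in>G. core {x} F = F0}"
        have "(\<lambda>F. (plinks_at {x} F, nlinks_at {x} F)) ` ?H \<subseteq> (\<lambda>(L,L'). (Pair x ` L, Pair x ` L')) ` ?D"
        proof (rule image_subsetI)
          fix F assume "F \<in> ?H"
          then have F: "F \<in> G" by simp
          have sub: "F \<subseteq> pairs k V" using F by (auto simp: G_def sparse_forms_def)
          have "Q \<inter> {x} = {}" if "Q \<in> plink F x \<union> nlink F x" for Q
            using that plink_sub[OF V(1) sub, of x] nlink_sub[OF sub, of x] by (auto simp: ksub_def)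
          then have "plinks_at {x} F = Pair x ` plink F x" "nlinks_at {x} F = Pair x ` nlink F x"
            by (auto simp: plinks_at_def nlinks_at_def)
          then show "(plinks_at {x} F, nlinks_at {x} F) \<in> (\<lambda>(L,L'). (Pair x ` L, Pair x ` L')) ` ?D"
            using mem[OF F] by (intro image_eqI[of _ _ "(plink F x, nlink F x)"]) auto
        qed
        then have "card ((\<lambda>F. (plinks_at {x} F, nlinks_at {x} F)) ` ?H) \<le> card ?D"
          using finD by (meson card_image_le card_mono finite_imageI le_trans)
        then show "real (card ((\<lambda>F. (plinks_at {x} F, nlinks_at {x} F)) ` ?H)) \<le> real (card ?D)" by simp
      qed simp
      also have "\<dots> \<le> real (card (minimal_forms k (V - {x}))) * 2 powr (real (n choose (k - 1)) - c / 2 ^ (k - 1) * real n ^ (k - 1))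
          * 2 powr (3 * real k ^ 2 * e * real (card V) ^ (k - 1))"
      proof (intro mult_mono mult_left_mono)
        have "real (card ?D) \<le> 2 powr (real ((n - 1) choose (k - 1)) - c * real (n - 1) ^ (k - 1))"
          using elim(1) V' by blast
        also have "\<dots> \<le> 2 powr (real (n choose (k - 1)) - c / 2 ^ (k - 1) * real n ^ (k - 1))"
        proof (rule powr_mono)
          have "c / 2 ^ (k - 1) * real n ^ (k - 1) = c * (real n ^ (k - 1) / 2 ^ (k - 1))" by simp
          also have "\<dots> \<le> c * ?m ^ (k - 1)" using c mk(2)[of "k - 1"] by (intro mult_left_mono) auto
          finally show "real ((n - 1) choose (k - 1)) - c * ?m ^ (k - 1) \<le> real (n choose (k - 1)) - c / 2 ^ (k - 1) * real n ^ (k - 1)"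
            using choose_mono_left[of "n - 1" n "k - 1"] by simp
        qed simp
        finally show "real (card ?D) \<le> 2 powr (real (n choose (k - 1)) - c / 2 ^ (k - 1) * real n ^ (k - 1))" .
        show "real (card (rest {x} ` G)) \<le> 2 powr (3 * real k ^ 2 * e * real (card V) ^ (k - 1))"
          using V ch x assms(3) by (intro rest_count[where s = s]) (auto simp: G_def)
      qed auto
      also have "\<dots> = real (card (minimal_forms k (V - {x}))) *
          2 powr (real (n choose (k - 1)) - c / 2 ^ (k - 1) * real n ^ (k - 1) + 3 * real k ^ 2 * e * real n ^ (k - 1))"
        using V(2) by (simp add: powr_add)
      finally show "real (card {F\<in>sparse_forms k V s. d * real n ^ (k - 1) \<le> real (card (plink F x)) \<and>
        \<xi> * real n ^ (k - 1) \<le> real (card (nlink F x)) \<and> real (card (kill k V {x} F)) \<le> g / 2 ^ k * real n ^ k})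
        \<le> real (card (minimal_forms k (V - {x}))) *
        2 powr (real (n choose (k - 1)) - c / 2 ^ (k - 1) * real n ^ (k - 1) + 3 * real k ^ 2 * e * real n ^ (k - 1))"
        unfolding G_def .
    qed
  qed
  moreover have "g / 2 ^ k > 0" "c / 2 ^ (k - 1) > 0" using g c by auto
  ultimately show ?thesis by blast
qed

section \<open>Common extensions and atypical sets\<close>

definition extensions :: "nat set \<Rightarrow> (nat set \<times> nat set) set \<Rightarrow> nat set \<Rightarrow> nat set \<Rightarrow> nat set set" where
  "extensions V F S T = {R\<in>ksub (V - S - T) (card S). \<forall>x\<in>S. R \<union> T \<in> plink F x}"

text \<open>For \<open>i = card S\<close> the set \<open>R \<union> T\<close> has
  \<open>k - 1\<close> elements, as members of links do. A clause with negated set \<open>S\<close>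
  has a positive part of \<open>k - i\<close> elements, one more than \<open>T\<close> here; if
  dropping some element of it leaves a set that is not atypical, the clause rules out of the order
  of \<open>n ^ i\<close> positive clauses.\<close>

definition atypical :: "nat \<Rightarrow> nat set \<Rightarrow> real \<Rightarrow> nat set \<Rightarrow> (nat set \<times> nat set) set \<Rightarrow> nat set set" where
  "atypical k V b S F = {T\<in>ksub (V - S) (k - 1 - card S). real (card (extensions V F S T)) < b * real (card V) ^ card S}"

lemma card_supersets:
  assumes "finite U" "A \<subseteq> ksub U t" "t + i = r"
  shows "card A * ((card U - t) choose i) \<le> 2 ^ r * card {Q\<in>ksub U r. \<exists>T\<in>A. T \<subseteq> Q}"
proof -
  let ?Q = "{Q\<in>ksub U r. \<exists>T\<in>A. T \<subseteq> Q}"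
  have fA: "finite A" by (rule finite_subset[OF assms(2) finite_ksub[OF assms(1)]])
  have fT: "finite T" "card T = t" "T \<subseteq> U" if "T \<in> A" for T
    using that assms(2) finite_subset[OF _ assms(1)] by (auto simp: ksub_def)
  have fQ: "finite Q" "card Q = r" if "Q \<in> ?Q" for Q
    using that finite_subset[OF _ assms(1)] by (auto simp: ksub_def)
  have "card (SIGMA T:A. ksub (U - T) i) \<le> card (SIGMA Q:?Q. Pow Q)"
  proof (rule card_inj_on_le[where f = "\<lambda>(T,R). (R \<union> T, T)"])
    show "inj_on (\<lambda>(T,R). (R \<union> T, T)) (SIGMA T:A. ksub (U - T) i)"
      by (auto simp: inj_on_def ksub_def)
    show "(\<lambda>(T,R). (R \<union> T, T)) ` (SIGMA T:A. ksub (U - T) i) \<subseteq> (SIGMA Q:?Q. Pow Q)"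
    proof (rule image_subsetI)
      fix p assume "p \<in> (SIGMA T:A. ksub (U - T) i)"
      then obtain T R where p: "p = (T,R)" and T: "T \<in> A" and R: "R \<in> ksub (U - T) i" by blast
      have "finite R" using R assms(1) finite_subset[of R "U - T"] by (auto simp: ksub_def)
      moreover have "R \<inter> T = {}" using R by (auto simp: ksub_def)
      ultimately have "card (R \<union> T) = r" using fT[OF T] R assms(3) by (simp add: card_Un_disjoint ksub_def)
      then have "R \<union> T \<in> ksub U r" using fT[OF T] R by (auto simp: ksub_def)
      then show "(case p of (T,R) \<Rightarrow> (R \<union> T, T)) \<in> (SIGMA Q:?Q. Pow Q)" using T p by auto
    qed
    show "finite (SIGMA Q:?Q. Pow Q)" using assms(1) fQ by (intro finite_SigmaI) auto
  qed
  also have "card (SIGMA Q:?Q. Pow Q) = (\<Sum>Q\<in>?Q. card (Pow Q))" using assms(1) fQ by (intro card_SigmaI) auto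
  also have "\<dots> = 2 ^ r * card ?Q" using fQ by (simp add: card_Pow)
  also have "card (SIGMA T:A. ksub (U - T) i) = (\<Sum>T\<in>A. card (ksub (U - T) i))"
    using fA assms(1) by (intro card_SigmaI) auto
  also have "\<dots> = (\<Sum>T\<in>A. (card U - t) choose i)"
    using assms(1) fT by (intro sum.cong) (auto simp: card_ksub card_Diff_subset)
  finally show ?thesis by simp
qed

text \<open>Each \<open>T\<close> has of the order of \<open>n ^ i\<close> supersets, and a
  \<open>(k - 1)\<close>-set has at most \<open>2 ^ (k - 1)\<close> subsets;
  \<open>(4 * k) ^ k\<close> generously absorbs \<open>2 ^ (k - 1) * (2 * k) ^ i\<close>.\<close>

lemma card_supersets_ge:
  assumes "finite V" "S \<subseteq> V" "card S = i" "i \<ge> 1" "i < k" "real (card V) \<ge> 2 * real k"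
    and "A \<subseteq> ksub (V - S) (k - 1 - i)"
  shows "real (card A) * real (card V) ^ i / (4 * real k) ^ k \<le> real (card {Q\<in>ksub (V - S) (k - 1). \<exists>T\<in>A. T \<subseteq> Q})"
proof -
  let ?n = "real (card V)" and ?Q = "{Q\<in>ksub (V - S) (k - 1). \<exists>T\<in>A. T \<subseteq> Q}"
  have fS: "finite S" by (rule finite_subset[OF assms(2,1)])
  have cU: "card (V - S) = card V - i" using assms fS by (simp add: card_Diff_subset)
  have nk: "card V \<ge> 2 * k" using assms(6) by linarith
  have eq: "card (V - S) - (k - 1 - i) = card V - (k - 1)" using cU assms(5) nk by linarith
  have le: "i \<le> card V - (k - 1)" using nk assms(5) by linarith
  have kp: "real k \<ge> 1" using assms(4,5) by simp
  have "(?n / (2 * real k)) ^ i \<le> (real (card V - (k - 1)) / real i) ^ i"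
  proof (rule power_mono)
    have "?n / 2 \<le> real (card V - (k - 1))" using nk by (simp add: of_nat_diff)
    then have "?n / 2 / real k \<le> real (card V - (k - 1)) / real i" using assms(4,5) by (intro frac_le) auto
    then show "?n / (2 * real k) \<le> real (card V - (k - 1)) / real i" by simp
  qed simp
  also have "\<dots> \<le> real ((card V - (k - 1)) choose i)"
    using binomial_ge_n_over_k_pow_k[OF le, where ?'a = real] by simp
  finally have b: "(?n / (2 * real k)) ^ i \<le> real ((card V - (k - 1)) choose i)" .
  have "card A * ((card (V - S) - (k - 1 - i)) choose i) \<le> 2 ^ (k - 1) * card ?Q"
    by (rule card_supersets) (use assms(1,5,7) in auto)
  then have "real (card A * ((card V - (k - 1)) choose i)) \<le> real (2 ^ (k - 1) * card ?Q)"
    unfolding eq by (simp only: of_nat_le_iff)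
  then have "real (card A) * (?n / (2 * real k)) ^ i \<le> 2 ^ (k - 1) * real (card ?Q)"
    using mult_left_mono[OF b, of "real (card A)"] by simp
  then have *: "real (card A) * ?n ^ i \<le> 2 ^ (k - 1) * (2 * real k) ^ i * real (card ?Q)"
    using kp by (simp add: power_divide divide_simps mult_ac)
  have "2 ^ (k - 1) * (2 * real k) ^ i \<le> 2 ^ k * (2 * real k) ^ k"
    using kp assms(5) by (intro mult_mono power_increasing) auto
  also have "\<dots> = (2 * (2 * real k)) ^ k" by (rule power_mult_distrib[symmetric])
  also have "\<dots> = (4 * real k) ^ k" by simp
  finally have "2 ^ (k - 1) * (2 * real k) ^ i * real (card ?Q) \<le> (4 * real k) ^ k * real (card ?Q)"
    by (intro mult_right_mono) auto
  then show ?thesis using * kp by (simp add: divide_simps mult_ac)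
qed

lemma card_Pow_ksub_le:
  assumes "finite U" "A \<subseteq> Pow (ksub U r)" "card U \<le> n"
  shows "real (card A) \<le> 2 powr (real n ^ r)"
proof -
  have "card A \<le> card (Pow (ksub U r))" using assms by (intro card_mono) auto
  then have "real (card A) \<le> real (card (Pow (ksub U r)))" by (simp only: of_nat_le_iff)
  also have "\<dots> = 2 powr real (card (ksub U r))" using assms(1) by (simp add: card_Pow powr_realpow)
  also have "\<dots> \<le> 2 powr (real n ^ r)"
  proof (rule powr_mono)
    have "real (card (ksub U r)) \<le> real (card U) ^ r" by (rule card_ksub_le[OF assms(1)])
    also have "\<dots> \<le> real n ^ r" using assms(3) by (intro power_mono) auto
    finally show "real (card (ksub U r)) \<le> real n ^ r" .
  qed simp
  finally show ?thesis .
qed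

lemma card_ksub_choose_le:
  assumes "finite V" shows "real (card (ksub (V - X) r)) \<le> real (card V choose r)"
proof -
  have "card (ksub (V - X) r) \<le> card (ksub V r)" using assms by (intro card_mono ksub_mono) auto
  then show ?thesis using card_ksub[OF assms, of r] by simp
qed

text \<open>If many \<open>T\<close> are atypical for \<open>S\<close>, the
  \<open>(k - 1)\<close>-sets above them form a family of positive density in which the links of
  \<open>S\<close> have a thin common intersection: its size is at most the sum of the numbers of
  extensions. The family of atypical sets consists of \<open>(k - 1 - i)\<close>-sets, so
  enumerating it costs at most \<open>n ^ (k - 2)\<close>.\<close>

lemma many_atypical_count:
  assumes "finite V" "cheap k V s e" "e > 0" "S \<subseteq> V" "card S = i" "1 \<le> i" "i + 2 \<le> k"
    and n: "real (card V) \<ge> real k ^ 2 / e" "real (card V) \<ge> 2 * real k"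
    and b: "b \<le> tuple_gain i / (4 * real k) ^ k"
    and G: "G = {F\<in>sparse_forms k V s. (\<forall>x\<in>S. real (card (nlink F x)) \<le> thin e * real (card V) ^ (k - 1)) \<and>
        \<xi> * real (card V) ^ (k - 1 - i) \<le> real (card (atypical k V b S F))}"
  shows "real (card G) \<le> real (card (minimal_forms k (V - S))) *
     2 powr (real i * real (card V choose (k - 1)) - tuple_gain i / (4 * real k) ^ k * \<xi> * real (card V) ^ (k - 1)
       + real (card V) ^ (k - 2) + 4 * real k ^ 2 * e * real (card V) ^ (k - 1))"
proof -
  let ?n = "real (card V)" and ?K = "ksub (V - S) (k - 1)" and ?g = "tuple_gain i"
  have fS: "finite S" by (rule finite_subset[OF assms(4,1)])
  define atypical_pairs where "atypical_pairs = {A. A \<subseteq> ksub (V - S) (k - 1 - i) \<and> \<xi> * ?n ^ (k - 1 - i) \<le> real (card A)}"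
  define Q where "Q A = {Q\<in>?K. \<exists>T\<in>A. T \<subseteq> Q}" for A
  define Y where "Y A = {Y. Y \<subseteq> S \<times> ?K \<and> real (card {q\<in>Q A. \<forall>x\<in>S. (x,q) \<in> Y}) \<le> tuple_gain (card S) * real (card (Q A))}" for A
  have finAt: "finite atypical_pairs" using assms(1) unfolding atypical_pairs_def
    by (rule_tac finite_subset[of _ "Pow (ksub (V - S) (k - 1 - i))"]) auto
  have finY: "finite (Y A)" for A using assms(1) fS unfolding Y_def
    by (rule_tac finite_subset[of _ "Pow (S \<times> ?K)"]) auto
  have k1: "k - 1 - i + i = k - 1" using assms(7) by simp
  have Qge: "real (card A) * ?n ^ i / (4 * real k) ^ k \<le> real (card (Q A))" if "A \<in> atypical_pairs" for A
    unfolding Q_def by (rule card_supersets_ge) (use that assms(1,4-7) n in \<open>auto simp: atypical_pairs_def\<close>)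
  have LcY: "plinks_at S F \<in> (\<Union>A\<in>atypical_pairs. Y A)" if F: "F \<in> G" for F
  proof -
    have sub: "F \<subseteq> pairs k V" using F by (auto simp: G sparse_forms_def)
    define A where "A = atypical k V b S F"
    have A: "A \<in> atypical_pairs" using F by (auto simp: A_def G atypical_pairs_def atypical_def assms(5))
    have fA: "finite A" by (rule_tac finite_subset[of _ "ksub (V - S) (k - 1 - i)"]) (use A assms(1) in \<open>auto simp: atypical_pairs_def\<close>)
    have fext: "finite (extensions V F S T)" for T using assms(1) by (simp add: extensions_def)
    have "{q\<in>Q A. \<forall>x\<in>S. (x,q) \<in> plinks_at S F} \<subseteq> (\<Union>T\<in>A. (\<lambda>R. R \<union> T) ` extensions V F S T)"
    proof
      fix q assume q: "q \<in> {q\<in>Q A. \<forall>x\<in>S. (x,q) \<in> plinks_at S F}"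
      then obtain T where T: "T \<in> A" "T \<subseteq> q" and qK: "q \<subseteq> V - S" "card q = k - 1" by (auto simp: Q_def ksub_def)
      have Tk: "card T = k - 1 - i" using T by (auto simp: A_def atypical_def ksub_def assms(5))
      have fq: "finite q" using qK(1) assms(1) by (auto intro: finite_subset)
      have fT: "finite T" by (rule finite_subset[OF T(2) fq])
      have "q - T \<in> ksub (V - S - T) i" using qK T Tk fT assms(7) by (auto simp: ksub_def card_Diff_subset)
      moreover have "(q - T) \<union> T = q" using T by auto
      moreover have "\<forall>x\<in>S. q \<in> plink F x" using q by (auto simp: plinks_at_def)
      ultimately have "q - T \<in> extensions V F S T" by (auto simp: extensions_def assms(5))
      then show "q \<in> (\<Union>T\<in>A. (\<lambda>R. R \<union> T) ` extensions V F S T)" using T(1) \<open>(q - T) \<union> T = q\<close> by blast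
    qed
    then have "card {q\<in>Q A. \<forall>x\<in>S. (x,q) \<in> plinks_at S F} \<le> card (\<Union>T\<in>A. (\<lambda>R. R \<union> T) ` extensions V F S T)"
      using fA fext by (intro card_mono) auto
    also have "\<dots> \<le> (\<Sum>T\<in>A. card ((\<lambda>R. R \<union> T) ` extensions V F S T))" by (rule card_UN_le[OF fA])
    also have "\<dots> \<le> (\<Sum>T\<in>A. card (extensions V F S T))" using fext by (intro sum_mono card_image_le)
    finally have "real (card {q\<in>Q A. \<forall>x\<in>S. (x,q) \<in> plinks_at S F}) \<le> (\<Sum>T\<in>A. real (card (extensions V F S T)))"
      by (simp only: of_nat_sum[symmetric] of_nat_le_iff)
    also have "\<dots> \<le> (\<Sum>T\<in>A. b * ?n ^ i)" by (intro sum_mono) (auto simp: A_def atypical_def assms(5))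
    also have "\<dots> = real (card A) * (b * ?n ^ i)" by simp
    also have "\<dots> \<le> real (card A) * (?g / (4 * real k) ^ k * ?n ^ i)" using b by (intro mult_left_mono mult_right_mono) auto
    also have "\<dots> = ?g * (real (card A) * ?n ^ i / (4 * real k) ^ k)" by simp
    also have "\<dots> \<le> ?g * real (card (Q A))" using Qge[OF A] tuple_gain_pos[of i] by (intro mult_left_mono) auto
    finally have "plinks_at S F \<in> Y A" using plinks_at_sub[OF assms(1) sub] by (auto simp: Y_def assms(5))
    then show ?thesis using A by blast
  qed
  let ?M = "2 powr (?n ^ (k - 2)) * 2 powr (real i * real (card V choose (k - 1)) - ?g / (4 * real k) ^ k * \<xi> * ?n ^ (k - 1))"
  have "real (card G) \<le> real (card (minimal_forms k (V - S))) * ?M * 2 powr (4 * real k ^ 2 * e * ?n ^ (k - 1))"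
  proof (rule deletion_thin[OF assms(1) _ assms(2,3,4)])
    fix F0
    have "plinks_at S ` {F\<in>G. core S F = F0} \<subseteq> (\<Union>A\<in>atypical_pairs. Y A)" using LcY by blast
    then have "card (plinks_at S ` {F\<in>G. core S F = F0}) \<le> card (\<Union>A\<in>atypical_pairs. Y A)" using finAt finY by (intro card_mono) auto
    also have "\<dots> \<le> (\<Sum>A\<in>atypical_pairs. card (Y A))" by (rule card_UN_le[OF finAt])
    finally have "real (card (plinks_at S ` {F\<in>G. core S F = F0})) \<le> (\<Sum>A\<in>atypical_pairs. real (card (Y A)))"
      by (simp only: of_nat_sum[symmetric] of_nat_le_iff)
    also have "\<dots> \<le> (\<Sum>A\<in>atypical_pairs. 2 powr (real i * real (card V choose (k - 1)) - ?g / (4 * real k) ^ k * \<xi> * ?n ^ (k - 1)))"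
    proof (rule sum_mono)
      fix A assume A: "A \<in> atypical_pairs"
      have "real (card (Y A)) \<le> 2 powr (real (card S) * real (card ?K) - tuple_gain (card S) * real (card (Q A)))"
        unfolding Y_def using fS assms(1) by (intro card_thin_intersections) (auto simp: Q_def)
      also have "\<dots> \<le> 2 powr (real i * real (card V choose (k - 1)) - ?g / (4 * real k) ^ k * \<xi> * ?n ^ (k - 1))"
      proof (intro powr_mono diff_mono)
        show "real (card S) * real (card ?K) \<le> real i * real (card V choose (k - 1))"
          using card_ksub_choose_le[OF assms(1)] assms(5) by (intro mult_mono) auto
        have "?n ^ (k - 1) = ?n ^ (k - 1 - i) * ?n ^ i" using k1 by (simp add: power_add[symmetric])
        then have "?g / (4 * real k) ^ k * \<xi> * ?n ^ (k - 1) = ?g * ((\<xi> * ?n ^ (k - 1 - i)) * ?n ^ i / (4 * real k) ^ k)" by simp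
        also have "\<dots> \<le> ?g * (real (card A) * ?n ^ i / (4 * real k) ^ k)"
          using A tuple_gain_pos[of i] by (intro mult_left_mono divide_right_mono mult_right_mono) (auto simp: atypical_pairs_def)
        also have "\<dots> \<le> ?g * real (card (Q A))" using Qge[OF A] tuple_gain_pos[of i] by (intro mult_left_mono) auto
        finally show "?g / (4 * real k) ^ k * \<xi> * ?n ^ (k - 1) \<le> tuple_gain (card S) * real (card (Q A))" by (simp add: assms(5))
      qed simp
      finally show "real (card (Y A)) \<le> 2 powr (real i * real (card V choose (k - 1)) - ?g / (4 * real k) ^ k * \<xi> * ?n ^ (k - 1))" .
    qed
    also have "\<dots> = real (card atypical_pairs) * 2 powr (real i * real (card V choose (k - 1)) - ?g / (4 * real k) ^ k * \<xi> * ?n ^ (k - 1))" by simp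
    also have "\<dots> \<le> ?M"
    proof (rule mult_right_mono)
      have "real (card atypical_pairs) \<le> 2 powr (real (card V) ^ (k - 1 - i))"
        using assms(1) by (intro card_Pow_ksub_le[of "V - S"]) (auto simp: atypical_pairs_def intro: card_mono)
      also have "\<dots> \<le> 2 powr (?n ^ (k - 2))"
      proof (rule powr_mono)
        have "?n \<ge> 1" using n(2) assms(7) by linarith
        then show "?n ^ (k - 1 - i) \<le> ?n ^ (k - 2)" using assms(6) by (intro power_increasing) auto
      qed simp
      finally show "real (card atypical_pairs) \<le> 2 powr (?n ^ (k - 2))" .
    qed simp
    finally show "real (card (plinks_at S ` {F\<in>G. core S F = F0})) \<le> ?M" .
  qed (use assms(5-7) n in \<open>auto simp: G\<close>)
  also have "\<dots> = real (card (minimal_forms k (V - S))) * (?M * 2 powr (4 * real k ^ 2 * e * ?n ^ (k - 1)))" by (rule mult.assoc)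
  also have "?M * 2 powr (4 * real k ^ 2 * e * ?n ^ (k - 1)) =
    2 powr (real i * real (card V choose (k - 1)) - ?g / (4 * real k) ^ k * \<xi> * ?n ^ (k - 1)
       + ?n ^ (k - 2) + 4 * real k ^ 2 * e * ?n ^ (k - 1))"
    by (simp only: powr_add[symmetric]) (simp only: algebra_simps)
  finally show ?thesis .
qed

lemma plink_core: "x \<notin> X \<Longrightarrow> plink (core X F) x = {Q\<in>plink F x. Q \<inter> X = {}}"
  by (auto simp: plink_def core_def)

text \<open>At most \<open>card S * n ^ (k - 2)\<close> members of the link meet \<open>S\<close>,
  which for \<open>n \<ge> 2 * k / d\<close> is at most half of the required size.\<close>

lemma plink_away:
  assumes "finite V" "F \<subseteq> pairs k V" "S \<subseteq> V" "card S \<le> k" "k \<ge> 2" "d > 0" "real (card V) \<ge> 2 * real k / d"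
    and "d * real (card V) ^ (k - 1) \<le> real (card (plink F x))"
  shows "d / 2 * real (card V) ^ (k - 1) \<le> real (card {Q\<in>plink F x. Q \<in> ksub (V - S) (k - 1)})"
proof -
  let ?n = "real (card V)" and ?A = "{Q\<in>plink F x. Q \<in> ksub (V - S) (k - 1)}"
  have k1: "k - 1 = Suc (k - 2)" using assms(5) by simp
  let ?B = "{Q\<in>ksub V (Suc (k - 2)). Q \<inter> S \<noteq> {}}"
  have lV: "plink F x \<subseteq> ksub V (k - 1)" using plink_sub[OF assms(1,2), of x] ksub_mono[of "V - {x}" V] by auto
  have "plink F x \<subseteq> ?A \<union> ?B" using lV k1 by (auto simp: ksub_def)
  then have "card (plink F x) \<le> card ?A + card ?B"
    using assms(1) by (intro order_trans[OF card_mono card_Un_le]) auto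
  then have "real (card (plink F x)) \<le> real (card ?A) + real (card ?B)" by linarith
  moreover have "real (card ?B) \<le> d / 2 * ?n ^ (k - 1)"
  proof -
    have "real (card ?B) \<le> real (card S) * ?n ^ (k - 2)" by (rule card_meeting[OF assms(1,3)])
    also have "\<dots> \<le> (d / 2 * ?n) * ?n ^ (k - 2)"
    proof (rule mult_right_mono)
      have "real k \<le> d / 2 * ?n" using assms(6,7) by (simp add: field_simps)
      then show "real (card S) \<le> d / 2 * ?n" using assms(4) by linarith
    qed simp
    finally show ?thesis unfolding k1 by simp
  qed
  ultimately show ?thesis using assms(8) by linarith
qed

text \<open>The reference family \<open>Q\<close> is a function of the core, so it is known when the
  links of \<open>X\<close> are counted and needs no encoding. A thin common intersection inside it
  then confines the tuple of links.\<close>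

lemma thin_intersection_deletion:
  assumes "finite V" "G \<subseteq> sparse_forms k V s" "cheap k V s e" "e > 0" "X \<subseteq> V" "card X \<le> k" "k \<ge> 2"
    and n: "real (card V) \<ge> real k ^ 2 / e"
    and thinN: "\<And>F x. F \<in> G \<Longrightarrow> x \<in> X \<Longrightarrow> real (card (nlink F x)) \<le> thin e * real (card V) ^ (k - 1)"
    and Q: "\<And>F. F \<in> G \<Longrightarrow> Q (core X F) \<subseteq> ksub (V - X) (k - 1)"
    and q: "\<And>F. F \<in> G \<Longrightarrow> q \<le> real (card (Q (core X F)))"
    and thin: "\<And>F. F \<in> G \<Longrightarrow> real (card {R\<in>Q (core X F). \<forall>x\<in>X. R \<in> plink F x}) \<le> tuple_gain (card X) * q"
  shows "real (card G) \<le> real (card (minimal_forms k (V - X))) *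
    2 powr (real (card X) * real (card V choose (k - 1)) - tuple_gain (card X) * q + 4 * real k ^ 2 * e * real (card V) ^ (k - 1))"
proof -
  let ?n = "real (card V)" and ?K = "ksub (V - X) (k - 1)" and ?g = "tuple_gain (card X)"
  have fX: "finite X" by (rule finite_subset[OF assms(5,1)])
  let ?M = "2 powr (real (card X) * real (card V choose (k - 1)) - ?g * q)"
  have "real (card G) \<le> real (card (minimal_forms k (V - X))) * ?M * 2 powr (4 * real k ^ 2 * e * ?n ^ (k - 1))"
  proof (rule deletion_thin[OF assms(1-8)])
    fix F0
    let ?H = "{F\<in>G. core X F = F0}"
    show "real (card (plinks_at X ` ?H)) \<le> ?M"
    proof (cases "?H = {}")
      case False
      \<comment> \<open>Any member of the fibre certifies the size of \<open>Q F0\<close>, which is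
        common to the whole fibre.\<close>
      then obtain F1 where F1: "F1 \<in> G" "core X F1 = F0" by blast
      let ?Y = "{Y. Y \<subseteq> X \<times> ?K \<and> real (card {R\<in>Q F0. \<forall>x\<in>X. (x,R) \<in> Y}) \<le> ?g * real (card (Q F0))}"
      have finY: "finite ?Y" using fX assms(1) by (rule_tac finite_subset[of _ "Pow (X \<times> ?K)"]) auto
      have "plinks_at X ` ?H \<subseteq> ?Y"
      proof (rule image_subsetI)
        fix F assume "F \<in> ?H"
        then have F: "F \<in> G" "core X F = F0" by auto
        have sub: "F \<subseteq> pairs k V" by (rule sparse_forms_sub[OF subsetD[OF assms(2) F(1)]])
        have "R \<inter> X = {}" if "R \<in> Q F0" for R using Q[OF F(1)] that F(2) by (auto simp: ksub_def)
        then have "{R\<in>Q F0. \<forall>x\<in>X. (x,R) \<in> plinks_at X F} = {R\<in>Q (core X F). \<forall>x\<in>X. R \<in> plink F x}"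
          using F(2) by (auto simp: plinks_at_def)
        then have "real (card {R\<in>Q F0. \<forall>x\<in>X. (x,R) \<in> plinks_at X F}) \<le> ?g * q" using thin[OF F(1)] by simp
        also have "\<dots> \<le> ?g * real (card (Q F0))"
          using q[OF F1(1)] F1(2) tuple_gain_pos[of "card X"] by (intro mult_left_mono) auto
        finally show "plinks_at X F \<in> ?Y" using plinks_at_sub[OF assms(1) sub] by auto
      qed
      then have "card (plinks_at X ` ?H) \<le> card ?Y" using finY by (intro card_mono)
      then have "real (card (plinks_at X ` ?H)) \<le> real (card ?Y)" by (simp only: of_nat_le_iff)
      also have "\<dots> \<le> 2 powr (real (card X) * real (card ?K) - ?g * real (card (Q F0)))"
        using fX assms(1) Q[OF F1(1)] F1(2) by (intro card_thin_intersections) auto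
      also have "\<dots> \<le> ?M"
      proof (intro powr_mono diff_mono mult_left_mono)
        show "q \<le> real (card (Q F0))" using q[OF F1(1)] F1(2) by simp
        show "0 \<le> ?g" using tuple_gain_pos[of "card X"] by simp
      qed (use card_ksub_choose_le[OF assms(1)] in auto)
      finally show ?thesis .
    next
      case True
      show ?thesis unfolding True by simp
    qed
  qed (use thinN in auto)
  also have "\<dots> = real (card (minimal_forms k (V - X))) * (?M * 2 powr (4 * real k ^ 2 * e * ?n ^ (k - 1)))" by (rule mult.assoc)
  finally show ?thesis by (simp only: powr_add[symmetric])
qed

text \<open>Here \<open>T\<close> is empty and the common intersection of all \<open>k - 1\<close>
  links of \<open>S\<close> is thin. One variable \<open>x1\<close> is kept: the part of its dense
  link that avoids \<open>S\<close> survives in the core and is the reference family for the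
  remaining \<open>k - 2\<close> links.\<close>

lemma atypical_full_count:
  assumes "finite V" "cheap k V s e" "e > 0" "S \<subseteq> V" "card S = k - 1" "k \<ge> 3" "x1 \<in> S" "d > 0"
    and n: "real (card V) \<ge> real k ^ 2 / e" "real (card V) \<ge> 2 * real k / d"
    and b: "b \<le> tuple_gain (k - 2) * (d / 2)"
    and G: "G = {F\<in>sparse_forms k V s. (\<forall>x\<in>S. real (card (nlink F x)) \<le> thin e * real (card V) ^ (k - 1)) \<and>
        d * real (card V) ^ (k - 1) \<le> real (card (plink F x1)) \<and> real (card (extensions V F S {})) < b * real (card V) ^ (k - 1)}"
  shows "real (card G) \<le> real (card (minimal_forms k (V - (S - {x1})))) *
     2 powr (real (k - 2) * real (card V choose (k - 1)) - tuple_gain (k - 2) * (d / 2) * real (card V) ^ (k - 1)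
       + 4 * real k ^ 2 * e * real (card V) ^ (k - 1))"
proof -
  let ?n = "real (card V)" and ?X = "S - {x1}"
  define Q where "Q F0 = {Q\<in>plink F0 x1. Q \<in> ksub (V - S) (k - 1)}" for F0
  have fS: "finite S" by (rule finite_subset[OF assms(4,1)])
  have cX: "card ?X = k - 2" using assms fS by simp
  have Qc: "Q (core ?X F) = {Q\<in>plink F x1. Q \<in> ksub (V - S) (k - 1)}" for F
    unfolding Q_def by (subst plink_core) (auto simp: ksub_def)
  have "real (card G) \<le> real (card (minimal_forms k (V - ?X))) *
    2 powr (real (card ?X) * real (card V choose (k - 1)) - tuple_gain (card ?X) * (d / 2 * ?n ^ (k - 1)) + 4 * real k ^ 2 * e * ?n ^ (k - 1))"
  proof (rule thin_intersection_deletion[OF assms(1) _ assms(2,3), where Q = Q])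
    fix F assume F: "F \<in> G"
    then have sub: "F \<subseteq> pairs k V" by (auto simp: G sparse_forms_def)
    show "Q (core ?X F) \<subseteq> ksub (V - ?X) (k - 1)" unfolding Qc by (auto simp: ksub_def)
    show "d / 2 * ?n ^ (k - 1) \<le> real (card (Q (core ?X F)))"
    proof -
      have "d * ?n ^ (k - 1) \<le> real (card (plink F x1))" using F by (simp add: G)
      then show ?thesis unfolding Qc using assms(5,6,8) n(2) by (intro plink_away[OF assms(1) sub assms(4)]) auto
    qed
    have "{R\<in>Q (core ?X F). \<forall>x\<in>?X. R \<in> plink F x} \<subseteq> extensions V F S {}"
      unfolding Qc extensions_def by (auto simp: assms(5))
    then have "card {R\<in>Q (core ?X F). \<forall>x\<in>?X. R \<in> plink F x} \<le> card (extensions V F S {})"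
      using assms(1) by (intro card_mono) (auto simp: extensions_def)
    then have "real (card {R\<in>Q (core ?X F). \<forall>x\<in>?X. R \<in> plink F x}) \<le> real (card (extensions V F S {}))" by (simp only: of_nat_le_iff)
    also have "\<dots> \<le> b * ?n ^ (k - 1)" using F by (auto simp: G)
    also have "\<dots> \<le> tuple_gain (k - 2) * (d / 2) * ?n ^ (k - 1)" using b by (intro mult_right_mono) auto
    finally show "real (card {R\<in>Q (core ?X F). \<forall>x\<in>?X. R \<in> plink F x}) \<le> tuple_gain (card ?X) * (d / 2 * ?n ^ (k - 1))"
      by (simp add: cX)
  qed (use assms(4-8) n cX in \<open>auto simp: G\<close>)
  then show ?thesis by (simp add: cX mult.assoc)
qed

text \<open>Keep \<open>x1\<close> and \<open>x2\<close>: their many common \<open>k\<close>-sets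
  survive in the core. Let \<open>Q\<close> consist of the \<open>(k - 1)\<close>-sets
  \<open>R\<close> with more than \<open>c * n\<close> common sets \<open>insert v R\<close>. If
  such an \<open>R\<close> lies in the links of all other variables of \<open>S\<close>, these sets
  are ruled out by the clause \<open>(S, {})\<close>; as few sets are ruled out, there are few such
  \<open>R\<close>, and the other \<open>k - 2\<close> links have a thin intersection in
  \<open>Q\<close>.\<close>

lemma negative_clause_pair_count:
  assumes "finite V" "cheap k V s e" "e > 0" "S \<subseteq> V" "card S = k" "k \<ge> 3" "x1 \<in> S" "x2 \<in> S" "x1 \<noteq> x2" "c > 0"
    and n: "real (card V) \<ge> real k ^ 2 / e" "real (card V) \<ge> 1"
    and \<gamma>: "\<gamma> \<le> tuple_gain (k - 2) * c\<^sup>2 / real k"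
    and G: "G = {F\<in>sparse_forms k V s. (\<forall>x\<in>S. real (card (nlink F x)) \<le> thin e * real (card V) ^ (k - 1)) \<and> (S,{}) \<in> F \<and>
        c * real (card V) ^ k \<le> real (card (common (V - S) (k - 1) (plink F x1) (plink F x2))) \<and>
        real (card (kill k V S F)) \<le> \<gamma> * real (card V) ^ k}"
  shows "real (card G) \<le> real (card (minimal_forms k (V - (S - {x1,x2})))) *
     2 powr (real (k - 2) * real (card V choose (k - 1)) - tuple_gain (k - 2) * c * real (card V) ^ (k - 1)
       + 4 * real k ^ 2 * e * real (card V) ^ (k - 1))"
proof -
  let ?n = "real (card V)" and ?X = "S - {x1,x2}" and ?U = "V - S"
  have k1: "k = Suc (k - 1)" using assms(6) by simp
  have fS: "finite S" by (rule finite_subset[OF assms(4,1)])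
  have fU: "finite ?U" using assms(1) by simp
  have cX: "card ?X = k - 2" using assms fS by (simp add: card_Diff_subset)
  have nU: "real (card ?U) \<le> ?n" using assms(1) by (simp add: card_mono)
  define E where "E F0 = common ?U (k - 1) (plink F0 x1) (plink F0 x2)" for F0
  define Q where "Q F0 = {Q\<in>ksub ?U (k - 1). real (deg ?U (E F0) Q) > c * ?n}" for F0
  \<comment> \<open>The common sets of the two kept variables avoid \<open>S\<close>, so no deleted
    variable occurs in the positive clauses that decide them.\<close>
  have Ec: "E (core ?X F) = E F" for F
  proof -
    have "Q \<in> plink (core ?X F) y \<longleftrightarrow> Q \<in> plink F y" if "Q \<subseteq> C" "C \<in> ksub ?U (Suc (k - 1))" "y \<in> {x1,x2}" for Q C y
      using that by (subst plink_core) (auto simp: ksub_def)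
    then show ?thesis unfolding E_def common_def by (intro Collect_cong) blast
  qed
  have Esub: "E F \<subseteq> ksub ?U (Suc (k - 1))" for F by (auto simp: E_def common_def)
  have "real (card G) \<le> real (card (minimal_forms k (V - ?X))) *
    2 powr (real (card ?X) * real (card V choose (k - 1)) - tuple_gain (card ?X) * (c * ?n ^ (k - 1)) + 4 * real k ^ 2 * e * ?n ^ (k - 1))"
  proof (rule thin_intersection_deletion[OF assms(1) _ assms(2,3), where Q = Q])
    fix F assume F: "F \<in> G"
    then have sub: "F \<subseteq> pairs k V" by (auto simp: G sparse_forms_def)
    have QE: "Q (core ?X F) = {Q\<in>ksub ?U (k - 1). real (deg ?U (E F) Q) > c * ?n}"
      unfolding Q_def Ec ..
    then show "Q (core ?X F) \<subseteq> ksub (V - ?X) (k - 1)" by (auto simp: ksub_def)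
    show "c * ?n ^ (k - 1) \<le> real (card (Q (core ?X F)))"
    proof -
      let ?q = "Q (core ?X F)"
      have "real (Suc (k - 1)) * real (card (E F)) = (\<Sum>Y\<in>ksub ?U (k - 1). real (deg ?U (E F) Y))"
        using sum_deg[OF fU Esub] by (simp only: of_nat_mult[symmetric] of_nat_sum[symmetric])
      also have "\<dots> = (\<Sum>Y\<in>?q. real (deg ?U (E F) Y)) + (\<Sum>Y\<in>ksub ?U (k - 1) - ?q. real (deg ?U (E F) Y))"
        using fU by (subst sum.subset_diff[of ?q]) (auto simp: QE)
      also have "(\<Sum>Y\<in>?q. real (deg ?U (E F) Y)) \<le> (\<Sum>Y\<in>?q. ?n)"
      proof (rule sum_mono)
        fix Y show "real (deg ?U (E F) Y) \<le> ?n" using deg_le[OF fU, of "E F" Y] nU by linarith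
      qed
      also have "(\<Sum>Y\<in>ksub ?U (k - 1) - ?q. real (deg ?U (E F) Y)) \<le> (\<Sum>Y\<in>ksub ?U (k - 1) - ?q. c * ?n)"
        by (intro sum_mono) (auto simp: QE)
      also have "(\<Sum>Y\<in>ksub ?U (k - 1) - ?q. c * ?n) = real (card (ksub ?U (k - 1) - ?q)) * (c * ?n)" by simp
      also have "\<dots> \<le> ?n ^ (k - 1) * (c * ?n)"
      proof (rule mult_right_mono)
        have "ksub ?U (k - 1) - ?q \<subseteq> ksub V (k - 1)" using ksub_mono[of ?U V] by auto
        then show "real (card (ksub ?U (k - 1) - ?q)) \<le> ?n ^ (k - 1)" by (rule card_ksub_subset_le[OF assms(1)])
      qed (use assms(10) in auto)
      finally have "real k * real (card (E F)) \<le> (real (card ?q) + c * ?n ^ (k - 1)) * ?n"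
        using k1 by (simp add: algebra_simps)
      \<comment> \<open>Since \<open>k \<ge> 2\<close>, the degree sum is at least twice
        \<open>c * n ^ k\<close>, while the sets outside \<open>Q\<close> contribute at most
        \<open>c * n ^ k\<close>.\<close>
      moreover have "2 * (c * ?n ^ k) \<le> real k * real (card (E F))"
        using F assms(6,10) by (intro mult_mono) (auto simp: G E_def)
      moreover have "?n ^ k = ?n ^ (k - 1) * ?n" by (subst k1) simp
      ultimately have "(2 * c * ?n ^ (k - 1)) * ?n \<le> (real (card ?q) + c * ?n ^ (k - 1)) * ?n" by simp
      then have "2 * c * ?n ^ (k - 1) \<le> real (card ?q) + c * ?n ^ (k - 1)" using n(2) by (simp only: mult_le_cancel_right)
      then show ?thesis by simp
    qed
    let ?f = "{R\<in>Q (core ?X F). \<forall>x\<in>?X. R \<in> plink F x}"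
    have "?f \<subseteq> {Y\<in>ksub ?U (k - 1). real (deg ?U (kill k V S F) Y) > c * ?n}"
    proof
      fix R assume R: "R \<in> ?f"
      then have Rk: "R \<in> ksub ?U (k - 1)" and dR: "real (deg ?U (E F) R) > c * ?n" unfolding QE by auto
      have "{v\<in>?U - R. insert v R \<in> E F} \<subseteq> {v\<in>?U - R. insert v R \<in> kill k V S F}"
      proof
        fix v assume "v \<in> {v\<in>?U - R. insert v R \<in> E F}"
        then have v: "v \<in> V" "v \<notin> S" "v \<notin> R" "insert v R \<in> E F" by auto
        have "insert v R \<in> ksub ?U k" using v(4) Esub[of F] k1 by auto
        moreover have "\<exists>Q\<in>plink F x. Q \<subseteq> insert v R" if "x \<in> S" for x
        proof (cases "x = x1 \<or> x = x2")
          case True then show ?thesis using v(4) by (auto simp: E_def common_def)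
        next
          case False
          then have "R \<in> plink F x" using R that by auto
          then show ?thesis by blast
        qed
        ultimately have "insert v R \<in> kill k V S F" using F by (auto simp: kill_def G)
        then show "v \<in> {v\<in>?U - R. insert v R \<in> kill k V S F}" using v by simp
      qed
      then have "deg ?U (E F) R \<le> deg ?U (kill k V S F) R" unfolding deg_def using assms(1) by (intro card_mono) auto
      then show "R \<in> {Y\<in>ksub ?U (k - 1). real (deg ?U (kill k V S F) Y) > c * ?n}" using Rk dR by auto
    qed
    then have "card ?f \<le> card {Y\<in>ksub ?U (k - 1). real (deg ?U (kill k V S F) Y) > c * ?n}" using fU by (intro card_mono) auto
    then have "real (card ?f) * (c * ?n) \<le> real (card {Y\<in>ksub ?U (k - 1). real (deg ?U (kill k V S F) Y) > c * ?n}) * (c * ?n)"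
      using assms(10) by (intro mult_right_mono) auto
    also have "\<dots> \<le> real (Suc (k - 1)) * real (card (kill k V S F))"
      by (rule card_high_deg[OF fU]) (use k1 in \<open>auto simp: kill_def\<close>)
    also have "\<dots> \<le> real k * (\<gamma> * ?n ^ k)" using F k1 by (intro mult_mono) (auto simp: G)
    also have "\<dots> \<le> real k * (tuple_gain (k - 2) * c\<^sup>2 / real k * ?n ^ k)"
      using \<gamma> by (intro mult_left_mono mult_right_mono) auto
    also have "\<dots> = (tuple_gain (k - 2) * c * ?n ^ (k - 1)) * (c * ?n)"
    proof -
      have "?n ^ k = ?n ^ (k - 1) * ?n" by (subst k1) simp
      then show ?thesis using assms(6) by (simp add: power2_eq_square)
    qed
    finally have "real (card ?f) \<le> tuple_gain (k - 2) * c * ?n ^ (k - 1)"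
      using n(2) assms(10) by (simp only: mult_le_cancel_right) auto
    then show "real (card ?f) \<le> tuple_gain (card ?X) * (c * ?n ^ (k - 1))" by (simp add: cX)
  qed (use assms(4-10) n cX in \<open>auto simp: G\<close>)
  then show ?thesis by (simp add: cX mult.assoc)
qed

text \<open>Now all \<open>k\<close> variables are deleted. Their links, restricted to sets avoiding
  \<open>S\<close>, pairwise form dense pairs, and the bound for pairwise related tuples replaces
  \<open>k\<close> links by \<open>k / 2\<close> pairs.\<close>

lemma negative_clause_all_pairs_count:
  assumes "d > 0" "k \<ge> 3"
  shows "\<exists>c1>0. \<exists>c>0. \<forall>\<^sub>F n in sequentially. \<forall>V s e S. finite V \<longrightarrow> card V = n \<longrightarrow> cheap k V s e \<longrightarrow> e > 0 \<longrightarrow>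
     real n \<ge> real k ^ 2 / e \<longrightarrow> S \<subseteq> V \<longrightarrow> card S = k \<longrightarrow>
     real (card {F\<in>sparse_forms k V s. (\<forall>x\<in>S. real (card (nlink F x)) \<le> thin e * real n ^ (k - 1) \<and> d * real n ^ (k - 1) \<le> real (card (plink F x))) \<and>
        (\<forall>x\<in>S. \<forall>y\<in>S. x \<noteq> y \<longrightarrow> real (card (common (V - S) (k - 1) (plink F x) (plink F y))) \<le> c1 * real n ^ k)})
     \<le> real (card (minimal_forms k (V - S))) *
        (2 * 2 powr (real k / 2 * (real (n choose (k - 1)) - c * real n ^ (k - 1)) + 4 * real k ^ 2 * e * real n ^ (k - 1)))"
proof -
  have k1: "k - 1 \<ge> 1" and k: "k = Suc (k - 1)" using assms(2) by auto
  have d2: "d / 2 > 0" using assms(1) by simp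
  obtain g c where g: "g > 0" and c: "c > 0" and ev: "\<forall>\<^sub>F n in sequentially. \<forall>V::nat set. finite V \<longrightarrow> card V = n \<longrightarrow>
     real (card (dense_pairs V (k - 1) (d/2) g)) \<le> 2 powr (real (n choose (k - 1)) - c * real n ^ (k - 1))"
    using dense_pairs_count[OF d2 k1] by blast
  have ev': "\<forall>\<^sub>F n in sequentially. \<forall>V::nat set. finite V \<longrightarrow> card V = n - k \<longrightarrow>
     real (card (dense_pairs V (k - 1) (d/2) g)) \<le> 2 powr (real ((n - k) choose (k - 1)) - c * real (n - k) ^ (k - 1))"
    using eventually_compose_filterlim[OF ev, of "\<lambda>n. n - k" sequentially] filterlim_minus_const_nat_at_top by blast
  have "\<forall>\<^sub>F n in sequentially. \<forall>V s e S. finite V \<longrightarrow> card V = n \<longrightarrow> cheap k V s e \<longrightarrow> e > 0 \<longrightarrow>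
     real n \<ge> real k ^ 2 / e \<longrightarrow> S \<subseteq> V \<longrightarrow> card S = k \<longrightarrow>
     real (card {F\<in>sparse_forms k V s. (\<forall>x\<in>S. real (card (nlink F x)) \<le> thin e * real n ^ (k - 1) \<and> d * real n ^ (k - 1) \<le> real (card (plink F x))) \<and>
        (\<forall>x\<in>S. \<forall>y\<in>S. x \<noteq> y \<longrightarrow> real (card (common (V - S) (k - 1) (plink F x) (plink F y))) \<le> g / 2 ^ k * real n ^ k)})
     \<le> real (card (minimal_forms k (V - S))) *
        (2 * 2 powr (real k / 2 * (real (n choose (k - 1)) - c / 2 ^ (k - 1) * real n ^ (k - 1)) + 4 * real k ^ 2 * e * real n ^ (k - 1)))"
    using ev' eventually_real_ge[of "2 * real k"] eventually_real_ge[of "2 * real k / d"]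
  proof eventually_elim
    case (elim n)
    show ?case
    proof (intro allI impI)
      fix V s e S
      assume V: "finite V" "card V = n" and ch: "cheap k V s e" "e > 0" "real n \<ge> real k ^ 2 / e" and S: "S \<subseteq> V" "card S = k"
      define G where "G = {F\<in>sparse_forms k V s. (\<forall>x\<in>S. real (card (nlink F x)) \<le> thin e * real n ^ (k - 1) \<and> d * real n ^ (k - 1) \<le> real (card (plink F x))) \<and>
        (\<forall>x\<in>S. \<forall>y\<in>S. x \<noteq> y \<longrightarrow> real (card (common (V - S) (k - 1) (plink F x) (plink F y))) \<le> g / 2 ^ k * real n ^ k)}"
      let ?V = "V - S" and ?m = "real (n - k)"
      let ?D = "Pow (ksub ?V (k - 1))" and ?R = "dense_pairs ?V (k - 1) (d/2) g"
      have fS: "finite S" by (rule finite_subset[OF S(1) V(1)])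
      have V': "finite ?V" "card ?V = n - k" using V S fS by (auto simp: card_Diff_subset)
      have m: "?m \<le> real n" "?m \<ge> real n / 2" using elim(2) by auto
      have mk: "?m ^ j \<le> real n ^ j" "real n ^ j / 2 ^ j \<le> ?m ^ j" for j
        using m power_mono[of ?m "real n" j] power_mono[of "real n / 2" ?m j] by (auto simp: power_divide)
      have finR: "finite ?R" by (rule finite_dense_pairs[OF V'(1)])
      have RD: "?R \<subseteq> ?D \<times> ?D" unfolding dense_pairs_def by blast
      define Fn where "Fn = {f\<in>S \<rightarrow>\<^sub>E ?D. \<forall>x\<in>S. \<forall>y\<in>S. x \<noteq> y \<longrightarrow> (f x, f y) \<in> ?R}"
      define L where "L F x = {Q\<in>plink F x. Q \<in> ksub ?V (k - 1)}" for F x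
      have Lfun: "restrict (L F) S \<in> Fn" if F: "F \<in> G" for F
      proof -
        have sub: "F \<subseteq> pairs k V" using F by (auto simp: G_def sparse_forms_def)
        have Ld: "d / 2 * ?m ^ (k - 1) \<le> real (card (L F x))" if x: "x \<in> S" for x
        proof -
          have "d / 2 * ?m ^ (k - 1) \<le> d / 2 * real n ^ (k - 1)" using d2 mk(1) by (intro mult_left_mono) auto
          also have "\<dots> \<le> real (card (L F x))" unfolding L_def
            using plink_away[OF V(1) sub S(1), of d x] S(2) assms V(2) elim(3) F x by (auto simp: G_def)
          finally show ?thesis .
        qed
        have "(L F x, L F y) \<in> ?R" if xy: "x \<in> S" "y \<in> S" "x \<noteq> y" for x y
        proof -
          have "common ?V (k - 1) (L F x) (L F y) \<subseteq> common ?V (k - 1) (plink F x) (plink F y)"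
            by (auto simp: common_def L_def)
          then have "card (common ?V (k - 1) (L F x) (L F y)) \<le> card (common ?V (k - 1) (plink F x) (plink F y))"
            using V'(1) by (intro card_mono) (auto simp: common_def)
          moreover have "real (card (common ?V (k - 1) (plink F x) (plink F y))) \<le> g / 2 ^ k * real n ^ k"
            using F xy unfolding G_def by blast
          ultimately have "real (card (common ?V (k - 1) (L F x) (L F y))) \<le> g / 2 ^ k * real n ^ k" by linarith
          also have "\<dots> = g * (real n ^ k / 2 ^ k)" by simp
          also have "\<dots> \<le> g * ?m ^ k" using g mk(2)[of k] by (intro mult_left_mono) auto
          finally have "real (card (common ?V (k - 1) (L F x) (L F y))) \<le> g * ?m ^ Suc (k - 1)" using k by simp
          then show ?thesis using Ld xy V' unfolding dense_pairs_def by (auto simp: L_def)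
        qed
        moreover have "L F x \<in> ?D" for x by (auto simp: L_def)
        ultimately show ?thesis unfolding Fn_def by (auto simp: PiE_iff)
      qed
      have finFn: "finite Fn" unfolding Fn_def
        by (rule finite_subset[of _ "S \<rightarrow>\<^sub>E ?D"]) (use fS V'(1) in \<open>auto intro: finite_PiE\<close>)
      let ?B = "2 powr (real (n choose (k - 1)) - c / 2 ^ (k - 1) * real n ^ (k - 1))"
      have R: "real (card ?R) \<le> ?B"
      proof -
        have "real (card ?R) \<le> 2 powr (real ((n - k) choose (k - 1)) - c * ?m ^ (k - 1))"
          using elim(1) V' by blast
        also have "\<dots> \<le> ?B"
        proof (rule powr_mono)
          have "c / 2 ^ (k - 1) * real n ^ (k - 1) = c * (real n ^ (k - 1) / 2 ^ (k - 1))" by simp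
          also have "\<dots> \<le> c * ?m ^ (k - 1)" using c mk(2)[of "k - 1"] by (intro mult_left_mono) auto
          finally show "real ((n - k) choose (k - 1)) - c * ?m ^ (k - 1) \<le> real (n choose (k - 1)) - c / 2 ^ (k - 1) * real n ^ (k - 1)"
            using choose_mono_left[of "n - k" n "k - 1"] by simp
        qed simp
        finally show ?thesis .
      qed
      let ?M = "2 * 2 powr (real k / 2 * (real (n choose (k - 1)) - c / 2 ^ (k - 1) * real n ^ (k - 1)))"
      have Fn: "real (card Fn) \<le> ?M"
      proof -
        have "real (card Fn) \<le> 2 * real (card ?R) powr (real (card S) / 2)"
          unfolding Fn_def using V'(1) RD fS S(2) assms(2) by (intro card_pairwise_related) auto
        also have "\<dots> \<le> 2 * ?B powr (real (card S) / 2)" using R by (intro mult_left_mono powr_mono2) auto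
        also have "?B powr (real (card S) / 2) = 2 powr (real k / 2 * (real (n choose (k - 1)) - c / 2 ^ (k - 1) * real n ^ (k - 1)))"
          using S(2) by (simp add: powr_powr mult.commute)
        finally show ?thesis .
      qed
      have "real (card G) \<le> real (card (minimal_forms k (V - S))) * ?M * 2 powr (4 * real k ^ 2 * e * real (card V) ^ (k - 1))"
      proof (rule deletion_thin[OF V(1) _ ch(1,2) S(1)])
        fix F0
        let ?H = "{F\<in>G. core S F = F0}"
        have LcL: "plinks_at S F = (\<Union>x\<in>S. Pair x ` restrict (L F) S x)" if "F \<in> G" for F
        proof -
          have sub: "F \<subseteq> pairs k V" using that by (auto simp: G_def sparse_forms_def)
          show ?thesis using plinks_at_sub[OF V(1) sub, of S] by (auto simp: plinks_at_def L_def ksub_def)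
        qed
        have "plinks_at S ` ?H \<subseteq> (\<lambda>f. \<Union>x\<in>S. Pair x ` f x) ` Fn"
        proof (rule image_subsetI)
          fix F assume "F \<in> ?H"
          then show "plinks_at S F \<in> (\<lambda>f. \<Union>x\<in>S. Pair x ` f x) ` Fn" using LcL Lfun by (intro image_eqI[of _ _ "restrict (L F) S"]) auto
        qed
        then have "card (plinks_at S ` ?H) \<le> card Fn" using finFn by (meson card_image_le card_mono finite_imageI le_trans)
        then show "real (card (plinks_at S ` ?H)) \<le> ?M" using Fn by linarith
      qed (use ch V S assms in \<open>auto simp: G_def\<close>)
      also have "\<dots> = real (card (minimal_forms k (V - S))) *
        (2 * 2 powr (real k / 2 * (real (n choose (k - 1)) - c / 2 ^ (k - 1) * real n ^ (k - 1)) + 4 * real k ^ 2 * e * real n ^ (k - 1)))"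
        using V(2) by (simp add: powr_add)
      finally show "real (card {F\<in>sparse_forms k V s. (\<forall>x\<in>S. real (card (nlink F x)) \<le> thin e * real n ^ (k - 1) \<and> d * real n ^ (k - 1) \<le> real (card (plink F x))) \<and>
        (\<forall>x\<in>S. \<forall>y\<in>S. x \<noteq> y \<longrightarrow> real (card (common (V - S) (k - 1) (plink F x) (plink F y))) \<le> g / 2 ^ k * real n ^ k)})
        \<le> real (card (minimal_forms k (V - S))) *
        (2 * 2 powr (real k / 2 * (real (n choose (k - 1)) - c / 2 ^ (k - 1) * real n ^ (k - 1)) + 4 * real k ^ 2 * e * real n ^ (k - 1)))"
        unfolding G_def .
    qed
  qed
  moreover have "g / 2 ^ k > 0" "c / 2 ^ (k - 1) > 0" using g c by auto
  ultimately show ?thesis by blast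
qed

section \<open>Savings from typical and atypical clauses\<close>

lemma exists_ge_average:
  fixes f :: "'a \<Rightarrow> real"
  assumes "finite A" "A \<noteq> {}" "real (card A) * c \<le> sum f A"
  shows "\<exists>x\<in>A. c \<le> f x"
proof (rule ccontr)
  assume "\<not> (\<exists>x\<in>A. c \<le> f x)"
  then have "sum f A < (\<Sum>x\<in>A. c)" using assms by (intro sum_strict_mono) auto
  then show False using assms(3) by simp
qed

text \<open>A uniformly random \<open>A \<subseteq> V\<close> contains \<open>T\<close> and misses
  \<open>\<sigma> T\<close> with probability \<open>1 / 2 ^ k\<close>.\<close>

lemma exists_separating:
  assumes "finite V" "finite Ts"
    and "\<And>T. T \<in> Ts \<Longrightarrow> T \<subseteq> V \<and> \<sigma> T \<subseteq> V \<and> \<sigma> T \<inter> T = {} \<and> card T + card (\<sigma> T) = k"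
  shows "\<exists>A\<subseteq>V. real (card Ts) / 2 ^ k \<le> real (card {T\<in>Ts. T \<subseteq> A \<and> \<sigma> T \<inter> A = {}})"
proof (cases "Ts = {}")
  case False
  have le: "k \<le> card V"
  proof -
    obtain T where T: "T \<in> Ts" using False by auto
    have f: "finite T" "finite (\<sigma> T)" using assms(3)[OF T] finite_subset[OF _ assms(1)] by auto
    have "card (T \<union> \<sigma> T) = k" using assms(3)[OF T] f by (subst card_Un_disjoint) auto
    moreover have "card (T \<union> \<sigma> T) \<le> card V" using assms(1) assms(3)[OF T] by (intro card_mono) auto
    ultimately show ?thesis by simp
  qed
  have "(\<Sum>A\<in>Pow V. real (card {T\<in>Ts. T \<subseteq> A \<and> \<sigma> T \<inter> A = {}})) = (\<Sum>A\<in>Pow V. \<Sum>T\<in>Ts. if T \<subseteq> A \<and> \<sigma> T \<inter> A = {} then 1 else 0)"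
    using assms(2) by (intro sum.cong) (auto simp: sum.If_cases Int_def)
  also have "\<dots> = (\<Sum>T\<in>Ts. \<Sum>A\<in>Pow V. if T \<subseteq> A \<and> \<sigma> T \<inter> A = {} then 1 else 0)" by (rule sum.swap)
  also have "\<dots> = (\<Sum>T\<in>Ts. 2 ^ card V / 2 ^ k)"
  proof (rule sum.cong)
    fix T assume T: "T \<in> Ts"
    have "(\<Sum>A\<in>Pow V. if T \<subseteq> A \<and> \<sigma> T \<inter> A = {} then 1 else 0::real) = real (card {A. A \<subseteq> V \<and> T \<subseteq> A \<and> \<sigma> T \<inter> A = {}})"
      using assms(1) by (auto simp: sum.If_cases Int_def intro!: arg_cong[of _ _ card])
    also have "\<dots> = 2 ^ (card V - card T - card (\<sigma> T))"
      using assms(1) assms(3)[OF T] by (subst card_separating_sets) auto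
    also have "card V - card T - card (\<sigma> T) = card V - k" using assms(3)[OF T] by linarith
    also have "(2::real) ^ (card V - k) = 2 ^ card V / 2 ^ k" using le by (simp add: power_diff)
    finally show "(\<Sum>A\<in>Pow V. if T \<subseteq> A \<and> \<sigma> T \<inter> A = {} then 1 else 0::real) = 2 ^ card V / 2 ^ k" .
  qed simp
  also have "\<dots> = real (card (Pow V)) * (real (card Ts) / 2 ^ k)" using assms(1) by (simp add: card_Pow)
  finally have "real (card (Pow V)) * (real (card Ts) / 2 ^ k) \<le> (\<Sum>A\<in>Pow V. real (card {T\<in>Ts. T \<subseteq> A \<and> \<sigma> T \<inter> A = {}}))" by simp
  then have "\<exists>A\<in>Pow V. real (card Ts) / 2 ^ k \<le> real (card {T\<in>Ts. T \<subseteq> A \<and> \<sigma> T \<inter> A = {}})"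
    using assms(1) by (intro exists_ge_average) auto
  then show ?thesis by blast
qed auto

text \<open>For random \<open>W\<close> the expected product of the number of captured sets and of
  \<open>card (V - W)\<close> is at least \<open>card A * n / 2 ^ (m + 2)\<close>: a given
  \<open>Y p\<close> is contained and a given point outside it missed with probability
  \<open>1 / 2 ^ (m + 1)\<close>, and at least half of all points lie outside. As neither factor
  exceeds its trivial bound, a large product makes both large.\<close>

lemma exists_containing:
  assumes "finite V" "finite A" "\<And>p. p \<in> A \<Longrightarrow> Y p \<subseteq> V \<and> card (Y p) = m" "real (card V) \<ge> 2 * real m" "A \<noteq> {}"
  shows "\<exists>W\<subseteq>V. real (card A) / 2 ^ (m + 2) \<le> real (card {p\<in>A. Y p \<subseteq> W}) \<and> real (card V) / 2 ^ (m + 2) \<le> real (card (V - W))"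
proof -
  let ?n = "real (card V)"
  have ind: "real (card {p\<in>A. Y p \<subseteq> W}) * real (card (V - W)) = (\<Sum>p\<in>A. \<Sum>v\<in>V. if Y p \<subseteq> W \<and> v \<notin> W then 1 else 0)" for W
  proof -
    have "(\<Sum>p\<in>A. \<Sum>v\<in>V. if Y p \<subseteq> W \<and> v \<notin> W then 1 else 0::real) = (\<Sum>p\<in>A. \<Sum>v\<in>V. (if Y p \<subseteq> W then 1 else 0) * (if v \<notin> W then 1 else 0))"
      by (intro sum.cong) auto
    also have "\<dots> = (\<Sum>p\<in>A. if Y p \<subseteq> W then 1 else 0) * (\<Sum>v\<in>V. if v \<notin> W then 1 else 0)" by (rule sum_product[symmetric])
    also have "(\<Sum>p\<in>A. if Y p \<subseteq> W then 1 else 0::real) = real (card {p\<in>A. Y p \<subseteq> W})"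
      using assms(2) by (simp add: sum.If_cases Int_def)
    also have "(\<Sum>v\<in>V. if v \<notin> W then 1 else 0::real) = real (card (V - W))"
      using assms(1) by (simp add: sum.If_cases Int_def set_diff_eq)
    finally show ?thesis by simp
  qed
  have each: "(\<Sum>W\<in>Pow V. \<Sum>v\<in>V. if Y p \<subseteq> W \<and> v \<notin> W then 1 else 0::real) \<ge> ?n / 2 * (2 ^ card V / 2 ^ (m + 1))" if p: "p \<in> A" for p
  proof -
    have Yp: "Y p \<subseteq> V" "card (Y p) = m" using assms(3)[OF p] by auto
    have fY: "finite (Y p)" by (rule finite_subset[OF Yp(1) assms(1)])
    have cd: "card (V - Y p) = card V - m" using Yp fY by (simp add: card_Diff_subset)
    have "(\<Sum>W\<in>Pow V. \<Sum>v\<in>V. if Y p \<subseteq> W \<and> v \<notin> W then 1 else 0::real) = (\<Sum>v\<in>V. \<Sum>W\<in>Pow V. if Y p \<subseteq> W \<and> v \<notin> W then 1 else 0)"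
      by (rule sum.swap)
    also have "\<dots> \<ge> (\<Sum>v\<in>V - Y p. \<Sum>W\<in>Pow V. if Y p \<subseteq> W \<and> v \<notin> W then 1 else 0)"
      using assms(1) by (intro sum_mono2) (auto intro!: sum_nonneg)
    also have "(\<Sum>v\<in>V - Y p. \<Sum>W\<in>Pow V. if Y p \<subseteq> W \<and> v \<notin> W then 1 else 0::real) = (\<Sum>v\<in>V - Y p. 2 ^ card V / 2 ^ (m + 1))"
    proof (rule sum.cong)
      fix v assume v: "v \<in> V - Y p"
      have "(\<Sum>W\<in>Pow V. if Y p \<subseteq> W \<and> v \<notin> W then 1 else 0::real) = real (card {W. W \<subseteq> V \<and> Y p \<subseteq> W \<and> {v} \<inter> W = {}})"
        using assms(1) by (auto simp: sum.If_cases Int_def intro!: arg_cong[of _ _ card])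
      also have "\<dots> = 2 ^ (card V - m - 1)" using assms(1) Yp v by (subst card_separating_sets) auto
      also have "\<dots> = 2 ^ (card V - (m + 1))" by simp
      also have "\<dots> = 2 ^ card V / 2 ^ (m + 1)"
      proof -
        have "card (insert v (Y p)) \<le> card V" using assms(1) Yp v by (intro card_mono) auto
        then have "m + 1 \<le> card V" using v Yp fY by simp
        then show ?thesis by (simp only: power_diff[of "2::real"] zero_neq_numeral not_False_eq_True)
      qed
      finally show "(\<Sum>W\<in>Pow V. if Y p \<subseteq> W \<and> v \<notin> W then 1 else 0::real) = 2 ^ card V / 2 ^ (m + 1)" .
    qed simp
    also have "\<dots> = real (card V - m) * (2 ^ card V / 2 ^ (m + 1))" by (simp add: cd)
    also have "\<dots> \<ge> ?n / 2 * (2 ^ card V / 2 ^ (m + 1))" using assms(4) by (intro mult_right_mono) (auto simp: of_nat_diff)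
    finally show ?thesis by linarith
  qed
  have "real (card (Pow V)) * (real (card A) * ?n / 2 ^ (m + 2)) = (\<Sum>p\<in>A. ?n / 2 * (2 ^ card V / 2 ^ (m + 1)))"
    using assms(1) by (simp add: card_Pow)
  also have "\<dots> \<le> (\<Sum>p\<in>A. \<Sum>W\<in>Pow V. \<Sum>v\<in>V. if Y p \<subseteq> W \<and> v \<notin> W then 1 else 0)" using each by (intro sum_mono)
  also have "\<dots> = (\<Sum>W\<in>Pow V. \<Sum>p\<in>A. \<Sum>v\<in>V. if Y p \<subseteq> W \<and> v \<notin> W then 1 else 0)" by (rule sum.swap)
  also have "\<dots> = (\<Sum>W\<in>Pow V. real (card {p\<in>A. Y p \<subseteq> W}) * real (card (V - W)))" by (simp add: ind)
  finally have "\<exists>W\<in>Pow V. real (card A) * ?n / 2 ^ (m + 2) \<le> real (card {p\<in>A. Y p \<subseteq> W}) * real (card (V - W))"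
    using assms(1) by (intro exists_ge_average) auto
  then obtain W where W: "W \<subseteq> V" "real (card A) * ?n / 2 ^ (m + 2) \<le> real (card {p\<in>A. Y p \<subseteq> W}) * real (card (V - W))" by blast
  show ?thesis
  proof (cases "card V = 0")
    case True
    then have "V = {}" using assms(1) by simp
    then have "{p\<in>A. Y p \<subseteq> W} = A" using assms(3) W(1) by auto
    moreover have "real (card A) * 1 \<le> real (card A) * 2 ^ (m + 2)" by (intro mult_left_mono one_le_power) auto
    ultimately show ?thesis using W(1) True \<open>V = {}\<close> by (intro exI[of _ W]) (auto simp: divide_simps)
  next
    case False
    have "real (card {p\<in>A. Y p \<subseteq> W}) * real (card (V - W)) \<le> real (card {p\<in>A. Y p \<subseteq> W}) * ?n"
      using assms(1) by (intro mult_left_mono) (auto intro: card_mono)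
    then have "real (card A) / 2 ^ (m + 2) * ?n \<le> real (card {p\<in>A. Y p \<subseteq> W}) * ?n" using W(2) by simp
    then have 1: "real (card A) / 2 ^ (m + 2) \<le> real (card {p\<in>A. Y p \<subseteq> W})" by (rule mult_right_le_imp_le) (use False in simp)
    have "real (card {p\<in>A. Y p \<subseteq> W}) * real (card (V - W)) \<le> real (card A) * real (card (V - W))"
      using assms(2) by (intro mult_right_mono) (auto intro: card_mono)
    then have "?n / 2 ^ (m + 2) * real (card A) \<le> real (card (V - W)) * real (card A)" using W(2) by (simp add: mult.commute)
    then have "?n / 2 ^ (m + 2) \<le> real (card (V - W))" by (rule mult_right_le_imp_le) (use assms(2,5) in \<open>simp add: card_gt_0_iff\<close>)
    then show ?thesis using W(1) 1 by blast
  qed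
qed

definition pos_extensions :: "nat set \<Rightarrow> nat set set \<Rightarrow> nat set \<Rightarrow> nat set \<Rightarrow> nat set set" where
  "pos_extensions V P S T = {R\<in>ksub (V - S - T) (card S). \<forall>x\<in>S. insert x (R \<union> T) \<in> P}"

lemma extensions_pos_extensions: assumes "T \<inter> S = {}" shows "extensions V F S T = pos_extensions V (pos F) S T"
  unfolding extensions_def pos_extensions_def plink_pos using assms by (auto simp: ksub_def)

text \<open>Restricting to pairs inside \<open>W\<close> and to \<open>R\<close> outside \<open>W\<close>, the \<open>k\<close>-sets that decide whether a
  pair is atypical determine \<open>insert x T\<close> as their trace on \<open>W\<close>; hence each pair shares them with
  at most \<open>k\<^sup>2 * n ^ (i - 1)\<close> others and a greedy choice makes the constraints independent.\<close>

lemma atypical_savings: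
  assumes "finite V" "1 \<le> i" "i < k" "real (card V) \<ge> real k * 2 ^ (k + 1)"
    and A: "\<And>S T. (S,T) \<in> A \<Longrightarrow> S \<in> ksub V i \<and> T \<in> ksub (V - S) (k - 1 - i)"
    and b: "b \<le> tuple_gain i * (1 / (real k * 2 ^ (k + 1))) ^ k"
  shows "real (card {P. P \<subseteq> ksub V k \<and> (\<forall>(S,T)\<in>A. real (card (pos_extensions V P S T)) < b * real (card V) ^ i)})
    \<le> 2 powr (real (card V choose k) - tuple_gain i * (1 / (real k * 2 ^ (k + 1))) ^ k / (2 ^ (k + 1) * real k ^ 2)
          * (real (card V) * real (card A)))"
proof (cases "A = {}")
  case True
  have "{P. P \<subseteq> ksub V k \<and> (\<forall>(S,T)\<in>A. real (card (pos_extensions V P S T)) < b * real (card V) ^ i)} = Pow (ksub V k)" using True by auto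
  then show ?thesis using True assms(1) by (simp add: card_Pow powr_realpow card_ksub)
next
  case False
  let ?n = "real (card V)" and ?g = "tuple_gain i" and ?\<kappa> = "(1 / (real k * 2 ^ (k + 1))) ^ k"
  have kp: "real k \<ge> 1" using assms(2,3) by simp
  have "A \<subseteq> Pow V \<times> Pow V"
  proof (rule subsetI)
    fix p assume "p \<in> A"
    then show "p \<in> Pow V \<times> Pow V" using A[of "fst p" "snd p"] by (cases p) (auto simp: ksub_def)
  qed
  then have finA: "finite A" by (rule finite_subset) (simp add: assms(1))
  have Ap: "fst p \<subseteq> V" "card (fst p) = i" "snd p \<subseteq> V - fst p" "card (snd p) = k - 1 - i"
    "finite (fst p)" "finite (snd p)" if "p \<in> A" for p
    using A[of "fst p" "snd p"] that finite_subset[OF _ assms(1)] by (auto simp: ksub_def)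
  have k1: "k - 1 + 2 = k + 1" using assms(2,3) by simp
  have n2: "?n \<ge> 2 * real (k - 1)"
  proof -
    have "2 * real (k - 1) \<le> real k * 2" by simp
    also have "\<dots> \<le> real k * 2 ^ (k + 1)" by (intro mult_left_mono) auto
    finally show ?thesis using assms(4) by linarith
  qed
  obtain W where W: "W \<subseteq> V" "real (card A) / 2 ^ (k + 1) \<le> real (card {p\<in>A. fst p \<union> snd p \<subseteq> W})"
    "?n / 2 ^ (k + 1) \<le> real (card (V - W))"
  proof -
    have "fst p \<union> snd p \<subseteq> V \<and> card (fst p \<union> snd p) = k - 1" if "p \<in> A" for p
    proof -
      have "card (fst p \<union> snd p) = k - 1" using Ap[OF that] assms(3) by (subst card_Un_disjoint) auto
      then show ?thesis using Ap[OF that] by auto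
    qed
    then have "\<exists>W\<subseteq>V. real (card A) / 2 ^ (k - 1 + 2) \<le> real (card {p\<in>A. fst p \<union> snd p \<subseteq> W}) \<and> ?n / 2 ^ (k - 1 + 2) \<le> real (card (V - W))"
      using n2 False finA assms(1) by (intro exists_containing) auto
    then show ?thesis using that unfolding k1 by blast
  qed
  define AW where "AW = {p\<in>A. fst p \<union> snd p \<subseteq> W}"
  define conf where "conf p q \<longleftrightarrow> (\<exists>x\<in>fst p. \<exists>y\<in>fst q. insert x (snd p) = insert y (snd q))"
    for p q :: "nat set \<times> nat set"
  have finAW: "finite AW" using finA by (simp add: AW_def)
  have "\<exists>I\<subseteq>AW. (\<forall>p\<in>I. \<forall>q\<in>I. p \<noteq> q \<longrightarrow> \<not> conf p q) \<and> card AW \<le> (k * k * card V ^ (i - 1)) * card I"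
  proof (rule greedy_independent_set[OF finAW])
    show "conf q p" if "conf p q" for p q using that unfolding conf_def by metis
    show "conf p p" if "p \<in> AW" for p
    proof -
      have "fst p \<noteq> {}" using Ap(2)[of p] that assms(2) by (auto simp: AW_def)
      then show ?thesis by (auto simp: conf_def)
    qed
    fix p assume "p \<in> AW"
    then have p: "p \<in> A" by (simp add: AW_def)
    \<comment> \<open>A pair \<open>q\<close> in conflict with \<open>p\<close> is determined by
      \<open>x\<close>, by \<open>y \<in> insert x (snd p)\<close> and by the \<open>i - 1\<close>
      other elements of \<open>fst q\<close>.\<close>
    let ?N = "(\<Union>x\<in>fst p. \<Union>y\<in>insert x (snd p). (\<lambda>Z. (insert y Z, insert x (snd p) - {y})) ` ksub V (i - 1))"
    have "{q\<in>AW. conf p q} \<subseteq> ?N"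
    proof
      fix q assume "q \<in> {q\<in>AW. conf p q}"
      then obtain x y where xy: "x \<in> fst p" "y \<in> fst q" "insert x (snd p) = insert y (snd q)" and q: "q \<in> A"
        by (auto simp: conf_def AW_def)
      have "y \<notin> snd q" using Ap(3)[OF q] xy(2) by auto
      then have "snd q = insert x (snd p) - {y}" using xy(3) by auto
      moreover have "fst q = insert y (fst q - {y})" using xy(2) by auto
      moreover have "fst q - {y} \<in> ksub V (i - 1)" using Ap[OF q] xy(2) by (auto simp: ksub_def)
      ultimately have "q \<in> (\<lambda>Z. (insert y Z, insert x (snd p) - {y})) ` ksub V (i - 1)"
        by (intro image_eqI[of _ _ "fst q - {y}"]) (auto simp: prod_eq_iff)
      moreover have "y \<in> insert x (snd p)" using xy(3) by simp
      ultimately show "q \<in> ?N" using xy(1) by blast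
    qed
    moreover have fN: "finite ?N" using Ap[OF p] assms(1) by auto
    ultimately have "card {q\<in>AW. conf p q} \<le> card ?N" by (intro card_mono)
    also have "\<dots> \<le> (\<Sum>x\<in>fst p. card (\<Union>y\<in>insert x (snd p). (\<lambda>Z. (insert y Z, insert x (snd p) - {y})) ` ksub V (i - 1)))"
      by (rule card_UN_le) (rule Ap(5)[OF p])
    also have "\<dots> \<le> (\<Sum>x\<in>fst p. k * card V ^ (i - 1))"
    proof (rule sum_mono)
      fix x assume "x \<in> fst p"
      have "card (\<Union>y\<in>insert x (snd p). (\<lambda>Z. (insert y Z, insert x (snd p) - {y})) ` ksub V (i - 1))
        \<le> (\<Sum>y\<in>insert x (snd p). card ((\<lambda>Z. (insert y Z, insert x (snd p) - {y})) ` ksub V (i - 1)))"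
        using Ap(6)[OF p] by (intro card_UN_le) auto
      also have "\<dots> \<le> (\<Sum>y\<in>insert x (snd p). card V ^ (i - 1))"
      proof (rule sum_mono)
        fix y
        have "card ((\<lambda>Z. (insert y Z, insert x (snd p) - {y})) ` ksub V (i - 1)) \<le> card (ksub V (i - 1))"
          using assms(1) by (intro card_image_le) auto
        also have "\<dots> \<le> card V ^ (i - 1)"
        proof -
          have "real (card (ksub V (i - 1))) \<le> real (card V ^ (i - 1))" using card_ksub_le[OF assms(1), of "i - 1"] by simp
          then show ?thesis by (simp only: of_nat_le_iff)
        qed
        finally show "card ((\<lambda>Z. (insert y Z, insert x (snd p) - {y})) ` ksub V (i - 1)) \<le> card V ^ (i - 1)" .
      qed
      also have "\<dots> = card (insert x (snd p)) * card V ^ (i - 1)" by simp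
      also have "\<dots> \<le> k * card V ^ (i - 1)"
      proof (rule mult_right_mono)
        have "card (insert x (snd p)) \<le> Suc (card (snd p))" using Ap(6)[OF p] by (simp add: card_insert_if)
        then show "card (insert x (snd p)) \<le> k" using Ap(4)[OF p] assms(2,3) by linarith
      qed simp
      finally show "card (\<Union>y\<in>insert x (snd p). (\<lambda>Z. (insert y Z, insert x (snd p) - {y})) ` ksub V (i - 1)) \<le> k * card V ^ (i - 1)" .
    qed
    also have "\<dots> = i * (k * card V ^ (i - 1))" using Ap(2)[OF p] by simp
    also have "\<dots> \<le> k * (k * card V ^ (i - 1))" using assms(3) by (intro mult_right_mono) auto
    finally show "card {q\<in>AW. conf p q} \<le> k * k * card V ^ (i - 1)" by simp
  qed
  then obtain I where I: "I \<subseteq> AW" "\<forall>p\<in>I. \<forall>q\<in>I. p \<noteq> q \<longrightarrow> \<not> conf p q" "card AW \<le> (k * k * card V ^ (i - 1)) * card I" by blast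
  define U where "U = V - W"
  define K where "K = ksub U i"
  \<comment> \<open>\<open>h p\<close> realises the pair \<open>(x, R)\<close> as the
    \<open>k\<close>-set \<open>insert x (R \<union> snd p)\<close>. It is injective for
    \<open>p \<in> I\<close>, so subsets of the block \<open>B p\<close> are families of subsets of
    \<open>K\<close> indexed by \<open>fst p\<close>.\<close>
  define h where "h p = (\<lambda>(x,R). insert x (R \<union> snd p))" for p :: "nat set \<times> nat set"
  define B where "B p = h p ` (fst p \<times> K)" for p
  define Pr where "Pr p Y \<longleftrightarrow> real (card {R\<in>K. \<forall>x\<in>fst p. insert x (R \<union> snd p) \<in> Y}) \<le> ?g * real (card K)"
    for p :: "nat set \<times> nat set" and Y
  have finU: "finite U" using assms(1) by (simp add: U_def)
  have finK: "finite K" using finU by (simp add: K_def)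
  have IA: "p \<in> A" "fst p \<subseteq> W" "snd p \<subseteq> W" if "p \<in> I" for p using I(1) that by (auto simp: AW_def)
  have hinj: "inj_on (h p) (fst p \<times> K)" if "p \<in> I" for p
  proof (rule inj_onI)
    fix u v assume uv: "u \<in> fst p \<times> K" "v \<in> fst p \<times> K" "h p u = h p v"
    obtain x R y R' where e: "u = (x,R)" "v = (y,R')" by (cases u, cases v)
    have m: "x \<in> fst p" "y \<in> fst p" "R \<subseteq> U" "R' \<subseteq> U" using uv e by (auto simp: K_def ksub_def)
    have eq: "insert x (R \<union> snd p) = insert y (R' \<union> snd p)" using uv(3) e by (simp add: h_def)
    have "insert x (R \<union> snd p) \<inter> U = R" "insert y (R' \<union> snd p) \<inter> U = R'" using m IA[OF that] by (auto simp: U_def)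
    then have R: "R = R'" using eq by simp
    have "insert x (R \<union> snd p) \<inter> fst p = {x}" "insert y (R' \<union> snd p) \<inter> fst p = {y}"
      using m IA[OF that] Ap(3)[OF IA(1)[OF that]] by (auto simp: U_def)
    then have "x = y" using eq by auto
    then show "u = v" using R e by simp
  qed
  have trace: "insert x (R \<union> snd p) \<inter> W = insert x (snd p)" if "p \<in> I" "x \<in> fst p" "R \<in> K" for p x R
    using that IA[OF that(1)] by (auto simp: K_def ksub_def U_def)
  \<comment> \<open>\<open>U\<close> has at least \<open>n / 2 ^ (k + 1)\<close> points, and
    \<open>K\<close> has at least \<open>(card U / i) ^ i\<close> members; this is the origin of the
    base \<open>1 / (k * 2 ^ (k + 1))\<close>.\<close>
  have Cge: "?\<kappa> * ?n ^ i \<le> real (card K)"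
  proof -
    have iU: "i \<le> card U"
    proof -
      have "real i \<le> real k" using assms(3) by simp
      also have "\<dots> \<le> ?n / 2 ^ (k + 1)" using assms(4) by (simp add: field_simps)
      also have "\<dots> \<le> real (card U)" using W(3) by (simp add: U_def)
      finally show ?thesis by simp
    qed
    have "?\<kappa> * ?n ^ i \<le> (1 / (real k * 2 ^ (k + 1))) ^ i * ?n ^ i"
    proof (rule mult_right_mono)
      have "(1::real) \<le> 2 ^ (k + 1)" by (rule one_le_power) simp
      then have "1 * 1 \<le> real k * 2 ^ (k + 1)" using kp by (intro mult_mono) auto
      then show "?\<kappa> \<le> (1 / (real k * 2 ^ (k + 1))) ^ i" using assms(3) by (intro power_decreasing) auto
    qed simp
    also have "\<dots> = ((?n / 2 ^ (k + 1)) / real k) ^ i" by (simp add: power_mult_distrib[symmetric] mult.commute)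
    also have "\<dots> \<le> (real (card U) / real i) ^ i"
      using W(3) assms(2,3) by (intro power_mono frac_le) (auto simp: U_def)
    also have "\<dots> \<le> real (card K)" unfolding K_def by (rule card_ksub_ge[OF finU iU])
    finally show ?thesis .
  qed
  have finI: "finite I" by (rule finite_subset[OF I(1) finAW])
  have "real (card {P. P \<subseteq> ksub V k \<and> (\<forall>p\<in>I. Pr p (P \<inter> B p))}) \<le> 2 powr (real (card (ksub V k)) - ?g * real (card K) * real (card I))"
  proof (rule card_block_constraints[OF finI finite_ksub[OF assms(1)]])
    show "\<forall>p\<in>I. B p \<subseteq> ksub V k"
    proof (intro ballI subsetI)
      fix p P assume p: "p \<in> I" and "P \<in> B p"
      then obtain x R where x: "x \<in> fst p" "R \<in> K" "P = insert x (R \<union> snd p)" by (auto simp: B_def h_def)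
      have q: "x \<notin> snd p" "R \<inter> snd p = {}" "x \<notin> R" "R \<subseteq> V" "x \<in> V" "snd p \<subseteq> V" "finite R" "card R = i"
        using x IA[OF p] Ap[OF IA(1)[OF p]] finite_subset[OF _ finU, of R] by (auto simp: K_def ksub_def U_def)
      have "card (R \<union> snd p) = i + (k - 1 - i)"
        using q Ap(4,6)[OF IA(1)[OF p]] by (subst card_Un_disjoint) auto
      then have "card P = k" using q Ap(6)[OF IA(1)[OF p]] assms(3) x(3) by simp
      then show "P \<in> ksub V k" using q x(3) by (auto simp: ksub_def)
    qed
    show "disjoint_family_on B I"
    proof (unfold disjoint_family_on_def, intro ballI impI)
      fix p q assume pq: "p \<in> I" "q \<in> I" "p \<noteq> q"
      show "B p \<inter> B q = {}"
      proof (rule ccontr)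
        assume "B p \<inter> B q \<noteq> {}"
        then obtain x R y R' where e: "x \<in> fst p" "R \<in> K" "y \<in> fst q" "R' \<in> K" "insert x (R \<union> snd p) = insert y (R' \<union> snd q)"
          by (auto simp: B_def h_def)
        then have "insert x (snd p) = insert y (snd q)" using trace[OF pq(1) e(1,2)] trace[OF pq(2) e(3,4)] by simp
        then have "conf p q" using e by (auto simp: conf_def)
        then show False using I(2) pq by blast
      qed
    qed
    show "\<forall>p\<in>I. real (card {Y. Y \<subseteq> B p \<and> Pr p Y}) \<le> 2 powr (real (card (B p)) - ?g * real (card K))"
    proof
      fix p assume p: "p \<in> I"
      have cS: "card (fst p) = i" "finite (fst p)" using Ap[OF IA(1)[OF p]] by auto
      have cB: "card (B p) = i * card K" unfolding B_def using hinj[OF p] cS by (simp add: card_image card_cartesian_product)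
      let ?Z = "{Z. Z \<subseteq> fst p \<times> K \<and> real (card {q\<in>K. \<forall>x\<in>fst p. (x,q) \<in> Z}) \<le> tuple_gain (card (fst p)) * real (card K)}"
      have finZ: "finite ?Z" using cS finK by (rule_tac finite_subset[of _ "Pow (fst p \<times> K)"]) auto
      have "{Y. Y \<subseteq> B p \<and> Pr p Y} \<subseteq> (\<lambda>Z. h p ` Z) ` ?Z"
      proof
        fix Y assume Y: "Y \<in> {Y. Y \<subseteq> B p \<and> Pr p Y}"
        define Z where "Z = {u\<in>fst p \<times> K. h p u \<in> Y}"
        have "Y = h p ` Z" using Y by (auto simp: Z_def B_def)
        moreover have "{q\<in>K. \<forall>x\<in>fst p. (x,q) \<in> Z} = {R\<in>K. \<forall>x\<in>fst p. insert x (R \<union> snd p) \<in> Y}"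
          by (auto simp: Z_def h_def)
        then have "Z \<in> ?Z" using Y by (auto simp: Pr_def Z_def cS)
        ultimately show "Y \<in> (\<lambda>Z. h p ` Z) ` ?Z" by blast
      qed
      then have "card {Y. Y \<subseteq> B p \<and> Pr p Y} \<le> card ?Z" using finZ by (meson card_image_le card_mono finite_imageI le_trans)
      then have "real (card {Y. Y \<subseteq> B p \<and> Pr p Y}) \<le> real (card ?Z)" by (simp only: of_nat_le_iff)
      also have "\<dots> \<le> 2 powr (real (card (fst p)) * real (card K) - tuple_gain (card (fst p)) * real (card K))"
        using cS finK by (intro card_thin_intersections) auto
      finally show "real (card {Y. Y \<subseteq> B p \<and> Pr p Y}) \<le> 2 powr (real (card (B p)) - ?g * real (card K))" by (simp add: cS cB)
    qed
  qed
  moreover have "{P. P \<subseteq> ksub V k \<and> (\<forall>(S,T)\<in>A. real (card (pos_extensions V P S T)) < b * ?n ^ i)} \<subseteq> {P. P \<subseteq> ksub V k \<and> (\<forall>p\<in>I. Pr p (P \<inter> B p))}"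
  proof clarify
    fix P a c assume P: "P \<subseteq> ksub V k" "\<forall>(S,T)\<in>A. real (card (pos_extensions V P S T)) < b * ?n ^ i" and p: "(a,c) \<in> I"
    have aA: "(a,c) \<in> A" and sub: "a \<subseteq> W" "c \<subseteq> W" using IA[OF p] by auto
    have "{R\<in>K. \<forall>x\<in>a. insert x (R \<union> c) \<in> P \<inter> B (a,c)} \<subseteq> pos_extensions V P a c"
      using sub Ap(2)[OF aA] by (auto simp: pos_extensions_def K_def ksub_def U_def)
    then have "card {R\<in>K. \<forall>x\<in>a. insert x (R \<union> c) \<in> P \<inter> B (a,c)} \<le> card (pos_extensions V P a c)"
      using assms(1) by (intro card_mono) (auto simp: pos_extensions_def)
    then have "real (card {R\<in>K. \<forall>x\<in>a. insert x (R \<union> c) \<in> P \<inter> B (a,c)}) \<le> real (card (pos_extensions V P a c))" by (simp only: of_nat_le_iff)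
    also have "\<dots> \<le> b * ?n ^ i" using P(2) aA by fastforce
    also have "\<dots> \<le> ?g * ?\<kappa> * ?n ^ i" using b by (intro mult_right_mono) auto
    also have "\<dots> = ?g * (?\<kappa> * ?n ^ i)" by simp
    also have "\<dots> \<le> ?g * real (card K)" using Cge tuple_gain_pos[of i] by (intro mult_left_mono) auto
    finally show "Pr (a,c) (P \<inter> B (a,c))" by (simp add: Pr_def)
  qed
  then have "card {P. P \<subseteq> ksub V k \<and> (\<forall>(S,T)\<in>A. real (card (pos_extensions V P S T)) < b * ?n ^ i)} \<le> card {P. P \<subseteq> ksub V k \<and> (\<forall>p\<in>I. Pr p (P \<inter> B p))}"
    using assms(1) by (rule_tac card_mono) (auto intro: finite_subset[of _ "Pow (ksub V k)"])
  ultimately have "real (card {P. P \<subseteq> ksub V k \<and> (\<forall>(S,T)\<in>A. real (card (pos_extensions V P S T)) < b * ?n ^ i)})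
     \<le> 2 powr (real (card (ksub V k)) - ?g * real (card K) * real (card I))" by linarith
  also have "\<dots> \<le> 2 powr (real (card V choose k) - ?g * ?\<kappa> / (2 ^ (k + 1) * real k ^ 2) * (?n * real (card A)))"
  proof (rule powr_mono)
    have np: "?n > 0"
    proof -
      have "0 < real k * 2 ^ (k + 1)" using kp by simp
      then show ?thesis using assms(4) by linarith
    qed
    \<comment> \<open>Each pair in \<open>I\<close> saves of the order of \<open>n ^ i\<close> and
      stands for at most \<open>k ^ 2 * n ^ (i - 1)\<close> pairs of \<open>AW\<close>; this leaves
      \<open>n\<close> per pair.\<close>
    have "real (card AW) \<le> real ((k * k * card V ^ (i - 1)) * card I)" using I(3) by (simp only: of_nat_le_iff)
    then have AWI: "real (card AW) \<le> real k ^ 2 * ?n ^ (i - 1) * real (card I)" by (simp add: power2_eq_square)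
    have ni: "?n ^ i = ?n * ?n ^ (i - 1)" using assms(2) by (metis Suc_diff_1 less_eq_Suc_le One_nat_def power_Suc)
    have "?\<kappa> / (2 ^ (k + 1) * real k ^ 2) * (?n * real (card A)) = ?\<kappa> * ?n / real k ^ 2 * (real (card A) / 2 ^ (k + 1))" by (simp add: mult_ac)
    also have "\<dots> \<le> ?\<kappa> * ?n / real k ^ 2 * real (card AW)" using W(2) by (intro mult_left_mono) (auto simp: AW_def)
    also have "\<dots> \<le> ?\<kappa> * ?n / real k ^ 2 * (real k ^ 2 * ?n ^ (i - 1) * real (card I))" using AWI by (intro mult_left_mono) auto
    also have "\<dots> = ?\<kappa> * ?n ^ i * real (card I)" using kp ni by simp
    also have "\<dots> \<le> real (card K) * real (card I)" using Cge by (intro mult_right_mono) auto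
    finally have "?g * (?\<kappa> / (2 ^ (k + 1) * real k ^ 2) * (?n * real (card A))) \<le> ?g * (real (card K) * real (card I))"
      using tuple_gain_pos[of i] by (intro mult_left_mono) auto
    then show "real (card (ksub V k)) - ?g * real (card K) * real (card I) \<le> real (card V choose k) - ?g * ?\<kappa> / (2 ^ (k + 1) * real k ^ 2) * (?n * real (card A))"
      using card_ksub[OF assms(1), of k] by (simp add: mult.assoc)
  qed simp
  finally show ?thesis .
qed


text \<open>After separating the sets \<open>T\<close> from the sets \<open>\<sigma> T\<close> by a set \<open>A\<close>, a clause \<open>R \<union> T\<close> that is ruled
  out has one more element in \<open>A\<close> than the clauses ruling it out, so for each value \<open>a\<close> of
  \<open>card (R \<inter> A)\<close> the former are determined by the clauses outside their own layer.\<close>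

lemma typical_savings:
  assumes "finite V" "1 \<le> i" "i < k" "finite Ts" "b \<ge> 0"
    and Ts: "\<And>T. T \<in> Ts \<Longrightarrow> T \<in> ksub V (k - i) \<and> \<sigma> T \<in> ksub V i \<and> \<sigma> T \<inter> T = {} \<and> \<tau> T \<in> T"
    and Gd: "\<And>T P. G T P = {R\<in>ksub (V - \<sigma> T - T) i. \<forall>x\<in>\<sigma> T. insert x (R \<union> (T - {\<tau> T})) \<in> P}"
  shows "real (card {P. P \<subseteq> ksub V k \<and> (\<forall>T\<in>Ts. b * real (card V) ^ i \<le> real (card (G T P)) \<and> (\<forall>R\<in>G T P. R \<union> T \<notin> P))})
    \<le> real k * 2 powr (real (card V choose k) - b / (real k * 4 ^ k) * (real (card V) ^ i * real (card Ts)))"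
proof -
  let ?n = "real (card V)" and ?X = "ksub V k"
  have Tf: "T \<subseteq> V" "card T = k - i" "finite T" "\<sigma> T \<subseteq> V" "card (\<sigma> T) = i" "\<sigma> T \<inter> T = {}" "\<tau> T \<in> T" if "T \<in> Ts" for T
    using Ts[OF that] finite_subset[OF _ assms(1)] by (auto simp: ksub_def)
  have "\<exists>A\<subseteq>V. real (card Ts) / 2 ^ k \<le> real (card {T\<in>Ts. T \<subseteq> A \<and> \<sigma> T \<inter> A = {}})"
    using Tf assms by (intro exists_separating) auto
  then obtain A where A: "A \<subseteq> V" "real (card Ts) / 2 ^ k \<le> real (card {T\<in>Ts. T \<subseteq> A \<and> \<sigma> T \<inter> A = {}})" by blast
  define TA where "TA = {T\<in>Ts. T \<subseteq> A \<and> \<sigma> T \<inter> A = {}}"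
  have TAf: "T \<in> Ts" "T \<subseteq> A" "\<sigma> T \<inter> A = {}" if "T \<in> TA" for T using that by (auto simp: TA_def)
  have finTA: "finite TA" using assms(4) by (simp add: TA_def)
  define Ga where "Ga a T P = {R\<in>G T P. card (R \<inter> A) = a}" for a T P
  define X1 where "X1 a = {P\<in>?X. card (P \<inter> A) \<noteq> k - i + a}" for a
  define f where "f a Y = (\<Union>T\<in>TA. (\<lambda>R. R \<union> T) ` Ga a T Y)" for a Y
  \<comment> \<open>A lower bound for the number of clauses ruled out in the best layer: averaging
    over the at most \<open>k\<close> values of \<open>a\<close> costs a factor \<open>k\<close>,
    and one clause may contain up to \<open>2 ^ k\<close> of the sets \<open>T\<close>. With the
    factor \<open>2 ^ k\<close> from the separation this gives \<open>k * 4 ^ k\<close>.\<close>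
  define g where "g = b * ?n ^ i * real (card TA) / (real k * 2 ^ k)"
  define Z where "Z a = {P. P \<subseteq> ?X \<and> P \<inter> f a (P \<inter> X1 a) = {} \<and> g \<le> real (card (f a (P \<inter> X1 a)))}" for a
  have GaR: "R \<subseteq> V" "R \<inter> T = {}" "R \<inter> \<sigma> T = {}" "card R = i" "finite R" "card (R \<inter> A) = a" if "R \<in> Ga a T P" for R a T P
    using that finite_subset[OF _ assms(1), of R] by (auto simp: Ga_def Gd ksub_def)
  have finGa: "finite (Ga a T P)" for a T P using assms(1) by (simp add: Ga_def Gd)
  have layer: "R \<union> T \<in> ?X - X1 a" if T: "T \<in> TA" and R: "R \<in> Ga a T P" for R T a P
  proof -
    have "card (R \<union> T) = k" using GaR[OF R] Tf[OF TAf(1)[OF T]] assms(3) by (subst card_Un_disjoint) auto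
    moreover have "(R \<union> T) \<inter> A = (R \<inter> A) \<union> T" using TAf(2)[OF T] by auto
    then have "card ((R \<union> T) \<inter> A) = a + (k - i)" using GaR[OF R] Tf[OF TAf(1)[OF T]]
      by (simp, subst card_Un_disjoint) auto
    ultimately show ?thesis using GaR[OF R] Tf[OF TAf(1)[OF T]] by (auto simp: X1_def ksub_def)
  qed
  \<comment> \<open>The \<open>k\<close>-sets deciding \<open>R \<in> Ga a T P\<close> meet
    \<open>A\<close> in \<open>a + (k - i) - 1\<close> elements, since
    \<open>x \<in> \<sigma> T\<close> is outside \<open>A\<close> and
    \<open>\<tau> T \<in> A\<close> has been dropped.\<close>
  have Gaeq: "Ga a T (P \<inter> X1 a) = Ga a T P" if T: "T \<in> TA" and P: "P \<subseteq> ?X" for a T P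
  proof -
    have "insert x (R \<union> (T - {\<tau> T})) \<in> X1 a"
      if x: "x \<in> \<sigma> T" and R: "R \<in> ksub (V - \<sigma> T - T) i" "card (R \<inter> A) = a" and m: "insert x (R \<union> (T - {\<tau> T})) \<in> P" for x R
    proof -
      have fR: "finite R" using R finite_subset[OF _ assms(1), of R] by (auto simp: ksub_def)
      have "insert x (R \<union> (T - {\<tau> T})) \<inter> A = (R \<inter> A) \<union> (T - {\<tau> T})" using TAf(2,3)[OF T] x by auto
      moreover have "card ((R \<inter> A) \<union> (T - {\<tau> T})) = a + (k - i - 1)"
      proof -
        have "card ((R \<inter> A) \<union> (T - {\<tau> T})) = card (R \<inter> A) + card (T - {\<tau> T})"
          using R fR Tf(3)[OF TAf(1)[OF T]] by (intro card_Un_disjoint) (auto simp: ksub_def)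
        then show ?thesis using R(2) Tf(2,3,7)[OF TAf(1)[OF T]] by simp
      qed
      ultimately have "card (insert x (R \<union> (T - {\<tau> T})) \<inter> A) \<noteq> k - i + a" using assms(3) by simp
      then show ?thesis using m P by (auto simp: X1_def)
    qed
    then show ?thesis unfolding Ga_def Gd by auto
  qed
  have cardf: "real (\<Sum>T\<in>TA. card (Ga a T P)) \<le> 2 ^ k * real (card (f a P))" for a P
  proof -
    have finf: "finite (f a P)" unfolding f_def using finTA finGa by auto
    have fP: "finite C" "card C = k" if "C \<in> f a P" for C
      using that layer finite_subset[OF _ assms(1), of C] unfolding f_def by (auto simp: ksub_def)
    have "(\<Sum>T\<in>TA. card (Ga a T P)) = card (SIGMA T:TA. Ga a T P)" using finTA finGa by (subst card_SigmaI) auto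
    also have "\<dots> \<le> card (SIGMA C:f a P. Pow C)"
    proof (rule card_inj_on_le[where f = "\<lambda>(T,R). (R \<union> T, T)"])
      show "inj_on (\<lambda>(T,R). (R \<union> T, T)) (SIGMA T:TA. Ga a T P)"
      proof (rule inj_onI)
        fix p q assume pq: "p \<in> (SIGMA T:TA. Ga a T P)" "q \<in> (SIGMA T:TA. Ga a T P)"
          "(case p of (T,R) \<Rightarrow> (R \<union> T, T)) = (case q of (T,R) \<Rightarrow> (R \<union> T, T))"
        obtain T R R' where e: "p = (T,R)" "q = (T,R')" "R \<union> T = R' \<union> T" using pq(3) by (cases p, cases q) auto
        have "R \<inter> T = {}" "R' \<inter> T = {}" using GaR(2)[of R a T P] GaR(2)[of R' a T P] pq e by auto
        then show "p = q" using e by blast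
      qed
      show "(\<lambda>(T,R). (R \<union> T, T)) ` (SIGMA T:TA. Ga a T P) \<subseteq> (SIGMA C:f a P. Pow C)" by (auto simp: f_def)
      show "finite (SIGMA C:f a P. Pow C)" using finf fP by (intro finite_SigmaI) auto
    qed
    also have "\<dots> = (\<Sum>C\<in>f a P. card (Pow C))" using finf fP by (intro card_SigmaI) auto
    also have "\<dots> = 2 ^ k * card (f a P)" using fP by (simp add: card_Pow)
    finally have "real (\<Sum>T\<in>TA. card (Ga a T P)) \<le> real (2 ^ k * card (f a P))" by (simp only: of_nat_le_iff)
    then show ?thesis by simp
  qed
  have sub: "{P. P \<subseteq> ?X \<and> (\<forall>T\<in>Ts. b * ?n ^ i \<le> real (card (G T P)) \<and> (\<forall>R\<in>G T P. R \<union> T \<notin> P))} \<subseteq> (\<Union>a\<in>{..i}. Z a)"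
  proof
    fix P assume "P \<in> {P. P \<subseteq> ?X \<and> (\<forall>T\<in>Ts. b * ?n ^ i \<le> real (card (G T P)) \<and> (\<forall>R\<in>G T P. R \<union> T \<notin> P))}"
    then have P: "P \<subseteq> ?X" and big: "\<And>T. T \<in> Ts \<Longrightarrow> b * ?n ^ i \<le> real (card (G T P))"
      and av: "\<And>T R. T \<in> Ts \<Longrightarrow> R \<in> G T P \<Longrightarrow> R \<union> T \<notin> P" by auto
    have GU: "real (card (G T P)) \<le> (\<Sum>a\<in>{..i}. real (card (Ga a T P)))" if "T \<in> TA" for T
    proof -
      have "G T P \<subseteq> (\<Union>a\<in>{..i}. Ga a T P)"
      proof
        fix R assume R: "R \<in> G T P"
        then have "card (R \<inter> A) \<le> card R" using finite_subset[OF _ assms(1), of R] by (intro card_mono) (auto simp: Gd ksub_def)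
        also have "card R = i" using R by (auto simp: Gd ksub_def)
        finally show "R \<in> (\<Union>a\<in>{..i}. Ga a T P)" using R by (auto simp: Ga_def)
      qed
      then have "card (G T P) \<le> card (\<Union>a\<in>{..i}. Ga a T P)" using finGa by (intro card_mono) auto
      also have "\<dots> \<le> (\<Sum>a\<in>{..i}. card (Ga a T P))" by (intro card_UN_le) auto
      finally show ?thesis by (simp only: of_nat_sum[symmetric] of_nat_le_iff)
    qed
    have "real (card {..i}) * (b * ?n ^ i * real (card TA) / real k) \<le> real k * (b * ?n ^ i * real (card TA) / real k)"
      using assms(3,5) by (intro mult_right_mono) auto
    also have "\<dots> = (\<Sum>T\<in>TA. b * ?n ^ i)" using assms(3) by simp
    also have "\<dots> \<le> (\<Sum>T\<in>TA. real (card (G T P)))" using big TAf(1) by (intro sum_mono) blast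
    also have "\<dots> \<le> (\<Sum>T\<in>TA. \<Sum>a\<in>{..i}. real (card (Ga a T P)))" using GU by (intro sum_mono)
    also have "\<dots> = (\<Sum>a\<in>{..i}. \<Sum>T\<in>TA. real (card (Ga a T P)))" by (rule sum.swap)
    finally have "\<exists>a\<in>{..i}. b * ?n ^ i * real (card TA) / real k \<le> (\<Sum>T\<in>TA. real (card (Ga a T P)))"
      by (intro exists_ge_average) auto
    then obtain a where a: "a \<le> i" "b * ?n ^ i * real (card TA) / real k \<le> real (\<Sum>T\<in>TA. card (Ga a T P))" by auto
    have fe: "f a (P \<inter> X1 a) = f a P" unfolding f_def using Gaeq[OF _ P] by simp
    have "g * 2 ^ k = b * ?n ^ i * real (card TA) / real k" by (simp add: g_def)
    then have "2 ^ k * g \<le> 2 ^ k * real (card (f a P))" using a(2) cardf[of a P] by (simp add: mult.commute)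
    then have "g \<le> real (card (f a P))" by simp
    moreover have "P \<inter> f a P = {}"
    proof (rule ccontr)
      assume "P \<inter> f a P \<noteq> {}"
      then obtain T R where "T \<in> TA" "R \<in> Ga a T P" "R \<union> T \<in> P" unfolding f_def by blast
      then show False using av[of T R] TAf(1)[of T] by (auto simp: Ga_def)
    qed
    ultimately have "P \<in> Z a" using P by (simp add: Z_def fe)
    then show "P \<in> (\<Union>a\<in>{..i}. Z a)" using a(1) by blast
  qed
  have Zb: "real (card (Z a)) \<le> 2 powr (real (card ?X) - g)" for a
    unfolding Z_def
  proof (rule card_avoiding[OF finite_ksub[OF assms(1)]])
    show "X1 a \<subseteq> ?X" by (auto simp: X1_def)
    show "f a Y \<subseteq> ?X - X1 a" for Y using layer unfolding f_def by blast
  qed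
  have finZ: "finite (Z a)" for a using assms(1) by (rule_tac finite_subset[of _ "Pow ?X"]) (auto simp: Z_def)
  have "real (card {P. P \<subseteq> ?X \<and> (\<forall>T\<in>Ts. b * ?n ^ i \<le> real (card (G T P)) \<and> (\<forall>R\<in>G T P. R \<union> T \<notin> P))}) \<le> real (card (\<Union>a\<in>{..i}. Z a))"
    using sub finZ by (intro of_nat_mono card_mono) auto
  also have "\<dots> \<le> (\<Sum>a\<in>{..i}. real (card (Z a)))"
    unfolding of_nat_sum[symmetric] of_nat_le_iff by (intro card_UN_le) auto
  also have "\<dots> \<le> (\<Sum>a\<in>{..i}. 2 powr (real (card ?X) - g))" using Zb by (intro sum_mono)
  also have "\<dots> = real (Suc i) * 2 powr (real (card ?X) - g)" by simp
  also have "\<dots> \<le> real k * 2 powr (real (card V choose k) - b / (real k * 4 ^ k) * (?n ^ i * real (card Ts)))"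
  proof (intro mult_mono powr_mono)
    have "(4::real) ^ k = 2 ^ k * 2 ^ k" by (subst power_mult_distrib[symmetric]) simp
    then have "b / (real k * 4 ^ k) * (?n ^ i * real (card Ts)) = b * ?n ^ i / (real k * 2 ^ k) * (real (card Ts) / 2 ^ k)" by simp
    also have "\<dots> \<le> b * ?n ^ i / (real k * 2 ^ k) * real (card TA)" using A(2) assms(5) by (intro mult_left_mono) (auto simp: TA_def)
    also have "\<dots> = g" by (simp add: g_def)
    finally show "real (card ?X) - g \<le> real (card V choose k) - b / (real k * 4 ^ k) * (?n ^ i * real (card Ts))"
      using card_ksub[OF assms(1), of k] by simp
  qed (use assms(3) in auto)
  finally show ?thesis .
qed

section \<open>Formulae without large irregularities\<close>

text \<open>Only \<open>T\<close> is recorded. One clause and one element \<open>t\<close> per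
  \<open>T\<close> are chosen later, at a cost of \<open>k * log 2 n\<close> bits that is dwarfed by
  the saving of order \<open>n ^ i\<close>; knowing \<open>T\<close> already bounds all clauses over
  it through loose families.\<close>

definition typical_sets :: "nat \<Rightarrow> nat set \<Rightarrow> real \<Rightarrow> nat \<Rightarrow> (nat set \<times> nat set) set \<Rightarrow> nat set set" where
  "typical_sets k V b i F = {T\<in>ksub V (k - i). \<exists>S t. card S = i \<and> (S,T) \<in> F \<and> t \<in> T \<and> T - {t} \<notin> atypical k V b S F}"

definition atypical_pairs :: "nat \<Rightarrow> nat set \<Rightarrow> real \<Rightarrow> nat \<Rightarrow> (nat set \<times> nat set) set \<Rightarrow> (nat set \<times> nat set) set" where
  "atypical_pairs k V b i F = (SIGMA S:ksub V i. atypical k V b S F)"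

definition clique_pairs :: "nat \<Rightarrow> nat set \<Rightarrow> nat \<Rightarrow> (nat set \<times> nat set) set \<Rightarrow> (nat set \<times> nat set) set" where
  "clique_pairs k V i A = {(S,T). S \<in> ksub V i \<and> T \<in> ksub V (k - i) \<and> (\<forall>t\<in>T. (S, T - {t}) \<in> A)}"

text \<open>For \<open>card S = k - 1\<close> the only candidate for an atypical set is the empty
  one, so being few means that there is none.\<close>

definition residual :: "nat \<Rightarrow> nat set \<Rightarrow> real \<Rightarrow> real \<Rightarrow> real \<Rightarrow> (nat set \<times> nat set) set set" where
  "residual k V s b \<xi> = {F\<in>sparse_forms k V s. negs F \<noteq> {} \<and> (\<forall>S. (S,{}) \<notin> F) \<and>
     (\<forall>S. S \<subseteq> V \<and> 1 \<le> card S \<and> card S + 2 \<le> k \<longrightarrow> real (card (atypical k V b S F)) \<le> \<xi> * real (card V) ^ (k - 1 - card S)) \<and>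
     (\<forall>S. S \<subseteq> V \<and> card S = k - 1 \<longrightarrow> atypical k V b S F = {})}"

text \<open>The conclusion of \<open>clique_count\<close> with \<open>s = m\<close> and
  \<open>B = D\<close>, for all sizes \<open>m < k\<close> at once.\<close>

definition clique_bound :: "nat \<Rightarrow> real \<Rightarrow> real \<Rightarrow> bool" where
  "clique_bound k e \<xi> \<longleftrightarrow> (\<forall>m V. \<forall>D::nat set set. 1 \<le> m \<and> m < k \<and> finite V \<and> D \<subseteq> ksub V m \<and> real (card D) \<le> \<xi> * real (card V) ^ m \<longrightarrow>
     real (card {T\<in>ksub V (Suc m). \<forall>t\<in>T. T - {t} \<in> D}) \<le> e * real (card V) * real (card D))"

lemma ksub_facets:
  assumes "finite T" "card T = Suc m" "\<forall>t\<in>T. T - {t} \<in> D" shows "ksub T m \<subseteq> D"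
proof
  fix Y assume Y: "Y \<in> ksub T m"
  then have "card (T - Y) = 1" using assms finite_subset[OF _ assms(1), of Y] by (auto simp: ksub_def card_Diff_subset)
  then obtain t where "T - Y = {t}" by (auto simp: card_1_singleton_iff)
  then have "t \<in> T" "Y = T - {t}" using Y by (auto simp: ksub_def)
  then show "Y \<in> D" using assms by simp
qed

lemma exists_clique_bound:
  assumes "e > 0" shows "\<exists>\<xi>>0. clique_bound k e \<xi>"
proof -
  have "\<forall>m\<in>{1..<k}. \<exists>x>0. \<forall>V. \<forall>D::nat set set. finite V \<longrightarrow> D \<subseteq> ksub V m \<longrightarrow> real (card D) \<le> x * real (card V) ^ m \<longrightarrow>
     real (card {T\<in>ksub V (Suc m). (\<forall>t\<in>T. T - {t} \<in> D) \<and> ksub T m \<subseteq> D}) \<le> e * real (card V) * real (card D)"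
  proof
    fix m assume "m \<in> {1..<k}"
    then have m: "1 \<le> m" "m \<le> m" by auto
    obtain x where "x > 0" and x: "\<forall>(V::nat set) D B. finite V \<longrightarrow> D \<subseteq> ksub V m \<longrightarrow> real (card D) \<le> x * real (card V) ^ m \<longrightarrow>
      B \<subseteq> ksub V m \<longrightarrow>
      real (card {T\<in>ksub V (Suc m). (\<forall>t\<in>T. T - {t} \<in> B) \<and> ksub T m \<subseteq> D}) \<le> e * real (card V) * real (card B)"
      using clique_count[OF assms m, where ?'a = nat] by blast
    then show "\<exists>x>0. \<forall>V. \<forall>D::nat set set. finite V \<longrightarrow> D \<subseteq> ksub V m \<longrightarrow> real (card D) \<le> x * real (card V) ^ m \<longrightarrow>
     real (card {T\<in>ksub V (Suc m). (\<forall>t\<in>T. T - {t} \<in> D) \<and> ksub T m \<subseteq> D}) \<le> e * real (card V) * real (card D)"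
      by (intro exI[of _ x]) auto
  qed
  then obtain x where x: "\<forall>m\<in>{1..<k}. x m > 0 \<and> (\<forall>V. \<forall>D::nat set set. finite V \<longrightarrow> D \<subseteq> ksub V m \<longrightarrow> real (card D) \<le> x m * real (card V) ^ m \<longrightarrow>
     real (card {T\<in>ksub V (Suc m). (\<forall>t\<in>T. T - {t} \<in> D) \<and> ksub T m \<subseteq> D}) \<le> e * real (card V) * real (card D))"
    using bchoice[of "{1..<k}" "\<lambda>m x. x > 0 \<and> (\<forall>V. \<forall>D::nat set set. finite V \<longrightarrow> D \<subseteq> ksub V m \<longrightarrow> real (card D) \<le> x * real (card V) ^ m \<longrightarrow>
     real (card {T\<in>ksub V (Suc m). (\<forall>t\<in>T. T - {t} \<in> D) \<and> ksub T m \<subseteq> D}) \<le> e * real (card V) * real (card D))"] by auto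
  define y where "y = Min (insert 1 (x ` {1..<k}))"
  have y: "y > 0" unfolding y_def using x by (subst Min_gr_iff) auto
  have yx: "y \<le> x m" if "m \<in> {1..<k}" for m unfolding y_def using that by (intro Min_le) auto
  have "clique_bound k e y"
    unfolding clique_bound_def
  proof (intro allI impI, elim conjE)
    fix m V and D :: "nat set set"
    assume h: "1 \<le> m" "m < k" "finite V" "D \<subseteq> ksub V m" "real (card D) \<le> y * real (card V) ^ m"
    have m: "m \<in> {1..<k}" using h by simp
    have "y * real (card V) ^ m \<le> x m * real (card V) ^ m" using yx[OF m] by (intro mult_right_mono) auto
    then have "real (card {T\<in>ksub V (Suc m). (\<forall>t\<in>T. T - {t} \<in> D) \<and> ksub T m \<subseteq> D}) \<le> e * real (card V) * real (card D)"
      using x m h(3-5) by (meson order_trans)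
    moreover have "{T\<in>ksub V (Suc m). (\<forall>t\<in>T. T - {t} \<in> D) \<and> ksub T m \<subseteq> D} = {T\<in>ksub V (Suc m). \<forall>t\<in>T. T - {t} \<in> D}"
      using ksub_facets[of _ m D] finite_subset[OF _ h(3)] by (auto simp: ksub_def)
    ultimately show "real (card {T\<in>ksub V (Suc m). \<forall>t\<in>T. T - {t} \<in> D}) \<le> e * real (card V) * real (card D)" by simp
  qed
  then show ?thesis using y by blast
qed

lemma atypical_sub: "atypical k V b S F \<subseteq> ksub V (k - 1 - card S)"
  by (auto simp: atypical_def ksub_def)

lemma finite_atypical_pairs: "finite V \<Longrightarrow> finite (atypical_pairs k V b i F)"
  unfolding atypical_pairs_def by (intro finite_SigmaI) (auto simp: atypical_def)

text \<open>Apply \<open>clique_bound\<close> to the atypical sets of each \<open>S\<close>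
  separately and add up; linearity in the size of the family makes the sum come out without loss.
  For \<open>i = k - 1\<close> there are no atypical pairs, while a one-element \<open>T\<close> has
  a facet, so nothing is left.\<close>

lemma card_clique_pairs_atypical_pairs:
  assumes "finite V" "F \<in> residual k V s b \<xi>" "clique_bound k e \<xi>" "1 \<le> i" "i < k" "e \<ge> 0"
  shows "real (card (clique_pairs k V i (atypical_pairs k V b i F))) \<le> e * real (card V) * real (card (atypical_pairs k V b i F))"
proof (cases "i + 2 \<le> k")
  case False
  then have i: "i = k - 1" using assms(5) by simp
  have "atypical k V b S F = {}" if "S \<in> ksub V i" for S using that assms(2) i by (auto simp: residual_def ksub_def)
  then have "atypical_pairs k V b i F = {}" by (auto simp: atypical_pairs_def)
  moreover have "T \<noteq> {}" if "T \<in> ksub V (k - i)" for T using that assms(5) by (auto simp: ksub_def)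
  ultimately have "clique_pairs k V i (atypical_pairs k V b i F) = {}" by (auto simp: clique_pairs_def)
  then show ?thesis using assms(6) by simp
next
  case True
  define m where "m = k - 1 - i"
  have m: "1 \<le> m" "m < k" "k - i = Suc m" using True assms(4) by (auto simp: m_def)
  let ?C = "\<lambda>S. {T\<in>ksub V (Suc m). \<forall>t\<in>T. T - {t} \<in> atypical k V b S F}"
  have fin: "finite (?C S)" for S using assms(1) by simp
  have "clique_pairs k V i (atypical_pairs k V b i F) \<subseteq> (SIGMA S:ksub V i. ?C S)" by (auto simp: clique_pairs_def atypical_pairs_def m(3))
  then have "card (clique_pairs k V i (atypical_pairs k V b i F)) \<le> card (SIGMA S:ksub V i. ?C S)"
    using assms(1) fin by (intro card_mono finite_SigmaI) auto
  also have "\<dots> = (\<Sum>S\<in>ksub V i. card (?C S))" using assms(1) fin by (intro card_SigmaI) auto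
  finally have "real (card (clique_pairs k V i (atypical_pairs k V b i F))) \<le> (\<Sum>S\<in>ksub V i. real (card (?C S)))"
    by (simp only: of_nat_sum[symmetric] of_nat_le_iff)
  also have "\<dots> \<le> (\<Sum>S\<in>ksub V i. e * real (card V) * real (card (atypical k V b S F)))"
  proof (rule sum_mono)
    fix S assume S: "S \<in> ksub V i"
    have "real (card (atypical k V b S F)) \<le> \<xi> * real (card V) ^ m"
      using assms(2,4) S True by (auto simp: residual_def ksub_def m_def)
    moreover have "atypical k V b S F \<subseteq> ksub V m" using atypical_sub[of k V b S F] S by (simp add: ksub_def m_def)
    ultimately show "real (card (?C S)) \<le> e * real (card V) * real (card (atypical k V b S F))"
      using assms(1,3) m(1,2) unfolding clique_bound_def by blast
  qed
  also have "\<dots> = e * real (card V) * real (\<Sum>S\<in>ksub V i. card (atypical k V b S F))" by (simp add: sum_distrib_left)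
  also have "(\<Sum>S\<in>ksub V i. card (atypical k V b S F)) = card (atypical_pairs k V b i F)"
    unfolding atypical_pairs_def using assms(1) by (subst card_SigmaI) (auto simp: atypical_def)
  finally show ?thesis .
qed

text \<open>Up to constants, \<open>n ^ i\<close> and \<open>n\<close> are what a typical set and an atypical pair save.\<close>

definition weight :: "nat \<Rightarrow> nat \<Rightarrow> (nat \<Rightarrow> nat set set) \<Rightarrow> (nat \<Rightarrow> (nat set \<times> nat set) set) \<Rightarrow> nat" where
  "weight k n Tf Af = (\<Sum>i\<in>{1..<k}. card (Tf i) * n ^ i + card (Af i) * n)"

lemma residual_pair:
  assumes "finite V" "F \<in> residual k V s b \<xi>" "(S,T) \<in> F" "S \<noteq> {}"
  shows "card S \<in> {1..<k}" "S \<in> ksub V (card S)" "T \<in> ksub V (k - card S)" "T \<noteq> {}" "S \<inter> T = {}"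
proof -
  have p: "(S,T) \<in> pairs k V" using assms(2,3) sparse_forms_sub[of F k V s] by (auto simp: residual_def)
  then have fin: "finite S" "finite T" using finite_subset[OF _ assms(1)] by (auto simp: pairs_def)
  show T: "T \<noteq> {}" using assms(2,3) by (auto simp: residual_def)
  have "card S > 0" "card T > 0" using fin assms(4) T by (auto simp: card_gt_0_iff)
  then show "card S \<in> {1..<k}" using p by (auto simp: pairs_def)
  show "S \<in> ksub V (card S)" "T \<in> ksub V (k - card S)" "S \<inter> T = {}" using p by (auto simp: pairs_def ksub_def)
qed

text \<open>Some clause has a negated variable. If its positive part is not typical, removing any
  element of it yields an atypical pair; either way the weight receives a summand of at least
  \<open>n\<close>.\<close>

lemma weight_ge:
  assumes "finite V" "F \<in> residual k V s b \<xi>" "card V \<ge> 1"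
  shows "card V \<le> weight k (card V) (\<lambda>i. typical_sets k V b i F) (\<lambda>i. atypical_pairs k V b i F)"
proof -
  obtain S T where ST: "(S,T) \<in> F" "S \<noteq> {}" using assms(2) by (auto simp: residual_def negs_def)
  note p = residual_pair[OF assms(1,2) ST]
  let ?i = "card S"
  have finT: "finite (typical_sets k V b ?i F)" using assms(1) by (simp add: typical_sets_def)
  have "card V \<le> card (typical_sets k V b ?i F) * card V ^ ?i + card (atypical_pairs k V b ?i F) * card V"
  proof (cases "T \<in> typical_sets k V b ?i F")
    case True
    then have "card (typical_sets k V b ?i F) \<ge> 1" using finT by (metis One_nat_def Suc_leI card_gt_0_iff empty_iff)
    moreover have "card V ^ 1 \<le> card V ^ ?i" using p(1) assms(3) by (intro power_increasing) auto
    ultimately have "1 * card V \<le> card (typical_sets k V b ?i F) * card V ^ ?i" by (intro mult_mono) auto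
    then show ?thesis by linarith
  next
    case False
    obtain t where "t \<in> T" using p(4) by auto
    then have "(S, T - {t}) \<in> atypical_pairs k V b ?i F" using False p ST by (auto simp: typical_sets_def atypical_pairs_def)
    then have "card (atypical_pairs k V b ?i F) \<ge> 1" using finite_atypical_pairs[OF assms(1)] by (metis One_nat_def Suc_leI card_gt_0_iff empty_iff)
    then have "1 * card V \<le> card (atypical_pairs k V b ?i F) * card V" by (intro mult_right_mono) auto
    then show ?thesis by linarith
  qed
  also have "\<dots> \<le> weight k (card V) (\<lambda>i. typical_sets k V b i F) (\<lambda>i. atypical_pairs k V b i F)"
    unfolding weight_def using p(1) by (intro member_le_sum) auto
  finally show ?thesis .
qed

text \<open>Once the typical sets and atypical pairs are known, the clauses over a typical set form
  a loose family of cost \<open>e * n ^ i\<close>, and any other clause has only atypical facets,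
  hence lies among at most \<open>e * n * card (Af i)\<close> pairs. The cost is proportional to the
  weight, with the small factor \<open>e\<close>.\<close>

lemma fibre_negs_count:
  assumes "finite V" "H \<subseteq> residual k V s b \<xi>" "cheap k V s e" "clique_bound k e \<xi>" "e \<ge> 0"
    and H: "\<And>F i. F \<in> H \<Longrightarrow> i \<in> {1..<k} \<Longrightarrow> typical_sets k V b i F = Tf i \<and> atypical_pairs k V b i F = Af i"
  shows "real (card (negs ` H)) \<le> 2 powr (e * real (weight k (card V) Tf Af))"
proof (cases "H = {}")
  case False
  then obtain F1 where F1: "F1 \<in> H" by auto
  let ?n = "real (card V)" and ?I = "{1..<k}"
  have Hs: "H \<subseteq> sparse_forms k V s" using assms(2) by (auto simp: residual_def)
  have finH: "finite H" using finite_subset[OF Hs finite_sparse_forms[OF assms(1)]] .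
  define p where "p i F = (\<Union>T\<in>Tf i. (\<lambda>S. (S,T)) ` neg_parts F T)" for i F
  define r where "r i F = {(S,T). (S,T) \<in> F \<and> card S = i \<and> T \<notin> Tf i}" for i and F :: "(nat set \<times> nat set) set"
  have Tfk: "Tf i \<subseteq> ksub V (k - i)" if "i \<in> ?I" for i using H[OF F1 that] by (auto simp: typical_sets_def)
  have finTf: "finite (Tf i)" if "i \<in> ?I" for i using finite_subset[OF Tfk[OF that]] assms(1) by simp
  have dec: "negs F = (\<Union>i\<in>?I. p i F \<union> r i F)" if F: "F \<in> H" for F
  proof (rule set_eqI)
    fix q :: "nat set \<times> nat set"
    obtain S T where q: "q = (S,T)" by (cases q)
    show "q \<in> negs F \<longleftrightarrow> q \<in> (\<Union>i\<in>?I. p i F \<union> r i F)"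
    proof
      assume "q \<in> negs F"
      then have ST: "(S,T) \<in> F" "S \<noteq> {}" unfolding q negs_def by auto
      have "card S \<in> ?I" by (rule residual_pair(1)[OF assms(1) subsetD[OF assms(2) F] ST])
      moreover have "q \<in> p (card S) F \<union> r (card S) F" unfolding q p_def r_def neg_parts_def using ST by auto
      ultimately show "q \<in> (\<Union>i\<in>?I. p i F \<union> r i F)" by blast
    next
      assume "q \<in> (\<Union>i\<in>?I. p i F \<union> r i F)"
      then obtain i where i: "i \<in> ?I" "q \<in> p i F \<union> r i F" by blast
      have m: "(S,T) \<in> F" using i(2) unfolding q p_def r_def neg_parts_def by auto
      have pr: "(S,T) \<in> pairs k V" using m sparse_forms_sub[OF subsetD[OF Hs F]] by blast
      have "card S = i"
      proof (cases "q \<in> r i F")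
        case True then show ?thesis unfolding q r_def by simp
      next
        case False
        then have "T \<in> Tf i" using i(2) unfolding q p_def by auto
        then have "card T = k - i" using Tfk[OF i(1)] by (auto simp: ksub_def)
        then show ?thesis using pr i(1) by (auto simp: pairs_def)
      qed
      then have "S \<noteq> {}" using i(1) by auto
      then show "q \<in> negs F" using m unfolding q negs_def by simp
    qed
  qed
  have pc: "real (card (p i ` H)) \<le> 2 powr (e * (real (card (Tf i)) * ?n ^ i))" if i: "i \<in> ?I" for i
    unfolding p_def
  proof (rule card_UN_loose_families_le[OF finTf[OF i] finH assms(1) _ assms(3), where m = "\<lambda>_. i"])
    fix T assume "T \<in> Tf i"
    then have "card T = k - i" using Tfk[OF i] by (auto simp: ksub_def)
    then have "k - card T = i" using i by auto
    then show "card ((\<lambda>F. (\<lambda>S. (S,T)) ` neg_parts F T) ` H) \<le> card (loose_families V i s)" using card_neg_parts_image[OF assms(1) Hs, of T] by simp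
  qed (use i in auto)
  have rc: "real (card (r i ` H)) \<le> 2 powr (e * (real (card (Af i)) * ?n))" if i: "i \<in> ?I" for i
  proof -
    have finC: "finite (clique_pairs k V i (Af i))" using assms(1)
      by (rule_tac finite_subset[of _ "ksub V i \<times> ksub V (k - i)"]) (auto simp: clique_pairs_def)
    have "r i ` H \<subseteq> Pow (clique_pairs k V i (Af i))"
    proof (intro image_subsetI PowI subsetI)
      fix F q assume F: "F \<in> H" and q: "q \<in> r i F"
      obtain S T where e: "q = (S,T)" "(S,T) \<in> F" "card S = i" "T \<notin> Tf i" using q unfolding r_def by blast
      have S0: "S \<noteq> {}" using e(3) i by auto
      note pp = residual_pair[OF assms(1) subsetD[OF assms(2) F] e(2) S0]
      have "(S, T - {t}) \<in> Af i" if "t \<in> T" for t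
      proof -
        have "T \<notin> typical_sets k V b i F" using H[OF F i] e(4) by simp
        then have "T - {t} \<in> atypical k V b S F" using that e(2,3) pp(3) by (auto simp: typical_sets_def)
        then have "(S, T - {t}) \<in> atypical_pairs k V b i F" using pp(2) e(3) by (simp add: atypical_pairs_def)
        then show ?thesis using H[OF F i] by simp
      qed
      then show "q \<in> clique_pairs k V i (Af i)" using pp e by (auto simp: clique_pairs_def)
    qed
    then have "card (r i ` H) \<le> card (Pow (clique_pairs k V i (Af i)))" using finC by (intro card_mono) auto
    then have "real (card (r i ` H)) \<le> real (card (Pow (clique_pairs k V i (Af i))))" by (simp only: of_nat_le_iff)
    also have "\<dots> = 2 powr real (card (clique_pairs k V i (Af i)))" using finC by (simp add: card_Pow powr_realpow)
    also have "\<dots> \<le> 2 powr (e * (real (card (Af i)) * ?n))"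
    proof (rule powr_mono)
      show "real (card (clique_pairs k V i (Af i))) \<le> e * (real (card (Af i)) * ?n)"
        using card_clique_pairs_atypical_pairs[OF assms(1) subsetD[OF assms(2) F1] assms(4), of i] H[OF F1 i] i assms(5) by (simp add: algebra_simps)
    qed simp
    finally show ?thesis .
  qed
  have img: "negs ` H = (\<lambda>F. \<Union>i\<in>?I. p i F \<union> r i F) ` H" using dec by (intro image_cong) auto
  have "real (card (negs ` H)) \<le> real (\<Prod>i\<in>?I. card ((\<lambda>F. p i F \<union> r i F) ` H))"
    unfolding img using card_image_UN_le[of ?I H "\<lambda>i F. p i F \<union> r i F"] finH by (simp only: of_nat_le_iff) simp
  also have "\<dots> \<le> (\<Prod>i\<in>?I. 2 powr (e * real (card (Tf i) * card V ^ i + card (Af i) * card V)))"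
    unfolding of_nat_prod
  proof (rule prod_mono, safe)
    fix i assume i: "i \<in> ?I"
    have "real (card ((\<lambda>F. p i F \<union> r i F) ` H)) \<le> real (card (p i ` H) * card (r i ` H))"
      using card_image_Un_le[OF finH, of "p i" "r i"] by (simp only: of_nat_le_iff)
    also have "\<dots> \<le> 2 powr (e * (real (card (Tf i)) * ?n ^ i)) * 2 powr (e * (real (card (Af i)) * ?n))"
      unfolding of_nat_mult using pc[OF i] rc[OF i] by (intro mult_mono) auto
    also have "\<dots> = 2 powr (e * real (card (Tf i) * card V ^ i + card (Af i) * card V))"
      by (simp add: powr_add[symmetric] algebra_simps)
    finally show "real (card ((\<lambda>F. p i F \<union> r i F) ` H)) \<le> 2 powr (e * real (card (Tf i) * card V ^ i + card (Af i) * card V))" .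
  qed simp
  also have "\<dots> = 2 powr (e * real (weight k (card V) Tf Af))"
    unfolding weight_def by (simp add: powr_sum[symmetric] sum_distrib_left del: of_nat_add of_nat_mult)
  finally show ?thesis .
qed simp

section \<open>Counting residual formulae by weight\<close>

lemma power_eq_powr_log: "n \<ge> 1 \<Longrightarrow> real n ^ k = 2 powr (real k * log 2 (real n))"
proof -
  assume n: "n \<ge> 1"
  have "2 powr (real k * log 2 (real n)) = (2 powr log 2 (real n)) powr real k" by (simp add: powr_powr mult.commute)
  also have "\<dots> = real n powr real k" using n by simp
  also have "\<dots> = real n ^ k" using n by (subst powr_realpow) auto
  finally show ?thesis by simp
qed

text \<open>For each typical \<open>T\<close> a clause and an element \<open>t\<close> with
  \<open>T - {t}\<close> not atypical are chosen by a function \<open>f\<close>; the at most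
  \<open>n ^ k\<close> choices per \<open>T\<close> cost at most \<open>e * n ^ i\<close> bits. For
  fixed \<open>f\<close> the savings of typical sets apply. Half of \<open>b\<close> is lost because
  the extensions \<open>R\<close> must also avoid \<open>t\<close>, which excludes at most
  \<open>n ^ (i - 1)\<close> of them.\<close>

lemma fibre_pos_count_typical:
  assumes "finite V" "H \<subseteq> residual k V s b \<xi>" "b > 0" "i \<in> {1..<k}" "real (card V) \<ge> 2 / b"
    and lg: "real k * log 2 (real (card V)) \<le> e * real (card V)" "card V \<ge> 1" "e \<ge> 0"
    and H: "\<And>F. F \<in> H \<Longrightarrow> typical_sets k V b i F = Tf" and Tf: "Tf \<subseteq> ksub V (k - i)"
  shows "real (card (pos ` H)) \<le> 2 powr (e * (real (card V) ^ i * real (card Tf))) *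
    (real k * 2 powr (real (card V choose k) - b / 2 / (real k * 4 ^ k) * (real (card V) ^ i * real (card Tf))))"
proof -
  let ?n = "real (card V)"
  have i: "1 \<le> i" "i < k" using assms(4) by auto
  have finTf: "finite Tf" using finite_subset[OF Tf] assms(1) by simp
  define Vd where "Vd = {f\<in>Tf \<rightarrow>\<^sub>E ksub V i \<times> V. \<forall>T\<in>Tf. fst (f T) \<inter> T = {} \<and> snd (f T) \<in> T}"
  define G where "G f T P = {R\<in>ksub (V - fst (f T) - T) i. \<forall>x\<in>fst (f T). insert x (R \<union> (T - {snd (f T)})) \<in> P}"
    for f :: "nat set \<Rightarrow> nat set \<times> nat" and T P
  define Z where "Z f = {P. P \<subseteq> ksub V k \<and> (\<forall>T\<in>Tf. b / 2 * ?n ^ i \<le> real (card (G f T P)) \<and> (\<forall>R\<in>G f T P. R \<union> T \<notin> P))}" for f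
  have finVd: "finite Vd" unfolding Vd_def
    by (rule finite_subset[of _ "Tf \<rightarrow>\<^sub>E ksub V i \<times> V"]) (use finTf assms(1) in \<open>auto intro!: finite_PiE\<close>)
  have finZ: "finite (Z f)" for f using assms(1) by (rule_tac finite_subset[of _ "Pow (ksub V k)"]) (auto simp: Z_def)
  have sub: "pos ` H \<subseteq> (\<Union>f\<in>Vd. Z f)"
  proof (rule image_subsetI)
    fix F assume F: "F \<in> H"
    have FB: "F \<in> residual k V s b \<xi>" using assms(2) F by blast
    have Fs: "F \<in> sparse_forms k V s" using FB by (simp add: residual_def)
    have Fm: "F \<in> minimal_forms k V" using Fs sparse_forms_minimal_forms by blast
    have "\<forall>T\<in>Tf. \<exists>p. card (fst p) = i \<and> (fst p,T) \<in> F \<and> snd p \<in> T \<and> T - {snd p} \<notin> atypical k V b (fst p) F"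
    proof
      fix T assume "T \<in> Tf"
      then have "T \<in> typical_sets k V b i F" using H[OF F] by simp
      then obtain S t where "card S = i \<and> (S,T) \<in> F \<and> t \<in> T \<and> T - {t} \<notin> atypical k V b S F" unfolding typical_sets_def by blast
      then show "\<exists>p. card (fst p) = i \<and> (fst p,T) \<in> F \<and> snd p \<in> T \<and> T - {snd p} \<notin> atypical k V b (fst p) F"
        by (intro exI[of _ "(S,t)"]) simp
    qed
    then obtain f0 where f0: "\<forall>T\<in>Tf. card (fst (f0 T)) = i \<and> (fst (f0 T),T) \<in> F \<and> snd (f0 T) \<in> T \<and> T - {snd (f0 T)} \<notin> atypical k V b (fst (f0 T)) F"
      using bchoice[of Tf "\<lambda>T p. card (fst p) = i \<and> (fst p,T) \<in> F \<and> snd p \<in> T \<and> T - {snd p} \<notin> atypical k V b (fst p) F"] by blast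
    define f where "f = restrict f0 Tf"
    have f: "card (fst (f T)) = i" "(fst (f T),T) \<in> F" "snd (f T) \<in> T" "T - {snd (f T)} \<notin> atypical k V b (fst (f T)) F"
      "fst (f T) \<noteq> {}" "fst (f T) \<in> ksub V i" "fst (f T) \<inter> T = {}" "T \<in> ksub V (k - i)" if T: "T \<in> Tf" for T
    proof -
      show a: "card (fst (f T)) = i" "(fst (f T),T) \<in> F" "snd (f T) \<in> T" "T - {snd (f T)} \<notin> atypical k V b (fst (f T)) F"
        using f0 T by (auto simp: f_def)
      show b: "fst (f T) \<noteq> {}" using a(1) i(1) by auto
      show "fst (f T) \<in> ksub V i" "fst (f T) \<inter> T = {}" "T \<in> ksub V (k - i)"
        using residual_pair[OF assms(1) FB a(2) b] a(1) by auto
    qed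
    have "f \<in> Tf \<rightarrow>\<^sub>E ksub V i \<times> V"
    proof (rule PiE_I)
      fix T assume T: "T \<in> Tf"
      have "snd (f T) \<in> V" using f(3,8)[OF T] by (auto simp: ksub_def)
      then show "f T \<in> ksub V i \<times> V" using f(6)[OF T] by (simp add: mem_Times_iff)
    qed (simp add: f_def)
    then have fV: "f \<in> Vd" using f(3,7) by (auto simp: Vd_def)
    have "b / 2 * ?n ^ i \<le> real (card (G f T (pos F))) \<and> (\<forall>R\<in>G f T (pos F). R \<union> T \<notin> pos F)" if T: "T \<in> Tf" for T
    proof
      define S t where "S = fst (f T)" and "t = snd (f T)"
      have ft: "card S = i" "(S,T) \<in> F" "t \<in> T" "T - {t} \<notin> atypical k V b S F" "S \<noteq> {}" "S \<subseteq> V" "S \<inter> T = {}" "T \<subseteq> V" "card T = k - i"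
        using f[OF T] by (auto simp: S_def t_def ksub_def)
      have finT: "finite T" by (rule finite_subset[OF ft(8) assms(1)])
      have "T - {t} \<in> ksub (V - S) (k - 1 - i)" using ft finT by (auto simp: ksub_def)
      then have big: "b * ?n ^ i \<le> real (card (extensions V F S (T - {t})))" using ft(1,4) by (auto simp: atypical_def)
      have ee: "extensions V F S (T - {t}) = pos_extensions V (pos F) S (T - {t})" using ft(7) by (intro extensions_pos_extensions) auto
      obtain i' where i': "i = Suc i'" using i(1) by (cases i) auto
      let ?D = "{R\<in>ksub V (Suc i'). R \<inter> {t} \<noteq> {}}"
      have "extensions V F S (T - {t}) \<subseteq> G f T (pos F) \<union> ?D"
        unfolding ee pos_extensions_def G_def S_def[symmetric] t_def[symmetric] ft(1) i'[symmetric] by (auto simp: ksub_def)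
      then have "card (extensions V F S (T - {t})) \<le> card (G f T (pos F)) + card ?D"
        using assms(1) by (intro order_trans[OF card_mono card_Un_le]) (auto simp: G_def)
      then have "real (card (extensions V F S (T - {t}))) \<le> real (card (G f T (pos F))) + real (card ?D)" by linarith
      moreover have "real (card ?D) \<le> real (card {t}) * ?n ^ i'" using ft(3,8) by (intro card_meeting[OF assms(1)]) auto
      moreover have "1 * ?n ^ i' \<le> (b / 2 * ?n) * ?n ^ i'" using assms(3,5) by (intro mult_right_mono) (auto simp: field_simps)
      moreover have "(b / 2 * ?n) * ?n ^ i' = b / 2 * ?n ^ i" by (simp add: i')
      moreover have "real (card {t}) * ?n ^ i' = 1 * ?n ^ i'" by simp
      ultimately show "b / 2 * ?n ^ i \<le> real (card (G f T (pos F)))" using big by linarith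
      show "\<forall>R\<in>G f T (pos F). R \<union> T \<notin> pos F"
      proof
        fix R assume R: "R \<in> G f T (pos F)"
        then have R': "R \<subseteq> V - S - T" "\<forall>x\<in>S. insert x (R \<union> (T - {t})) \<in> pos F"
          unfolding G_def S_def[symmetric] t_def[symmetric] ksub_def by blast+
        have "({}, R \<union> T) \<notin> F"
        proof (rule killed[OF Fm ft(2,5)])
          show "\<forall>x\<in>S. \<exists>Q\<in>plink F x. Q \<subseteq> R \<union> T"
          proof
            fix x assume x: "x \<in> S"
            have "x \<notin> R" "x \<notin> T" using R'(1) ft(7) x by blast+
            moreover have "insert x (R \<union> (T - {t})) \<in> pos F" using R'(2) x by blast
            ultimately have "R \<union> (T - {t}) \<in> plink F x" unfolding plink_pos by simp
            moreover have "R \<union> (T - {t}) \<subseteq> R \<union> T" by auto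
            ultimately show "\<exists>Q\<in>plink F x. Q \<subseteq> R \<union> T" by (rule bexI[rotated])
          qed
        qed (use R' ft(7) in auto)
        then show "R \<union> T \<notin> pos F" by (simp add: pos_def)
      qed
    qed
    moreover have "pos F \<subseteq> ksub V k" by (rule pos_sub[OF sparse_forms_sub[OF Fs]])
    ultimately have "pos F \<in> Z f" by (simp add: Z_def)
    then show "pos F \<in> (\<Union>f\<in>Vd. Z f)" using fV by blast
  qed
  have Zb: "real (card (Z f)) \<le> real k * 2 powr (real (card V choose k) - b / 2 / (real k * 4 ^ k) * (?n ^ i * real (card Tf)))"
    if f: "f \<in> Vd" for f
    unfolding Z_def
  proof (rule typical_savings[OF assms(1) i finTf, where \<sigma> = "\<lambda>T. fst (f T)" and \<tau> = "\<lambda>T. snd (f T)"])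
    fix T assume T: "T \<in> Tf"
    have "f T \<in> ksub V i \<times> V" using f T by (auto simp: Vd_def)
    then show "T \<in> ksub V (k - i) \<and> fst (f T) \<in> ksub V i \<and> fst (f T) \<inter> T = {} \<and> snd (f T) \<in> T"
      using f T Tf by (auto simp: Vd_def)
  qed (use assms(3) in \<open>auto simp: G_def\<close>)
  have Vdc: "real (card Vd) \<le> 2 powr (e * (?n ^ i * real (card Tf)))"
  proof -
    have "card Vd \<le> card (Tf \<rightarrow>\<^sub>E ksub V i \<times> V)"
      unfolding Vd_def using finTf assms(1) by (intro card_mono finite_PiE) auto
    also have "\<dots> = (card (ksub V i) * card V) ^ card Tf" using finTf by (simp add: card_PiE card_cartesian_product)
    finally have "real (card Vd) \<le> (real (card (ksub V i)) * ?n) ^ card Tf"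
      by (simp only: of_nat_mult[symmetric] of_nat_power[symmetric] of_nat_le_iff)
    also have "\<dots> \<le> (?n ^ k) ^ card Tf"
    proof (rule power_mono)
      have "real (card (ksub V i)) * ?n \<le> ?n ^ i * ?n" using card_ksub_le[OF assms(1)] by (intro mult_right_mono) auto
      also have "\<dots> = ?n ^ Suc i" by simp
      also have "\<dots> \<le> ?n ^ k" using i(2) lg(2) by (intro power_increasing) auto
      finally show "real (card (ksub V i)) * ?n \<le> ?n ^ k" .
    qed simp
    also have "\<dots> = 2 powr (real k * log 2 ?n * real (card Tf))"
      by (simp add: power_eq_powr_log[OF lg(2)] powr_power mult.commute mult.left_commute)
    also have "\<dots> \<le> 2 powr (e * (?n ^ i * real (card Tf)))"
    proof (rule powr_mono)
      have "real k * log 2 ?n * real (card Tf) \<le> (e * ?n) * real (card Tf)" using lg(1) by (intro mult_right_mono) auto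
      also have "\<dots> \<le> (e * ?n ^ i) * real (card Tf)"
        using lg i(1) by (intro mult_right_mono mult_left_mono self_le_power) auto
      finally show "real k * log 2 ?n * real (card Tf) \<le> e * (?n ^ i * real (card Tf))" by (simp add: mult.assoc)
    qed simp
    finally show ?thesis .
  qed
  have "real (card (pos ` H)) \<le> real (card (\<Union>f\<in>Vd. Z f))" using sub finVd finZ by (intro of_nat_mono card_mono) auto
  also have "\<dots> \<le> (\<Sum>f\<in>Vd. real (card (Z f)))"
    unfolding of_nat_sum[symmetric] of_nat_le_iff by (rule card_UN_le[OF finVd])
  also have "\<dots> \<le> (\<Sum>f\<in>Vd. real k * 2 powr (real (card V choose k) - b / 2 / (real k * 4 ^ k) * (?n ^ i * real (card Tf))))"
    using Zb by (intro sum_mono)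
  also have "\<dots> = real (card Vd) * (real k * 2 powr (real (card V choose k) - b / 2 / (real k * 4 ^ k) * (?n ^ i * real (card Tf))))" by simp
  also have "\<dots> \<le> 2 powr (e * (?n ^ i * real (card Tf))) * (real k * 2 powr (real (card V choose k) - b / 2 / (real k * 4 ^ k) * (?n ^ i * real (card Tf))))"
    using Vdc by (intro mult_right_mono) auto
  finally show ?thesis .
qed

lemma fibre_pos_count_atypical:
  assumes "finite V" "H \<subseteq> residual k V s b \<xi>" "i \<in> {1..<k}" "real (card V) \<ge> real k * 2 ^ (k + 1)"
    and b: "b \<le> tuple_gain i * (1 / (real k * 2 ^ (k + 1))) ^ k"
    and H: "\<And>F. F \<in> H \<Longrightarrow> atypical_pairs k V b i F = Af" and "H \<noteq> {}"
  shows "real (card (pos ` H)) \<le> 2 powr (real (card V choose k) -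
    tuple_gain i * (1 / (real k * 2 ^ (k + 1))) ^ k / (2 ^ (k + 1) * real k ^ 2) * (real (card V) * real (card Af)))"
proof -
  let ?Z = "{P. P \<subseteq> ksub V k \<and> (\<forall>(S,T)\<in>Af. real (card (pos_extensions V P S T)) < b * real (card V) ^ i)}"
  have finZ: "finite ?Z" using assms(1) by (rule_tac finite_subset[of _ "Pow (ksub V k)"]) auto
  obtain F1 where F1: "F1 \<in> H" using assms(7) by auto
  have AfD: "S \<in> ksub V i \<and> T \<in> ksub (V - S) (k - 1 - i)" if "(S,T) \<in> Af" for S T
  proof -
    have "(S,T) \<in> atypical_pairs k V b i F1" using that H[OF F1] by simp
    then show ?thesis by (auto simp: atypical_pairs_def atypical_def ksub_def)
  qed
  have "pos ` H \<subseteq> ?Z"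
  proof (rule image_subsetI)
    fix F assume F: "F \<in> H"
    have Fs: "F \<in> sparse_forms k V s" using assms(2) F by (auto simp: residual_def)
    have "real (card (pos_extensions V (pos F) S T)) < b * real (card V) ^ i" if ST: "(S,T) \<in> Af" for S T
    proof -
      have "(S,T) \<in> atypical_pairs k V b i F" using ST H[OF F] by simp
      then have "real (card (extensions V F S T)) < b * real (card V) ^ i" by (auto simp: atypical_pairs_def atypical_def ksub_def)
      moreover have "T \<inter> S = {}" using AfD[OF ST] by (auto simp: ksub_def)
      ultimately show ?thesis by (simp add: extensions_pos_extensions)
    qed
    then show "pos F \<in> ?Z" using pos_sub[OF sparse_forms_sub[OF Fs]] by auto
  qed
  then have "card (pos ` H) \<le> card ?Z" using finZ by (intro card_mono)
  then have "real (card (pos ` H)) \<le> real (card ?Z)" by (simp only: of_nat_le_iff)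
  also have "\<dots> \<le> 2 powr (real (card V choose k) -
    tuple_gain i * (1 / (real k * 2 ^ (k + 1))) ^ k / (2 ^ (k + 1) * real k ^ 2) * (real (card V) * real (card Af)))"
    using assms(1,3,4) b AfD by (intro atypical_savings) auto
  finally show ?thesis .
qed

text \<open>The weight has \<open>2 * (k - 1)\<close> summands, so one of them has at least the
  share \<open>1 / (2 * k)\<close>.\<close>

lemma weight_heavy:
  assumes "k \<ge> 2"
  shows "\<exists>i\<in>{1..<k}. weight k n Tf Af \<le> 2 * k * (card (Tf i) * n ^ i) \<or> weight k n Tf Af \<le> 2 * k * (card (Af i) * n)"
proof (rule ccontr)
  let ?w = "weight k n Tf Af" and ?I = "{1..<k}"
  assume "\<not> (\<exists>i\<in>?I. ?w \<le> 2 * k * (card (Tf i) * n ^ i) \<or> ?w \<le> 2 * k * (card (Af i) * n))"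
  then have lt: "2 * k * (card (Tf i) * n ^ i) + 2 * k * (card (Af i) * n) < 2 * ?w" if "i \<in> ?I" for i
    using that by (smt (verit) add_strict_mono linorder_not_le mult_2)
  have "2 * k * ?w = (\<Sum>i\<in>?I. 2 * k * (card (Tf i) * n ^ i) + 2 * k * (card (Af i) * n))"
    unfolding weight_def sum_distrib_left by (intro sum.cong) (auto simp: algebra_simps)
  also have "\<dots> < (\<Sum>i\<in>?I. 2 * ?w)" using lt assms by (intro sum_strict_mono) auto
  also have "\<dots> = (k - 1) * (2 * ?w)" by simp
  also have "\<dots> \<le> k * (2 * ?w)" by (intro mult_right_mono) auto
  finally show False by simp
qed

text \<open>All costs are multiples of \<open>e * w\<close>: the \<open>2 * (k - 1)\<close> families
  of typical sets and atypical pairs, the clauses with negative literals, and the choice function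
  for typical sets. Against them, the heaviest summand of the weight saves
  \<open>c / (2 * k) * w\<close>.\<close>

lemma residual_weight_count:
  assumes "finite V" "k \<ge> 2" "b > 0" "cheap k V s e" "clique_bound k e \<xi>" "e > 0" "c > 0" "card V \<ge> 1"
    and n: "real (card V) \<ge> real k * 2 ^ (k + 1)" "real (card V) \<ge> 2 / b" "1 + real k * log 2 (real (card V)) \<le> e * real (card V)"
    and b: "\<And>i. i \<in> {1..<k} \<Longrightarrow> b \<le> tuple_gain i * (1 / (real k * 2 ^ (k + 1))) ^ k"
    and c: "\<And>i. i \<in> {1..<k} \<Longrightarrow> c \<le> tuple_gain i * (1 / (real k * 2 ^ (k + 1))) ^ k / (2 ^ (k + 1) * real k ^ 2)"
      "c \<le> b / 2 / (real k * 4 ^ k)"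
    and G: "G = {F\<in>residual k V s b \<xi>. weight k (card V) (\<lambda>i. typical_sets k V b i F) (\<lambda>i. atypical_pairs k V b i F) = w}"
  shows "real (card G) \<le> real k * 2 powr (real (card V choose k) - (c / (2 * real k) - (2 * real k + 2) * e) * real w)"
proof -
  let ?n = "real (card V)" and ?I = "{1..<k}" and ?w = "real w"
  have kp: "real k \<ge> 2" using assms(2) by simp
  define a where "a F = (restrict (\<lambda>i. typical_sets k V b i F) ?I, restrict (\<lambda>i. atypical_pairs k V b i F) ?I)" for F
  have GB: "G \<subseteq> residual k V s b \<xi>" by (auto simp: G)
  have Gs: "G \<subseteq> sparse_forms k V s" using GB by (auto simp: residual_def)
  have finG: "finite G" using finite_subset[OF Gs finite_sparse_forms[OF assms(1)]] .
  \<comment> \<open>Every typical set and every atypical pair contributes at least \<open>n\<close>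
    to the weight, so no family has more than \<open>q\<close> members, and encoding a member takes
    at most \<open>e * n\<close> bits.\<close>
  define q where "q = w div card V"
  define X1 where "X1 i = {Y. Y \<subseteq> ksub V (k - i) \<and> card Y \<le> q}" for i
  define X2 where "X2 i = {Y. Y \<subseteq> ksub V i \<times> ksub V (k - 1 - i) \<and> card Y \<le> q}" for i
  have cnt: "real (card {Y. Y \<subseteq> X \<and> card Y \<le> q}) \<le> 2 powr (e * ?w)" if X: "finite X" "real (card X) \<le> ?n ^ k" for X :: "'x set"
  proof -
    have "real (card {Y. Y \<subseteq> X \<and> card Y \<le> q}) \<le> real ((card X + 1) ^ q)"
      using card_subsets_le_pow[OF X(1), of q] by (simp only: of_nat_le_iff)
    also have "\<dots> = (real (card X) + 1) ^ q" by (simp add: add.commute)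
    also have "\<dots> \<le> (2 powr (e * ?n)) ^ q"
    proof (rule power_mono)
      have "1 \<le> ?n ^ k" using assms(8) by (intro one_le_power) auto
      then have "real (card X) + 1 \<le> 2 * ?n ^ k" using X(2) by linarith
      also have "\<dots> = 2 powr (1 + real k * log 2 ?n)" by (simp add: power_eq_powr_log[OF assms(8)] powr_add)
      also have "\<dots> \<le> 2 powr (e * ?n)" using n(3) by (intro powr_mono) auto
      finally show "real (card X) + 1 \<le> 2 powr (e * ?n)" .
    qed simp
    also have "\<dots> = 2 powr (e * (?n * real q))" by (simp add: powr_power mult_ac)
    also have "\<dots> \<le> 2 powr (e * ?w)"
    proof (intro powr_mono mult_left_mono)
      have "card V * q \<le> w" by (simp add: q_def)
      then have "real (card V * q) \<le> real w" by (simp only: of_nat_le_iff)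
      then show "?n * real q \<le> ?w" by simp
    qed (use assms(6) in auto)
    finally show ?thesis .
  qed
  have X1c: "real (card (X1 i)) \<le> 2 powr (e * ?w)" if i: "i \<in> ?I" for i
    unfolding X1_def
  proof (rule cnt)
    have "real (card (ksub V (k - i))) \<le> ?n ^ (k - i)" by (rule card_ksub_le[OF assms(1)])
    also have "\<dots> \<le> ?n ^ k" using assms(8) by (intro power_increasing) auto
    finally show "real (card (ksub V (k - i))) \<le> ?n ^ k" .
  qed (use assms(1) in simp)
  have X2c: "real (card (X2 i)) \<le> 2 powr (e * ?w)" if i: "i \<in> ?I" for i
    unfolding X2_def
  proof (rule cnt)
    have "real (card (ksub V i \<times> ksub V (k - 1 - i))) \<le> ?n ^ i * ?n ^ (k - 1 - i)"
      unfolding card_cartesian_product of_nat_mult using card_ksub_le[OF assms(1)] by (intro mult_mono) auto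
    also have "\<dots> = ?n ^ (k - 1)" using i by (simp add: power_add[symmetric])
    also have "\<dots> \<le> ?n ^ k" using assms(8) by (intro power_increasing) auto
    finally show "real (card (ksub V i \<times> ksub V (k - 1 - i))) \<le> ?n ^ k" .
  qed (use assms(1) in simp)
  have fX: "finite (X1 i)" "finite (X2 i)" for i using assms(1)
    by (auto simp: X1_def X2_def intro: finite_subset[of _ "Pow (ksub V (k - i))"] finite_subset[of _ "Pow (ksub V i \<times> ksub V (k - 1 - i))"])
  have ac: "real (card (a ` G)) \<le> 2 powr (2 * real k * e * ?w)"
  proof -
    have "a ` G \<subseteq> (PiE ?I X1) \<times> (PiE ?I X2)"
    proof (rule image_subsetI)
      fix F assume F: "F \<in> G"
      have w: "(\<Sum>i\<in>?I. card (typical_sets k V b i F) * card V ^ i + card (atypical_pairs k V b i F) * card V) = w" using F by (simp add: G weight_def)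
      have "card (typical_sets k V b i F) \<le> q \<and> card (atypical_pairs k V b i F) \<le> q" if i: "i \<in> ?I" for i
      proof -
        have "card (typical_sets k V b i F) * card V ^ i + card (atypical_pairs k V b i F) * card V \<le> w"
          unfolding w[symmetric] using i by (intro member_le_sum) auto
        moreover have "card (typical_sets k V b i F) * card V \<le> card (typical_sets k V b i F) * card V ^ i"
          using i assms(8) by (intro mult_left_mono self_le_power) auto
        ultimately have "card (typical_sets k V b i F) * card V \<le> w" "card (atypical_pairs k V b i F) * card V \<le> w" by linarith+
        then show ?thesis unfolding q_def using assms(8) by (simp add: less_eq_div_iff_mult_less_eq)
      qed
      moreover have "typical_sets k V b i F \<subseteq> ksub V (k - i)" for i by (auto simp: typical_sets_def)
      moreover have "atypical_pairs k V b i F \<subseteq> ksub V i \<times> ksub V (k - 1 - i)" for i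
        by (auto simp: atypical_pairs_def atypical_def ksub_def)
      ultimately show "a F \<in> (PiE ?I X1) \<times> (PiE ?I X2)" by (auto simp: a_def X1_def X2_def)
    qed
    moreover have "finite ((PiE ?I X1) \<times> (PiE ?I X2))" using fX by (intro finite_cartesian_product finite_PiE) auto
    ultimately have "card (a ` G) \<le> card ((PiE ?I X1) \<times> (PiE ?I X2))" by (rule_tac card_mono)
    also have "\<dots> = (\<Prod>i\<in>?I. card (X1 i)) * (\<Prod>i\<in>?I. card (X2 i))" by (simp add: card_cartesian_product card_PiE)
    finally have "real (card (a ` G)) \<le> (\<Prod>i\<in>?I. real (card (X1 i))) * (\<Prod>i\<in>?I. real (card (X2 i)))"
      by (simp only: of_nat_mult[symmetric] of_nat_prod[symmetric] of_nat_le_iff)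
    also have "\<dots> \<le> (\<Prod>i\<in>?I. 2 powr (e * ?w)) * (\<Prod>i\<in>?I. 2 powr (e * ?w))"
      using X1c X2c by (intro mult_mono prod_mono) (auto intro!: prod_nonneg)
    also have "\<dots> = 2 powr (real (k - 1) * (e * ?w)) * 2 powr (real (k - 1) * (e * ?w))" by (simp add: powr_power mult.commute)
    also have "\<dots> = 2 powr (2 * real (k - 1) * (e * ?w))" unfolding powr_add[symmetric] by (simp add: mult_ac)
    also have "\<dots> \<le> 2 powr (2 * real k * (e * ?w))" using assms(6) by (intro powr_mono mult_right_mono) auto
    finally show ?thesis by (simp add: mult.assoc)
  qed
  define Bd where "Bd = 2 powr (e * ?w) * (real k * 2 powr (real (card V choose k) - (c / (2 * real k) - e) * ?w))"
  have fib: "real (card {F\<in>G. a F = D}) \<le> Bd" for D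
  proof (cases "{F\<in>G. a F = D} = {}")
    case True
    show ?thesis unfolding True by (simp add: Bd_def)
  next
    case False
    let ?H = "{F\<in>G. a F = D}"
    obtain F1 where F1: "F1 \<in> ?H" using False by blast
    define Tf Af where "Tf i = typical_sets k V b i F1" and "Af i = atypical_pairs k V b i F1" for i
    have HB: "?H \<subseteq> residual k V s b \<xi>" using GB by auto
    have Hd: "typical_sets k V b i F = Tf i \<and> atypical_pairs k V b i F = Af i" if "F \<in> ?H" "i \<in> ?I" for F i
    proof -
      have "a F = a F1" using that(1) F1 by simp
      then have "restrict (\<lambda>i. typical_sets k V b i F) ?I i = restrict (\<lambda>i. typical_sets k V b i F1) ?I i"
        "restrict (\<lambda>i. atypical_pairs k V b i F) ?I i = restrict (\<lambda>i. atypical_pairs k V b i F1) ?I i" by (auto simp: a_def)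
      then show ?thesis using that(2) by (simp add: Tf_def Af_def)
    qed
    have wt: "weight k (card V) Tf Af = w" using F1 by (simp add: G Tf_def[abs_def] Af_def[abs_def])
    have finH: "finite ?H" using finG by simp
    have nc: "real (card (negs ` ?H)) \<le> 2 powr (e * ?w)"
      using fibre_negs_count[OF assms(1) HB assms(4,5), of Tf Af] Hd assms(6) wt by auto
    have pc: "real (card (pos ` ?H)) \<le> real k * 2 powr (real (card V choose k) - (c / (2 * real k) - e) * ?w)"
    proof -
      obtain i where i: "i \<in> ?I" and heavy: "w \<le> 2 * k * (card (Tf i) * card V ^ i) \<or> w \<le> 2 * k * (card (Af i) * card V)"
        using weight_heavy[OF assms(2), of "card V" Tf Af] wt by auto
      show ?thesis
      proof (cases "w \<le> 2 * k * (card (Tf i) * card V ^ i)")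
        case True
        define y where "y = ?n ^ i * real (card (Tf i))"
        have "real w \<le> real (2 * k * (card (Tf i) * card V ^ i))" using True by (simp only: of_nat_le_iff)
        then have wy: "?w \<le> 2 * real k * y" by (simp add: y_def mult_ac)
        have "y \<le> ?w"
        proof -
          have "card (Tf i) * card V ^ i + card (Af i) * card V \<le> w"
            unfolding wt[symmetric] weight_def using i by (intro member_le_sum) auto
          then have "card (Tf i) * card V ^ i \<le> w" by linarith
          then have "real (card (Tf i) * card V ^ i) \<le> ?w" by (simp only: of_nat_le_iff)
          then show ?thesis by (simp add: y_def mult.commute)
        qed
        have "real (card (pos ` ?H)) \<le> 2 powr (e * y) * (real k * 2 powr (real (card V choose k) - b / 2 / (real k * 4 ^ k) * y))"
          unfolding y_def
        proof (rule fibre_pos_count_typical[OF assms(1) HB assms(3) i n(2)])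
          show "real k * log 2 ?n \<le> e * ?n" using n(3) by linarith
          show "Tf i \<subseteq> ksub V (k - i)" by (auto simp: Tf_def typical_sets_def)
        qed (use assms(6,8) Hd i in auto)
        also have "\<dots> = real k * 2 powr (e * y + (real (card V choose k) - b / 2 / (real k * 4 ^ k) * y))" by (simp add: powr_add)
        also have "\<dots> \<le> real k * 2 powr (real (card V choose k) - (c / (2 * real k) - e) * ?w)"
        proof (intro mult_left_mono powr_mono)
          have "c / (2 * real k) * ?w \<le> c / (2 * real k) * (2 * real k * y)" using wy assms(7) by (intro mult_left_mono) auto
          also have "\<dots> = c * y" using kp by simp
          also have "\<dots> \<le> b / 2 / (real k * 4 ^ k) * y" using c(2) by (intro mult_right_mono) (auto simp: y_def)
          finally have "c / (2 * real k) * ?w \<le> b / 2 / (real k * 4 ^ k) * y" .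
          moreover have "e * y \<le> e * ?w" using \<open>y \<le> ?w\<close> assms(6) by (intro mult_left_mono) auto
          ultimately show "e * y + (real (card V choose k) - b / 2 / (real k * 4 ^ k) * y) \<le> real (card V choose k) - (c / (2 * real k) - e) * ?w"
            by (simp add: left_diff_distrib)
        qed auto
        finally show ?thesis .
      next
        case F: False
        define y where "y = ?n * real (card (Af i))"
        let ?c = "tuple_gain i * (1 / (real k * 2 ^ (k + 1))) ^ k / (2 ^ (k + 1) * real k ^ 2)"
        have "w \<le> 2 * k * (card (Af i) * card V)" using F heavy by blast
        then have "real w \<le> real (2 * k * (card (Af i) * card V))" by (simp only: of_nat_le_iff)
        then have wy: "?w \<le> 2 * real k * y" by (simp add: y_def mult_ac)
        have "real (card (pos ` ?H)) \<le> 2 powr (real (card V choose k) - ?c * y)"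
          unfolding y_def
          by (rule fibre_pos_count_atypical[OF assms(1) HB i n(1) b[OF i] _ False]) (use Hd i in auto)
        also have "\<dots> \<le> 2 powr (real (card V choose k) - (c / (2 * real k) - e) * ?w)"
        proof (rule powr_mono)
          have "c / (2 * real k) * ?w \<le> c / (2 * real k) * (2 * real k * y)" using wy assms(7) by (intro mult_left_mono) auto
          also have "\<dots> = c * y" using kp by simp
          also have "\<dots> \<le> ?c * y" using c(1)[OF i] by (intro mult_right_mono) (auto simp: y_def)
          finally have "c / (2 * real k) * ?w \<le> ?c * y" .
          moreover have "0 \<le> e * ?w" using assms(6) by simp
          ultimately show "real (card V choose k) - ?c * y \<le> real (card V choose k) - (c / (2 * real k) - e) * ?w"
            by (simp add: left_diff_distrib)
        qed simp
        also have "\<dots> = 1 * 2 powr (real (card V choose k) - (c / (2 * real k) - e) * ?w)" by simp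
        also have "\<dots> \<le> real k * 2 powr (real (card V choose k) - (c / (2 * real k) - e) * ?w)" using kp by (intro mult_right_mono) auto
        finally show ?thesis .
      qed
    qed
    have "card ?H \<le> card (negs ` ?H \<times> pos ` ?H)"
    proof (rule card_inj_on_le[where f = "\<lambda>F. (negs F, pos F)"])
      show "inj_on (\<lambda>F. (negs F, pos F)) ?H"
        using formula_negs_pos by (metis (no_types, lifting) Pair_inject inj_onI)
      show "finite (negs ` ?H \<times> pos ` ?H)" using finH by auto
    qed auto
    then have "real (card ?H) \<le> real (card (negs ` ?H)) * real (card (pos ` ?H))"
      by (simp only: card_cartesian_product of_nat_mult[symmetric] of_nat_le_iff)
    also have "\<dots> \<le> Bd" unfolding Bd_def using nc pc by (intro mult_mono) auto
    finally show ?thesis .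
  qed
  have "real (card G) \<le> real (card (a ` G)) * Bd"
  proof (rule card_fibres[OF finG, where b = "\<lambda>F. F"])
    fix N
    show "real (card ((\<lambda>F. F) ` {F\<in>G. a F = N})) \<le> Bd" using fib[of N] by simp
  qed (auto simp: inj_on_def Bd_def)
  also have "\<dots> \<le> 2 powr (2 * real k * e * ?w) * Bd" using ac by (intro mult_right_mono) (auto simp: Bd_def)
  also have "\<dots> = real k * (2 powr (2 * real k * e * ?w) * 2 powr (e * ?w) * 2 powr (real (card V choose k) - (c / (2 * real k) - e) * ?w))"
    by (simp add: Bd_def)
  also have "2 powr (2 * real k * e * ?w) * 2 powr (e * ?w) * 2 powr (real (card V choose k) - (c / (2 * real k) - e) * ?w) =
     2 powr (2 * real k * e * ?w + e * ?w + (real (card V choose k) - (c / (2 * real k) - e) * ?w))" by (simp only: powr_add)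
  also have "2 * real k * e * ?w + e * ?w + (real (card V choose k) - (c / (2 * real k) - e) * ?w) =
     real (card V choose k) - (c / (2 * real k) - (2 * real k + 2) * e) * ?w"
    by (simp add: left_diff_distrib distrib_right)
  finally show ?thesis .
qed

lemma weight_le:
  assumes "finite V" "card V \<ge> 1"
  shows "weight k (card V) (\<lambda>i. typical_sets k V b i F) (\<lambda>i. atypical_pairs k V b i F) \<le> 2 * k * card V ^ (2 * k)"
proof -
  have ks: "card (ksub V r) \<le> card V ^ r" for r
  proof -
    have "real (card (ksub V r)) \<le> real (card V ^ r)" using card_ksub_le[OF assms(1), of r] by simp
    then show ?thesis by (simp only: of_nat_le_iff)
  qed
  have each: "card (typical_sets k V b i F) * card V ^ i + card (atypical_pairs k V b i F) * card V \<le> 2 * card V ^ (2 * k)" if i: "i \<in> {1..<k}" for i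
  proof -
    have "card (typical_sets k V b i F) \<le> card (ksub V (k - i))" using assms(1) by (intro card_mono) (auto simp: typical_sets_def)
    then have "card (typical_sets k V b i F) * card V ^ i \<le> card V ^ (k - i) * card V ^ i" using ks[of "k - i"] by (intro mult_right_mono) auto
    also have "\<dots> = card V ^ k" using i by (simp add: power_add[symmetric])
    also have "\<dots> \<le> card V ^ (2 * k)" using assms(2) by (intro power_increasing) auto
    finally have 1: "card (typical_sets k V b i F) * card V ^ i \<le> card V ^ (2 * k)" .
    have "card (atypical_pairs k V b i F) \<le> card (ksub V i \<times> ksub V (k - 1 - i))" using assms(1)
      by (intro card_mono) (auto simp: atypical_pairs_def atypical_def ksub_def)
    also have "\<dots> \<le> card V ^ i * card V ^ (k - 1 - i)" unfolding card_cartesian_product using ks by (intro mult_mono) auto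
    finally have "card (atypical_pairs k V b i F) * card V \<le> card V ^ i * card V ^ (k - 1 - i) * card V ^ 1" by simp
    also have "\<dots> = card V ^ (i + (k - 1 - i) + 1)" by (simp only: power_add)
    also have "\<dots> \<le> card V ^ (2 * k)" using assms(2) i by (intro power_increasing) auto
    finally show ?thesis using 1 by linarith
  qed
  have "weight k (card V) (\<lambda>i. typical_sets k V b i F) (\<lambda>i. atypical_pairs k V b i F) \<le> (\<Sum>i\<in>{1..<k}. 2 * card V ^ (2 * k))"
    unfolding weight_def using each by (intro sum_mono)
  also have "\<dots> = (k - 1) * (2 * card V ^ (2 * k))" by simp
  also have "\<dots> \<le> k * (2 * card V ^ (2 * k))" by (intro mult_right_mono) auto
  finally show ?thesis by simp
qed

text \<open>Weights range from \<open>n\<close> to a polynomial in \<open>n\<close>, so summing over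
  them costs only logarithmically many bits against a saving that is at least linear in
  \<open>n\<close>.\<close>

lemma residual_count:
  assumes "k \<ge> 2" "b > 0" and b: "\<And>i. i \<in> {1..<k} \<Longrightarrow> b \<le> tuple_gain i * (1 / (real k * 2 ^ (k + 1))) ^ k"
  shows "\<exists>\<xi>>0. \<exists>e>0. \<exists>c>0. \<forall>\<^sub>F n in sequentially. \<forall>V s. finite V \<longrightarrow> card V = n \<longrightarrow> cheap k V s e \<longrightarrow>
     real (card (residual k V s b \<xi>)) \<le> 2 powr (real (n choose k) - c * real n)"
proof -
  define gn where "gn i = tuple_gain i * (1 / (real k * 2 ^ (k + 1))) ^ k / (2 ^ (k + 1) * real k ^ 2)" for i
  define c where "c = Min (insert (b / 2 / (real k * 4 ^ k)) (gn ` {1..<k}))"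
  have kp: "real k \<ge> 2" using assms(1) by simp
  have gp: "gn i > 0" for i using tuple_gain_pos[of i] kp by (simp add: gn_def)
  have c: "c > 0" unfolding c_def using gp assms(2) kp by (subst Min_gr_iff) auto
  have c1: "c \<le> gn i" if "i \<in> {1..<k}" for i unfolding c_def using that by (intro Min_le) auto
  have c2: "c \<le> b / 2 / (real k * 4 ^ k)" unfolding c_def by (intro Min_le) auto
  \<comment> \<open>Chosen so that the costs \<open>(2 * k + 2) * e\<close> use up exactly half of
    the saving \<open>c / (2 * k)\<close>.\<close>
  define e where "e = c / (4 * real k * (2 * real k + 2))"
  have e: "e > 0" using c kp by (simp add: e_def)
  have ce: "c / (2 * real k) - (2 * real k + 2) * e = c / (4 * real k)"
  proof -
    have "2 * real k + 2 \<noteq> 0" using kp by linarith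
    then have "(2 * real k + 2) * e = c / (4 * real k)" by (simp add: e_def)
    moreover have "c / (2 * real k) = c / (4 * real k) + c / (4 * real k)" by (simp add: field_simps)
    ultimately show ?thesis by linarith
  qed
  obtain \<xi> where \<xi>: "\<xi> > 0" "clique_bound k e \<xi>" using exists_clique_bound[OF e] by blast
  have lg1: "\<forall>\<^sub>F n in sequentially. 1 + real k * log 2 (real n) \<le> e * real n" using e by real_asymp
  have c8: "c / (8 * real k) > 0" using c kp by simp
  have lg2: "\<forall>\<^sub>F n in sequentially. 2 + 2 * real k + 2 * real k * log 2 (real n) \<le> c / (8 * real k) * real n" using c8 by real_asymp
  have "\<forall>\<^sub>F n in sequentially. \<forall>V s. finite V \<longrightarrow> card V = n \<longrightarrow> cheap k V s e \<longrightarrow>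
     real (card (residual k V s b \<xi>)) \<le> 2 powr (real (n choose k) - c / (8 * real k) * real n)"
    using lg1 lg2 eventually_real_ge[of "real k * 2 ^ (k + 1)"] eventually_real_ge[of "2 / b"] eventually_real_ge[of 1]
  proof eventually_elim
    case (elim n)
    show ?case
    proof (intro allI impI)
      fix V s assume V: "finite V" "card V = n" and ch: "cheap k V s e"
      have n1: "card V \<ge> 1" using elim(5) V(2) by simp
      define Wm where "Wm = 2 * k * n ^ (2 * k)"
      define G where "G w = {F\<in>residual k V s b \<xi>. weight k (card V) (\<lambda>i. typical_sets k V b i F) (\<lambda>i. atypical_pairs k V b i F) = w}" for w
      have finB: "finite (residual k V s b \<xi>)" using finite_sparse_forms[OF V(1)] by (simp add: residual_def)
      have sub: "residual k V s b \<xi> \<subseteq> (\<Union>w\<in>{n..Wm}. G w)"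
        using weight_ge[OF V(1) _ n1] weight_le[OF V(1) n1] V(2) by (auto simp: G_def Wm_def)
      have "real (card (residual k V s b \<xi>)) \<le> real (card (\<Union>w\<in>{n..Wm}. G w))"
        using sub finB by (intro of_nat_mono card_mono) (auto simp: G_def)
      also have "\<dots> \<le> (\<Sum>w\<in>{n..Wm}. real (card (G w)))"
        unfolding of_nat_sum[symmetric] of_nat_le_iff by (intro card_UN_le) auto
      also have "\<dots> \<le> (\<Sum>w\<in>{n..Wm}. real k * 2 powr (real (n choose k) - c / (4 * real k) * real n))"
      proof (rule sum_mono)
        fix w assume w: "w \<in> {n..Wm}"
        have "real (card (G w)) \<le> real k * 2 powr (real (card V choose k) - (c / (2 * real k) - (2 * real k + 2) * e) * real w)"
          by (rule residual_weight_count[OF V(1) assms(1,2) ch \<xi>(2) e c n1])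
             (use elim V(2) b c1 c2 in \<open>auto simp: G_def gn_def\<close>)
        also have "\<dots> \<le> real k * 2 powr (real (n choose k) - c / (4 * real k) * real n)"
          unfolding ce V(2) using w c kp by (intro mult_left_mono powr_mono diff_left_mono) auto
        finally show "real (card (G w)) \<le> real k * 2 powr (real (n choose k) - c / (4 * real k) * real n)" .
      qed
      also have "\<dots> = real (card {n..Wm}) * real k * 2 powr (real (n choose k) - c / (4 * real k) * real n)" by simp
      also have "\<dots> \<le> 2 powr (c / (8 * real k) * real n) * 2 powr (real (n choose k) - c / (4 * real k) * real n)"
      proof (rule mult_right_mono)
        have "real (card {n..Wm}) \<le> real (Wm + 1)" by simp
        also have "\<dots> \<le> 4 * real k * real n ^ (2 * k)"
        proof -
          have "1 * 1 \<le> real k * real n ^ (2 * k)" using kp elim(5) by (intro mult_mono one_le_power) auto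
          then show ?thesis by (simp add: Wm_def)
        qed
        finally have "real (card {n..Wm}) * real k \<le> 4 * real k * real n ^ (2 * k) * real k" by (intro mult_right_mono) auto
        also have "\<dots> = (4 * (real k * real k)) * real n ^ (2 * k)" by simp
        also have "\<dots> \<le> 2 powr (2 + 2 * real k) * real n ^ (2 * k)"
        proof (rule mult_right_mono)
          have "real k \<le> 2 ^ k" using of_nat_less_two_power[of k, where ?'a = real] by linarith
          then have "real k * real k \<le> 2 ^ k * 2 ^ k" by (intro mult_mono) auto
          then show "4 * (real k * real k) \<le> 2 powr (2 + 2 * real k)"
            by (simp add: powr_add powr_realpow[symmetric] powr_add[symmetric])
        qed simp
        also have "\<dots> = 2 powr (2 + 2 * real k + 2 * real k * log 2 (real n))"
          using power_eq_powr_log[of n "2 * k"] n1 V(2) by (simp add: powr_add)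
        also have "\<dots> \<le> 2 powr (c / (8 * real k) * real n)" using elim(2) by (intro powr_mono) auto
        finally show "real (card {n..Wm}) * real k \<le> 2 powr (c / (8 * real k) * real n)" .
      qed simp
      also have "\<dots> = 2 powr (real (n choose k) - c / (8 * real k) * real n)"
        using kp by (simp add: powr_add[symmetric] field_simps)
      finally show "real (card (residual k V s b \<xi>)) \<le> 2 powr (real (n choose k) - c / (8 * real k) * real n)" .
    qed
  qed
  then show ?thesis using \<xi>(1) e c8 by blast
qed

section \<open>Translation of clauses\<close>

definition split_clause :: "clause \<Rightarrow> nat set \<times> nat set" where
  "split_clause C = ({x. Neg x \<in> C}, {x. Pos x \<in> C})"

definition join_clause :: "nat set \<times> nat set \<Rightarrow> clause" where
  "join_clause p = Neg ` fst p \<union> Pos ` snd p"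

lemma join_clause_split_clause: "join_clause (split_clause C) = C"
proof (rule set_eqI)
  fix l show "l \<in> join_clause (split_clause C) \<longleftrightarrow> l \<in> C" by (cases l) (auto simp: join_clause_def split_clause_def)
qed

lemma inj_split_clause: "inj split_clause" by (metis injI join_clause_split_clause)

lemma split_clause_pairs:
  assumes "C \<in> clauses k n" shows "split_clause C \<in> pairs k {1..n}"
proof -
  have C: "finite C" "card C = k" "inj_on var C" "var ` C \<subseteq> {1..n}" using assms by (auto simp: clauses_def)
  let ?S = "{x. Neg x \<in> C}" and ?T = "{x. Pos x \<in> C}"
  have S: "?S \<subseteq> {1..n}"
  proof
    fix x assume "x \<in> ?S"
    then have "var (Neg x) \<in> var ` C" by blast
    then show "x \<in> {1..n}" using C(4) by auto
  qed
  have T: "?T \<subseteq> {1..n}"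
  proof
    fix x assume "x \<in> ?T"
    then have "var (Pos x) \<in> var ` C" by blast
    then show "x \<in> {1..n}" using C(4) by auto
  qed
  have dis: "?S \<inter> ?T = {}" using C(3) by (auto simp: inj_on_def) (metis literal.distinct(1) literal.sel)
  have fin: "finite ?S" "finite ?T" using S T by (auto intro: finite_subset)
  have "C = Neg ` ?S \<union> Pos ` ?T" using join_clause_split_clause[of C] by (simp add: join_clause_def split_clause_def)
  then have "card C = card (Neg ` ?S \<union> Pos ` ?T)" by simp
  also have "\<dots> = card (Neg ` ?S) + card (Pos ` ?T)" using fin by (intro card_Un_disjoint) auto
  also have "\<dots> = card ?S + card ?T" by (simp add: card_image inj_on_def)
  finally show ?thesis using C(2) S T dis by (simp add: split_clause_def pairs_def)
qed

lemma satisfies_split_clause: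
  assumes "split_clause C \<in> pairs k {1..n}"
  shows "satisfies a C \<longleftrightarrow> psat {x\<in>{1..n}. a x} (split_clause C)"
proof -
  have "satisfies a C \<longleftrightarrow> (\<forall>x. Neg x \<in> C \<longrightarrow> \<not> a x) \<and> (\<forall>x. Pos x \<in> C \<longrightarrow> a x)"
  proof
    assume "satisfies a C"
    then show "(\<forall>x. Neg x \<in> C \<longrightarrow> \<not> a x) \<and> (\<forall>x. Pos x \<in> C \<longrightarrow> a x)" by (auto simp: satisfies_def)
  next
    assume h: "(\<forall>x. Neg x \<in> C \<longrightarrow> \<not> a x) \<and> (\<forall>x. Pos x \<in> C \<longrightarrow> a x)"
    have "lit_true a l" if "l \<in> C" for l using h that by (cases l) auto
    then show "satisfies a C" by (simp add: satisfies_def)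
  qed
  also have "\<dots> \<longleftrightarrow> psat {x\<in>{1..n}. a x} (split_clause C)"
  proof -
    have "Neg x \<in> C \<Longrightarrow> x \<in> {1..n}" "Pos x \<in> C \<Longrightarrow> x \<in> {1..n}" for x
      using assms unfolding pairs_def split_clause_def by blast+
    then show ?thesis unfolding psat_def split_clause_def by auto
  qed
  finally show ?thesis .
qed

lemma sparse_split_clause:
  assumes "\<Phi> \<in> minimal_formulae k n" "sparsely_minimal n z \<Phi>"
  shows "split_clause ` \<Phi> \<in> sparse_forms k {1..n} (z * real n)"
proof -
  have pr: "split_clause C \<in> pairs k {1..n}" if "C \<in> \<Phi>" for C
    using that assms(1) by (intro split_clause_pairs) (auto simp: minimal_formulae_def formulae_def)
  have "\<exists>W\<subseteq>{1..n}. real (card W) < z * real n \<and> pwitness (split_clause ` \<Phi>) p W" if p: "p \<in> split_clause ` \<Phi>" for p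
  proof -
    obtain C where C: "C \<in> \<Phi>" "p = split_clause C" using p by blast
    obtain a where a: "witness \<Phi> C a" "real (card {x\<in>{1..n}. a x}) < z * real n"
      using assms(2) C by (auto simp: sparsely_minimal_def)
    let ?W = "{x\<in>{1..n}. a x}"
    have "pwitness (split_clause ` \<Phi>) p ?W"
      unfolding pwitness_def
    proof (intro conjI ballI impI)
      show "psat ?W p" using a(1) satisfies_split_clause[OF pr[OF C(1)], of a] C(2) by (simp add: witness_def)
      fix q assume "q \<in> split_clause ` \<Phi>" "q \<noteq> p"
      then obtain D where D: "D \<in> \<Phi>" "q = split_clause D" "D \<noteq> C" using C(2) by auto
      then have "\<not> satisfies a D" using a(1) by (auto simp: witness_def)
      then show "\<not> psat ?W q" using satisfies_split_clause[OF pr[OF D(1)], of a] D(2) by simp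
    qed
    moreover have "?W \<subseteq> {1..n}" by auto
    ultimately show ?thesis using a(2) by blast
  qed
  moreover have "split_clause ` \<Phi> \<subseteq> pairs k {1..n}" using pr by auto
  ultimately show ?thesis by (simp add: sparse_forms_def)
qed

text \<open>After a deletion the variables no longer form an initial interval; relabelling them
  along a bijection leads back to \<open>minimal_formulae\<close>, and a witness \<open>W\<close>
  becomes the assignment that is true exactly on its image.\<close>

lemma card_minimal_forms_le:
  assumes "finite V"
  shows "card (minimal_forms k V) \<le> card (minimal_formulae k (card V))"
proof -
  let ?m = "card V"
  obtain h where h: "bij_betw h V {1..?m}" using finite_same_card_bij[OF assms, of "{1..?m}"] by auto
  have hi: "inj_on h V" and hV: "h ` V = {1..?m}" using h by (auto simp: bij_betw_def)
  define g where "g p = join_clause (h ` fst p, h ` snd p)" for p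
  have spg: "split_clause (g p) = (h ` fst p, h ` snd p)" for p by (auto simp: split_clause_def g_def join_clause_def)
  have pV: "fst p \<subseteq> V" "snd p \<subseteq> V" "fst p \<inter> snd p = {}" "card (fst p) + card (snd p) = k" if "p \<in> pairs k V" for p
    using that by (auto simp: pairs_def)
  have "inj_on g (pairs k V)"
  proof (rule inj_onI)
    fix p q assume pq: "p \<in> pairs k V" "q \<in> pairs k V" "g p = g q"
    then have "h ` fst p = h ` fst q" "h ` snd p = h ` snd q" using spg by (metis prod.inject)+
    then have "fst p = fst q" "snd p = snd q" using pV[OF pq(1)] pV[OF pq(2)] hi by (simp_all add: inj_on_image_eq_iff)
    then show "p = q" by (simp add: prod_eq_iff)
  qed
  then have inj: "inj_on (image g) (minimal_forms k V)"
    by (rule inj_on_subset[OF inj_on_image_Pow]) (auto simp: minimal_forms_def)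
  have gcl: "g p \<in> clauses k ?m" if p: "p \<in> pairs k V" for p
  proof -
    have fin: "finite (fst p)" "finite (snd p)" using pV[OF p] assms finite_subset by auto
    have dis: "h ` fst p \<inter> h ` snd p = {}" using pV[OF p] hi by (metis image_empty inj_on_image_Int)
    have "\<forall>a\<in>fst p. \<forall>b\<in>snd p. h a \<noteq> h b \<and> h b \<noteq> h a" using dis by (metis IntI empty_iff imageI)
    then have "inj_on var (g p)" unfolding g_def join_clause_def by (auto simp: inj_on_def)
    moreover have "card (g p) = k"
    proof -
      have "card (g p) = card (Neg ` h ` fst p) + card (Pos ` h ` snd p)"
        unfolding g_def join_clause_def using fin by (simp, intro card_Un_disjoint) auto
      also have "\<dots> = card (h ` fst p) + card (h ` snd p)" by (simp add: card_image inj_on_def)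
      also have "\<dots> = card (fst p) + card (snd p)"
        using pV[OF p] hi by (metis card_image inj_on_subset)
      finally show ?thesis using pV[OF p] by simp
    qed
    moreover have "h ` fst p \<subseteq> {1..?m}" "h ` snd p \<subseteq> {1..?m}" unfolding hV[symmetric] using pV[OF p] by (auto intro: image_mono)
    then have "var ` g p \<subseteq> {1..?m}" by (auto simp: g_def join_clause_def image_Un image_image)
    moreover have "finite (g p)" using fin by (simp add: g_def join_clause_def)
    ultimately show ?thesis by (simp add: clauses_def)
  qed
  have "image g ` minimal_forms k V \<subseteq> minimal_formulae k ?m"
  proof (rule image_subsetI)
    fix F assume F: "F \<in> minimal_forms k V"
    then have sub: "F \<subseteq> pairs k V" by (simp add: minimal_forms_def)
    have "\<exists>a. witness (g ` F) C a" if C: "C \<in> g ` F" for C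
    proof -
      obtain p where p: "p \<in> F" "C = g p" using C by blast
      obtain W where W: "W \<subseteq> V" "pwitness F p W" using F p by (auto simp: minimal_forms_def)
      define a where "a x \<longleftrightarrow> x \<in> h ` W" for x
      have sat: "satisfies a (g q) \<longleftrightarrow> psat W q" if q: "q \<in> F" for q
      proof -
        have qk: "q \<in> pairs k V" using q sub by blast
        have "h ` W \<subseteq> {1..?m}" unfolding hV[symmetric] by (rule image_mono[OF W(1)])
        then have set_eq: "{x\<in>{1..?m}. a x} = h ` W" by (auto simp: a_def)
        have "satisfies a (g q) \<longleftrightarrow> psat (h ` W) (split_clause (g q))"
          using satisfies_split_clause[OF split_clause_pairs[OF gcl[OF qk]], of a] set_eq by simp
        also have "\<dots> \<longleftrightarrow> h ` snd q \<subseteq> h ` W \<and> h ` fst q \<inter> h ` W = {}" by (simp add: psat_def spg)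
        also have "\<dots> \<longleftrightarrow> psat W q"
        proof -
          have "h ` snd q \<subseteq> h ` W \<longleftrightarrow> snd q \<subseteq> W" 
          proof -
            have "h x \<in> h ` W \<longleftrightarrow> x \<in> W" if "x \<in> snd q" for x
              using that pV(2)[OF qk] W(1) hi by (intro inj_on_image_mem_iff[of h V]) auto
            then show ?thesis unfolding image_subset_iff by blast
          qed
          moreover have "h ` fst q \<inter> h ` W = h ` (fst q \<inter> W)" using pV(1)[OF qk] W(1) hi by (simp add: inj_on_image_Int)
          ultimately show ?thesis by (simp add: psat_def)
        qed
        finally show ?thesis .
      qed
      have "witness (g ` F) C a" unfolding witness_def
      proof (intro conjI ballI impI)
        show "satisfies a C" using W(2) sat[OF p(1)] p(2) by (simp add: pwitness_def)
        fix D assume "D \<in> g ` F" "D \<noteq> C"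
        then obtain q where q: "q \<in> F" "D = g q" "q \<noteq> p" using p(2) by auto
        then show "\<not> satisfies a D" using W(2) sat[OF q(1)] by (simp add: pwitness_def)
      qed
      then show ?thesis by blast
    qed
    moreover have "g ` F \<subseteq> clauses k ?m" using sub gcl by auto
    ultimately show "g ` F \<in> minimal_formulae k ?m" by (simp add: minimal_formulae_def formulae_def minimal_def)
  qed
  then show ?thesis using inj finite_minimal_formulae by (intro card_inj_on_le) auto
qed


text \<open>Over each \<open>T\<close> containing \<open>x\<close> the loose family has at most
  \<open>1 + s * n ^ (k - 1 - t)\<close> members, and there are at most \<open>n ^ (t - 1)\<close>
  such sets of size \<open>t\<close>. For \<open>s = z * n\<close> the total is, up to lower order,
  \<open>k * z * n ^ (k - 1)\<close>.\<close>

lemma card_mixed_occurrences: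
  assumes "finite V" "F \<in> sparse_forms k V s" "s \<ge> 0" "x \<in> V" "k \<ge> 2" "card V \<ge> 1"
  shows "real (card {p\<in>negs F. x \<in> snd p}) \<le> real k * ((1 + s) * real (card V) ^ (k - 2))"
proof -
  let ?n = "real (card V)"
  let ?J = "{T. T \<subseteq> V \<and> x \<in> T \<and> card T < k}"
  have finJ: "finite ?J" using assms(1) by (rule_tac finite_subset[of _ "Pow V"]) auto
  have sF: "neg_parts F T \<in> loose_families V (k - card T) s" for T by (rule neg_parts_loose_families[OF assms(2)])
  have fs: "finite (neg_parts F T)" for T
  proof (rule finite_subset)
    show "neg_parts F T \<subseteq> ksub V (k - card T)" using sF[of T] by (simp add: loose_families_def)
  qed (use assms(1) in simp)
  have "{p\<in>negs F. x \<in> snd p} \<subseteq> (\<Union>T\<in>?J. (\<lambda>S. (S,T)) ` neg_parts F T)"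
  proof
    fix p assume p: "p \<in> {p\<in>negs F. x \<in> snd p}"
    obtain S T where e: "p = (S,T)" by (cases p)
    have m: "(S,T) \<in> F" "S \<noteq> {}" "x \<in> T" using p unfolding e negs_def by auto
    have q: "S \<subseteq> V" "T \<subseteq> V" "card S + card T = k" using m(1) sparse_forms_sub[OF assms(2)] by (auto simp: pairs_def)
    have "card S > 0" using m(2) finite_subset[OF q(1) assms(1)] by (simp add: card_gt_0_iff)
    then have "T \<in> ?J" using q m by auto
    moreover have "p \<in> (\<lambda>S. (S,T)) ` neg_parts F T" using m(1) e by (simp add: neg_parts_def)
    ultimately show "p \<in> (\<Union>T\<in>?J. (\<lambda>S. (S,T)) ` neg_parts F T)" by blast
  qed
  then have "card {p\<in>negs F. x \<in> snd p} \<le> card (\<Union>T\<in>?J. (\<lambda>S. (S,T)) ` neg_parts F T)" using finJ fs by (intro card_mono) auto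
  also have "\<dots> \<le> (\<Sum>T\<in>?J. card ((\<lambda>S. (S,T)) ` neg_parts F T))" by (rule card_UN_le[OF finJ])
  also have "\<dots> \<le> (\<Sum>T\<in>?J. card (neg_parts F T))" using fs by (intro sum_mono card_image_le)
  finally have "real (card {p\<in>negs F. x \<in> snd p}) \<le> (\<Sum>T\<in>?J. real (card (neg_parts F T)))"
    by (simp only: of_nat_sum[symmetric] of_nat_le_iff)
  also have "\<dots> \<le> (\<Sum>T\<in>?J. 1 + s * ?n ^ (k - 1 - card T))"
  proof (rule sum_mono)
    fix T assume "T \<in> ?J"
    then have "k - card T = Suc (k - 1 - card T)" by auto
    then show "real (card (neg_parts F T)) \<le> 1 + s * ?n ^ (k - 1 - card T)" using sF[of T] by (intro loose_families_card_le[OF assms(1) _ assms(3)]) simp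
  qed
  also have "\<dots> \<le> real (card {1..<k}) * ((1 + s) * ?n ^ (k - 2))"
  proof (rule sum_by_card_le[OF finJ])
    fix T assume T: "T \<in> ?J"
    then have "finite T" using finite_subset[OF _ assms(1)] by auto
    then have "card T > 0" using T by (auto simp: card_gt_0_iff)
    then show "card T \<in> {1..<k}" using T by auto
  next
    fix t assume t: "t \<in> {1..<k}"
    then obtain i where i: "t = Suc i" by (cases t) auto
    have "card {T\<in>?J. card T = t} \<le> card {S\<in>ksub V (Suc i). S \<inter> {x} \<noteq> {}}"
      using assms(1) by (intro card_mono) (auto simp: ksub_def i)
    then have c: "real (card {T\<in>?J. card T = t}) \<le> ?n ^ i" using card_meeting[OF assms(1), of "{x}" i] assms(4) by simp
    have "real (card {T\<in>?J. card T = t}) * (1 + s * ?n ^ (k - 1 - t)) \<le> ?n ^ i * (1 + s * ?n ^ (k - 1 - t))"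
      using c assms(3) by (intro mult_right_mono) auto
    also have "\<dots> = ?n ^ i + s * ?n ^ (i + (k - 1 - t))" by (simp add: power_add algebra_simps)
    also have "i + (k - 1 - t) = k - 2" using t i by auto
    also have "?n ^ i + s * ?n ^ (k - 2) \<le> ?n ^ (k - 2) + s * ?n ^ (k - 2)"
      using t i assms(6) by (intro add_right_mono power_increasing) auto
    also have "\<dots> = (1 + s) * ?n ^ (k - 2)" by (simp add: algebra_simps)
    finally show "real (card {T\<in>?J. card T = t}) * (1 + s * ?n ^ (k - 1 - t)) \<le> (1 + s) * ?n ^ (k - 2)" .
  qed simp
  also have "\<dots> \<le> real k * ((1 + s) * ?n ^ (k - 2))" using assms(3) by (intro mult_right_mono) auto
  finally show ?thesis .
qed

text \<open>Clauses mixing a positive \<open>x\<close> with negated variables are negligible for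
  sparse witnesses, so many positive occurrences of \<open>x\<close> give a dense positive
  link.\<close>

lemma card_plink_ge:
  assumes "finite V" "F \<in> sparse_forms k V s" "s \<ge> 0" "x \<in> V" "k \<ge> 2" "card V \<ge> 1"
  shows "real (card {p\<in>F. x \<in> snd p}) \<le> real (card (plink F x)) + real k * ((1 + s) * real (card V) ^ (k - 2))"
proof -
  have sub: "F \<subseteq> pairs k V" by (rule sparse_forms_sub[OF assms(2)])
  have finF: "finite F" by (rule finite_subset[OF sub finite_pairs[OF assms(1)]])
  have finL: "finite (plink F x)" by (rule finite_subset[OF plink_sub[OF assms(1) sub]]) (simp add: assms(1))
  have "{p\<in>F. x \<in> snd p} \<subseteq> (\<lambda>Q. ({}, insert x Q)) ` plink F x \<union> {p\<in>negs F. x \<in> snd p}"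
  proof
    fix p assume p: "p \<in> {p\<in>F. x \<in> snd p}"
    show "p \<in> (\<lambda>Q. ({}, insert x Q)) ` plink F x \<union> {p\<in>negs F. x \<in> snd p}"
    proof (cases "fst p = {}")
      case True
      then have e: "p = ({}, insert x (snd p - {x}))" using p by (cases p) auto
      moreover have "({}, insert x (snd p - {x})) \<in> F" using p calculation by simp
      then have "snd p - {x} \<in> plink F x" by (simp add: plink_def)
      ultimately have "p \<in> (\<lambda>Q. ({}, insert x Q)) ` plink F x" by (rule image_eqI)
      then show ?thesis by (rule UnI1)
    next
      case False then show ?thesis using p by (auto simp: negs_def)
    qed
  qed
  then have "card {p\<in>F. x \<in> snd p} \<le> card ((\<lambda>Q. ({} :: nat set, insert x Q)) ` plink F x) + card {p\<in>negs F. x \<in> snd p}"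
    using finF finL by (intro order_trans[OF card_mono card_Un_le]) (auto simp: negs_def)
  moreover have "card ((\<lambda>Q. ({} :: nat set, insert x Q)) ` plink F x) \<le> card (plink F x)" by (rule card_image_le[OF finL])
  ultimately show ?thesis using card_mixed_occurrences[OF assms] by linarith
qed

text \<open>Positive dominance puts at least half of the occurrences of \<open>x\<close> on the
  positive literal, which turns the density \<open>1 / (10 * k)\<close> into
  \<open>1 / (20 * k)\<close>.\<close>

lemma card_occurrences_ge:
  assumes "\<Phi> \<in> I1_star k n z" "x \<in> {1..n}" "k \<ge> 1"
  shows "1 / (20 * real k) * real ((n - 1) choose (k - 1)) \<le> real (card {p\<in>split_clause ` \<Phi>. x \<in> snd p})"
proof -
  have cP: "card {p\<in>split_clause ` \<Phi>. x \<in> snd p} = occurrences \<Phi> (Pos x)"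
  proof -
    have "{p\<in>split_clause ` \<Phi>. x \<in> snd p} = split_clause ` {C\<in>\<Phi>. Pos x \<in> C}"
    proof -
      have "x \<in> snd (split_clause C) \<longleftrightarrow> Pos x \<in> C" for C by (simp add: split_clause_def)
      then show ?thesis by (simp only: Compr_image_eq)
    qed
    moreover have "inj_on split_clause {C\<in>\<Phi>. Pos x \<in> C}" by (rule inj_on_subset[OF inj_split_clause]) simp
    ultimately show ?thesis unfolding occurrences_def by (simp add: card_image)
  qed
  have "x \<in> var ` C \<longleftrightarrow> Pos x \<in> C \<or> Neg x \<in> C" for C
  proof
    assume "x \<in> var ` C"
    then obtain l where "l \<in> C" "var l = x" by auto
    then show "Pos x \<in> C \<or> Neg x \<in> C" by (cases l) auto
  next
    assume "Pos x \<in> C \<or> Neg x \<in> C"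
    then show "x \<in> var ` C" by (metis imageI literal.sel)
  qed
  then have "{C\<in>\<Phi>. x \<in> var ` C} = {C\<in>\<Phi>. Pos x \<in> C} \<union> {C\<in>\<Phi>. Neg x \<in> C}" by auto
  then have "card {C\<in>\<Phi>. x \<in> var ` C} \<le> occurrences \<Phi> (Pos x) + occurrences \<Phi> (Neg x)"
    unfolding occurrences_def by (metis card_Un_le)
  moreover have "occurrences \<Phi> (Neg x) \<le> occurrences \<Phi> (Pos x)"
    using assms(1,2) by (auto simp: I1_star_def positive_dominant_def)
  moreover have "1 / (10 * real k) * real ((n - 1) choose (k - 1)) \<le> real (card {C\<in>\<Phi>. x \<in> var ` C})"
    using assms(1,2) by (auto simp: I1_star_def dense_formula_def)
  ultimately have "1 / (10 * real k) * real ((n - 1) choose (k - 1)) \<le> 2 * real (occurrences \<Phi> (Pos x))" by linarith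
  then show ?thesis using cP by simp
qed

text \<open>Signing the variables of a graph without isolated vertices gives pairwise distinct unate formulae.\<close>

lemma card_minimal_formulae_2_ge:
  assumes "m \<ge> 4"
  shows "2 powr (real (m choose 2) + real m - 1) \<le> real (card (minimal_formulae 2 m))"
proof -
  let ?V = "{1..m}" and ?K = "ksub {1..m} 2"
  define Iso where "Iso x = {G. G \<subseteq> ksub ({1..m} - {x}) 2}" for x
  define Gs where "Gs = {G. G \<subseteq> ?K \<and> (\<forall>x\<in>?V. \<exists>C\<in>G. x \<in> C)}"
  have finK: "finite ?K" by simp
  have cK: "card ?K = m choose 2" by (simp add: card_ksub)
  have ch: "m choose 2 = ((m - 1) choose 2) + (m - 1)"
    using assms binomial_Suc_Suc[of "m - 1" 1] by (simp add: numeral_2_eq_2)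
  have GsB: "2 ^ (m choose 2) \<le> 2 * card Gs"
  proof -
    have sub: "Pow ?K \<subseteq> Gs \<union> (\<Union>x\<in>?V. Iso x)"
    proof
      fix G assume G: "G \<in> Pow ?K"
      show "G \<in> Gs \<union> (\<Union>x\<in>?V. Iso x)"
      proof (cases "G \<in> Gs")
        case False
        then obtain x where x: "x \<in> ?V" "\<forall>C\<in>G. x \<notin> C" using G by (auto simp: Gs_def)
        then have "G \<in> Iso x" using G by (auto simp: Iso_def ksub_def)
        then show ?thesis using x by blast
      qed simp
    qed
    have finI: "finite (Iso x)" for x unfolding Iso_def by (rule finite_subset[of _ "Pow (ksub ({1..m} - {x}) 2)"]) auto
    have finGs: "finite Gs" unfolding Gs_def by (rule finite_subset[of _ "Pow ?K"]) auto
    have "card (Pow ?K) \<le> card Gs + card (\<Union>x\<in>?V. Iso x)"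
      using sub finGs finI by (intro order_trans[OF card_mono card_Un_le]) auto
    also have "card (\<Union>x\<in>?V. Iso x) \<le> (\<Sum>x\<in>?V. card (Iso x))" by (intro card_UN_le) simp
    also have "\<dots> = (\<Sum>x\<in>?V. 2 ^ ((m - 1) choose 2))"
    proof (rule sum.cong)
      fix x assume "x \<in> ?V"
      then have "card (ksub ({1..m} - {x}) 2) = (m - 1) choose 2" by (simp add: card_ksub)
      then show "card (Iso x) = 2 ^ ((m - 1) choose 2)" unfolding Iso_def Pow_def[symmetric] by (simp add: card_Pow)
    qed simp
    also have "\<dots> = m * 2 ^ ((m - 1) choose 2)" by simp
    finally have 1: "2 ^ (m choose 2) \<le> card Gs + m * 2 ^ ((m - 1) choose 2)" by (simp only: card_Pow[OF finK] cK)
    \<comment> \<open>At most \<open>m * 2 ^ ((m - 1) choose 2)\<close> graphs have an isolated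
      vertex; by this inequality, valid from \<open>m = 4\<close> on, they are at most half of all
      graphs.\<close>
    have "2 * m \<le> 2 ^ (m - 1)"
      using assms
    proof (induction m rule: nat_induct_at_least)
      case (Suc m)
      have "2 * Suc m \<le> 2 * (2 * m)" using Suc by simp
      also have "\<dots> \<le> 2 * 2 ^ (m - 1)" using Suc by simp
      also have "\<dots> = 2 ^ (Suc m - 1)" using Suc by (metis Suc_diff_1 diff_Suc_1 less_le_trans power_Suc zero_less_numeral)
      finally show ?case .
    qed simp
    then have "2 * m * 2 ^ ((m - 1) choose 2) \<le> 2 ^ (m - 1) * 2 ^ ((m - 1) choose 2)" by (rule mult_right_mono) simp
    also have "\<dots> = 2 ^ (m choose 2)" by (simp add: ch power_add)
    finally show ?thesis using 1 by linarith
  qed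
  \<comment> \<open>\<open>lit U\<close> negates exactly the variables in \<open>U\<close>. Every
    variable occurs in \<open>G\<close>, hence \<open>U\<close> can be read off from the signed
    formula.\<close>
  define lit where "lit U x = (if x \<in> U then Neg x else Pos x)" for U :: "nat set" and x
  define f where "f = (\<lambda>(G,U). (image (lit U)) ` G)"
  have vl: "var (lit U x) = x" for U x by (simp add: lit_def)
  have vim: "var ` lit U ` C = C" for U C by (simp add: image_image vl)
  have inj: "inj_on f (Gs \<times> Pow ?V)"
  proof (rule inj_onI)
    fix p q assume pq: "p \<in> Gs \<times> Pow ?V" "q \<in> Gs \<times> Pow ?V" "f p = f q"
    obtain G U H W where e: "p = (G,U)" "q = (H,W)" by (cases p, cases q)
    have eq: "(image (lit U)) ` G = (image (lit W)) ` H" using pq(3) e by (simp add: f_def)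
    have "image var ` (image (lit U)) ` G = image var ` (image (lit W)) ` H" using eq by simp
    then have GH: "G = H" by (simp add: image_image vl)
    have mem: "x \<in> A \<longleftrightarrow> Neg x \<in> \<Union> ((image (lit A)) ` G)" if x: "x \<in> ?V" for x A
    proof -
      have "\<forall>x\<in>?V. \<exists>C\<in>G. x \<in> C" using pq(1) e by (simp add: Gs_def)
      then obtain C where "C \<in> G" "x \<in> C" using x by blast
      then show ?thesis by (auto simp: lit_def split: if_splits)
    qed
    have "U = W"
    proof (rule set_eqI)
      fix x
      show "x \<in> U \<longleftrightarrow> x \<in> W"
      proof (cases "x \<in> ?V")
        case True
        have "(image (lit U)) ` G = (image (lit W)) ` G" using eq GH by simp
        then show ?thesis using mem[OF True, of U] mem[OF True, of W] by (simp only:)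
      next
        case False then show ?thesis using pq e by auto
      qed
    qed
    then show "p = q" using GH e by simp
  qed
  have im: "f ` (Gs \<times> Pow ?V) \<subseteq> minimal_formulae 2 m"
  proof clarify
    fix G U assume G: "G \<in> Gs" and U: "U \<subseteq> ?V"
    have Gk: "C \<subseteq> ?V" "card C = 2" if "C \<in> G" for C using that G by (auto simp: Gs_def ksub_def)
    have "lit U ` C \<in> clauses 2 m" if C: "C \<in> G" for C
    proof -
      have "inj_on (lit U) C" by (metis inj_onI vl)
      then have "card (lit U ` C) = 2" using Gk[OF C] by (simp add: card_image)
      moreover have "inj_on var (lit U ` C)" by (auto simp: inj_on_def vl)
      moreover have "finite (lit U ` C)" using Gk[OF C] by (auto intro: finite_subset)
      moreover have "var ` lit U ` C \<subseteq> {1..m}" unfolding vim by (rule Gk(1)[OF C])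
      ultimately show ?thesis by (simp add: clauses_def)
    qed
    moreover have "\<exists>a. witness (f (G,U)) D a" if D: "D \<in> f (G,U)" for D
    proof -
      obtain C where C: "C \<in> G" "D = lit U ` C" using D by (auto simp: f_def)
      \<comment> \<open>This assignment makes precisely the literals on the vertices of
        \<open>C\<close> true, so a signed edge is satisfied only if it is contained in
        \<open>C\<close>, that is, equal to \<open>C\<close>.\<close>
      define a where "a x \<longleftrightarrow> (x \<in> C \<longleftrightarrow> x \<notin> U)" for x
      have lt: "lit_true a (lit U x) \<longleftrightarrow> x \<in> C" for x by (auto simp: lit_def a_def)
      have sat: "satisfies a (lit U ` E) \<longleftrightarrow> E \<subseteq> C" for E by (auto simp: satisfies_def lt)
      have "witness (f (G,U)) D a" unfolding witness_def
      proof (intro conjI ballI impI)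
        show "satisfies a D" using sat C by simp
        fix D' assume D': "D' \<in> f (G,U)" "D' \<noteq> D"
        then obtain E where E: "E \<in> G" "D' = lit U ` E" "E \<noteq> C" using C by (auto simp: f_def)
        have "finite C" using Gk[OF C(1)] by (auto intro: finite_subset)
        then have "\<not> E \<subseteq> C" using E(3) Gk(2)[OF E(1)] Gk(2)[OF C(1)] card_subset_eq by metis
        then show "\<not> satisfies a D'" using sat E by simp
      qed
      then show ?thesis by blast
    qed
    ultimately show "f (G,U) \<in> minimal_formulae 2 m"
      by (auto simp: minimal_formulae_def formulae_def minimal_def f_def)
  qed
  have "card Gs * 2 ^ m = card (Gs \<times> Pow ?V)" by (simp add: card_cartesian_product card_Pow)
  also have "\<dots> \<le> card (minimal_formulae 2 m)" using inj im finite_minimal_formulae by (rule card_inj_on_le)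
  finally have "2 * card Gs * 2 ^ m \<le> 2 * card (minimal_formulae 2 m)" by simp
  moreover have "2 ^ (m choose 2) * 2 ^ m \<le> 2 * card Gs * 2 ^ m" using GsB by (intro mult_right_mono) auto
  ultimately have "real (2 ^ (m choose 2) * 2 ^ m) \<le> real (2 * card (minimal_formulae 2 m))"
    unfolding of_nat_le_iff by linarith
  then have "2 powr (real (m choose 2)) * 2 powr (real m) \<le> 2 * real (card (minimal_formulae 2 m))"
    by (simp add: powr_realpow)
  then show ?thesis by (simp add: powr_add powr_diff)
qed

section \<open>The case distinction\<close>

text \<open>The form in which density and positive dominance enter the count, next to the sparse
  witnesses.\<close>

definition good :: "nat \<Rightarrow> nat set \<Rightarrow> real \<Rightarrow> real \<Rightarrow> (nat set \<times> nat set) set set" where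
  "good k V s d = {F\<in>sparse_forms k V s. \<forall>x\<in>V. d * real (card V) ^ (k - 1) \<le> real (card (plink F x))}"

lemma cheap_mono: "cheap k V s e \<Longrightarrow> e \<le> e' \<Longrightarrow> cheap k V s e'"
  unfolding cheap_def by (meson order_trans powr_mono mult_right_mono one_le_numeral of_nat_0_le_iff zero_le_power)

lemma card_monotone_formulae:
  assumes "finite V" shows "card {F\<in>sparse_forms k V s. negs F = {}} \<le> 2 ^ (card V choose k)"
proof -
  have "card {F\<in>sparse_forms k V s. negs F = {}} \<le> card (Pow (ksub V k))"
  proof (rule card_inj_on_le[where f = pos])
    show "inj_on pos {F\<in>sparse_forms k V s. negs F = {}}"
    proof (rule inj_onI)
      fix F F' assume h: "F \<in> {F\<in>sparse_forms k V s. negs F = {}}" "F' \<in> {F\<in>sparse_forms k V s. negs F = {}}" "pos F = pos F'"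
      then show "F = F'" using formula_negs_pos[of F] formula_negs_pos[of F'] by simp
    qed
    show "pos ` {F\<in>sparse_forms k V s. negs F = {}} \<subseteq> Pow (ksub V k)" using pos_sub sparse_forms_sub by blast
  qed (use assms in simp)
  then show ?thesis using assms by (simp add: card_Pow card_ksub)
qed

lemma card_UN_bound:
  assumes "finite I" "\<And>i. i \<in> I \<Longrightarrow> real (card (A i)) \<le> B" "real (card I) \<le> N" "B \<ge> 0"
  shows "real (card (\<Union>i\<in>I. A i)) \<le> N * B"
proof -
  have "real (card (\<Union>i\<in>I. A i)) \<le> (\<Sum>i\<in>I. real (card (A i)))"
    unfolding of_nat_sum[symmetric] of_nat_le_iff by (rule card_UN_le[OF assms(1)])
  also have "\<dots> \<le> (\<Sum>i\<in>I. B)" using assms(2) by (intro sum_mono)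
  also have "\<dots> = real (card I) * B" by simp
  also have "\<dots> \<le> N * B" using assms(3,4) by (intro mult_right_mono)
  finally show ?thesis .
qed

text \<open>Of the saving \<open>\<gamma> * n ^ k\<close> one half pays for the choice of
  \<open>S\<close> and a quarter for the clauses with negative literals.\<close>

lemma big_kill_union_count:
  assumes "\<gamma> > 0" "k \<ge> 1" "e > 0" "real k * e \<le> \<gamma> / 4"
  shows "\<forall>\<^sub>F n in sequentially. \<forall>V s. finite V \<longrightarrow> card V = n \<longrightarrow> cheap k V s e \<longrightarrow>
    real (card (\<Union>S\<in>{S. S \<subseteq> V \<and> S \<noteq> {} \<and> card S \<le> k}. {F\<in>sparse_forms k V s. \<gamma> * real n ^ k \<le> real (card (kill k V S F))}))
    \<le> exp2 ((1 - \<gamma> / 4) * real (n choose k))"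
proof -
  have "\<forall>\<^sub>F n in sequentially. real k + real k * log 2 (real n) \<le> \<gamma> / 2 * real n" using assms(1) by real_asymp
  then show ?thesis using eventually_real_ge[of 1]
  proof eventually_elim
    case (elim n)
    show ?case
    proof (intro allI impI)
      fix V s assume V: "finite V" "card V = n" and ch: "cheap k V s e"
      let ?I = "{S. S \<subseteq> V \<and> S \<noteq> {} \<and> card S \<le> k}"
      have finI: "finite ?I" using V(1) by (rule_tac finite_subset[of _ "Pow V"]) auto
      have n1: "n \<ge> 1" using elim(2) by simp
      let ?B = "2 powr (real (n choose k) - \<gamma> * real n ^ k + real k * (e * real n ^ k))"
      have "real (card (\<Union>S\<in>?I. {F\<in>sparse_forms k V s. \<gamma> * real n ^ k \<le> real (card (kill k V S F))})) \<le> 2 powr (\<gamma> / 2 * real n ^ k) * ?B"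
      proof (rule card_UN_bound[OF finI])
        fix S assume "S \<in> ?I"
        then show "real (card {F\<in>sparse_forms k V s. \<gamma> * real n ^ k \<le> real (card (kill k V S F))}) \<le> ?B"
          using big_kill_count[OF V(1) ch assms(3), of S "\<gamma> * real n ^ k"] V(2) by simp
      next
        have "card ?I \<le> card {S. S \<subseteq> V \<and> card S \<le> k}" using V(1)
          by (intro card_mono) (auto intro: finite_subset[of _ "Pow V"])
        also have "\<dots> \<le> (n + 1) ^ k" using card_subsets_le_pow[OF V(1), of k] V(2) by simp
        finally have "real (card ?I) \<le> real ((n + 1) ^ k)" by (simp only: of_nat_le_iff)
        also have "\<dots> = (real n + 1) ^ k" by (simp add: add.commute)
        also have "\<dots> \<le> (2 * real n) ^ k" using elim(2) by (intro power_mono) auto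
        also have "\<dots> = 2 powr (real k + real k * log 2 (real n))"
          using power_eq_powr_log[OF n1, of k] by (simp add: power_mult_distrib powr_add powr_realpow)
        also have "\<dots> \<le> 2 powr (\<gamma> / 2 * real n ^ k)"
        proof (rule powr_mono)
          have "\<gamma> / 2 * real n \<le> \<gamma> / 2 * real n ^ k" using assms(1,2) elim(2) by (intro mult_left_mono self_le_power) auto
          then show "real k + real k * log 2 (real n) \<le> \<gamma> / 2 * real n ^ k" using elim(1) by linarith
        qed simp
        finally show "real (card ?I) \<le> 2 powr (\<gamma> / 2 * real n ^ k)" .
      qed simp
      also have "\<dots> \<le> exp2 ((1 - \<gamma> / 4) * real (n choose k))"
        unfolding exp2_def powr_add[symmetric]
      proof (rule powr_mono)
        have "real k * e * real n ^ k \<le> \<gamma> / 4 * real n ^ k" using assms(4) by (intro mult_right_mono) auto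
        moreover have "real (n choose k) \<le> real n ^ k" using card_ksub_le[OF V(1), of k] card_ksub[OF V(1), of k] V(2) by simp
        then have "\<gamma> / 4 * real (n choose k) \<le> \<gamma> / 4 * real n ^ k" using assms(1) by (intro mult_left_mono) auto
        ultimately show "\<gamma> / 2 * real n ^ k + (real (n choose k) - \<gamma> * real n ^ k + real k * (e * real n ^ k)) \<le> (1 - \<gamma> / 4) * real (n choose k)"
          by (simp add: left_diff_distrib mult.assoc)
      qed simp
      finally show "real (card (\<Union>S\<in>?I. {F\<in>sparse_forms k V s. \<gamma> * real n ^ k \<le> real (card (kill k V S F))})) \<le> exp2 ((1 - \<gamma> / 4) * real (n choose k))" .
    qed
  qed
qed

text \<open>Each alternative is entered only when the earlier ones that it relies on fail: a small
  \<open>kill\<close> gives thin negative links, and these are then available in the deletion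
  arguments. \<open>Min S\<close> merely fixes which variable of \<open>S\<close> is kept as
  reference.\<close>

lemma good_cover:
  assumes "finite V" "card V = n" "k \<ge> 3"
  shows "good k V s d \<subseteq> {F\<in>sparse_forms k V s. negs F = {}} \<union>
    (\<Union>S\<in>{S. S \<subseteq> V \<and> S \<noteq> {} \<and> card S \<le> k}. {F\<in>sparse_forms k V s. \<gamma> * real n ^ k \<le> real (card (kill k V S F))}) \<union>
    (\<Union>x\<in>V. {F\<in>sparse_forms k V s. d * real n ^ (k - 1) \<le> real (card (plink F x)) \<and>
        t * real n ^ (k - 1) \<le> real (card (nlink F x)) \<and> real (card (kill k V {x} F)) \<le> \<gamma> * real n ^ k}) \<union>
    (\<Union>i\<in>{1..k-2}. \<Union>S\<in>ksub V i. {F\<in>sparse_forms k V s. (\<forall>x\<in>S. real (card (nlink F x)) \<le> t * real n ^ (k - 1)) \<and>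
        \<xi> * real n ^ (k - 1 - i) \<le> real (card (atypical k V b S F))}) \<union>
    (\<Union>S\<in>ksub V (k - 1). {F\<in>sparse_forms k V s. (\<forall>x\<in>S. real (card (nlink F x)) \<le> t * real n ^ (k - 1)) \<and>
        d * real n ^ (k - 1) \<le> real (card (plink F (Min S))) \<and> real (card (extensions V F S {})) < b * real n ^ (k - 1)}) \<union>
    (\<Union>S\<in>ksub V k. \<Union>x\<in>S. \<Union>y\<in>S - {x}. {F\<in>sparse_forms k V s. (\<forall>x\<in>S. real (card (nlink F x)) \<le> t * real n ^ (k - 1)) \<and> (S,{}) \<in> F \<and>
        c1 * real n ^ k \<le> real (card (common (V - S) (k - 1) (plink F x) (plink F y))) \<and>
        real (card (kill k V S F)) \<le> \<gamma> * real n ^ k}) \<union>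
    (\<Union>S\<in>ksub V k. {F\<in>sparse_forms k V s. (\<forall>x\<in>S. real (card (nlink F x)) \<le> t * real n ^ (k - 1) \<and> d * real n ^ (k - 1) \<le> real (card (plink F x))) \<and>
        (\<forall>x\<in>S. \<forall>y\<in>S. x \<noteq> y \<longrightarrow> real (card (common (V - S) (k - 1) (plink F x) (plink F y))) \<le> c1 * real n ^ k)}) \<union>
    residual k V s b \<xi>" (is "_ \<subseteq> ?M \<union> ?K \<union> ?A1 \<union> ?A2 \<union> ?A3 \<union> ?A4 \<union> ?A5 \<union> ?B")
proof
  fix F assume F: "F \<in> good k V s d"
  have Fs: "F \<in> sparse_forms k V s" and ld: "\<And>x. x \<in> V \<Longrightarrow> d * real n ^ (k - 1) \<le> real (card (plink F x))"
    using F assms(2) by (auto simp: good_def)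
  show "F \<in> ?M \<union> ?K \<union> ?A1 \<union> ?A2 \<union> ?A3 \<union> ?A4 \<union> ?A5 \<union> ?B"
  proof (rule ccontr)
    assume "F \<notin> ?M \<union> ?K \<union> ?A1 \<union> ?A2 \<union> ?A3 \<union> ?A4 \<union> ?A5 \<union> ?B"
    then have no: "F \<notin> ?M" "F \<notin> ?K" "F \<notin> ?A1" "F \<notin> ?A2" "F \<notin> ?A3" "F \<notin> ?A4" "F \<notin> ?A5" "F \<notin> ?B" by simp_all
    have kl: "real (card (kill k V S F)) \<le> \<gamma> * real n ^ k" if "S \<subseteq> V" "S \<noteq> {}" "card S \<le> k" for S
    proof (rule ccontr)
      assume "\<not> ?thesis"
      then have "F \<in> ?K" using that Fs by (intro UN_I[of S]) auto
      then show False using no(2) by simp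
    qed
    have tl: "real (card (nlink F x)) \<le> t * real n ^ (k - 1)" if x: "x \<in> V" for x
    proof (rule ccontr)
      assume "\<not> ?thesis"
      moreover have "real (card (kill k V {x} F)) \<le> \<gamma> * real n ^ k" using x assms(3) by (intro kl) auto
      ultimately have "F \<in> ?A1" using x Fs ld[OF x] by (intro UN_I[of x]) auto
      then show False using no(3) by simp
    qed
    have a2: "real (card (atypical k V b S F)) \<le> \<xi> * real n ^ (k - 1 - card S)" if S: "S \<subseteq> V" "1 \<le> card S" "card S + 2 \<le> k" for S
    proof (rule ccontr)
      assume n: "\<not> ?thesis"
      have "F \<in> ?A2"
      proof (rule UN_I[of "card S"])
        show "card S \<in> {1..k-2}" using S by auto
        show "F \<in> (\<Union>S'\<in>ksub V (card S). {F\<in>sparse_forms k V s. (\<forall>x\<in>S'. real (card (nlink F x)) \<le> t * real n ^ (k - 1)) \<and>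
          \<xi> * real n ^ (k - 1 - card S) \<le> real (card (atypical k V b S' F))})"
          using n S(1) Fs tl by (intro UN_I[of S]) (auto simp: ksub_def)
      qed
      then show False using no(4) by simp
    qed
    have a3: "atypical k V b S F = {}" if S: "S \<subseteq> V" "card S = k - 1" for S
    proof (rule ccontr)
      assume "atypical k V b S F \<noteq> {}"
      then obtain T where T: "T \<in> atypical k V b S F" by auto
      have "finite T" "card T = 0" using T S finite_subset[OF _ assms(1), of T] by (auto simp: atypical_def ksub_def)
      then have "T = {}" by simp
      then have e: "real (card (extensions V F S {})) < b * real n ^ (k - 1)" using T S assms(2) by (simp add: atypical_def)
      have "finite S" "S \<noteq> {}" using S assms finite_subset[OF S(1) assms(1)] by auto
      then have "Min S \<in> S" by (rule Min_in)
      then have "F \<in> ?A3" using e S Fs tl ld by (intro UN_I[of S]) (auto simp: ksub_def)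
      then show False using no(5) by simp
    qed
    have a4: "(S,{}) \<notin> F" for S
    proof
      assume SF: "(S,{}) \<in> F"
      then have S: "S \<subseteq> V" "card S = k" using sparse_forms_sub[OF Fs] by (auto simp: pairs_def)
      have Sk: "S \<in> ksub V k" using S by (simp add: ksub_def)
      have S0: "S \<noteq> {}" using S assms(3) by auto
      have kS: "real (card (kill k V S F)) \<le> \<gamma> * real n ^ k" using S S0 by (intro kl) auto
      have "real (card (common (V - S) (k - 1) (plink F x) (plink F y))) \<le> c1 * real n ^ k" if xy: "x \<in> S" "y \<in> S" "x \<noteq> y" for x y
      proof (rule ccontr)
        assume "\<not> ?thesis"
        then have "F \<in> ?A4" using xy SF kS Fs tl S
          by (intro UN_I[OF Sk] UN_I[OF xy(1)] UN_I[of y]) auto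
        then show False using no(6) by simp
      qed
      then have "F \<in> ?A5" using Fs tl ld S by (intro UN_I[OF Sk]) auto
      then show False using no(7) by simp
    qed
    have "negs F \<noteq> {}" using no(1) Fs by simp
    then have "F \<in> ?B" unfolding residual_def using Fs a2 a3 a4 assms(2) by simp
    then show False using no(8) by simp
  qed
qed

lemma poly_le_exponential:
  assumes "2 + 2 * real k + real k * log 2 (real n) \<le> x" "n \<ge> 1"
  shows "4 * real k ^ 2 * real n ^ k \<le> 2 powr x"
proof -
  have "real k \<le> 2 ^ k" using of_nat_less_two_power[of k, where ?'a = real] by linarith
  then have "real k ^ 2 \<le> (2 ^ k) ^ 2" by (intro power_mono) auto
  also have "\<dots> = 2 powr (2 * real k)"
  proof -
    have "(2::real) ^ k = 2 powr real k" by (simp add: powr_realpow)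
    then show ?thesis by (simp only: powr_power) (simp add: mult.commute)
  qed
  finally have "4 * real k ^ 2 * real n ^ k \<le> 4 * 2 powr (2 * real k) * real n ^ k" by (intro mult_right_mono mult_left_mono) auto
  also have "\<dots> = 2 powr (2 + 2 * real k + real k * log 2 (real n))"
    using power_eq_powr_log[OF assms(2), of k] by (simp add: powr_add)
  also have "\<dots> \<le> 2 powr x" using assms(1) by (intro powr_mono) auto
  finally show ?thesis .
qed

text \<open>The constants depend on each other in the order \<open>c1\<close>, \<open>b\<close>,
  \<open>\<xi>\<close>, \<open>\<delta>1\<close>, \<open>e2\<close>, \<open>t\<close>,
  \<open>\<gamma>1\<close>, \<open>\<gamma>\<close>, \<open>e\<close>, \<open>z\<close>. Two rates
  are needed: \<open>e2\<close> fixes the threshold \<open>t\<close> for thin negative links and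
  suffices for the deletions with thin links, but \<open>\<gamma>1\<close> and \<open>cA\<close>
  depend on \<open>t\<close>, so the rate \<open>e\<close> for a large \<open>kill\<close> or a
  large negative link comes later. What is cheap at rate \<open>e\<close> is also cheap at the rates
  \<open>e2\<close> and \<open>eB\<close>.\<close>

lemma good_count_ge3:
  assumes "k \<ge> 3" "d > 0"
  shows "\<exists>z>0. \<exists>c>0. \<forall>\<^sub>F n in sequentially. real (card (good k {1..n} (z * real n) d)) \<le>
     2 ^ (n choose k) + exp2 ((1 - c) * real (n choose k))
     + (\<Sum>i=1..k-2. exp2 (real i * (1 - c) * real (n choose (k - 1))) * real (card (minimal_formulae k (n - i))))
     + exp2 (real k / 2 * (1 - c) * real (n choose (k - 1))) * real (card (minimal_formulae k (n - k)))
     + exp2 (real (n choose k) - c * real n)"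
proof -
  have kp: "real k \<ge> 3" using assms(1) by simp
  obtain c1 c3 where c1: "c1 > 0" and c3: "c3 > 0" and ev5: "\<forall>\<^sub>F n in sequentially. \<forall>V s e S. finite V \<longrightarrow> card V = n \<longrightarrow> cheap k V s e \<longrightarrow> e > 0 \<longrightarrow>
     real n \<ge> real k ^ 2 / e \<longrightarrow> S \<subseteq> V \<longrightarrow> card S = k \<longrightarrow>
     real (card {F\<in>sparse_forms k V s. (\<forall>x\<in>S. real (card (nlink F x)) \<le> thin e * real n ^ (k - 1) \<and> d * real n ^ (k - 1) \<le> real (card (plink F x))) \<and>
        (\<forall>x\<in>S. \<forall>y\<in>S. x \<noteq> y \<longrightarrow> real (card (common (V - S) (k - 1) (plink F x) (plink F y))) \<le> c1 * real n ^ k)})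
     \<le> real (card (minimal_forms k (V - S))) *
        (2 * 2 powr (real k / 2 * (real (n choose (k - 1)) - c3 * real n ^ (k - 1)) + 4 * real k ^ 2 * e * real n ^ (k - 1)))"
    using negative_clause_all_pairs_count[OF assms(2,1)] by blast
  define g where "g = tuple_gain (k - 2)"
  have g: "g > 0" using tuple_gain_pos by (simp add: g_def)
  \<comment> \<open>One threshold for all uses of \<open>atypical\<close>: full intersections with
    \<open>card S = k - 1\<close>, the independent blocks of residual formulae, and many atypical
    sets for one \<open>S\<close>, in this order.\<close>
  define b where "b = Min (insert (g * (d / 2)) ((\<lambda>i. tuple_gain i * (1 / (real k * 2 ^ (k + 1))) ^ k) ` {1..<k} \<union> (\<lambda>i. tuple_gain i / (4 * real k) ^ k) ` {1..<k}))"
  have b: "b > 0" unfolding b_def using g assms kp tuple_gain_pos by (subst Min_gr_iff) auto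
  have b1: "b \<le> g * (d / 2)" unfolding b_def by (intro Min_le) auto
  have b2: "b \<le> tuple_gain i * (1 / (real k * 2 ^ (k + 1))) ^ k" if "i \<in> {1..<k}" for i unfolding b_def using that by (intro Min_le) auto
  have b3: "b \<le> tuple_gain i / (4 * real k) ^ k" if "i \<in> {1..<k}" for i unfolding b_def using that by (intro Min_le) auto
  have k2: "k \<ge> 2" using assms(1) by simp
  obtain \<xi> eB cB where \<xi>: "\<xi> > 0" and eB: "eB > 0" and cB: "cB > 0" and evB: "\<forall>\<^sub>F n in sequentially. \<forall>V s. finite V \<longrightarrow> card V = n \<longrightarrow> cheap k V s eB \<longrightarrow>
     real (card (residual k V s b \<xi>)) \<le> 2 powr (real (n choose k) - cB * real n)"
    using residual_count[OF k2 b b2] by blast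
  \<comment> \<open>The least saving, per \<open>n ^ (k - 1)\<close>, among the deletions with thin
    negative links.\<close>
  define \<delta>1 where "\<delta>1 = Min ({c3, g * (d / 2), g * c1} \<union> (\<lambda>i. tuple_gain i / (4 * real k) ^ k * \<xi>) ` {1..<k})"
  have \<delta>1: "\<delta>1 > 0" unfolding \<delta>1_def using c3 g assms c1 \<xi> kp tuple_gain_pos by (subst Min_gr_iff) auto
  have \<delta>1a: "\<delta>1 \<le> c3" "\<delta>1 \<le> g * (d / 2)" "\<delta>1 \<le> g * c1" unfolding \<delta>1_def by (intro Min_le; simp)+
  have \<delta>1b: "\<delta>1 \<le> tuple_gain i / (4 * real k) ^ k * \<xi>" if "i \<in> {1..<k}" for i unfolding \<delta>1_def using that by (intro Min_le) auto
  define e2 where "e2 = min eB (\<delta>1 / (16 * real k ^ 2))"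
  have e2: "e2 > 0" "e2 \<le> eB" using eB \<delta>1 kp by (auto simp: e2_def)
  have e2b: "4 * real k ^ 2 * e2 \<le> \<delta>1 / 4"
  proof -
    have "4 * real k ^ 2 * e2 \<le> 4 * real k ^ 2 * (\<delta>1 / (16 * real k ^ 2))" by (intro mult_left_mono) (auto simp: e2_def)
    also have "\<dots> = \<delta>1 / 4" using kp by (simp add: field_simps)
    finally show ?thesis .
  qed
  define t where "t = thin e2"
  have t: "t > 0" using thin_pos[OF e2(1)] by (simp add: t_def)
  obtain \<gamma>1 cA where \<gamma>1: "\<gamma>1 > 0" and cA: "cA > 0" and ev1: "\<forall>\<^sub>F n in sequentially. \<forall>V s e x. finite V \<longrightarrow> card V = n \<longrightarrow> cheap k V s e \<longrightarrow> e > 0 \<longrightarrow>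
     real n \<ge> real k ^ 2 / e \<longrightarrow> x \<in> V \<longrightarrow>
     real (card {F\<in>sparse_forms k V s. d * real n ^ (k - 1) \<le> real (card (plink F x)) \<and>
        t * real n ^ (k - 1) \<le> real (card (nlink F x)) \<and> real (card (kill k V {x} F)) \<le> \<gamma>1 * real n ^ k})
     \<le> real (card (minimal_forms k (V - {x}))) *
        2 powr (real (n choose (k - 1)) - cA * real n ^ (k - 1) + 3 * real k ^ 2 * e * real n ^ (k - 1))"
    using large_negative_link_count[OF assms(2) t assms(1)] by blast
  \<comment> \<open>The first bound is for large negative links, the second for a pair with many
    common sets in a clause with only negative literals.\<close>
  define \<gamma> where "\<gamma> = min \<gamma>1 (g * c1\<^sup>2 / real k)"
  have \<gamma>: "\<gamma> > 0" "\<gamma> \<le> \<gamma>1" "\<gamma> \<le> g * c1\<^sup>2 / real k" using \<gamma>1 g c1 kp by (auto simp: \<gamma>_def)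
  define e where "e = min e2 (min (cA / (6 * real k ^ 2)) (\<gamma> / (4 * real k)))"
  have e: "e > 0" "e \<le> e2" using e2 cA \<gamma> kp by (auto simp: e_def)
  have eA: "3 * real k ^ 2 * e \<le> cA / 2"
  proof -
    have "3 * real k ^ 2 * e \<le> 3 * real k ^ 2 * (cA / (6 * real k ^ 2))" by (intro mult_left_mono) (auto simp: e_def)
    also have "\<dots> = cA / 2" using kp by (simp add: field_simps)
    finally show ?thesis .
  qed
  have eK: "real k * e \<le> \<gamma> / 4"
  proof -
    have "real k * e \<le> real k * (\<gamma> / (4 * real k))" by (intro mult_left_mono) (auto simp: e_def)
    also have "\<dots> = \<gamma> / 4" using kp by (simp add: field_simps)
    finally show ?thesis .
  qed
  obtain z where z: "z > 0" and evC: "\<forall>\<^sub>F n in sequentially. \<forall>V. finite V \<longrightarrow> card V = n \<longrightarrow> cheap k V (z * real n) e"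
    using card_loose_families[OF e(1)] by blast
  have k1: "k \<ge> 1" using assms(1) by simp
  note evK = big_kill_union_count[OF \<gamma>(1) k1 e(1) eK]
  \<comment> \<open>What is left of \<open>\<delta>1\<close> after a quarter each for the rate
    \<open>e2\<close> and for the term \<open>n ^ (k - 2)\<close>, and of \<open>cA\<close> after
    one half for the rate \<open>e\<close>.\<close>
  define \<delta> where "\<delta> = min (\<delta>1 / 2) (cA / 2)"
  have \<delta>: "\<delta> > 0" "\<delta> \<le> \<delta>1 / 2" "\<delta> \<le> cA / 2" using \<delta>1 cA by (auto simp: \<delta>_def)
  have lg: "\<forall>\<^sub>F n in sequentially. 2 + 2 * real k + real k * log 2 (real n) \<le> \<delta> / 2 * real n" using \<delta>(1) by real_asymp
  \<comment> \<open>The factor \<open>1 - c\<close> applies to at most \<open>k\<close> links, so it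
    uses up \<open>k * c \<le> \<delta> / 2\<close>; the other \<open>\<delta> / 2\<close> absorbs
    the polynomial number of choices of variables.\<close>
  define c where "c = min (min (\<delta> / (2 * real k)) (\<gamma> / 4)) cB"
  have c: "c > 0" "c \<le> \<delta> / (2 * real k)" "c \<le> \<gamma> / 4" "c \<le> cB" using \<delta> \<gamma> cB kp by (auto simp: c_def)
  have kc: "real k * c \<le> \<delta> / 2"
  proof -
    have "real k * c \<le> real k * (\<delta> / (2 * real k))" using c(2) by (intro mult_left_mono) auto
    also have "\<dots> = \<delta> / 2" using kp by simp
    finally show ?thesis .
  qed
  have "\<forall>\<^sub>F n in sequentially. real (card (good k {1..n} (z * real n) d)) \<le>
     2 ^ (n choose k) + exp2 ((1 - c) * real (n choose k))
     + (\<Sum>i=1..k-2. exp2 (real i * (1 - c) * real (n choose (k - 1))) * real (card (minimal_formulae k (n - i))))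
     + exp2 (real k / 2 * (1 - c) * real (n choose (k - 1))) * real (card (minimal_formulae k (n - k)))
     + exp2 (real (n choose k) - c * real n)"
    using ev5 evB ev1 evC evK lg eventually_real_ge[of 1] eventually_real_ge[of "2 * real k"] eventually_real_ge[of "real k ^ 2 / e"]
      eventually_real_ge[of "real k ^ 2 / e2"] eventually_real_ge[of "2 * real k / d"] eventually_real_ge[of "4 / \<delta>1"]
  proof eventually_elim
    case (elim n)
    define V where "V = {1..n}"
    define s where "s = z * real n"
    have V: "finite V" "card V = n" by (auto simp: V_def)
    have n1: "n \<ge> 1" using elim(7) by simp
    have ch: "cheap k V s e" using elim(4) V by (simp add: s_def)
    have ch2: "cheap k V s e2" by (rule cheap_mono[OF ch e(2)])
    have chB: "cheap k V s eB" by (rule cheap_mono[OF ch2 e2(2)])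
    define P where "P i = real (card (minimal_formulae k (n - i)))" for i
    define n' where "n' = real n ^ (k - 1)"
    define Cn where "Cn = real (n choose (k - 1))"
    define U where "U i = P i * 2 powr (real i * Cn - \<delta> * n')" for i
    have U0: "U i \<ge> 0" for i by (simp add: U_def P_def)
    have n'0: "n' \<ge> 0" "real n \<le> n'" using n1 assms(1) by (auto simp: n'_def self_le_power)
    have Cn: "0 \<le> Cn" "Cn \<le> n'" unfolding Cn_def n'_def
      using card_ksub_le[OF V(1), of "k - 1"] card_ksub[OF V(1), of "k - 1"] V(2) by auto
    have n2: "real n ^ (k - 2) \<le> \<delta>1 / 4 * n'"
    proof -
      have "1 \<le> \<delta>1 / 4 * real n" using elim(12) \<delta>1 by (simp add: field_simps)
      then have "1 * real n ^ (k - 2) \<le> (\<delta>1 / 4 * real n) * real n ^ (k - 2)" by (intro mult_right_mono) auto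
      also have "\<dots> = \<delta>1 / 4 * real n ^ Suc (k - 2)" by simp
      also have "Suc (k - 2) = k - 1" using assms(1) by simp
      finally show ?thesis by (simp add: n'_def)
    qed
    have pm: "real (card (minimal_forms k (V - X))) \<le> P i" if "X \<subseteq> V" "card X = i" for X i
    proof -
      have "card (V - X) = n - i" using that V finite_subset[OF that(1) V(1)] by (simp add: card_Diff_subset)
      then show ?thesis using card_minimal_forms_le[of "V - X" k] V(1) by (simp add: P_def)
    qed
    have ks: "real (card (ksub V i)) \<le> real n ^ k" if "i \<le> k" for i
    proof -
      have "real (card (ksub V i)) \<le> real n ^ i" using card_ksub_le[OF V(1)] V(2) by metis
      also have "\<dots> \<le> real n ^ k" using that n1 by (intro power_increasing) auto
      finally show ?thesis .
    qed
    have saving: "real (card (minimal_forms k (V - X))) * 2 powr x \<le> U i"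
      if "X \<subseteq> V" "card X = i" "x \<le> real i * Cn - \<delta> * n'" for X i x
      unfolding U_def using pm[OF that(1,2)] that(3) by (intro mult_mono powr_mono) auto
    define M where "M = {F\<in>sparse_forms k V s. negs F = {}}"
    define K where "K = (\<Union>S\<in>{S. S \<subseteq> V \<and> S \<noteq> {} \<and> card S \<le> k}. {F\<in>sparse_forms k V s. \<gamma> * real n ^ k \<le> real (card (kill k V S F))})"
    define A1 where "A1 x = {F\<in>sparse_forms k V s. d * real n ^ (k - 1) \<le> real (card (plink F x)) \<and>
        t * real n ^ (k - 1) \<le> real (card (nlink F x)) \<and> real (card (kill k V {x} F)) \<le> \<gamma> * real n ^ k}" for x
    define A2 where "A2 i S = {F\<in>sparse_forms k V s. (\<forall>x\<in>S. real (card (nlink F x)) \<le> t * real n ^ (k - 1)) \<and>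
        \<xi> * real n ^ (k - 1 - i) \<le> real (card (atypical k V b S F))}" for i S
    define A3 where "A3 S = {F\<in>sparse_forms k V s. (\<forall>x\<in>S. real (card (nlink F x)) \<le> t * real n ^ (k - 1)) \<and>
        d * real n ^ (k - 1) \<le> real (card (plink F (Min S))) \<and> real (card (extensions V F S {})) < b * real n ^ (k - 1)}" for S
    define A4 where "A4 S x y = {F\<in>sparse_forms k V s. (\<forall>x\<in>S. real (card (nlink F x)) \<le> t * real n ^ (k - 1)) \<and> (S,{}) \<in> F \<and>
        c1 * real n ^ k \<le> real (card (common (V - S) (k - 1) (plink F x) (plink F y))) \<and>
        real (card (kill k V S F)) \<le> \<gamma> * real n ^ k}" for S x y
    define A5 where "A5 S = {F\<in>sparse_forms k V s. (\<forall>x\<in>S. real (card (nlink F x)) \<le> t * real n ^ (k - 1) \<and> d * real n ^ (k - 1) \<le> real (card (plink F x))) \<and>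
        (\<forall>x\<in>S. \<forall>y\<in>S. x \<noteq> y \<longrightarrow> real (card (common (V - S) (k - 1) (plink F x) (plink F y))) \<le> c1 * real n ^ k)}" for S
    define B where "B = residual k V s b \<xi>"
    let ?Un = "M \<union> K \<union> (\<Union>x\<in>V. A1 x) \<union> (\<Union>i\<in>{1..k-2}. \<Union>S\<in>ksub V i. A2 i S) \<union> (\<Union>S\<in>ksub V (k - 1). A3 S) \<union>
       (\<Union>S\<in>ksub V k. \<Union>x\<in>S. \<Union>y\<in>S - {x}. A4 S x y) \<union> (\<Union>S\<in>ksub V k. A5 S) \<union> B"
    have cover: "good k V s d \<subseteq> ?Un"
      unfolding M_def K_def A1_def A2_def A3_def A4_def A5_def B_def by (rule good_cover[OF V assms(1)])
    have "M \<subseteq> sparse_forms k V s" "K \<subseteq> sparse_forms k V s" "B \<subseteq> sparse_forms k V s" "\<And>x. A1 x \<subseteq> sparse_forms k V s" "\<And>i S. A2 i S \<subseteq> sparse_forms k V s"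
      "\<And>S. A3 S \<subseteq> sparse_forms k V s" "\<And>S x y. A4 S x y \<subseteq> sparse_forms k V s" "\<And>S. A5 S \<subseteq> sparse_forms k V s"
      unfolding M_def K_def A1_def A2_def A3_def A4_def A5_def B_def residual_def by auto
    then have "?Un \<subseteq> sparse_forms k V s" by (intro Un_least UN_least)
    then have "finite ?Un" by (rule finite_subset[OF _ finite_sparse_forms[OF V(1)]])
    then have "card (good k V s d) \<le> card ?Un" using cover by (intro card_mono)
    also have "\<dots> \<le> card M + card K + card (\<Union>x\<in>V. A1 x) + card (\<Union>i\<in>{1..k-2}. \<Union>S\<in>ksub V i. A2 i S) + card (\<Union>S\<in>ksub V (k - 1). A3 S) +
       card (\<Union>S\<in>ksub V k. \<Union>x\<in>S. \<Union>y\<in>S - {x}. A4 S x y) + card (\<Union>S\<in>ksub V k. A5 S) + card B"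
      by (intro order_trans[OF card_Un_le] add_mono order_refl)
    finally have total: "real (card (good k V s d)) \<le> real (card M) + real (card K) + real (card (\<Union>x\<in>V. A1 x)) +
       real (card (\<Union>i\<in>{1..k-2}. \<Union>S\<in>ksub V i. A2 i S)) + real (card (\<Union>S\<in>ksub V (k - 1). A3 S)) +
       real (card (\<Union>S\<in>ksub V k. \<Union>x\<in>S. \<Union>y\<in>S - {x}. A4 S x y)) + real (card (\<Union>S\<in>ksub V k. A5 S)) + real (card B)"
      by linarith
    have "real (card M) \<le> real (2 ^ (n choose k))"
      using card_monotone_formulae[OF V(1), of k s] V(2) unfolding M_def of_nat_le_iff by simp
    then have bM: "real (card M) \<le> 2 ^ (n choose k)" by simp
    have "real (card K) \<le> exp2 ((1 - \<gamma> / 4) * real (n choose k))" unfolding K_def using elim(5) V ch by blast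
    also have "\<dots> \<le> exp2 ((1 - c) * real (n choose k))" unfolding exp2_def using c(3) by (intro powr_mono mult_right_mono) auto
    finally have bK: "real (card K) \<le> exp2 ((1 - c) * real (n choose k))" .
    have "real (card B) \<le> 2 powr (real (n choose k) - cB * real n)" unfolding B_def using elim(2) V chB by blast
    also have "\<dots> \<le> exp2 (real (n choose k) - c * real n)" unfolding exp2_def using c(4) by (intro powr_mono diff_left_mono mult_right_mono) auto
    finally have bB: "real (card B) \<le> exp2 (real (n choose k) - c * real n)" .
    have b1': "real (card (\<Union>x\<in>V. A1 x)) \<le> real n ^ k * U 1"
    proof (rule card_UN_bound[OF V(1)])
      fix x assume x: "x \<in> V"
      let ?A = "{F\<in>sparse_forms k V s. d * real n ^ (k - 1) \<le> real (card (plink F x)) \<and>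
        t * real n ^ (k - 1) \<le> real (card (nlink F x)) \<and> real (card (kill k V {x} F)) \<le> \<gamma>1 * real n ^ k}"
      have "\<gamma> * real n ^ k \<le> \<gamma>1 * real n ^ k" using \<gamma>(2) by (intro mult_right_mono) auto
      then have "A1 x \<subseteq> ?A" by (auto simp: A1_def)
      then have "card (A1 x) \<le> card ?A" using finite_sparse_forms[OF V(1)] by (intro card_mono) auto
      then have "real (card (A1 x)) \<le> real (card ?A)" by (simp only: of_nat_le_iff)
      also have "\<dots> \<le> real (card (minimal_forms k (V - {x}))) *
        2 powr (real (n choose (k - 1)) - cA * real n ^ (k - 1) + 3 * real k ^ 2 * e * real n ^ (k - 1))"
        using elim(3) V ch e(1) elim(9) x by blast
      also have "\<dots> \<le> U 1"
      proof (rule saving)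
        have "3 * real k ^ 2 * e * n' \<le> cA / 2 * n'" using eA n'0 by (intro mult_right_mono) auto
        moreover have "\<delta> * n' \<le> cA / 2 * n'" using \<delta>(3) n'0 by (intro mult_right_mono) auto
        ultimately show "real (n choose (k - 1)) - cA * real n ^ (k - 1) + 3 * real k ^ 2 * e * real n ^ (k - 1) \<le> real 1 * Cn - \<delta> * n'"
          unfolding Cn_def[symmetric] n'_def[symmetric] by simp
      qed (use x in auto)
      finally show "real (card (A1 x)) \<le> U 1" .
    qed (use V(2) n1 assms(1) U0 in \<open>auto simp: self_le_power\<close>)
    have b2': "real (card (\<Union>i\<in>{1..k-2}. \<Union>S\<in>ksub V i. A2 i S)) \<le> real n ^ k * (\<Sum>i=1..k-2. U i)"
    proof -
      have each: "real (card (\<Union>S\<in>ksub V i. A2 i S)) \<le> real n ^ k * U i" if i: "i \<in> {1..k-2}" for i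
      proof (rule card_UN_bound[OF finite_ksub[OF V(1)]])
        fix S assume "S \<in> ksub V i"
        then have S: "S \<subseteq> V" "card S = i" by (auto simp: ksub_def)
        have ik: "i \<in> {1..<k}" "1 \<le> i" "i + 2 \<le> k" using i assms(1) by auto
        have "real (card (A2 i S)) \<le> real (card (minimal_forms k (V - S))) *
          2 powr (real i * real (card V choose (k - 1)) - tuple_gain i / (4 * real k) ^ k * \<xi> * real (card V) ^ (k - 1)
           + real (card V) ^ (k - 2) + 4 * real k ^ 2 * e2 * real (card V) ^ (k - 1))"
          using elim(8,10) V(2)
          by (intro many_atypical_count[OF V(1) ch2 e2(1) S ik(2,3) _ _ b3[OF ik(1)]]) (auto simp: A2_def t_def)
        also have "\<dots> \<le> U i"
        proof (rule saving[OF S])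
          have "4 * real k ^ 2 * e2 * n' \<le> \<delta>1 / 4 * n'" using e2b n'0 by (intro mult_right_mono) auto
          moreover have "\<delta>1 * n' \<le> tuple_gain i / (4 * real k) ^ k * \<xi> * n'" using \<delta>1b[OF ik(1)] n'0 by (intro mult_right_mono) auto
          moreover have "\<delta> * n' \<le> \<delta>1 / 2 * n'" using \<delta>(2) n'0 by (intro mult_right_mono) auto
          ultimately show "real i * real (card V choose (k - 1)) - tuple_gain i / (4 * real k) ^ k * \<xi> * real (card V) ^ (k - 1)
           + real (card V) ^ (k - 2) + 4 * real k ^ 2 * e2 * real (card V) ^ (k - 1) \<le> real i * Cn - \<delta> * n'"
            unfolding V(2) Cn_def[symmetric] n'_def[symmetric] using n2 by linarith
        qed
        finally show "real (card (A2 i S)) \<le> U i" .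
      qed (use ks[of i] i U0 in auto)
      have "real (card (\<Union>i\<in>{1..k-2}. \<Union>S\<in>ksub V i. A2 i S)) \<le> (\<Sum>i\<in>{1..k-2}. real (card (\<Union>S\<in>ksub V i. A2 i S)))"
        unfolding of_nat_sum[symmetric] of_nat_le_iff by (intro card_UN_le) simp
      also have "\<dots> \<le> (\<Sum>i\<in>{1..k-2}. real n ^ k * U i)" using each by (intro sum_mono)
      finally show ?thesis by (simp add: sum_distrib_left)
    qed
    have b3': "real (card (\<Union>S\<in>ksub V (k - 1). A3 S)) \<le> real n ^ k * U (k - 2)"
    proof (rule card_UN_bound[OF finite_ksub[OF V(1)]])
      fix S assume "S \<in> ksub V (k - 1)"
      then have S: "S \<subseteq> V" "card S = k - 1" by (auto simp: ksub_def)
      have fS: "finite S" by (rule finite_subset[OF S(1) V(1)])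
      have "S \<noteq> {}" using S assms(1) by auto
      then have m: "Min S \<in> S" using fS by (intro Min_in)
      have "real (card (A3 S)) \<le> real (card (minimal_forms k (V - (S - {Min S})))) *
         2 powr (real (k - 2) * real (card V choose (k - 1)) - tuple_gain (k - 2) * (d / 2) * real (card V) ^ (k - 1)
         + 4 * real k ^ 2 * e2 * real (card V) ^ (k - 1))"
        using elim(10,11) V(2) b1
        by (intro atypical_full_count[OF V(1) ch2 e2(1) S assms(1) m assms(2), where b = b]) (auto simp: A3_def t_def g_def)
      also have "\<dots> \<le> U (k - 2)"
      proof (rule saving)
        show "card (S - {Min S}) = k - 2" using m fS S by simp
        have "4 * real k ^ 2 * e2 * n' \<le> \<delta>1 / 4 * n'" using e2b n'0 by (intro mult_right_mono) auto
        moreover have "\<delta>1 * n' \<le> g * (d / 2) * n'" using \<delta>1a(2) n'0 by (intro mult_right_mono) auto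
        moreover have "\<delta> * n' \<le> \<delta>1 / 2 * n'" using \<delta>(2) n'0 by (intro mult_right_mono) auto
        moreover have "0 \<le> \<delta>1 * n'" using \<delta>1 n'0 by simp
        ultimately show "real (k - 2) * real (card V choose (k - 1)) - tuple_gain (k - 2) * (d / 2) * real (card V) ^ (k - 1)
          + 4 * real k ^ 2 * e2 * real (card V) ^ (k - 1) \<le> real (k - 2) * Cn - \<delta> * n'"
          unfolding V(2) Cn_def[symmetric] n'_def[symmetric] g_def[symmetric] by linarith
      qed (use S in auto)
      finally show "real (card (A3 S)) \<le> U (k - 2)" .
    qed (use ks[of "k - 1"] U0 in auto)
    have b4': "real (card (\<Union>S\<in>ksub V k. \<Union>x\<in>S. \<Union>y\<in>S - {x}. A4 S x y)) \<le> real n ^ k * (real k * (real k * U (k - 2)))"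
    proof (rule card_UN_bound[OF finite_ksub[OF V(1)]])
      fix S assume "S \<in> ksub V k"
      then have S: "S \<subseteq> V" "card S = k" by (auto simp: ksub_def)
      have fS: "finite S" by (rule finite_subset[OF S(1) V(1)])
      show "real (card (\<Union>x\<in>S. \<Union>y\<in>S - {x}. A4 S x y)) \<le> real k * (real k * U (k - 2))"
      proof (rule card_UN_bound[OF fS])
        fix x assume x: "x \<in> S"
        show "real (card (\<Union>y\<in>S - {x}. A4 S x y)) \<le> real k * U (k - 2)"
        proof (rule card_UN_bound)
          fix y assume y: "y \<in> S - {x}"
          then have xy: "y \<in> S" "x \<noteq> y" by auto
          have "real (card (A4 S x y)) \<le> real (card (minimal_forms k (V - (S - {x,y})))) *
            2 powr (real (k - 2) * real (card V choose (k - 1)) - tuple_gain (k - 2) * c1 * real (card V) ^ (k - 1)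
            + 4 * real k ^ 2 * e2 * real (card V) ^ (k - 1))"
            using elim(7,10) V(2) \<gamma>(3)
            by (intro negative_clause_pair_count[OF V(1) ch2 e2(1) S assms(1) x xy c1, where \<gamma> = \<gamma>]) (auto simp: A4_def t_def g_def)
          also have "\<dots> \<le> U (k - 2)"
          proof (rule saving)
            show "card (S - {x,y}) = k - 2" using x xy fS S by (simp add: card_Diff_subset)
            have "4 * real k ^ 2 * e2 * n' \<le> \<delta>1 / 4 * n'" using e2b n'0 by (intro mult_right_mono) auto
            moreover have "\<delta>1 * n' \<le> g * c1 * n'" using \<delta>1a(3) n'0 by (intro mult_right_mono) auto
            moreover have "\<delta> * n' \<le> \<delta>1 / 2 * n'" using \<delta>(2) n'0 by (intro mult_right_mono) auto
            moreover have "0 \<le> \<delta>1 * n'" using \<delta>1 n'0 by simp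
            ultimately show "real (k - 2) * real (card V choose (k - 1)) - tuple_gain (k - 2) * c1 * real (card V) ^ (k - 1)
              + 4 * real k ^ 2 * e2 * real (card V) ^ (k - 1) \<le> real (k - 2) * Cn - \<delta> * n'"
              unfolding V(2) Cn_def[symmetric] n'_def[symmetric] g_def[symmetric] by linarith
          qed (use S in auto)
          finally show "real (card (A4 S x y)) \<le> U (k - 2)" .
        next
          have "card (S - {x}) \<le> k" using fS S(2) by (metis card_Diff1_le)
          then show "real (card (S - {x})) \<le> real k" by simp
        qed (use fS U0 in auto)
      qed (use S U0 in auto)
    qed (use ks[of k] U0 in auto)
    have b5': "real (card (\<Union>S\<in>ksub V k. A5 S)) \<le> real n ^ k * (P k * (2 * 2 powr (real k / 2 * Cn - \<delta> * n')))"
    proof (rule card_UN_bound[OF finite_ksub[OF V(1)]])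
      fix S assume "S \<in> ksub V k"
      then have S: "S \<subseteq> V" "card S = k" by (auto simp: ksub_def)
      have "real (card (A5 S)) \<le> real (card (minimal_forms k (V - S))) *
        (2 * 2 powr (real k / 2 * (real (n choose (k - 1)) - c3 * real n ^ (k - 1)) + 4 * real k ^ 2 * e2 * real n ^ (k - 1)))"
        unfolding A5_def t_def using elim(1) V ch2 e2(1) elim(10) S by blast
      also have "\<dots> \<le> P k * (2 * 2 powr (real k / 2 * Cn - \<delta> * n'))"
      proof (intro mult_mono powr_mono pm[OF S])
        have "4 * real k ^ 2 * e2 * n' \<le> \<delta>1 / 4 * n'" using e2b n'0 by (intro mult_right_mono) auto
        moreover have "\<delta>1 * n' \<le> c3 * n'" using \<delta>1a(1) n'0 by (intro mult_right_mono) auto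
        moreover have "1 * (c3 * n') \<le> real k / 2 * (c3 * n')" using kp c3 n'0 by (intro mult_right_mono) auto
        moreover have "\<delta> * n' \<le> \<delta>1 / 2 * n'" using \<delta>(2) n'0 by (intro mult_right_mono) auto
        moreover have "0 \<le> \<delta>1 * n'" using \<delta>1 n'0 by simp
        moreover have "real k / 2 * (Cn - c3 * n') = real k / 2 * Cn - real k / 2 * (c3 * n')" by (rule right_diff_distrib)
        ultimately show "real k / 2 * (real (n choose (k - 1)) - c3 * real n ^ (k - 1)) + 4 * real k ^ 2 * e2 * real n ^ (k - 1) \<le> real k / 2 * Cn - \<delta> * n'"
          unfolding Cn_def[symmetric] n'_def[symmetric] by linarith
      qed (auto simp: P_def)
      finally show "real (card (A5 S)) \<le> P k * (2 * 2 powr (real k / 2 * Cn - \<delta> * n'))" .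
    qed (use ks[of k] in \<open>auto simp: P_def\<close>)
    have poly: "4 * real k ^ 2 * real n ^ k \<le> 2 powr (\<delta> / 2 * n')"
    proof (rule poly_le_exponential[OF _ n1])
      have "\<delta> / 2 * real n \<le> \<delta> / 2 * n'" using n'0 \<delta>(1) by (intro mult_left_mono) auto
      then show "2 + 2 * real k + real k * log 2 (real n) \<le> \<delta> / 2 * n'" using elim(6) by linarith
    qed
    have gain: "4 * real k ^ 2 * real n ^ k * (P i * 2 powr (x * Cn - \<delta> * n')) \<le> exp2 (x * (1 - c) * Cn) * P i" if x: "0 \<le> x" "x \<le> real k" for i x
    proof -
      have "4 * real k ^ 2 * real n ^ k * (P i * 2 powr (x * Cn - \<delta> * n')) \<le> 2 powr (\<delta> / 2 * n') * (P i * 2 powr (x * Cn - \<delta> * n'))"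
        using poly by (intro mult_right_mono) (auto simp: P_def)
      also have "\<dots> = 2 powr (\<delta> / 2 * n' + (x * Cn - \<delta> * n')) * P i" by (simp only: powr_add mult_ac)
      also have "\<dots> \<le> exp2 (x * (1 - c) * Cn) * P i"
        unfolding exp2_def
      proof (intro mult_right_mono powr_mono)
        have "x * c * Cn \<le> real k * c * n'" using x c(1) Cn by (intro mult_mono) auto
        also have "\<dots> \<le> \<delta> / 2 * n'" using kc n'0 by (intro mult_right_mono) auto
        finally have "x * c * Cn \<le> \<delta> / 2 * n'" .
        moreover have "x * (1 - c) * Cn = x * Cn - x * c * Cn" by (simp add: algebra_simps)
        ultimately show "\<delta> / 2 * n' + (x * Cn - \<delta> * n') \<le> x * (1 - c) * Cn" by linarith
      qed (auto simp: P_def)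
      finally show ?thesis .
    qed
    define Us where "Us = (\<Sum>i=1..k-2. U i)"
    have UU: "U i \<le> Us" if "i \<in> {1..k-2}" for i unfolding Us_def using that U0 by (intro member_le_sum) auto
    have Us0: "Us \<ge> 0" unfolding Us_def using U0 by (intro sum_nonneg) auto
    have nk0: "real n ^ k \<ge> 0" by simp
    have kin: "k - 2 \<in> {1..k-2}" "1 \<in> {1..k-2}" using assms(1) by auto
    have "real n ^ k * U 1 \<le> real n ^ k * Us" using UU[OF kin(2)] by (intro mult_left_mono) auto
    moreover have "real n ^ k * U (k - 2) \<le> real n ^ k * Us" using UU[OF kin(1)] by (intro mult_left_mono) auto
    moreover have "real n ^ k * (real k * (real k * U (k - 2))) \<le> real n ^ k * (real k * (real k * Us))"
      using UU[OF kin(1)] by (intro mult_left_mono) auto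
    moreover have "real n ^ k * Us + real n ^ k * Us + real n ^ k * Us + real n ^ k * (real k * (real k * Us)) \<le> 4 * real k ^ 2 * real n ^ k * Us"
    proof -
      have "1 \<le> real k ^ 2" using kp by (intro one_le_power) auto
      then have "3 + real k ^ 2 \<le> 4 * real k ^ 2" by linarith
      then have "(3 + real k ^ 2) * (real n ^ k * Us) \<le> (4 * real k ^ 2) * (real n ^ k * Us)" using Us0 by (intro mult_right_mono) auto
      then show ?thesis by (simp add: power2_eq_square algebra_simps)
    qed
    moreover have "4 * real k ^ 2 * real n ^ k * Us \<le> (\<Sum>i=1..k-2. exp2 (real i * (1 - c) * Cn) * P i)"
      unfolding Us_def sum_distrib_left U_def using assms(1) by (intro sum_mono gain) auto
    ultimately have mid: "real (card (\<Union>x\<in>V. A1 x)) + real (card (\<Union>i\<in>{1..k-2}. \<Union>S\<in>ksub V i. A2 i S)) + real (card (\<Union>S\<in>ksub V (k - 1). A3 S)) +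
       real (card (\<Union>S\<in>ksub V k. \<Union>x\<in>S. \<Union>y\<in>S - {x}. A4 S x y)) \<le> (\<Sum>i=1..k-2. exp2 (real i * (1 - c) * Cn) * P i)"
      using b1' b2' b3' b4' unfolding Us_def[symmetric] by linarith
    have "real n ^ k * (P k * (2 * 2 powr (real k / 2 * Cn - \<delta> * n'))) \<le> 4 * real k ^ 2 * real n ^ k * (P k * 2 powr (real k / 2 * Cn - \<delta> * n'))"
    proof -
      have "1 \<le> real k ^ 2" using kp by (intro one_le_power) auto
      then have "2 \<le> 4 * real k ^ 2" by linarith
      then have "2 * (real n ^ k * (P k * 2 powr (real k / 2 * Cn - \<delta> * n'))) \<le> 4 * real k ^ 2 * (real n ^ k * (P k * 2 powr (real k / 2 * Cn - \<delta> * n')))"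
        by (intro mult_right_mono) (auto simp: P_def)
      then show ?thesis by (simp add: algebra_simps)
    qed
    also have "\<dots> \<le> exp2 (real k / 2 * (1 - c) * Cn) * P k" by (rule gain) auto
    finally have last: "real (card (\<Union>S\<in>ksub V k. A5 S)) \<le> exp2 (real k / 2 * (1 - c) * Cn) * P k" using b5' by linarith
    have "real (card (good k V s d)) \<le> 2 ^ (n choose k) + exp2 ((1 - c) * real (n choose k))
      + (\<Sum>i=1..k-2. exp2 (real i * (1 - c) * Cn) * P i) + exp2 (real k / 2 * (1 - c) * Cn) * P k
      + exp2 (real (n choose k) - c * real n)"
      using total bM bK bB mid last by linarith
    then show ?case unfolding V_def s_def P_def Cn_def .
  qed
  then show ?thesis using z c(1) by blast
qed

lemma good_cover_2:
  assumes "finite V" "card V = n" "d > 0" "b \<le> d" "real n \<ge> 8 / d"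
  shows "good 2 V s d \<subseteq> {F\<in>sparse_forms 2 V s. negs F = {}} \<union>
    (\<Union>S\<in>{S. S \<subseteq> V \<and> S \<noteq> {} \<and> card S \<le> 2}. {F\<in>sparse_forms 2 V s. d\<^sup>2 / 128 * real n ^ 2 \<le> real (card (kill 2 V S F))}) \<union>
    residual 2 V s b \<xi>" (is "_ \<subseteq> ?M \<union> ?K \<union> ?B")
proof
  fix F assume F: "F \<in> good 2 V s d"
  have Fs: "F \<in> sparse_forms 2 V s" and ld: "\<And>x. x \<in> V \<Longrightarrow> d * real n ^ 1 \<le> real (card (plink F x))"
    using F assms(2) by (auto simp: good_def)
  have sub: "F \<subseteq> pairs 2 V" by (rule sparse_forms_sub[OF Fs])
  have n0: "real n > 0" using assms(3,5) by (smt (verit) divide_pos_pos)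
  show "F \<in> ?M \<union> ?K \<union> ?B"
  proof (rule ccontr)
    assume "F \<notin> ?M \<union> ?K \<union> ?B"
    then have no: "F \<notin> ?M" "F \<notin> ?K" "F \<notin> ?B" by simp_all
    have "(S,{}) \<notin> F" for S
    proof
      assume SF: "(S,{}) \<in> F"
      then have S: "S \<subseteq> V" "card S = 2" using sub by (auto simp: pairs_def)
      then obtain x y where xy: "S = {x,y}" "x \<noteq> y" by (auto simp: card_2_iff)
      define t where "t = d / 4 * real n"
      have fU: "finite (V - S)" using assms(1) by simp
      have dg: "real (deg (V - S) (plink F v) {}) > t" if v: "v \<in> S" for v
      proof -
        have "d / 2 * real (card V) ^ (2 - 1) \<le> real (card {Q\<in>plink F v. Q \<in> ksub (V - S) (2 - 1)})"
        proof (rule plink_away[OF assms(1) sub S(1)])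
          show "real (card V) \<ge> 2 * real 2 / d" using assms(2,3,5) by (simp add: field_simps)
          show "d * real (card V) ^ (2 - 1) \<le> real (card (plink F v))" using ld[of v] v S(1) assms(2) by auto
        qed (use S assms(3) in auto)
        moreover have "{Q\<in>plink F v. Q \<in> ksub (V - S) (2 - 1)} = (\<lambda>u. {u}) ` {u\<in>V - S - {}. insert u {} \<in> plink F v}"
          by (auto simp: ksub_def card_1_singleton_iff)
        then have "card {Q\<in>plink F v. Q \<in> ksub (V - S) (2 - 1)} = deg (V - S) (plink F v) {}"
          unfolding deg_def by (simp add: card_image)
        moreover have "d / 4 * real n < d / 2 * real n" using assms(3) n0 by (intro mult_strict_right_mono) auto
        ultimately show ?thesis using assms(2) by (simp add: t_def)
      qed
      have "t\<^sup>2 / 8 \<le> real (card {C\<in>common (V - S) (Suc 0) (plink F x) (plink F y). {} \<subseteq> C})"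
      proof (rule card_common_above[OF fU])
        show "2 \<le> t" using assms(3,5) by (simp add: t_def field_simps)
      qed (use dg xy in \<open>auto simp: ksub_def\<close>)
      also have "\<dots> \<le> real (card (kill 2 V S F))"
      proof (intro of_nat_mono card_mono)
        show "finite (kill 2 V S F)" using assms(1) by (simp add: kill_def)
        show "{C\<in>common (V - S) (Suc 0) (plink F x) (plink F y). {} \<subseteq> C} \<subseteq> kill 2 V S F"
        proof
          fix C assume "C \<in> {C\<in>common (V - S) (Suc 0) (plink F x) (plink F y). {} \<subseteq> C}"
          then have "C \<in> ksub (V - S) 2" "\<exists>Q\<in>plink F x. Q \<subseteq> C" "\<exists>Q\<in>plink F y. Q \<subseteq> C"
            by (auto simp: common_def numeral_2_eq_2)
          moreover have "\<exists>T. T \<subseteq> C \<and> (S,T) \<in> F" using SF by blast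
          ultimately show "C \<in> kill 2 V S F" using xy(1) by (simp add: kill_def)
        qed
      qed
      also have "t\<^sup>2 / 8 = d\<^sup>2 / 128 * real n ^ 2" by (simp add: t_def power_mult_distrib power_divide)
      finally have "F \<in> ?K" using S Fs by (intro UN_I[of S]) auto
      then show False using no(2) by simp
    qed
    moreover have "atypical 2 V b S F = {}" if S: "S \<subseteq> V" "card S = 2 - 1" for S
    proof (rule ccontr)
      assume "atypical 2 V b S F \<noteq> {}"
      then obtain T where T: "T \<in> atypical 2 V b S F" by auto
      obtain x where x: "S = {x}" using S(2) by (auto simp: card_1_singleton_iff)
      have "finite T" "card T = 0" using T S finite_subset[OF _ assms(1), of T] by (auto simp: atypical_def ksub_def)
      then have "T = {}" by simp
      then have lt: "real (card (extensions V F S {})) < b * real n" using T S assms(2) by (simp add: atypical_def)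
      have "plink F x \<subseteq> extensions V F S {}" using plink_sub[OF assms(1) sub, of x] x by (auto simp: extensions_def)
      then have "card (plink F x) \<le> card (extensions V F S {})" using assms(1) by (intro card_mono) (auto simp: extensions_def)
      then have "d * real n < b * real n" using ld[of x] S(1) x lt by simp
      then show False using assms(4) n0 by simp
    qed
    moreover have "negs F \<noteq> {}" using no(1) Fs by simp
    ultimately have "F \<in> ?B" unfolding residual_def using Fs by simp
    then show False using no(3) by simp
  qed
qed

lemma good_count_2:
  assumes "d > 0" "k = 2"
  shows "\<exists>z>0. \<exists>c>0. \<forall>\<^sub>F n in sequentially. real (card (good k {1..n} (z * real n) d)) \<le>
     2 ^ (n choose k) + 2 * exp2 ((1 - c) * real (n choose k))
     + exp2 (real k / 2 * (1 - c) * real (n choose (k - 1))) * real (card (minimal_formulae k (n - k)))"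
proof -
  define b where "b = min d (tuple_gain 1 * (1 / (real 2 * 2 ^ (2 + 1))) ^ 2)"
  have b: "b > 0" "b \<le> d" using assms(1) tuple_gain_pos[of 1] by (auto simp: b_def)
  have b2: "b \<le> tuple_gain i * (1 / (real 2 * 2 ^ (2 + 1))) ^ 2" if "i \<in> {1..<2}" for i
  proof -
    have "i = 1" using that by auto
    then show ?thesis by (simp add: b_def)
  qed
  obtain \<xi> eB cB where eB: "eB > 0" and cB: "cB > 0" and evB: "\<forall>\<^sub>F n in sequentially. \<forall>V s. finite V \<longrightarrow> card V = n \<longrightarrow> cheap 2 V s eB \<longrightarrow>
     real (card (residual 2 V s b \<xi>)) \<le> 2 powr (real (n choose 2) - cB * real n)"
    using residual_count[OF order_refl b(1) b2] by blast
  define \<gamma> where "\<gamma> = d\<^sup>2 / 128"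
  have \<gamma>: "\<gamma> > 0" using assms(1) by (simp add: \<gamma>_def)
  define e where "e = min eB (\<gamma> / 8)"
  have e: "e > 0" "e \<le> eB" "real 2 * e \<le> \<gamma> / 4" using eB \<gamma> by (auto simp: e_def)
  obtain z where z: "z > 0" and evC: "\<forall>\<^sub>F n in sequentially. \<forall>V. finite V \<longrightarrow> card V = n \<longrightarrow> cheap 2 V (z * real n) e"
    using card_loose_families[OF e(1)] by blast
  have one2: "(2::nat) \<ge> 1" by simp
  note evK = big_kill_union_count[OF \<gamma> one2 e(1,3)]
  define c where "c = min (\<gamma> / 4) cB"
  have c: "c > 0" "c \<le> \<gamma> / 4" "c \<le> cB" using \<gamma> cB by (auto simp: c_def)
  have "\<forall>\<^sub>F n in sequentially. real (card (good 2 {1..n} (z * real n) d)) \<le>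
     2 ^ (n choose 2) + exp2 ((1 - c) * real (n choose 2)) + exp2 ((1 - c) * real n) * real (card (minimal_formulae 2 (n - 2)))"
    using evB evC evK eventually_real_ge[of "8 / d"] eventually_real_ge[of 6]
  proof eventually_elim
    case (elim n)
    define V where "V = {1..n}"
    define s where "s = z * real n"
    have V: "finite V" "card V = n" by (auto simp: V_def)
    have ch: "cheap 2 V s e" using elim(2) V by (simp add: s_def)
    have chB: "cheap 2 V s eB" by (rule cheap_mono[OF ch e(2)])
    define M where "M = {F\<in>sparse_forms 2 V s. negs F = {}}"
    define K where "K = (\<Union>S\<in>{S. S \<subseteq> V \<and> S \<noteq> {} \<and> card S \<le> 2}. {F\<in>sparse_forms 2 V s. \<gamma> * real n ^ 2 \<le> real (card (kill 2 V S F))})"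
    define B where "B = residual 2 V s b \<xi>"
    have cover: "good 2 V s d \<subseteq> M \<union> K \<union> B"
      unfolding M_def K_def B_def \<gamma>_def by (rule good_cover_2[OF V assms(1) b(2) elim(4)])
    have "M \<subseteq> sparse_forms 2 V s" "K \<subseteq> sparse_forms 2 V s" "B \<subseteq> sparse_forms 2 V s" unfolding M_def K_def B_def residual_def by auto
    then have "M \<union> K \<union> B \<subseteq> sparse_forms 2 V s" by (intro Un_least)
    then have "finite (M \<union> K \<union> B)" by (rule finite_subset[OF _ finite_sparse_forms[OF V(1)]])
    then have "card (good 2 V s d) \<le> card (M \<union> K \<union> B)" using cover by (intro card_mono)
    also have "\<dots> \<le> card M + card K + card B" by (intro order_trans[OF card_Un_le] add_mono order_refl)
    finally have total: "real (card (good 2 V s d)) \<le> real (card M) + real (card K) + real (card B)" by linarith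
    have "real (card M) \<le> real (2 ^ (n choose 2))"
      using card_monotone_formulae[OF V(1), of 2 s] V(2) unfolding M_def of_nat_le_iff by simp
    then have bM: "real (card M) \<le> 2 ^ (n choose 2)" by simp
    have "real (card K) \<le> exp2 ((1 - \<gamma> / 4) * real (n choose 2))" unfolding K_def using elim(3) V ch by blast
    also have "\<dots> \<le> exp2 ((1 - c) * real (n choose 2))" unfolding exp2_def using c(2) by (intro powr_mono mult_right_mono) auto
    finally have bK: "real (card K) \<le> exp2 ((1 - c) * real (n choose 2))" .
    have "real (card B) \<le> 2 powr (real (n choose 2) - cB * real n)" unfolding B_def using elim(1) V chB by blast
    also have "\<dots> \<le> 2 powr (real (n choose 2) - c * real n)" using c(3) by (intro powr_mono diff_left_mono mult_right_mono) auto
    \<comment> \<open>With \<open>m = n - 2\<close>, \<open>n choose 2\<close> equals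
      \<open>n + (m choose 2) + m - 1\<close>; the unate formulae on \<open>m\<close> variables
      supply the term \<open>m - 1\<close> beyond \<open>m choose 2\<close>.\<close>
    also have "\<dots> = exp2 ((1 - c) * real n) * 2 powr (real ((n - 2) choose 2) + real (n - 2) - 1)"
    proof -
      have n2: "n \<ge> 6" using elim(5) by simp
      define m where "m = n - 2"
      have m: "n = Suc (Suc m)" using n2 by (simp add: m_def)
      have "n choose 2 = (m choose 2) + 2 * m + 1" unfolding m by (simp add: numeral_2_eq_2)
      then have "real (n choose 2) = real (m choose 2) + 2 * real m + 1" by simp
      then have "real (n choose 2) - c * real n = (1 - c) * real n + (real ((n - 2) choose 2) + real (n - 2) - 1)"
        using m by (simp add: algebra_simps)
      then show ?thesis unfolding exp2_def by (simp add: powr_add[symmetric])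
    qed
    also have "\<dots> \<le> exp2 ((1 - c) * real n) * real (card (minimal_formulae 2 (n - 2)))"
      using elim(5) by (intro mult_left_mono card_minimal_formulae_2_ge) (auto simp: exp2_def)
    finally have bB: "real (card B) \<le> exp2 ((1 - c) * real n) * real (card (minimal_formulae 2 (n - 2)))" .
    have "real (card (good 2 V s d)) \<le> 2 ^ (n choose 2) + exp2 ((1 - c) * real (n choose 2)) + exp2 ((1 - c) * real n) * real (card (minimal_formulae 2 (n - 2)))"
      using total bM bK bB by linarith
    then show ?case unfolding V_def s_def .
  qed
  then have "\<forall>\<^sub>F n in sequentially. real (card (good k {1..n} (z * real n) d)) \<le>
     2 ^ (n choose k) + 2 * exp2 ((1 - c) * real (n choose k))
     + exp2 (real k / 2 * (1 - c) * real (n choose (k - 1))) * real (card (minimal_formulae k (n - k)))"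
  proof (rule eventually_mono)
    fix n :: nat
    assume h: "real (card (good 2 {1..n} (z * real n) d)) \<le>
     2 ^ (n choose 2) + exp2 ((1 - c) * real (n choose 2)) + exp2 ((1 - c) * real n) * real (card (minimal_formulae 2 (n - 2)))"
    have "exp2 ((1 - c) * real (n choose 2)) \<ge> 0" by (simp add: exp2_def)
    then show "real (card (good k {1..n} (z * real n) d)) \<le>
     2 ^ (n choose k) + 2 * exp2 ((1 - c) * real (n choose k))
     + exp2 (real k / 2 * (1 - c) * real (n choose (k - 1))) * real (card (minimal_formulae k (n - k)))"
      using h unfolding assms(2) by simp
  qed
  then show ?thesis using z c(1) by blast
qed

section \<open>From formulae with dense positive links to the theorem\<close>

definition density :: "nat \<Rightarrow> real" where
  "density k = 1 / (80 * real k * (2 * real k) ^ (k - 1))"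

text \<open>\<open>(n - 1) choose (k - 1)\<close> is at least
  \<open>n ^ (k - 1) / (2 * k) ^ (k - 1)\<close>, so each variable has at least
  \<open>4 * density k * n ^ (k - 1)\<close> positive occurrences. Clauses mixing it with negated
  variables take at most half of these, by the bounds on \<open>z\<close> and
  \<open>n\<close>.\<close>

lemma I1_star_good:
  assumes "k \<ge> 2" "z > 0" "real k * z \<le> density k" "real n \<ge> real k / density k" "n \<ge> k"
  shows "card (I1_star k n z) \<le> card (good k {1..n} (z * real n) (density k))"
proof (rule card_inj_on_le[where f = "image split_clause"])
  show "inj_on (image split_clause) (I1_star k n z)"
    by (rule inj_on_subset[OF inj_on_image_Pow[OF inj_split_clause]]) auto
  show "finite (good k {1..n} (z * real n) (density k))" using finite_sparse_forms[of "{1..n}"] by (simp add: good_def)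
  show "image split_clause ` I1_star k n z \<subseteq> good k {1..n} (z * real n) (density k)"
  proof (rule image_subsetI)
    fix \<Phi> assume \<Phi>: "\<Phi> \<in> I1_star k n z"
    have F: "split_clause ` \<Phi> \<in> sparse_forms k {1..n} (z * real n)" using \<Phi> by (intro sparse_split_clause) (auto simp: I1_star_def)
    have kp: "real k \<ge> 2" using assms(1) by simp
    have d: "density k > 0" using kp by (simp add: density_def)
    have n1: "n \<ge> 2" "n \<ge> 1" using assms(1,5) by auto
    have "density k * real n ^ (k - 1) \<le> real (card (plink (split_clause ` \<Phi>) x))" if x: "x \<in> {1..n}" for x
    proof -
      let ?n' = "real n ^ (k - 1)"
      have "(real n / (2 * real k)) ^ (k - 1) \<le> (real (n - 1) / real (k - 1)) ^ (k - 1)"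
      proof (rule power_mono)
        have "real n / 2 \<le> real (n - 1)" using n1 by (simp add: of_nat_diff)
        then have "real n / 2 / real k \<le> real (n - 1) / real (k - 1)" using assms(1) by (intro frac_le) auto
        then show "real n / (2 * real k) \<le> real (n - 1) / real (k - 1)" by simp
      qed simp
      also have "\<dots> \<le> real ((n - 1) choose (k - 1))"
        using binomial_ge_n_over_k_pow_k[of "k - 1" "n - 1", where ?'a = real] assms(5) by simp
      finally have "?n' / (2 * real k) ^ (k - 1) \<le> real ((n - 1) choose (k - 1))" by (simp add: power_divide)
      then have "1 / (20 * real k) * (?n' / (2 * real k) ^ (k - 1)) \<le> 1 / (20 * real k) * real ((n - 1) choose (k - 1))"
        by (intro mult_left_mono) auto
      moreover have "1 / (20 * real k) * (?n' / (2 * real k) ^ (k - 1)) = 4 * density k * ?n'" by (simp add: density_def)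
      moreover have "1 / (20 * real k) * real ((n - 1) choose (k - 1)) \<le> real (card {p\<in>split_clause ` \<Phi>. x \<in> snd p})"
        using assms(1) by (intro card_occurrences_ge[OF \<Phi> x]) auto
      moreover have "real (card {p\<in>split_clause ` \<Phi>. x \<in> snd p}) \<le> real (card (plink (split_clause ` \<Phi>) x)) + real k * ((1 + z * real n) * real (card {1..n}) ^ (k - 2))"
        using assms(1,2) n1 x by (intro card_plink_ge[OF _ F]) auto
      moreover have "real k * ((1 + z * real n) * real (card {1..n}) ^ (k - 2)) \<le> 2 * density k * ?n'"
      proof -
        have "k - 1 = Suc (k - 2)" using assms(1) by simp
        then have nk: "?n' = real n * real n ^ (k - 2)" by (simp only: power_Suc)
        have "real k \<le> density k * real n" using assms(4) d by (simp add: field_simps)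
        then have "real k * real n ^ (k - 2) \<le> (density k * real n) * real n ^ (k - 2)" by (intro mult_right_mono) auto
        moreover have "real k * z * ?n' \<le> density k * ?n'" using assms(3) by (intro mult_right_mono) auto
        moreover have "real k * ((1 + z * real n) * real (card {1..n}) ^ (k - 2)) = real k * real n ^ (k - 2) + real k * z * ?n'"
          unfolding nk by (simp add: algebra_simps)
        moreover have "(density k * real n) * real n ^ (k - 2) = density k * ?n'" unfolding nk by simp
        ultimately show ?thesis by linarith
      qed
      moreover have "0 \<le> density k * ?n'" using d by simp
      ultimately show ?thesis by linarith
    qed
    then show "split_clause ` \<Phi> \<in> good k {1..n} (z * real n) (density k)" using F by (simp add: good_def)
  qed
qed

lemma good_mono: "s \<le> s' \<Longrightarrow> good k V s d \<subseteq> good k V s' d"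
  by (auto simp: good_def sparse_forms_def) (meson order_less_le_trans)

text \<open>A witness with fewer than one variable set to one satisfies no positive literal, so no
  clause contains one; positive dominance then excludes negative literals too.\<close>

lemma I1_star_small:
  assumes "k \<ge> 1" "z * real n \<le> 1" shows "I1_star k n z \<subseteq> {{}}"
proof
  fix \<Phi> assume \<Phi>: "\<Phi> \<in> I1_star k n z"
  have cl: "\<Phi> \<subseteq> clauses k n" using \<Phi> by (auto simp: I1_star_def minimal_formulae_def formulae_def)
  have nopos: "Pos x \<notin> C" if C: "C \<in> \<Phi>" for C x
  proof
    assume x: "Pos x \<in> C"
    then have "var (Pos x) \<in> var ` C" by blast
    moreover have "var ` C \<subseteq> {1..n}" using subsetD[OF cl C] by (simp add: clauses_def)
    ultimately have xn: "x \<in> {1..n}" by auto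
    obtain a where a: "witness \<Phi> C a" "real (card {x\<in>{1..n}. a x}) < z * real n"
      using \<Phi> C by (auto simp: I1_star_def sparsely_minimal_def)
    have "real (card {x\<in>{1..n}. a x}) < 1" using a(2) assms(2) by linarith
    then have "{x\<in>{1..n}. a x} = {}" by simp
    moreover have "a x" using a(1) x by (auto simp: witness_def satisfies_def)
    ultimately show False using xn by blast
  qed
  have "\<Phi> = {}"
  proof (rule ccontr)
    assume "\<Phi> \<noteq> {}"
    then obtain C where C: "C \<in> \<Phi>" by auto
    have Cc: "C \<in> clauses k n" using cl C by auto
    then have "C \<noteq> {}" using assms(1) by (auto simp: clauses_def)
    then obtain l where l: "l \<in> C" by auto
    then obtain x where x: "l = Neg x" using nopos[OF C] by (cases l) auto
    have "var (Neg x) \<in> var ` C" using l x by blast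
    moreover have "var ` C \<subseteq> {1..n}" using Cc by (simp add: clauses_def)
    ultimately have xn: "x \<in> {1..n}" by auto
    have fin: "finite \<Phi>" by (rule finite_subset[OF cl finite_clauses])
    have "occurrences \<Phi> (Neg x) \<le> occurrences \<Phi> (Pos x)" using \<Phi> xn by (auto simp: I1_star_def positive_dominant_def)
    moreover have "{D\<in>\<Phi>. Pos x \<in> D} = {}" using nopos by auto
    then have "occurrences \<Phi> (Pos x) = 0" unfolding occurrences_def by (simp only: card.empty)
    ultimately have "card {D\<in>\<Phi>. Neg x \<in> D} = 0" by (simp add: occurrences_def)
    then have "{D\<in>\<Phi>. Neg x \<in> D} = {}" using fin by simp
    then show False using C l x by blast
  qed
  then show "\<Phi> \<in> {{}}" by simp
qed

text \<open>For the finitely many small \<open>n\<close> it suffices to shrink \<open>\<zeta>\<close> below \<open>1 / n\<close>: then witnesses are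
  identically zero and only the empty formula is left.\<close>

lemma exists_zeta_all_n:
  assumes "k \<ge> 2" "z > 0" "\<forall>\<^sub>F n in sequentially. real (card (good k {1..n} (z * real n) (density k))) \<le> R n" "\<And>n. 1 \<le> R n"
  shows "\<exists>\<zeta>>0. \<forall>n. real (card (I1_star k n \<zeta>)) \<le> R n"
proof -
  have kp: "real k \<ge> 2" using assms(1) by simp
  have d: "density k > 0" using kp by (simp add: density_def)
  have "\<forall>\<^sub>F n in sequentially. real (card (good k {1..n} (z * real n) (density k))) \<le> R n \<and> real n \<ge> real k / density k \<and> real n \<ge> real k"
    using assms(3) eventually_real_ge[of "real k / density k"] eventually_real_ge[of "real k"] by eventually_elim auto
  then obtain N where N: "\<And>n. n \<ge> N \<Longrightarrow> real (card (good k {1..n} (z * real n) (density k))) \<le> R n \<and> real n \<ge> real k / density k \<and> real n \<ge> real k"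
    by (auto simp: eventually_sequentially)
  \<comment> \<open>The bound \<open>density k / k\<close> keeps mixed clauses negligible for large
    \<open>n\<close>, and \<open>1 / (N + 1)\<close> gives \<open>\<zeta> * n \<le> 1\<close> for
    all \<open>n < N\<close>.\<close>
  define \<zeta> where "\<zeta> = min (min z (density k / real k)) (1 / (real N + 1))"
  have \<zeta>: "\<zeta> > 0" "\<zeta> \<le> z" "\<zeta> \<le> density k / real k" "\<zeta> \<le> 1 / (real N + 1)" using assms(2) d kp by (auto simp: \<zeta>_def)
  have "real (card (I1_star k n \<zeta>)) \<le> R n" for n
  proof (cases "n \<ge> N")
    case True
    have "real k * \<zeta> \<le> density k" using \<zeta>(3) kp by (simp add: field_simps)
    then have "card (I1_star k n \<zeta>) \<le> card (good k {1..n} (\<zeta> * real n) (density k))"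
      using N[OF True] assms(1) \<zeta>(1) by (intro I1_star_good) auto
    also have "\<dots> \<le> card (good k {1..n} (z * real n) (density k))"
    proof (rule card_mono)
      show "finite (good k {1..n} (z * real n) (density k))" using finite_sparse_forms[of "{1..n}"] by (simp add: good_def)
      show "good k {1..n} (\<zeta> * real n) (density k) \<subseteq> good k {1..n} (z * real n) (density k)"
        using \<zeta>(2) by (intro good_mono mult_right_mono) auto
    qed
    finally show ?thesis using N[OF True] by linarith
  next
    case False
    have "\<zeta> * real n \<le> 1 / (real N + 1) * (real N + 1)" using False \<zeta>(4) by (intro mult_mono) auto
    also have "\<dots> = 1" by simp
    finally have "I1_star k n \<zeta> \<subseteq> {{}}" using assms(1) by (intro I1_star_small) auto
    then have "card (I1_star k n \<zeta>) \<le> card {{} :: formula}" by (intro card_mono) auto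
    then show ?thesis using assms(4)[of n] by simp
  qed
  then show ?thesis using \<zeta>(1) by blast
qed

theorem theorem6p1:
  fixes k :: nat
  shows "(k \<ge> 3 \<longrightarrow> (\<exists>\<zeta>>0. \<exists>c>0. \<forall>n::nat.
           real (card (I1_star k n \<zeta>)) \<le>
             2 ^ (n choose k)
             + exp2 ((1 - c) * real (n choose k))
             + (\<Sum>i=1..k-2. exp2 (real i * (1 - c) * real (n choose (k - 1)))
                              * real (card (minimal_formulae k (n - i))))
             + exp2 (real k / 2 * (1 - c) * real (n choose (k - 1)))
                 * real (card (minimal_formulae k (n - k)))
             + exp2 (real (n choose k) - c * real n)))
       \<and> (k = 2 \<longrightarrow> (\<exists>\<zeta>>0. \<exists>c>0. \<forall>n::nat.
           real (card (I1_star k n \<zeta>)) \<le>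
             2 ^ (n choose k)
             + 2 * exp2 ((1 - c) * real (n choose k))
             + exp2 (real k / 2 * (1 - c) * real (n choose (k - 1)))
                 * real (card (minimal_formulae k (n - k)))))"
proof -
  have d: "density k > 0" if "k \<ge> 2" using that by (simp add: density_def)
  \<comment> \<open>The right-hand sides are at least 1 through the term
    \<open>2 ^ (n choose k)\<close>; this covers the empty formula for small
    \<open>n\<close>.\<close>
  have one: "1 \<le> (2::real) ^ m + x" if "x \<ge> 0" for m :: nat and x
    using one_le_power[of "2::real" m] that by linarith
  have pos: "exp2 x \<ge> 0" for x by (simp add: exp2_def)
  show ?thesis
  proof (intro conjI impI)
    assume k: "k \<ge> 3"
    then have k2: "k \<ge> 2" by simp
    obtain z c where z: "z > 0" and c: "c > 0" and ev: "\<forall>\<^sub>F n in sequentially. real (card (good k {1..n} (z * real n) (density k))) \<le>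
       2 ^ (n choose k) + exp2 ((1 - c) * real (n choose k))
       + (\<Sum>i=1..k-2. exp2 (real i * (1 - c) * real (n choose (k - 1))) * real (card (minimal_formulae k (n - i))))
       + exp2 (real k / 2 * (1 - c) * real (n choose (k - 1))) * real (card (minimal_formulae k (n - k)))
       + exp2 (real (n choose k) - c * real n)"
      using good_count_ge3[OF k d[OF k2]] by blast
    have "1 \<le> 2 ^ (n choose k) + exp2 ((1 - c) * real (n choose k))
       + (\<Sum>i=1..k-2. exp2 (real i * (1 - c) * real (n choose (k - 1))) * real (card (minimal_formulae k (n - i))))
       + exp2 (real k / 2 * (1 - c) * real (n choose (k - 1))) * real (card (minimal_formulae k (n - k)))
       + exp2 (real (n choose k) - c * real n)" for n
      unfolding add.assoc using pos by (intro one add_nonneg_nonneg sum_nonneg mult_nonneg_nonneg) auto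
    from exists_zeta_all_n[OF k2 z ev this] show "\<exists>\<zeta>>0. \<exists>c>0. \<forall>n::nat.
           real (card (I1_star k n \<zeta>)) \<le>
             2 ^ (n choose k)
             + exp2 ((1 - c) * real (n choose k))
             + (\<Sum>i=1..k-2. exp2 (real i * (1 - c) * real (n choose (k - 1)))
                              * real (card (minimal_formulae k (n - i))))
             + exp2 (real k / 2 * (1 - c) * real (n choose (k - 1)))
                 * real (card (minimal_formulae k (n - k)))
             + exp2 (real (n choose k) - c * real n)"
      using c by blast
  next
    assume k: "k = 2"
    then have k2: "k \<ge> 2" by simp
    obtain z c where z: "z > 0" and c: "c > 0" and ev: "\<forall>\<^sub>F n in sequentially. real (card (good k {1..n} (z * real n) (density k))) \<le>
       2 ^ (n choose k) + 2 * exp2 ((1 - c) * real (n choose k))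
       + exp2 (real k / 2 * (1 - c) * real (n choose (k - 1))) * real (card (minimal_formulae k (n - k)))"
      using good_count_2[OF d[OF k2] k] by blast
    have "1 \<le> 2 ^ (n choose k) + 2 * exp2 ((1 - c) * real (n choose k))
       + exp2 (real k / 2 * (1 - c) * real (n choose (k - 1))) * real (card (minimal_formulae k (n - k)))" for n
      unfolding add.assoc using pos by (intro one add_nonneg_nonneg mult_nonneg_nonneg) auto
    from exists_zeta_all_n[OF k2 z ev this] show "\<exists>\<zeta>>0. \<exists>c>0. \<forall>n::nat.
           real (card (I1_star k n \<zeta>)) \<le>
             2 ^ (n choose k)
             + 2 * exp2 ((1 - c) * real (n choose k))
             + exp2 (real k / 2 * (1 - c) * real (n choose (k - 1)))
                 * real (card (minimal_formulae k (n - k)))"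
      using c by blast
  qed
qed

end
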